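(* Consider the system in $\mathbb R^{3d}$ $$d\mathbf q=\mathbf p\,dt,\qquad d\mathbf p=(\mathbf b(\mathbf q)+\mathbf z)\,dt,\qquad d\mathbf z=-(\alpha\mathbf z+\mathbf p)\,dt+\sqrt{2\beta^{-1}\alpha}\,d\mathbf B,$$ where $\alpha>0$, $\beta>0$ are constants and $\mathbf b\in C^\infty(\mathbb R^d;\mathbb R^d)$, with initial probability density function $\rho_0(\mathbf q,\mathbf p,\mathbf z)>0$. Then the following are equivalent: (i) (Reversibility) the stochastic process $(\mathbf q_t,\mathbf p_t,\mathbf z_t)_{t\ge0}$ is reversible. (ii) (Symmetry) $\rho_0(\mathbf q,\mathbf p,\mathbf z)=\rho_0(\mathbf q,-\mathbf p,\mathbf z)$, and for arbitrary $\varphi_1(\mathbf q),\varphi_2(\mathbf p),\varphi_3(\mathbf z),\psi_1(\mathbf q),\psi_2(\mathbf p),\psi_3(\mathbf z)\in C_0^\infty(\mathbb R^d)$, $$\iiint\varphi_1(\mathbf q)\varphi_2(\mathbf p)\varphi_3(\mathbf z)\,\mathcal L\big(\psi_1(\mathbf q)\psi_2(\mathbf p)\psi_3(\mathbf z)\big)\rho_0\,d\mathbf q\,d\mathbf p\,d\mathbf z=\iiint\mathcal L\big(\varphi_1(\mathbf q)\widetilde\varphi_2(\mathbf p)\varphi_3(\mathbf z)\big)\psi_1(\mathbf q)\widetilde\psi_2(\mathbf p)\psi_3(\mathbf z)\rho_0\,d\mathbf q\,d\mathbf p\,d\mathbf z,$$ where $\widetilde\varphi_2(\mathbf p)=\varphi_2(-\mathbf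 p)$ and $\widetilde\psi_2(\mathbf p)=\psi_2(-\mathbf p)$. (iii) (Potential condition) there exists $U:\mathbb R^d\to\mathbb R$ such that $-\nabla_{\mathbf q}U(\mathbf q)=\mathbf b(\mathbf q)$ and $\rho_0(\mathbf q,\mathbf p,\mathbf z)=\frac1Ze^{-\beta H(\mathbf q,\mathbf p,\mathbf z)}$, $Z=\iiint e^{-\beta H}\,d\mathbf q\,d\mathbf p\,d\mathbf z<\infty$, where $H(\mathbf q,\mathbf p,\mathbf z):=U(\mathbf q)+\frac{|\mathbf p|^2}2+\frac{|\mathbf z|^2}2$. (iv) (Evenness in the $\mathbf p$ variable) $\rho_0(\mathbf q,\mathbf p,\mathbf z)=\rho_0(\mathbf q,-\mathbf p,\mathbf z)$ and $\rho_0$ is stationary, i.e. it solves $\mathcal L^*\rho_0=0$. (v) (Separation of variables) $\rho_0(\mathbf q,\mathbf p,\mathbf z)=U_1(\mathbf q)U_2(\mathbf p)U_3(\mathbf z)$ with $U_1,U_2,U_3>0$, and $\rho_0$ is stationary, i.e. it solves $\mathcal L^*\rho_0=0$.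
   Context: $\mathbf B$ is a $d$-dimensional standard Brownian motion; the SDE is assumed well-posed. The generator is $$\mathcal Lf:=\mathbf p\cdot\nabla_{\mathbf q}f+\mathbf b(\mathbf q)\cdot\nabla_{\mathbf p}f+\mathbf z\cdot\nabla_{\mathbf p}f-\mathbf p\cdot\nabla_{\mathbf z}f+\alpha\big(-\mathbf z\cdot\nabla_{\mathbf z}f+\tfrac1\beta\Delta_{\mathbf z}f\big),$$ and the Fokker–Planck operator is $$\mathcal L^*\rho:=-\mathbf p\cdot\nabla_{\mathbf q}\rho-\mathbf b(\mathbf q)\cdot\nabla_{\mathbf p}\rho-\mathbf z\cdot\nabla_{\mathbf p}\rho+\mathbf p\cdot\nabla_{\mathbf z}\rho+\alpha\nabla_{\mathbf z}\cdot\big(\mathbf z\rho+\tfrac1\beta\nabla_{\mathbf z}\rho\big).$$ A process is stationary if its finite-dimensional distributions are invariant under time shifts. Here $\mathbf q$ and $\mathbf z$ are even variables and $\mathbf p$ is odd: for $T>0$ the time-reversed process is $(\mathbf q_{T-t},-\mathbf p_{T-t},\mathbf z_{T-t})$, $0\le t\le T$. The process is reversible if it is stationary and, for every $T>0$, the time-reversed process has the same finite-dimensional distributions as $(\mathbf q_t,\mathbf p_t,\mathbf z_t)_{0\le t\le T}$. *)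

theory Defs
  imports "HOL-Probability.Probability"
begin

type_synonym 'd state = "(real^'d) \<times> (real^'d) \<times> (real^'d)"

section \<open>Differential operators\<close>

text \<open>
  In finite dimension, a function is of class C^(k+1) iff it is differentiable and all its
  directional derivatives are of class C^k.
\<close>
primrec Ck :: "nat \<Rightarrow> ('a::euclidean_space \<Rightarrow> 'b::real_normed_vector) \<Rightarrow> bool" where
  "Ck 0 f \<longleftrightarrow> continuous_on UNIV f"
| "Ck (Suc k) f \<longleftrightarrow>
     (\<forall>x. f differentiable (at x)) \<and> (\<forall>v. Ck k (\<lambda>x. frechet_derivative f (at x) v))"

definition smooth :: "('a::euclidean_space \<Rightarrow> 'b::real_normed_vector) \<Rightarrow> bool" where
  "smooth f \<longleftrightarrow> (\<forall>k. Ck k f)"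

definition test_function :: "('a::euclidean_space \<Rightarrow> real) \<Rightarrow> bool" where
  "test_function f \<longleftrightarrow> smooth f \<and> compact (closure {x. f x \<noteq> 0})"

definition grad :: "(real^'d \<Rightarrow> real) \<Rightarrow> real^'d \<Rightarrow> real^'d" where
  "grad f x = (\<chi> i. frechet_derivative f (at x) (axis i 1))"

definition divergence :: "(real^'d \<Rightarrow> real^'d) \<Rightarrow> real^'d \<Rightarrow> real" where
  "divergence F x = (\<Sum>i\<in>UNIV. frechet_derivative F (at x) (axis i 1) $ i)"

definition laplacian :: "(real^'d \<Rightarrow> real) \<Rightarrow> real^'d \<Rightarrow> real" where
  "laplacian f = divergence (grad f)"

definition generator ::
    "real \<Rightarrow> real \<Rightarrow> (real^'d \<Rightarrow> real^'d) \<Rightarrow> ('d state \<Rightarrow> real) \<Rightarrow> 'd state \<Rightarrow> real" where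
  "generator \<alpha> \<beta> b f = (\<lambda>(q, p, z).
       p \<bullet> grad (\<lambda>q'. f (q', p, z)) q
     + b q \<bullet> grad (\<lambda>p'. f (q, p', z)) p
     + z \<bullet> grad (\<lambda>p'. f (q, p', z)) p
     - p \<bullet> grad (\<lambda>z'. f (q, p, z')) z
     + \<alpha> * (- (z \<bullet> grad (\<lambda>z'. f (q, p, z')) z)
            + (1 / \<beta>) * laplacian (\<lambda>z'. f (q, p, z')) z))"

definition fokker_planck ::
    "real \<Rightarrow> real \<Rightarrow> (real^'d \<Rightarrow> real^'d) \<Rightarrow> ('d state \<Rightarrow> real) \<Rightarrow> 'd state \<Rightarrow> real" where
  "fokker_planck \<alpha> \<beta> b \<rho> = (\<lambda>(q, p, z).
     - (p \<bullet> grad (\<lambda>q'. \<rho> (q', p, z)) q)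
     - b q \<bullet> grad (\<lambda>p'. \<rho> (q, p', z)) p
     - z \<bullet> grad (\<lambda>p'. \<rho> (q, p', z)) p
     + p \<bullet> grad (\<lambda>z'. \<rho> (q, p, z')) z
     + \<alpha> * divergence
         (\<lambda>z'. \<rho> (q, p, z') *\<^sub>R z' + (1 / \<beta>) *\<^sub>R grad (\<lambda>z''. \<rho> (q, p, z'')) z') z)"

text \<open>
  A probability density is only determined up to a null set and is not assumed regular, so it is
  a stationary density if it has a version that is a classical solution of the stationary
  Fokker-Planck equation. If the density is continuous, that version is the density itself.
\<close>
definition stationary_density ::
    "real \<Rightarrow> real \<Rightarrow> (real^'d \<Rightarrow> real^'d) \<Rightarrow> ('d state \<Rightarrow> real) \<Rightarrow> bool" where
  "stationary_density \<alpha> \<beta> b \<rho> \<longleftrightarrow>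
     (\<exists>r. (AE x in lborel. \<rho> x = r x) \<and> Ck 2 r \<and> (\<forall>x. fokker_planck \<alpha> \<beta> b r x = 0))"

definition even_in_p :: "('d::finite state \<Rightarrow> real) \<Rightarrow> bool" where
  "even_in_p \<rho> \<longleftrightarrow> (AE (q, p, z) in lborel. \<rho> (q, p, z) = \<rho> (q, - p, z))"

section \<open>The stochastic differential equation\<close>

text \<open>
  Processes are indexed by the reals; only their values at nonnegative times matter.
\<close>
definition brownian_motion :: "'w measure \<Rightarrow> (real \<Rightarrow> 'w \<Rightarrow> real^'d) \<Rightarrow> bool" where
  "brownian_motion M B \<longleftrightarrow>
     prob_space M \<and>
     (\<forall>t\<ge>0. B t \<in> borel_measurable M) \<and>
     (AE \<omega> in M. B 0 \<omega> = 0) \<and>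
     (AE \<omega> in M. continuous_on {0..} (\<lambda>t. B t \<omega>)) \<and>
     (\<forall>s t. 0 \<le> s \<and> s < t \<longrightarrow>
        distributed M lborel (\<lambda>\<omega>. B t \<omega> - B s \<omega>)
          (\<lambda>x. ennreal (\<Prod>i\<in>UNIV. normal_density 0 (sqrt (t - s)) (x $ i)))) \<and>
     (\<forall>n (\<tau> :: nat \<Rightarrow> real). 0 \<le> \<tau> 0 \<and> strict_mono \<tau> \<longrightarrow>
        prob_space.indep_vars M (\<lambda>_. borel) (\<lambda>i \<omega>. B (\<tau> (Suc i)) \<omega> - B (\<tau> i) \<omega>) {..<n})"

definition independent_of_process ::
    "'w measure \<Rightarrow> ('w \<Rightarrow> 'x::topological_space) \<Rightarrow> (real \<Rightarrow> 'w \<Rightarrow> real^'d) \<Rightarrow> bool" where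
  "independent_of_process M Y B \<longleftrightarrow>
     prob_space.indep_set M
       (sets (vimage_algebra (space M) Y borel))
       (sets (vimage_algebra (space M) (\<lambda>\<omega>. \<lambda>t\<in>{0..}. B t \<omega>) (PiM {0..} (\<lambda>_. borel))))"

definition state_process ::
    "(real \<Rightarrow> 'w \<Rightarrow> real^'d) \<Rightarrow> (real \<Rightarrow> 'w \<Rightarrow> real^'d) \<Rightarrow> (real \<Rightarrow> 'w \<Rightarrow> real^'d)
       \<Rightarrow> real \<Rightarrow> 'w \<Rightarrow> 'd state" where
  "state_process q p z t \<omega> = (q t \<omega>, p t \<omega>, z t \<omega>)"

text \<open>
  The noise is additive with a constant coefficient, so the stochastic integral in the Ito form
  of the equation is that coefficient times \<open>B t - B 0\<close>, and every continuous process satisfying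
  the resulting pathwise integral equations is automatically nonanticipating (smooth drifts are
  locally Lipschitz) once its initial value is independent of the Brownian motion.
\<close>
definition sde_solution ::
    "real \<Rightarrow> real \<Rightarrow> (real^'d \<Rightarrow> real^'d) \<Rightarrow> 'w measure \<Rightarrow> (real \<Rightarrow> 'w \<Rightarrow> real^'d)
       \<Rightarrow> (real \<Rightarrow> 'w \<Rightarrow> real^'d) \<Rightarrow> (real \<Rightarrow> 'w \<Rightarrow> real^'d) \<Rightarrow> (real \<Rightarrow> 'w \<Rightarrow> real^'d) \<Rightarrow> bool" where
  "sde_solution \<alpha> \<beta> b M B q p z \<longleftrightarrow>
     (\<forall>t\<ge>0. q t \<in> borel_measurable M \<and> p t \<in> borel_measurable M \<and> z t \<in> borel_measurable M) \<and>
     independent_of_process M (state_process q p z 0) B \<and>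
     (AE \<omega> in M.
        continuous_on {0..} (\<lambda>t. state_process q p z t \<omega>) \<and>
        (\<forall>t\<ge>0.
           ((\<lambda>s. p s \<omega>) has_integral (q t \<omega> - q 0 \<omega>)) {0..t} \<and>
           ((\<lambda>s. b (q s \<omega>) + z s \<omega>) has_integral (p t \<omega> - p 0 \<omega>)) {0..t} \<and>
           ((\<lambda>s. - (\<alpha> *\<^sub>R z s \<omega> + p s \<omega>)) has_integral
              (z t \<omega> - z 0 \<omega> - sqrt (2 * inverse \<beta> * \<alpha>) *\<^sub>R (B t \<omega> - B 0 \<omega>))) {0..t}))"

text \<open>
  Strong well-posedness on the given probability space: for every initial value independent of the
  Brownian motion (in particular every deterministic one) there is a global solution, unique up to
  indistinguishability.
\<close>
definition sde_well_posed ::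
    "real \<Rightarrow> real \<Rightarrow> (real^'d \<Rightarrow> real^'d) \<Rightarrow> 'w measure \<Rightarrow> (real \<Rightarrow> 'w \<Rightarrow> real^'d) \<Rightarrow> bool" where
  "sde_well_posed \<alpha> \<beta> b M B \<longleftrightarrow>
     (\<forall>Y \<in> borel_measurable M. independent_of_process M Y B \<longrightarrow>
        (\<exists>q p z. sde_solution \<alpha> \<beta> b M B q p z \<and>
                 (AE \<omega> in M. state_process q p z 0 \<omega> = Y \<omega>)) \<and>
        (\<forall>q p z q' p' z'.
           sde_solution \<alpha> \<beta> b M B q p z \<and> (AE \<omega> in M. state_process q p z 0 \<omega> = Y \<omega>) \<and>
           sde_solution \<alpha> \<beta> b M B q' p' z' \<and> (AE \<omega> in M. state_process q' p' z' 0 \<omega> = Y \<omega>) \<longrightarrow>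
           (AE \<omega> in M. \<forall>t\<ge>0. state_process q p z t \<omega> = state_process q' p' z' t \<omega>)))"

section \<open>Stationarity and reversibility\<close>

definition fdd ::
    "'w measure \<Rightarrow> (real \<Rightarrow> 'w \<Rightarrow> 'x::topological_space) \<Rightarrow> real set \<Rightarrow> (real \<Rightarrow> 'x) measure" where
  "fdd M X J = distr M (PiM J (\<lambda>_. borel)) (\<lambda>\<omega>. \<lambda>t\<in>J. X t \<omega>)"

definition stationary_process ::
    "'w measure \<Rightarrow> (real \<Rightarrow> 'w \<Rightarrow> 'x::topological_space) \<Rightarrow> bool" where
  "stationary_process M X \<longleftrightarrow>
     (\<forall>h\<ge>0. \<forall>J. finite J \<and> J \<subseteq> {0..} \<longrightarrow> fdd M (\<lambda>t. X (t + h)) J = fdd M X J)"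

definition flip_p :: "'d::finite state \<Rightarrow> 'd state" where
  "flip_p = (\<lambda>(q, p, z). (q, - p, z))"

definition reversible_process ::
    "'w measure \<Rightarrow> (real \<Rightarrow> 'w \<Rightarrow> 'd::finite state) \<Rightarrow> bool" where
  "reversible_process M X \<longleftrightarrow>
     stationary_process M X \<and>
     (\<forall>T>0. \<forall>J. finite J \<and> J \<subseteq> {0..T} \<longrightarrow>
        fdd M (\<lambda>t \<omega>. flip_p (X (T - t) \<omega>)) J = fdd M X J)"

section \<open>The equivalent conditions\<close>

definition tensor3 ::
    "(real^'d \<Rightarrow> real) \<Rightarrow> (real^'d \<Rightarrow> real) \<Rightarrow> (real^'d \<Rightarrow> real) \<Rightarrow> 'd state \<Rightarrow> real" where
  "tensor3 f g h = (\<lambda>(q, p, z). f q * g p * h z)"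

definition symmetric_generator ::
    "real \<Rightarrow> real \<Rightarrow> (real^'d \<Rightarrow> real^'d) \<Rightarrow> ('d state \<Rightarrow> real) \<Rightarrow> bool" where
  "symmetric_generator \<alpha> \<beta> b \<rho> \<longleftrightarrow>
     (\<forall>\<phi>1 \<phi>2 \<phi>3 \<psi>1 \<psi>2 \<psi>3.
        test_function \<phi>1 \<and> test_function \<phi>2 \<and> test_function \<phi>3 \<and>
        test_function \<psi>1 \<and> test_function \<psi>2 \<and> test_function \<psi>3 \<longrightarrow>
        (\<integral>x. tensor3 \<phi>1 \<phi>2 \<phi>3 x * generator \<alpha> \<beta> b (tensor3 \<psi>1 \<psi>2 \<psi>3) x * \<rho> x \<partial>lborel)
      = (\<integral>x. generator \<alpha> \<beta> b (tensor3 \<phi>1 (\<lambda>p. \<phi>2 (- p)) \<phi>3) x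
             * tensor3 \<psi>1 (\<lambda>p. \<psi>2 (- p)) \<psi>3 x * \<rho> x \<partial>lborel))"

definition hamiltonian :: "(real^'d \<Rightarrow> real) \<Rightarrow> 'd state \<Rightarrow> real" where
  "hamiltonian U = (\<lambda>(q, p, z). U q + (norm p)\<^sup>2 / 2 + (norm z)\<^sup>2 / 2)"

definition potential_condition ::
    "real \<Rightarrow> (real^'d \<Rightarrow> real^'d) \<Rightarrow> ('d state \<Rightarrow> real) \<Rightarrow> bool" where
  "potential_condition \<beta> b \<rho> \<longleftrightarrow>
     (\<exists>U. (\<forall>q. GDERIV U q :> - b q) \<and>
          integrable lborel (\<lambda>x. exp (- \<beta> * hamiltonian U x)) \<and>
          (AE x in lborel. \<rho> x =
             1 / (\<integral>y. exp (- \<beta> * hamiltonian U y) \<partial>lborel) * exp (- \<beta> * hamiltonian U x)))"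

definition separated_variables :: "('d::finite state \<Rightarrow> real) \<Rightarrow> bool" where
  "separated_variables \<rho> \<longleftrightarrow>
     (\<exists>U1 U2 U3. (\<forall>x. U1 x > 0) \<and> (\<forall>x. U2 x > 0) \<and> (\<forall>x. U3 x > 0) \<and>
        (AE x in lborel. \<rho> x = tensor3 U1 U2 U3 x))"

end

theory Submission
  imports Defs
begin

text \<open>
  If the process is reversible, then \<open>E (f (X 0) * g (X t)) = E (f (flip_p (X t)) * g (flip_p (X 0)))\<close>.
  Dividing the increments of both sides by \<open>t\<close> and letting \<open>t\<close> tend to zero gives the symmetry of the
  generator. In the symmetry relation, exchanging test functions isolates the first-order identity in
  \<open>z\<close>, and commutators with the transport operator yield those in \<open>p\<close> and \<open>q\<close>; they say that
  the weak logarithmic gradient of the density is \<open>\<beta> (b q, - p, - z)\<close>, which is the Gibbs form.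

  For an even stationary density, parity in \<open>p\<close> separates the Fokker-Planck equation into a transport
  equation and an Ornstein-Uhlenbeck equation in \<open>z\<close>, whose positive solutions are Gaussian. For a
  product density, stationarity forces the logarithmic gradients in \<open>p\<close> and \<open>z\<close> to be affine with the
  same linear part \<open>A\<close>, where \<open>A + A\<^sup>2 / \<beta> = 0\<close>, and integrability leaves only \<open>A = - \<beta>\<close>.

  Conversely, under the Gibbs measure a kick-drift-kick discretization with step \<open>h\<close> is reversible up to
  a factor \<open>exp (O(h\<^sup>2))\<close> per step as long as it stays bounded. Letting \<open>h\<close> tend to zero and
  removing the cutoff bounds the correlations of the process by those of its reversal; applied twice this
  gives equality. Stationarity follows by composing the reversals over \<open>T\<close> and \<open>T + h\<close>.
\<close>

text \<open>The density is only positive and integrable, so identities for its gradient stay weak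
  until a differentiable version has been built. The drift has no growth bound, so neither moments
  of the process nor global Lipschitz constants are at hand; this forces the cutoffs and the
  pathwise error estimates. The symmetry relation speaks only of products of functions of
  \<open>q\<close>, \<open>p\<close> and \<open>z\<close>, and its usable consequences only of
  squares of such products; squared product bumps at all scales and centres therefore act as
  mollifiers that reach arbitrary test functions. In the discretization \<open>z\<close> is advanced
  by the midpoint rule: with noise strength 2 \<alpha> / \<beta> the quotient of the backward and
  the forward Gaussian kernel is then exactly the exponential of a discrete energy increment. Only
  an energy error of order h^2 remains, and n = T / h steps accumulate it to O(T^2 / n). The cutoff
  can only lose mass, which is why the limit is an inequality. In the short-time limit the
  second-order part of the generator comes from the Gaussian law of the noise and the first-order
  part from the path, so no stochastic calculus is involved.\<close>

notation scaleR (infixr "*R" 75)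
notation LIMSEQ ("((_)/ ----> (_))" [60, 60] 60)

abbreviation nn_integral_lborel :: "('a::euclidean_space => ennreal) => ennreal" (binder "NN " 10) where
  "nn_integral_lborel f == integral\<^sup>N lborel f"

abbreviation integral_lborel :: "('a::euclidean_space => real) => real" (binder "LB " 10) where
  "integral_lborel f == integral\<^sup>L lborel f"

section \<open>Calculus of \<open>C\<^sup>k\<close> functions\<close>

abbreviation pd ::
    "'a::euclidean_space => ('a => 'b::real_normed_vector) => 'a => 'b" where
  "pd v f x \<equiv> frechet_derivative f (at x) v"

lemma pd_eq: "(f has_derivative f') (at x) ==> pd v f x = f' v" by (metis frechet_derivative_at)

lemma Ck_SucI: assumes "!!x. (f has_derivative f' x) (at x)" "!!v. Ck k (%x. f' x v)" shows "Ck (Suc k) f"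
proof -
  have "pd v f = (%x. f' x v)" for v using pd_eq[OF assms(1)] by auto
  then show ?thesis using assms unfolding Ck.simps differentiable_def by metis
qed

lemma Ck_has_derivative:
  "Ck (Suc k) f ==> (f has_derivative frechet_derivative f (at x)) (at x)"
  by (simp add: frechet_derivative_works[symmetric])

lemma Ck_pd: "Ck (Suc k) f ==> Ck k (pd v f)" by simp

lemma Ck_continuous: "Ck k f ==> continuous_on UNIV f"
  by (cases k) (auto intro!: differentiable_imp_continuous_on simp: differentiable_on_def)

lemma Ck_Suc: "Ck (Suc k) f ==> Ck k f" by (induction k arbitrary: f) (auto intro!: Ck_continuous[of "Suc 0"])

lemma Ck_le: "k <= m ==> Ck m f ==> Ck k f" by (induction m rule: dec_induct) (blast dest: Ck_Suc)+

lemma smooth_Ck: "smooth f ==> Ck k f" by (simp add: smooth_def)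

lemma Ck_const: "Ck k (%_. c)"
proof (induction k arbitrary: c)
  case (Suc k)
  then show ?case by (intro Ck_SucI[of _ "%_ _. 0"]) auto
qed auto

lemma Ck_linear: assumes "bounded_linear f" shows "Ck k f"
proof (cases k)
  case 0
  then show ?thesis using assms by (simp add: linear_continuous_on)
next
  case (Suc m)
  show ?thesis unfolding Suc
    by (rule Ck_SucI[of _ "%_. f"]) (auto intro: bounded_linear_imp_has_derivative assms Ck_const)
qed

lemma Ck_add: "Ck k f ==> Ck k g ==> Ck k (%x. f x + g x)"
proof (induction k arbitrary: f g)
  case (Suc k)
  show ?case by (rule Ck_SucI[of _ "%x v. pd v f x + pd v g x"])
      (use Suc in \<open>auto intro!: has_derivative_add Ck_has_derivative[of k]\<close>)
qed (auto intro!: continuous_intros)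

lemma Ck_bilinear: assumes "bounded_bilinear B" shows "Ck k f ==> Ck k g ==> Ck k (%x. B (f x) (g x))"
proof (induction k arbitrary: f g)
  case 0
  then show ?case by (auto intro!: bounded_bilinear.continuous_on[OF assms])
next
  case (Suc k)
  show ?case
  proof (rule Ck_SucI[of _ "%x v. B (f x) (pd v g x) + B (pd v f x) (g x)"])
    fix x show "((%x. B (f x) (g x)) has_derivative (%v. B (f x) (pd v g x) + B (pd v f x) (g x))) (at x)"
      by (intro bounded_bilinear.FDERIV[OF assms] Ck_has_derivative[OF Suc.prems(1)]
          Ck_has_derivative[OF Suc.prems(2)])
  next
    fix v show "Ck k (%x. B (f x) (pd v g x) + B (pd v f x) (g x))"
      by (intro Ck_add Suc.IH Ck_pd[OF Suc.prems(1)] Ck_pd[OF Suc.prems(2)]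
          Ck_Suc[OF Suc.prems(1)] Ck_Suc[OF Suc.prems(2)])
  qed
qed

lemmas Ck_mult = Ck_bilinear[OF bounded_bilinear_mult]
lemmas Ck_scaleR = Ck_bilinear[OF bounded_bilinear_scaleR]
lemmas Ck_inner = Ck_bilinear[OF bounded_bilinear_inner]

lemma Ck_minus: "Ck k f ==> Ck k (%x. - f x)" using Ck_scaleR[OF Ck_const[of k "-1"], of f] by simp

lemma Ck_diff: "Ck k f ==> Ck k g ==> Ck k (%x. f x - g x)" using Ck_add[OF _ Ck_minus, of k f g] by simp

lemma Ck_sum: "(!!i. i \<in> I ==> Ck k (f i)) ==> Ck k (%x. \<Sum>i\<in>I. f i x)"
  by (induction I rule: infinite_finite_induct) (auto intro: Ck_add Ck_const)

lemma Ck_prod: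
  fixes f :: "'i => 'a::euclidean_space => real" shows "(!!i. i \<in> I ==> Ck k (f i)) ==> Ck k (%x. \<Prod>i\<in>I. f i x)"
  by (induction I rule: infinite_finite_induct) (auto intro: Ck_mult Ck_const)

lemma Ck_power:
  fixes f :: "'a::euclidean_space => real" shows "Ck k f ==> Ck k (%x. f x ^ n)"
  by (induction n) (auto intro: Ck_mult Ck_const)

lemma Ck_affine_compose: assumes "bounded_linear L" shows "Ck k f ==> Ck k (%x. f (L x + c))"
proof (induction k arbitrary: f)
  case 0
  then show ?case by (auto intro!: continuous_on_compose2[of UNIV f] continuous_intros
        linear_continuous_on[OF assms])
next
  case (Suc k)
  show ?case
  proof (rule Ck_SucI[of _ "%x v. pd (L v) f (L x + c)"])
    fix x show "((%x. f (L x + c)) has_derivative (%v. pd (L v) f (L x + c))) (at x)"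
      by (rule has_derivative_compose[OF _ Ck_has_derivative[OF Suc.prems]])
        (auto intro!: derivative_eq_intros bounded_linear_imp_has_derivative assms)
  qed (intro Suc.IH Ck_pd Suc.prems)
qed

lemmas Ck_linear_compose = Ck_affine_compose[where c = 0, simplified]
lemmas Ck_translate = Ck_affine_compose[OF bounded_linear_ident]

lemma Ck_exp:
  fixes f :: "'a::euclidean_space => real" shows "Ck k f ==> Ck k (%x. exp (f x))"
proof (induction k)
  case (Suc k)
  show ?case
  proof (rule Ck_SucI[of _ "%x v. exp (f x) * pd v f x"])
    fix x show "((%x. exp (f x)) has_derivative (%v. exp (f x) * pd v f x)) (at x)"
      using has_derivative_exp[OF Ck_has_derivative[OF Suc.prems]] by (simp add: mult.commute)
  next
    fix v show "Ck k (%x. exp (f x) * pd v f x)" by (intro Ck_mult Suc.IH Ck_Suc[OF Suc.prems] Ck_pd Suc.prems)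
  qed
qed (auto intro!: continuous_intros)

lemma Ck_component:
  fixes f :: "'a::euclidean_space => real^'n" shows "Ck k f ==> Ck k (%x. f x $ i)"
  using Ck_inner[OF _ Ck_const[of k "axis i 1"], of f] by (simp add: inner_axis)

lemma Ck_linear_intros:
  "Ck k (%x. x)"
  "Ck k (%x::'a::euclidean_space \<times> 'b::euclidean_space. fst x)"
  "Ck k (%x::'a \<times> 'b. snd x)"
  by (auto intro!: Ck_linear bounded_linear_fst bounded_linear_snd bounded_linear_ident)

lemmas Ck_intros = Ck_const Ck_add Ck_diff Ck_minus Ck_mult Ck_scaleR Ck_inner Ck_sum Ck_prod
  Ck_power Ck_exp Ck_component

subsection \<open>Compactly supported functions\<close>

abbreviation csupp :: "('a::euclidean_space => 'b::real_normed_vector) => bool" where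
  "csupp f \<equiv> bounded {x. f x ~= 0}"

lemma bounded_cball_0:
  fixes S :: "'a::real_normed_vector set" assumes "bounded S" obtains R where "S \<subseteq> cball 0 R"
  using assms by (auto simp: bounded_iff subset_iff)

lemma test_function_iff: "test_function f \<longleftrightarrow> smooth f & csupp f" by (simp add: test_function_def)

lemma csupp_mono: "csupp f ==> (!!x. f x = 0 ==> g x = 0) ==> csupp g" by (erule bounded_subset) auto

lemma csupp_add: "csupp f ==> csupp g ==> csupp (%x. f x + g x)"
  by (rule bounded_subset[of "{x. f x ~= 0} \<union> {x. g x ~= 0}"]) auto

lemma csupp_diff: "csupp f ==> csupp g ==> csupp (%x. f x - g x)"
  by (rule bounded_subset[of "{x. f x ~= 0} \<union> {x. g x ~= 0}"]) auto

lemma csupp_sum: "(!!i. i \<in> I ==> csupp (f i)) ==> csupp (%x. \<Sum>i\<in>I. f i x)"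
  by (induction I rule: infinite_finite_induct) (auto intro: csupp_add)

lemma csupp_mult_left: "csupp f ==> csupp (%x. g x * f x :: real)" by (erule csupp_mono) simp

lemma csupp_mult_right: "csupp f ==> csupp (%x. f x * g x :: real)" by (erule csupp_mono) simp

lemma pd_eq_0_outside: assumes "x \<notin> closure {x. f x ~= 0}" shows "pd v f x = 0"
proof -
  let ?S = "closure {x. f x ~= 0}"
  have zero: "0 = f y" if "y \<in> - ?S" for y
    using that closure_subset[THEN subsetD, of y "{x. f x ~= 0}"] by (metis ComplD mem_Collect_eq)
  have "(f has_derivative (%_. 0)) (at x)" by (rule has_derivative_transform_within_open[of "%_. 0" _ _ _ "- ?S"])
      (use assms zero in \<open>simp_all only: has_derivative_const open_Compl closed_closure Compl_iff not_False_eq_True\<close>)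
  then show ?thesis using pd_eq by blast
qed

lemma csupp_pd: assumes "csupp f" shows "csupp (pd v f)"
proof -
  have "{x. pd v f x ~= 0} \<subseteq> closure {x. f x ~= 0}" using pd_eq_0_outside by blast
  then show ?thesis using assms bounded_closure bounded_subset by blast
qed

lemma csupp_translate: assumes "csupp f" shows "csupp (%x. f (x + c))"
proof -
  have "{x. f (x + c) ~= 0} = (%x. x - c) ` {x. f x ~= 0}" by (force simp: image_iff algebra_simps)
  then show ?thesis using bounded_translation[OF assms, of "- c"] by (simp add: add.commute)
qed

lemma smooth_pd: "smooth f ==> smooth (pd v f)" unfolding smooth_def using Ck_pd by blast

lemma test_function_pd: "test_function f ==> test_function (pd v f)"
  by (simp add: test_function_iff smooth_pd csupp_pd)

lemma test_function_mult: "smooth g ==> test_function f ==> test_function (%x. g x * f x)"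
  unfolding test_function_iff smooth_def by (intro conjI allI Ck_mult csupp_mult_left) auto

lemma test_function_smooth: "test_function f ==> smooth f" by (simp add: test_function_iff)

lemma test_function_add: "test_function f ==> test_function g ==> test_function (%x. f x + g x)"
  unfolding test_function_iff smooth_def by (intro conjI allI Ck_add csupp_add) auto

lemma test_function_diff: "test_function f ==> test_function g ==> test_function (%x. f x - g x)"
  unfolding test_function_iff smooth_def by (intro conjI allI Ck_diff csupp_diff) auto

lemma test_function_sum:
  "(!!i. i \<in> I ==> test_function (f i)) ==> test_function (%x. \<Sum>i\<in>I. f i x)"
  unfolding test_function_iff smooth_def by (intro conjI allI Ck_sum csupp_sum) auto

lemma test_function_translate: "test_function f ==> test_function (%x. f (x + c))"
  unfolding test_function_iff smooth_def by (intro conjI allI Ck_translate csupp_translate) auto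

lemma bounded_of_csupp:
  fixes f :: "'a::euclidean_space => real" assumes "continuous_on UNIV f" "csupp f" shows "\<exists>C\<ge>0. \<forall>x. \<bar>f x\<bar> <= C"
proof -
  have "compact (f ` closure {x. f x ~= 0})"
    using assms by (intro compact_continuous_image) (auto intro: continuous_on_subset)
  then obtain C where C: "!!y. y \<in> f ` closure {x. f x ~= 0} ==> norm y <= C"
    using compact_imp_bounded bounded_iff by metis
  have "\<bar>f x\<bar> <= max C 0" for x
  proof (cases "f x = 0")
    case False
    then have "x \<in> closure {x. f x ~= 0}" using closure_subset[of "{x. f x ~= 0}"] by auto
    then show ?thesis using C[of "f x"] by simp
  qed simp
  then show ?thesis by (intro exI[of _ "max C 0"]) auto
qed

lemma integrable_csupp_mult:
  fixes f \<rho> :: "'a::euclidean_space => real" assumes "continuous_on UNIV f" "csupp f" "integrable lborel \<rho>"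
  shows "integrable lborel (%x. f x * \<rho> x)"
proof -
  obtain C where C: "C >= 0" "!!x. \<bar>f x\<bar> <= C" using bounded_of_csupp[OF assms(1,2)] by blast
  have "f \<in> borel_measurable borel" using assms(1) by (rule borel_measurable_continuous_onI)
  moreover have "\<rho> \<in> borel_measurable borel" using assms(3) by auto
  moreover have "norm (f x * \<rho> x) <= norm (C * \<rho> x)" for x
    using C(1) mult_right_mono[OF C(2)[of x], of "\<bar>\<rho> x\<bar>"] by (simp add: abs_mult)
  ultimately show ?thesis
    by (intro Bochner_Integration.integrable_bound[OF integrable_mult_right[OF assms(3), of C]]
        borel_measurable_times AE_I2) auto
qed

lemma integrable_csupp:
  fixes f :: "'a::euclidean_space => real" assumes "continuous_on UNIV f" "csupp f" shows "integrable lborel f"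
proof -
  obtain R where R: "closure {x. f x ~= 0} \<subseteq> cball 0 R" using bounded_closure[OF assms(2)] by (rule bounded_cball_0)
  have "integrable lborel (%x. indicator (cball 0 R) x *R f x)"
    by (intro borel_integrable_compact) (auto intro: continuous_on_subset[OF assms(1)])
  also have "(%x. indicator (cball 0 R) x *R f x) = f"
  proof
    fix x
    show "indicator (cball 0 R) x *R f x = f x"
    proof (cases "f x = 0")
      case False
      then have "x \<in> cball 0 R" using R closure_subset[of "{x. f x ~= 0}"] by auto
      then show ?thesis by simp
    qed simp
  qed
  finally show ?thesis .
qed

section \<open>Translation invariance and integrals of derivatives\<close>

lemma lborel_integral_translate:
  fixes f :: "'a::euclidean_space => real" assumes "f \<in> borel_measurable borel"
  shows "(LB x. f (x + c)) = (LB x. f x)"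
proof -
  have "(LB x. f x) = (\<integral>x. f x \<partial>distr lborel borel (%x. c + x))" by (simp add: lborel_distr_plus)
  also have "... = (LB x. f (c + x))" by (rule integral_distr) (auto simp: assms)
  finally show ?thesis by (simp add: add.commute)
qed

text \<open>The integral of a directional derivative vanishes because the integrals of
  \<open>f (x + t v)\<close> do not depend on \<open>t\<close>.\<close>
lemma integral_pd_eq_0:
  fixes f :: "'a::euclidean_space => real" assumes "Ck 1 f" "csupp f" shows "(LB x. pd v f x) = 0"
proof -
  have der: "(f has_derivative frechet_derivative f (at x)) (at x)" for x
    using assms(1) Ck_has_derivative[of 0] by simp
  have cont: "continuous_on UNIV (pd v f)" "continuous_on UNIV f"
    using assms(1) Ck_pd[of 0 f] Ck_continuous[OF assms(1)] by auto
  obtain C where C: "C >= 0" "!!x. \<bar>pd v f x\<bar> <= C" using bounded_of_csupp[OF cont(1) csupp_pd[OF assms(2)]] by blast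
  obtain R where R: "{x. f x ~= 0} \<subseteq> cball 0 R" using assms(2) by (rule bounded_cball_0)
  have line: "((%t. f (x + t *R v)) has_real_derivative pd v f (x + t *R v)) (at t)" for x t
  proof -
    have "((%t. f (x + t *R v)) has_derivative (%s. pd (s *R v) f (x + t *R v))) (at t)"
      by (rule has_derivative_compose[OF _ der]) (auto intro!: derivative_eq_intros)
    moreover have "pd (s *R v) f y = s * pd v f y" for s y
      using linear_scale[OF has_derivative_linear[OF der]] by simp
    ultimately show ?thesis by (simp add: has_field_derivative_def mult_commute_abs)
  qed
  \<comment> \<open>Increments of at most 1 keep the supports of all the quotients inside one ball
    of radius \<open>R + norm v\<close>, which provides the dominating function.\<close>
  define q where "q = (%n x. (f (x + inverse (real (Suc n)) *R v) - f x) / inverse (real (Suc n)))"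
  have "(%n. LB x. q n x) ----> (LB x. pd v f x)"
  proof (rule integral_dominated_convergence[where w = "%x. C * indicator (cball 0 (R + norm v)) x"])
    show "pd v f \<in> borel_measurable lborel" using cont(1) by (simp add: borel_measurable_continuous_onI)
    show "q n \<in> borel_measurable lborel" for n
      using borel_measurable_continuous_onI[OF cont(2)] unfolding q_def by simp
    show "integrable lborel (%x. C * indicator (cball 0 (R + norm v)) x)"
      using emeasure_lborel_cball_finite[of 0 "R + norm v"]
      by (intro integrable_mult_right integrable_real_indicator) (auto simp: emeasure_lborel_cball_finite)
    show "AE x in lborel. (%n. q n x) ----> pd v f x"
    proof (rule AE_I2)
      fix x
      have "((%t. (f (x + t *R v) - f x) / t) \<longlongrightarrow> pd v f x) (at 0)"
        using line[of x 0] by (simp add: has_field_derivative_iff)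
      moreover have "filterlim (%n. inverse (real (Suc n))) (at 0) sequentially"
        unfolding filterlim_at using LIMSEQ_inverse_real_of_nat by auto
      ultimately show "(%n. q n x) ----> pd v f x" unfolding q_def by (rule filterlim_compose)
    qed
    show "AE x in lborel. norm (q n x) <= C * indicator (cball 0 (R + norm v)) x" for n
    proof (rule AE_I2)
      fix x
      let ?t = "inverse (real (Suc n))"
      have t: "0 < ?t" "?t <= 1" by (auto simp: field_simps)
      obtain s where "f (x + ?t *R v) - f (x + 0 *R v) = (?t - 0) * pd v f (x + s *R v)"
        using MVT2[of 0 ?t "%t. f (x + t *R v)" "%t. pd v f (x + t *R v)"] line t by auto
      then have "\<bar>q n x\<bar> <= C" unfolding q_def using C t by (simp add: abs_mult field_simps)
      moreover have "q n x = 0" if "x \<notin> cball 0 (R + norm v)"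
      proof -
        have "norm (?t *R v) <= norm v" using t by (simp add: mult_left_le_one_le)
        moreover have "norm x > R + norm v" using that by simp
        ultimately have "norm (x + ?t *R v) > R" "norm x > R"
          using norm_ge_zero[of v] norm_triangle_ineq2[of x "- (?t *R v)"]
          unfolding norm_minus_cancel diff_minus_eq_add by linarith+
        then have "x + ?t *R v \<notin> cball 0 R" "x \<notin> cball 0 R" by auto
        then have "f (x + ?t *R v) = 0" "f x = 0" using R by blast+
        then show ?thesis by (simp add: q_def)
      qed
      ultimately show "norm (q n x) <= C * indicator (cball 0 (R + norm v)) x" by (auto simp: indicator_def)
    qed
  qed
  moreover have "(LB x. q n x) = 0" for n
  proof -
    let ?t = "inverse (real (Suc n))"
    have "(LB x. f (x + ?t *R v)) = (LB x. f x)"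
      by (intro lborel_integral_translate borel_measurable_continuous_onI cont)
    moreover have "integrable lborel f" by (rule integrable_csupp[OF cont(2) assms(2)])
    moreover have "integrable lborel (%x. f (x + ?t *R v))"
      by (rule integrable_csupp[OF _ csupp_translate[OF assms(2)]])
        (auto intro!: continuous_intros continuous_on_compose2[OF cont(2)])
    ultimately show ?thesis unfolding q_def by simp
  qed
  ultimately show ?thesis using LIMSEQ_unique[OF _ tendsto_const] by simp
qed

subsection \<open>Smooth bump functions\<close>

text \<open>Dividing the usual flat function by powers yields a family whose derivatives are linear
  combinations of its members, so smoothness follows by an induction that is general in
  \<open>n\<close>.\<close>

definition flat_exp :: "nat => real => real" where
  "flat_exp n x = (if x <= 0 then 0 else exp (- (1 / x)) / x ^ n)"

lemma flat_tendsto_0: "((%x. flat_exp n x) \<longlongrightarrow> 0) (at_right 0)"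
proof -
  have "((%x::real. x ^ n / exp x) \<longlongrightarrow> 0) at_top" by (rule tendsto_power_div_exp_0)
  then have "((%x::real. inverse x ^ n / exp (inverse x)) \<longlongrightarrow> 0) (at_right 0)"
    by (rule filterlim_compose) (rule filterlim_inverse_at_top_right)
  moreover have "\<forall>\<^sub>F x in at_right 0. inverse x ^ n / exp (inverse x) = flat_exp n x"
    by (auto simp: eventually_at_filter flat_exp_def exp_minus field_simps power_inverse)
  ultimately show ?thesis by (rule Lim_transform_eventually)
qed

lemma flat_has_derivative:
  "(flat_exp n has_real_derivative flat_exp (n + 2) x - n * flat_exp (n + 1) x) (at x)"
proof (cases x "0::real" rule: linorder_cases)
  case less
  have "(flat_exp n has_real_derivative 0) (at x)"
    by (rule has_field_derivative_transform_within_open[of "%_. 0" _ _ "{..<0}"])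
      (use less in \<open>auto simp: flat_exp_def\<close>)
  then show ?thesis using less by (simp add: flat_exp_def)
next
  case greater
  have pow: "((%x. x ^ n) has_real_derivative n * x ^ n / x) (at x)"
    using DERIV_pow[of n x] greater by (cases n) auto
  have "((%x. exp (- (1 / x))) has_real_derivative exp (- (1 / x)) / x\<^sup>2) (at x)"
    using greater by (auto intro!: derivative_eq_intros simp: power2_eq_square)
  then have "((%x. exp (- (1 / x)) / x ^ n) has_real_derivative
      flat_exp (n + 2) x - n * flat_exp (n + 1) x) (at x)" by (rule DERIV_cong[OF DERIV_divide[OF _ pow]])
      (use greater in \<open>auto simp: flat_exp_def field_simps power2_eq_square\<close>)
  then show ?thesis by (rule has_field_derivative_transform_within_open[of _ _ _ "{0<..}"])
      (use greater in \<open>auto simp: flat_exp_def\<close>)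
next
  case equal
  have "((%y. flat_exp n y / y) \<longlongrightarrow> 0) (at_right 0)"
  proof (rule Lim_transform_eventually[OF flat_tendsto_0[of "Suc n"]])
    show "\<forall>\<^sub>F y in at_right 0. flat_exp (Suc n) y = flat_exp n y / y"
      by (auto simp: eventually_at_filter flat_exp_def field_simps)
  qed
  moreover have "((%y. flat_exp n y / y) \<longlongrightarrow> 0) (at_left 0)" by (rule Lim_transform_eventually[OF tendsto_const])
      (auto simp: eventually_at_filter flat_exp_def)
  ultimately have "((%y. flat_exp n y / y) \<longlongrightarrow> 0) (at 0)" by (simp add: filterlim_at_split)
  then show ?thesis using equal by (simp add: has_field_derivative_iff flat_exp_def)
qed

lemma Ck_flat: "Ck k (flat_exp n)"
proof (induction k arbitrary: n)
  case 0
  then show ?case using flat_has_derivative by (auto intro!: continuous_at_imp_continuous_on DERIV_isCont)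
next
  case (Suc k)
  show ?case by (rule Ck_SucI[of _ "%x v. (flat_exp (n + 2) x - n * flat_exp (n + 1) x) * v"])
      (use flat_has_derivative in \<open>auto simp: has_field_derivative_def
        intro!: Ck_mult Ck_diff Suc.IH Ck_const\<close>)
qed

lemma flat_exp_nonneg: "0 <= flat_exp n x" by (simp add: flat_exp_def)

text \<open>The set where this product is nonzero is exactly the open box, not just contained in it.
  That makes it possible to approximate the indicator of the box by functions of the bump.\<close>

definition box_bump :: "'a::euclidean_space => 'a => 'a => real" where
  "box_bump l u x = (\<Prod>i\<in>Basis. flat_exp 0 (x \<bullet> i - l \<bullet> i) * flat_exp 0 (u \<bullet> i - x \<bullet> i))"

lemma box_bump_nonneg: "0 <= box_bump l u x" by (auto simp: box_bump_def flat_exp_nonneg intro!: prod_nonneg)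

lemma box_bump_eq_0_iff: "box_bump l u x = 0 \<longleftrightarrow> x \<notin> box l u"
  by (auto simp: box_bump_def flat_exp_def mem_box not_le)

lemma box_bump_pos: "x \<in> box l u ==> 0 < box_bump l u x"
  using box_bump_nonneg[of l u x] box_bump_eq_0_iff[of l u x] by linarith

lemma Ck_box_bump: "Ck k (box_bump l u)"
proof -
  have "Ck k (%x::'a. flat_exp 0 (x \<bullet> i + c))" "Ck k (%x::'a. flat_exp 0 (- (x \<bullet> i) + c))" for c i
    by (rule Ck_affine_compose[OF _ Ck_flat];
        intro bounded_linear_minus bounded_linear_inner_left)+
  from this(1)[of _ "- l \<bullet> _"] this(2)[of _ "u \<bullet> _"] show ?thesis
    unfolding box_bump_def[abs_def] by (intro Ck_prod Ck_mult) (auto simp: add.commute)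
qed

lemma csupp_box_bump: "csupp (box_bump l u)" by (simp add: box_bump_eq_0_iff)

abbreviation bump :: "'a::euclidean_space => real" where
  "bump \<equiv> box_bump (- One) One"

lemma bump_0_pos: "0 < bump 0" by (rule box_bump_pos) (simp add: mem_box)

lemmas Ck_bump = Ck_box_bump[of _ "- One" One]
lemmas csupp_bump = csupp_box_bump[of "- One" One]

lemma csupp_scale:
  fixes f :: "'a::euclidean_space => 'b::real_normed_vector" assumes "csupp f" "c ~= 0"
  shows "csupp (%x. f (c *R x))"
proof -
  have "{x. f (c *R x) ~= 0} = (%x. inverse c *R x) ` {x. f x ~= 0}"
    using assms(2) by (force simp: image_iff intro!: exI[of _ "c *R _"])
  then show ?thesis using bounded_scaling[OF assms(1), of "inverse c"] by simp
qed

lemma Ck_scale: "Ck k f ==> Ck k (%x. f (c *R x))" by (rule Ck_linear_compose) (rule bounded_linear_scaleR_right)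

lemma test_function_bump_scaled: assumes "c ~= 0" shows "test_function (%x. bump (c *R (x - a)))"
proof -
  have "test_function (%x. bump (c *R x))" unfolding test_function_iff smooth_def
    by (intro conjI allI Ck_scale Ck_bump csupp_scale csupp_bump assms)
  from test_function_translate[OF this, of "- a"] show ?thesis by simp
qed

subsection \<open>Directional derivatives\<close>

declare Ck.simps(2) [simp del] One_nat_def [simp del]

lemma Ck1_has_derivative:
  "Ck 1 f ==> (f has_derivative frechet_derivative f (at x)) (at x)"
  using Ck_has_derivative[of 0] by (simp add: One_nat_def)

lemma Ck1: "Ck (Suc k) f ==> Ck 1 f" by (rule Ck_le[of 1 "Suc k"]) (auto simp: One_nat_def)

lemma Ck1_continuous_pd: "Ck 1 f ==> continuous_on UNIV (pd v f)" by (simp add: Ck.simps One_nat_def)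

lemma smooth_Ck1: "smooth f ==> Ck 1 f" by (simp add: smooth_def)

lemma linear_pd: "Ck 1 f ==> linear (%v. pd v f x)" by (rule has_derivative_linear[OF Ck1_has_derivative])

lemma pd_vec_add: "Ck 1 f ==> pd (v + w) f x = pd v f x + pd w f x"
  and pd_vec_scale: "Ck 1 f ==> pd (c *R v) f x = c *R pd v f x"
  and pd_vec_minus: "Ck 1 f ==> pd (- v) f x = - pd v f x" and pd_vec_zero: "Ck 1 f ==> pd 0 f x = 0"
  and pd_vec_sum: "Ck 1 f ==> pd (\<Sum>i\<in>J. g i) f x = (\<Sum>i\<in>J. pd (g i) f x)" using linear_pd[of f x]
  by (auto simp: linear_add linear_scale linear_neg linear_0 linear_sum)

lemma pd_basis: "Ck 1 f ==> pd v f x = (\<Sum>e\<in>Basis. (v \<bullet> e) *R pd e f x)"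
  by (subst euclidean_representation[of v, symmetric]) (simp only: pd_vec_sum pd_vec_scale)

lemma pd_const: "pd v (%_. c) x = 0" by (rule pd_eq) simp

lemma pd_bounded_linear: "bounded_linear L ==> pd v L x = L v"
  by (rule pd_eq) (rule bounded_linear_imp_has_derivative)

lemma pd_add: "Ck 1 f ==> Ck 1 g ==> pd v (%x. f x + g x) x = pd v f x + pd v g x"
  by (rule pd_eq) (intro has_derivative_add Ck1_has_derivative)

lemma pd_diff: "Ck 1 f ==> Ck 1 g ==> pd v (%x. f x - g x) x = pd v f x - pd v g x"
  by (rule pd_eq) (intro has_derivative_diff Ck1_has_derivative)

lemma pd_sum:
  "(!!i. i \<in> J ==> Ck 1 (f i)) ==> pd v (%x. \<Sum>i\<in>J. f i x) x = (\<Sum>i\<in>J. pd v (f i) x)"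
  by (rule pd_eq) (intro has_derivative_sum Ck1_has_derivative)

lemma pd_mult:
  fixes f g :: "'a::euclidean_space => real"
  shows "Ck 1 f ==> Ck 1 g ==> pd v (%x. f x * g x) x = f x * pd v g x + pd v f x * g x"
  by (rule pd_eq) (intro has_derivative_mult Ck1_has_derivative)

lemma pd_cmult:
  fixes g :: "'a::euclidean_space => real" shows "Ck 1 g ==> pd v (%x. c * g x) x = c * pd v g x"
  using pd_mult[OF Ck_const] by (simp add: pd_const)

lemma pd_exp:
  fixes f :: "'a::euclidean_space => real" shows "Ck 1 f ==> pd v (%x. exp (f x)) x = exp (f x) * pd v f x"
  using pd_eq[OF has_derivative_exp[OF Ck1_has_derivative]] by (simp add: mult.commute)

lemma pd_affine: assumes "bounded_linear L" "Ck 1 f" shows "pd v (%x. f (L x + c)) x = pd (L v) f (L x + c)"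
  by (rule pd_eq, rule has_derivative_compose[OF _ Ck1_has_derivative[OF assms(2)]])
    (auto intro!: derivative_eq_intros bounded_linear_imp_has_derivative assms)

lemma DERIV_line:
  fixes f :: "'a::euclidean_space => real" assumes "Ck 1 f"
  shows "((%t. f (x + t *R v)) has_real_derivative pd v f (x + t *R v)) (at t within S)"
proof -
  have "((%t. f (x + t *R v)) has_derivative (%s. pd (s *R v) f (x + t *R v))) (at t within S)"
    by (rule has_derivative_compose[OF _ Ck1_has_derivative[OF assms]]) (auto intro!: derivative_eq_intros)
  then show ?thesis by (simp add: has_field_derivative_def pd_vec_scale[OF assms] mult_commute_abs)
qed

text \<open>The mean value theorem is applied twice: along \<open>w\<close> to the increment in
  direction \<open>v\<close>, and along \<open>v\<close> to the resulting derivative. The second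
  difference itself is symmetric in \<open>v\<close> and \<open>w\<close>.\<close>

lemma second_difference:
  fixes f :: "'a::euclidean_space => real" assumes f: "Ck 2 f" and "t > 0"
  shows "\<exists>y. dist y x <= t * (norm v + norm w) &
    f (x + t *R v + t *R w) - f (x + t *R v) - f (x + t *R w) + f x = t\<^sup>2 * pd v (pd w f) y"
proof -
  have C: "Ck 1 f" "Ck 1 (pd w f)" using f Ck1[of 1 f] Ck_pd[of 1 f] by (auto simp: numeral_2_eq_2 One_nat_def)
  obtain s where s: "0 < s" "s < t" "(f (x + t *R v + t *R w) - f (x + t *R w))
      - (f (x + t *R v + 0 *R w) - f (x + 0 *R w))
    = (t - 0) * (pd w f (x + t *R v + s *R w) - pd w f (x + s *R w))"
    using MVT2[OF \<open>0 < t\<close>, of "%s. f (x + t *R v + s *R w) - f (x + s *R w)"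
        "%s. pd w f (x + t *R v + s *R w) - pd w f (x + s *R w)"]
      DERIV_diff[OF DERIV_line[OF C(1)] DERIV_line[OF C(1)]] by blast
  obtain r where r: "0 < r" "r < t" "pd w f (x + s *R w + t *R v) - pd w f (x + s *R w + 0 *R v)
     = (t - 0) * pd v (pd w f) (x + s *R w + r *R v)"
    using MVT2[OF \<open>0 < t\<close>, of "%r. pd w f (x + s *R w + r *R v)"
        "%r. pd v (pd w f) (x + s *R w + r *R v)"] DERIV_line[OF C(2)] by blast
  have "dist (x + s *R w + r *R v) x = norm (s *R w + r *R v)" by (simp add: dist_norm)
  also have "... <= s * norm w + r * norm v" using norm_triangle_ineq[of "s *R w" "r *R v"] s(1) r(1) by simp
  also have "... <= t * norm w + t * norm v" using s(2) r(2) by (intro add_mono mult_right_mono) auto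
  finally have "dist (x + s *R w + r *R v) x <= t * (norm v + norm w)" by (simp add: algebra_simps)
  moreover have sw: "x + t *R v + s *R w = x + s *R w + t *R v" by (simp add: algebra_simps)
  have "f (x + t *R v + t *R w) - f (x + t *R v) - f (x + t *R w) + f x
      = t\<^sup>2 * pd v (pd w f) (x + s *R w + r *R v)" using s(3)[unfolded sw] r(3) by (simp add: power2_eq_square)
  ultimately show ?thesis by blast
qed

text \<open>Both mixed derivatives, each at some point near \<open>x\<close>, represent the same
  symmetric second difference; continuity moves both points to \<open>x\<close>.\<close>

lemma pd_commute:
  fixes f :: "'a::euclidean_space => real" assumes f: "Ck 2 f" shows "pd v (pd w f) x = pd w (pd v f) x"
proof -
  have cont: "continuous_on UNIV (pd v (pd w f))" "continuous_on UNIV (pd w (pd v f))"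
    using f by (auto simp: numeral_2_eq_2 Ck.simps)
  let ?t = "%n. inverse (real (Suc n))"
  let ?N = "norm v + norm w"
  have pos: "?t n > 0" for n by simp
  obtain y where y: "!!n. dist (y n) x <= ?t n * ?N"
    "!!n. f (x + ?t n *R v + ?t n *R w) - f (x + ?t n *R v) - f (x + ?t n *R w) + f x
      = (?t n)\<^sup>2 * pd v (pd w f) (y n)" using second_difference[OF f pos, where x = x and v = v and w = w] by metis
  obtain y' where y': "!!n. dist (y' n) x <= ?t n * ?N"
    "!!n. f (x + ?t n *R w + ?t n *R v) - f (x + ?t n *R w) - f (x + ?t n *R v) + f x
      = (?t n)\<^sup>2 * pd w (pd v f) (y' n)"
    using second_difference[OF f pos, where x = x and v = w and w = v] by (metis add.commute)
  have lim: "u ----> x" if "!!n. dist (u n) x <= ?t n * ?N" for u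
  proof -
    have "(%n. ?t n * ?N) ----> 0 * ?N" by (intro tendsto_mult tendsto_const LIMSEQ_inverse_real_of_nat)
    then have null: "(%n. ?t n * ?N) ----> 0" by simp
    have "(%n. dist (u n) x) ----> 0" by (rule tendsto_sandwich[OF _ _ tendsto_const null])
        (rule always_eventually allI zero_le_dist that)+
    then show ?thesis unfolding tendsto_dist_iff[of u] .
  qed
  have eq: "pd v (pd w f) (y n) = pd w (pd v f) (y' n)" for n
  proof -
    have "(?t n)\<^sup>2 * pd v (pd w f) (y n) = (?t n)\<^sup>2 * pd w (pd v f) (y' n)"
      unfolding y(2)[symmetric] y'(2)[symmetric] by (simp add: algebra_simps)
    then show ?thesis by simp
  qed
  have "(%n. pd v (pd w f) (y n)) ----> pd v (pd w f) x"
    "(%n. pd w (pd v f) (y' n)) ----> pd w (pd v f) x"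
    by (rule continuous_on_tendsto_compose[OF cont(1) lim[OF y(1)]];simp)
      (rule continuous_on_tendsto_compose[OF cont(2) lim[OF y'(1)]];simp)
  then show ?thesis unfolding eq by (rule LIMSEQ_unique)
qed

subsection \<open>The generator in terms of directional derivatives\<close>

abbreviation (input) qq :: "'d::finite state => real^'d" where "qq x \<equiv> fst x"
abbreviation (input) pp :: "'d::finite state => real^'d" where "pp x \<equiv> fst (snd x)"
abbreviation (input) zz :: "'d::finite state => real^'d" where "zz x \<equiv> snd (snd x)"

abbreviation eq :: "'d => 'd::finite state" where "eq i \<equiv> (axis i 1, 0, 0)"
abbreviation ep :: "'d => 'd::finite state" where "ep i \<equiv> (0, axis i 1, 0)"
abbreviation ez :: "'d => 'd::finite state" where "ez i \<equiv> (0, 0, axis i 1)"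

definition transport :: "(real^'d => real^'d) => 'd::finite state => 'd state" where
  "transport b x = (pp x, b (qq x) + zz x, - pp x)"

definition ou :: "real => ('d::finite state => real) => 'd state => real" where
  "ou \<beta> f x = (\<Sum>i\<in>UNIV. 1 / \<beta> * pd (ez i) (pd (ez i) f) x - zz x $ i * pd (ez i) f x)"

lemma pd_cart: "Ck 1 f ==> pd v f x = (\<Sum>i\<in>UNIV. v $ i *R pd (axis i 1) f x)"
  for f :: "real^'d => 'b::real_normed_vector" by (subst basis_expansion[of v, symmetric])
    (simp only: pd_vec_sum pd_vec_scale scalar_mult_eq_scaleR)

lemma inner_grad: "Ck 1 f ==> v \<bullet> grad f x = pd v f x"
  by (subst pd_cart, assumption) (simp add: grad_def inner_vec_def)

lemma vec_sum_axis: "(v :: real^'d) = (\<Sum>i\<in>UNIV. v $ i *R axis i 1)"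
  using basis_expansion[of v] by (simp add: scalar_mult_eq_scaleR)

lemma bounded_linear_state:
  "bounded_linear (%v::'a::euclidean_space. (v, 0::'b::euclidean_space, 0::'c::euclidean_space))"
  "bounded_linear (%v::'b. (0::'a, v, 0::'c))"
  "bounded_linear (%v::'c. (0::'a, 0::'b, v))"
  by (intro bounded_linear_Pair bounded_linear_ident bounded_linear_zero)+

text \<open>Written this way a slice is a composition with an affine map, so the composition rules
  for \<open>Ck\<close> and \<open>pd\<close> apply.\<close>

lemma slice_eqs:
  "(%y. f (y, p, z)) = (%y. f ((y, 0, 0) + (0, p, z)))"
  "(%y. f (q, y, z)) = (%y. f ((0, y, 0) + (q, 0, z)))"
  "(%y. f (q, p, y)) = (%y. f ((0, 0, y) + (q, p, 0)))"
  for f :: "'a::euclidean_space \<times> 'b::euclidean_space \<times> 'c::euclidean_space => 'e" by auto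

lemma Ck_slices:
  fixes f :: "'a::euclidean_space \<times> 'b::euclidean_space \<times> 'c::euclidean_space => 'e::real_normed_vector"
  assumes "Ck k f" shows "Ck k (%q. f (q, p, z))" "Ck k (%p. f (q, p, z))" "Ck k (%z. f (q, p, z))"
  unfolding slice_eqs by (intro Ck_affine_compose bounded_linear_state assms)+

lemma pd_slices:
  fixes f :: "'a::euclidean_space \<times> 'b::euclidean_space \<times> 'c::euclidean_space => 'e::real_normed_vector"
  assumes "Ck 1 f" shows "pd v (%q. f (q, p, z)) q = pd (v, 0, 0) f (q, p, z)"
    "pd w (%p. f (q, p, z)) p = pd (0, w, 0) f (q, p, z)"
    "pd u (%z. f (q, p, z)) z = pd (0, 0, u) f (q, p, z)" unfolding slice_eqs
  using pd_affine[OF bounded_linear_state(1) assms, where v = v and c = "(0, p, z)" and x = q]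
    pd_affine[OF bounded_linear_state(2) assms, where v = w and c = "(q, 0, z)" and x = p]
    pd_affine[OF bounded_linear_state(3) assms, where v = u and c = "(q, p, 0)" and x = z] by auto

lemma Ck_vec_lambda:
  fixes f :: "'i::finite => 'a::euclidean_space => real" assumes "!!i. Ck k (f i)" shows "Ck k (%x. \<chi> i. f i x)"
proof -
  have "(%x. \<chi> i. f i x) = (%x. \<Sum>i\<in>UNIV. f i x *R axis i 1)" using vec_sum_axis[of "\<chi> i. f i _"] by auto
  then show ?thesis using assms by (auto intro!: Ck_sum Ck_scaleR Ck_const)
qed

lemma Ck_grad: "Ck (Suc k) f ==> Ck k (grad f)" unfolding grad_def[abs_def] by (intro Ck_vec_lambda Ck_pd)

lemma pd_component: "Ck 1 F ==> pd v F x $ i = pd v (%x. F x $ i) x" by (rule pd_eq[symmetric])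
    (rule bounded_linear.has_derivative[OF bounded_linear_vec_nth Ck1_has_derivative])

lemma laplacian_eq: assumes "Ck 2 f" shows "laplacian f x = (\<Sum>i\<in>UNIV. pd (axis i 1) (pd (axis i 1) f) x)"
proof -
  have "Ck 1 (grad f)" using assms by (intro Ck_grad) (simp add: numeral_2_eq_2 One_nat_def)
  then show ?thesis unfolding laplacian_def divergence_def by (simp add: pd_component) (simp add: grad_def)
qed

lemma generator_eq: assumes "Ck 2 f" shows "generator \<alpha> \<beta> b f x = pd (transport b x) f x + \<alpha> * ou \<beta> f x"
proof -
  obtain q p z where x: "x = (q, p, z)" by (cases x)
  have C: "Ck 1 f" "Ck 1 (pd v f)" for v
    using assms Ck1[of 1 f] Ck_pd[of 1 f] by (auto simp: numeral_2_eq_2 One_nat_def)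
  have "pd (transport b x) f x = pd (p, 0, 0) f x + pd (0, b q, 0) f x + pd (0, z, 0) f x - pd (0, 0, p) f x"
  proof -
    have "transport b x = (p, 0, 0) + (0, b q, 0) + (0, z, 0) + - (0, 0, p)" by (simp add: transport_def x)
    then show ?thesis by (simp only: pd_vec_add[OF C(1)] pd_vec_minus[OF C(1)])
  qed
  moreover have "ou \<beta> f x = - pd (0, 0, z) f x + (1 / \<beta>) * laplacian (%z. f (q, p, z)) z"
  proof -
    have "(0, 0, z) = (\<Sum>i\<in>UNIV. z $ i *R ez i)"
      by (subst vec_sum_axis[of z]) (simp add: sum_prod[symmetric] prod_eq_iff fst_sum snd_sum)
    then have "pd (0, 0, z) f x = (\<Sum>i\<in>UNIV. z $ i * pd (ez i) f x)"
      by (simp only: pd_vec_sum[OF C(1)] pd_vec_scale[OF C(1)] real_scaleR_def)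
    moreover have "laplacian (%z. f (q, p, z)) z = (\<Sum>i\<in>UNIV. pd (ez i) (pd (ez i) f) x)"
      using pd_slices(3)[OF C(2)] by (simp add: laplacian_eq[OF Ck_slices(3)[OF assms]] pd_slices[OF C(1)] x)
    ultimately show ?thesis by (simp add: ou_def x sum_subtractf sum_distrib_left)
  qed
  ultimately show ?thesis by (simp add: generator_def x inner_grad Ck_slices C pd_slices)
qed

subsection \<open>Momentum reversal\<close>

lemma flip_p_eq: "flip_p x = (qq x, - pp x, zz x)" by (simp add: flip_p_def split_beta)

lemma flip_flip [simp]: "flip_p (flip_p x) = x" by (simp add: flip_p_eq)

lemma bounded_linear_flip_p: "bounded_linear flip_p" unfolding flip_p_eq[abs_def]
  by (intro bounded_linear_Pair bounded_linear_minus bounded_linear_fst bounded_linear_snd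
      bounded_linear_compose[OF bounded_linear_fst] bounded_linear_compose[OF bounded_linear_snd])

lemma measurable_flip_p [measurable]: "flip_p \<in> borel_measurable borel"
  by (intro borel_measurable_continuous_onI linear_continuous_on bounded_linear_flip_p)

text \<open>Momentum reversal is diagonal in the standard basis with entries 1 and -1, so the affine
  transformation formula yields density 1.\<close>

lemma distr_lborel_flip_p: "distr lborel borel (flip_p :: 'd::finite state => _) = lborel"
proof -
  define c where "c = (%j :: 'd state. if pp j = 0 then 1 else - 1 :: real)"
  have flip: "flip_p x = 0 + (\<Sum>j\<in>Basis. (c j * (x \<bullet> j)) *R j)" for x :: "'d state"
  proof -
    have "flip_p x = flip_p (\<Sum>j\<in>Basis. (x \<bullet> j) *R j)" by (simp add: euclidean_representation)
    also have "... = (\<Sum>j\<in>Basis. (x \<bullet> j) *R flip_p j)"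
      by (simp only: linear_sum[OF bounded_linear.linear[OF bounded_linear_flip_p]]
          linear_scale[OF bounded_linear.linear[OF bounded_linear_flip_p]])
    also have "... = (\<Sum>j\<in>Basis. (c j * (x \<bullet> j)) *R j)"
    proof (rule sum.cong[OF refl])
      fix j :: "'d state" assume "j \<in> Basis"
      then have "flip_p j = c j *R j" by (auto simp: flip_p_eq c_def Basis_prod_def nonzero_Basis zero_prod_def)
      then show "(x \<bullet> j) *R flip_p j = (c j * (x \<bullet> j)) *R j" by simp
    qed
    finally show ?thesis by simp
  qed
  have "c j ~= 0" "\<bar>c j\<bar> = 1" for j by (auto simp: c_def)
  then have "lborel = density (distr lborel borel (flip_p :: 'd state => _)) (%_. 1)"
    using lborel_affine_euclidean[of c 0] flip[abs_def] by (simp add: one_ennreal_def[symmetric])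
  then show ?thesis by (simp add: density_1)
qed

lemma nn_integral_flip_p: assumes "f \<in> borel_measurable borel"
  shows "(NN x. f (flip_p x)) = (NN x. f x)"
  by (subst (2) distr_lborel_flip_p[symmetric], subst nn_integral_distr) (use assms in auto)

lemma integral_flip_p:
  fixes f :: "'d::finite state => real" assumes "f \<in> borel_measurable borel"
  shows "(LB x. f (flip_p x)) = (LB x. f x)"
  by (subst (2) distr_lborel_flip_p[symmetric], subst integral_distr) (use assms in auto)

lemma even_in_p_iff: "even_in_p \<rho> \<longleftrightarrow> (AE x in lborel. \<rho> x = \<rho> (flip_p x))"
  by (simp add: even_in_p_def flip_p_eq split_beta)

lemma transport_flip_p: "flip_p (transport b (flip_p x)) = - transport b x" by (simp add: transport_def flip_p_eq)

lemma pd_flip_p: "Ck 1 f ==> pd v (%x. f (flip_p x)) x = pd (flip_p v) f (flip_p x)"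
  using pd_affine[OF bounded_linear_flip_p, where f = f and v = v and c = 0 and x = x] by simp

lemma Ck_flip_p: "Ck k f ==> Ck k (%x. f (flip_p x))" by (rule Ck_linear_compose[OF bounded_linear_flip_p])

lemma flip_p_ez: "flip_p (ez i) = ez i" by (simp add: flip_p_eq)

text \<open>Conjugation with the reversal changes the sign of the transport part, since the
  transport field is odd under it, and preserves the part in \<open>z\<close>.\<close>

lemma generator_flip_p: assumes "Ck 2 f"
  shows "generator \<alpha> \<beta> b (%x. f (flip_p x)) (flip_p x) = - pd (transport b x) f x + \<alpha> * ou \<beta> f x"
proof -
  have C: "Ck 1 f" "Ck 1 (pd v f)" for v
    using assms Ck1[of 1 f] Ck_pd[of 1 f] by (auto simp: numeral_2_eq_2 One_nat_def)
  have "ou \<beta> (%x. f (flip_p x)) (flip_p x) = ou \<beta> f x"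
  proof -
    have "pd (ez i) (%x. f (flip_p x)) = (%x. pd (ez i) f (flip_p x))" for i
      using pd_flip_p[OF C(1)] by (auto simp: flip_p_ez)
    moreover have "zz (flip_p x) = zz x" by (simp add: flip_p_eq)
    ultimately show ?thesis using pd_flip_p[OF C(2)] pd_flip_p[OF C(1)] by (simp add: ou_def flip_p_ez)
  qed
  then show ?thesis by (simp add: generator_eq Ck_flip_p assms pd_flip_p C transport_flip_p pd_vec_minus)
qed

subsection \<open>Weak gradients\<close>

lemma smooth_intros:
  "smooth (%_. c)"
  "smooth f ==> smooth g ==> smooth (%x. f x + g x)"
  "smooth f ==> smooth g ==> smooth (%x. f x - g x)"
  "smooth h ==> smooth k ==> smooth (%x. h x * k x)" for h k :: "'a::euclidean_space => real"
  by (simp_all add: smooth_def Ck_intros)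

lemma Ck_coordinates:
  "Ck k (%x :: 'd::finite state. qq x $ i)"
  "Ck k (%x :: 'd::finite state. pp x $ i)"
  "Ck k (%x :: 'd::finite state. zz x $ i)" by (intro Ck_linear bounded_linear_compose[OF bounded_linear_vec_nth]
      bounded_linear_compose[OF bounded_linear_fst] bounded_linear_compose[OF bounded_linear_snd]
      bounded_linear_fst bounded_linear_snd)+

lemma Ck_force:
  fixes b :: "real^'d => real^'d" shows "Ck k b ==> Ck k (%x :: 'd::finite state. b (qq x) $ i)"
  by (intro Ck_component) (rule Ck_linear_compose[OF bounded_linear_fst])

lemma smooth_coordinates:
  "smooth (%x :: 'd::finite state. qq x $ i)"
  "smooth (%x :: 'd::finite state. pp x $ i)"
  "smooth (%x :: 'd::finite state. zz x $ i)" by (simp_all add: smooth_def Ck_coordinates)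

lemma smooth_force:
  fixes b :: "real^'d => real^'d" shows "smooth b ==> smooth (%x :: 'd::finite state. b (qq x) $ i)"
  by (simp add: smooth_def Ck_force)

lemma pd_coordinates:
  "pd v (%x :: 'd::finite state. qq x $ i) x = qq v $ i"
  "pd v (%x :: 'd::finite state. pp x $ i) x = pp v $ i"
  "pd v (%x :: 'd::finite state. zz x $ i) x = zz v $ i"
  by (subst pd_bounded_linear; intro bounded_linear_compose[OF bounded_linear_vec_nth]
      bounded_linear_compose[OF bounded_linear_fst] bounded_linear_compose[OF bounded_linear_snd]
      bounded_linear_fst bounded_linear_snd refl)+

lemma pd_force:
  fixes b :: "real^'d => real^'d" assumes "Ck 1 b"
  shows "pd v (%x :: 'd::finite state. b (qq x) $ i) x = pd (qq v) (%q. b q $ i) (qq x)"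
  using pd_affine[OF bounded_linear_fst Ck_component[OF assms], where v = v and c = 0 and x = x and i1 = i] by simp

lemma pd_transport: assumes "Ck 1 f" shows "pd (transport b x) f x = (\<Sum>i\<in>UNIV. pp x $ i * pd (eq i) f x
    + (b (qq x) $ i + zz x $ i) * pd (ep i) f x - pp x $ i * pd (ez i) f x)"
proof -
  have "transport b x = (\<Sum>i\<in>UNIV. pp x $ i *R eq i + (b (qq x) $ i + zz x $ i) *R ep i + (- pp x $ i) *R ez i)"
    using vec_sum_axis[of "pp x"] vec_sum_axis[of "b (qq x) + zz x"] vec_sum_axis[of "- pp x"]
    by (simp add: transport_def prod_eq_iff fst_sum snd_sum)
  then show ?thesis by (simp only: pd_vec_sum[OF assms] pd_vec_add[OF assms] pd_vec_scale[OF assms]) simp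
qed

text \<open>The gradient of \<open>- \<beta> * hamiltonian U\<close> when \<open>b\<close> is minus
  the gradient of \<open>U\<close>. It is expressed through \<open>b\<close>, so it is available
  before a potential is known to exist.\<close>

definition gibbs_field :: "real => (real^'d => real^'d) => 'd::finite state => 'd state" where
  "gibbs_field \<beta> b x = (\<beta> *R b (qq x), - \<beta> *R pp x, - \<beta> *R zz x)"

lemma inner_gibbs_field:
  "gibbs_field \<beta> b x \<bullet> eq i = \<beta> * b (qq x) $ i"
  "gibbs_field \<beta> b x \<bullet> ep i = - \<beta> * pp x $ i"
  "gibbs_field \<beta> b x \<bullet> ez i = - \<beta> * zz x $ i" by (simp_all add: gibbs_field_def inner_prod_def inner_axis)

text \<open>The distributional form of "the gradient of \<open>\<rho>\<close> equals
  \<open>\<rho> F\<close>", that is, \<open>F\<close> is the weak logarithmic gradient. No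
  regularity of \<open>\<rho>\<close> is presupposed.\<close>

definition weak_gradient :: "('a::euclidean_space => 'a) => ('a => real) => bool" where
  "weak_gradient F \<rho> \<longleftrightarrow> (\<forall>th v. Ck 1 th & csupp th --> (LB x. (pd v th x + (F x \<bullet> v) * th x) * \<rho> x) = 0)"

abbreviation c0c :: "('a::euclidean_space => real) => bool" where
  "c0c f \<equiv> continuous_on UNIV f & csupp f"

lemma c0c_test: "test_function f ==> c0c f" by (auto simp: test_function_iff smooth_def intro: Ck_continuous[of 0])

locale integrable_weight =
  fixes \<rho> :: "'a::euclidean_space => real" assumes integrable_weight: "integrable lborel \<rho>"
begin

definition I :: "('a => real) => real" where
  "I f = (LB x. f x * \<rho> x)"

lemma I_integrable: "c0c f ==> integrable lborel (%x. f x * \<rho> x)"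
  by (rule integrable_csupp_mult[OF _ _ integrable_weight]) auto

lemma I_add: "c0c f ==> c0c g ==> I (%x. f x + g x) = I f + I g"
  unfolding I_def distrib_right by (rule Bochner_Integration.integral_add) (rule I_integrable; simp)+

lemma I_diff: "c0c f ==> c0c g ==> I (%x. f x - g x) = I f - I g"
  unfolding I_def left_diff_distrib by (rule Bochner_Integration.integral_diff) (rule I_integrable; simp)+

lemma I_cmult: "I (%x. c * f x) = c * I f" by (simp add: I_def mult.assoc)

lemma I_sum: "(!!i. i \<in> J ==> c0c (f i)) ==> I (%x. \<Sum>i\<in>J. f i x) = (\<Sum>i\<in>J. I (f i))" unfolding I_def sum_distrib_right
  by (rule Bochner_Integration.integral_sum) (rule I_integrable; simp)

lemmas I_test_add = I_add[OF c0c_test c0c_test]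
lemmas I_test_diff = I_diff[OF c0c_test c0c_test]
lemmas I_test_sum = I_sum[OF c0c_test]

end

lemmas test_intros = test_function_add test_function_diff test_function_sum
  test_function_mult test_function_pd smooth_intros smooth_coordinates smooth_force smooth_pd
  test_function_smooth

lemma test_pd_mult_coord:
  fixes th g :: "'a::euclidean_space => real" assumes "smooth g" "test_function th"
  shows "pd v (%x. g x * th x) x = g x * pd v th x + pd v g x * th x"
  using assms by (intro pd_mult) (auto simp: test_function_iff smooth_def)

locale langevin_weight = integrable_weight \<rho> for \<rho> :: "'d::finite state => real" +
  fixes \<alpha> \<beta> :: real and b :: "real^'d => real^'d" assumes \<alpha>: "\<alpha> > 0" and \<beta>: "\<beta> > 0" and b: "smooth b"
begin

lemma Ck_b: "Ck k b" using b by (simp add: smooth_def)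

text \<open>Evenness and the invariance of Lebesgue measure remove the reversal from the right-hand
  integral at the price of the sign of the transport part. The resulting equation has a left side
  symmetric in \<open>\<phi>\<close> and \<open>\<psi>\<close> and an antisymmetric right
  side.\<close>

lemma sym_part_iff: assumes even: "even_in_p \<rho>" and \<phi>: "test_function \<phi>" and \<psi>: "test_function \<psi>"
  shows "(LB x. \<phi> x * generator \<alpha> \<beta> b \<psi> x * \<rho> x)
      = (LB x. generator \<alpha> \<beta> b (%x. \<phi> (flip_p x)) x * \<psi> (flip_p x) * \<rho> x)
    \<longleftrightarrow> I (%x. \<phi> x * pd (transport b x) \<psi> x) + I (%x. \<psi> x * pd (transport b x) \<phi> x)
      = \<alpha> * (I (%x. \<psi> x * ou \<beta> \<phi> x) - I (%x. \<phi> x * ou \<beta> \<psi> x))"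
proof -
  have C: "Ck k \<phi>" "Ck k \<psi>" for k using \<phi> \<psi> by (auto simp: test_function_iff smooth_def)
  have C1: "Ck (Suc 0) \<phi>" "Ck (Suc 0) \<psi>" using C by blast+
  have T: "test_function (%x. pd (transport b x) f x)" "test_function (ou \<beta> f)" if "test_function f" for f
  proof -
    have "Ck 1 f" using that by (simp add: test_function_iff smooth_def)
    then show "test_function (%x. pd (transport b x) f x)" by (simp only: pd_transport) (intro test_intros b that)
    show "test_function (ou \<beta> f)" unfolding ou_def[abs_def] by (intro test_intros that)
  qed
  have \<rho>m: "\<rho> \<in> borel_measurable borel" using integrable_weight by auto
  have cm: "f \<in> borel_measurable borel" if "test_function f" for f :: "'d state => real"
    using c0c_test[OF that] by (simp add: borel_measurable_continuous_onI)
  have "(LB x. \<phi> x * generator \<alpha> \<beta> b \<psi> x * \<rho> x)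
      = I (%x. \<phi> x * pd (transport b x) \<psi> x + \<alpha> * (\<phi> x * ou \<beta> \<psi> x))"
    unfolding I_def by (simp add: generator_eq C algebra_simps)
  also have "... = I (%x. \<phi> x * pd (transport b x) \<psi> x) + \<alpha> * I (%x. \<phi> x * ou \<beta> \<psi> x)"
    unfolding I_cmult[symmetric] by (rule I_test_add; intro test_intros T \<phi> \<psi>)
  finally have 1: "(LB x. \<phi> x * generator \<alpha> \<beta> b \<psi> x * \<rho> x) = ..." .
  let ?g = "%x. \<psi> x * (- pd (transport b x) \<phi> x + \<alpha> * ou \<beta> \<phi> x)"
  have g: "test_function (%x. \<alpha> * (\<psi> x * ou \<beta> \<phi> x) - \<psi> x * pd (transport b x) \<phi> x)" by (intro test_intros T \<phi> \<psi>)
  have gm: "?g \<in> borel_measurable borel" using cm[OF g] by (simp add: algebra_simps)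
  have "(LB x. generator \<alpha> \<beta> b (%x. \<phi> (flip_p x)) x * \<psi> (flip_p x) * \<rho> x)
      = (LB x. ?g (flip_p x) * \<rho> x)"
    using generator_flip_p[OF C(1)[of 2], of \<alpha> \<beta> b "flip_p _"] by (simp add: mult.commute)
  also have "... = (LB x. ?g (flip_p x) * \<rho> (flip_p x))"
    using even[unfolded even_in_p_iff] measurable_compose[OF measurable_flip_p gm] \<rho>m by (intro integral_cong_AE)
      (auto intro!: borel_measurable_times elim!: eventually_mono simp del: mult_minus_right
        simp: measurable_compose[OF measurable_flip_p])
  also have "... = (LB x. ?g x * \<rho> x)"
    by (rule integral_flip_p[of "%x. ?g x * \<rho> x"]) (intro borel_measurable_times gm \<rho>m)
  also have "... = I (%x. \<alpha> * (\<psi> x * ou \<beta> \<phi> x) - \<psi> x * pd (transport b x) \<phi> x)"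
    unfolding I_def by (simp add: algebra_simps)
  also have "... = \<alpha> * I (%x. \<psi> x * ou \<beta> \<phi> x) - I (%x. \<psi> x * pd (transport b x) \<phi> x)"
    unfolding I_cmult[symmetric] by (rule I_test_diff; intro test_intros T \<phi> \<psi>)
  finally show ?thesis unfolding 1 by (auto simp: algebra_simps)
qed

end

lemma axis_component: "axis i 1 $ j = (if i = j then 1 else 0 :: real)" by (simp add: axis_def)

lemma test_function_tensor3:
  fixes f g h :: "real^'d => real" assumes "test_function f" "test_function g" "test_function h"
  shows "test_function (tensor3 f g h)"
proof -
  have sm: "Ck k f" "Ck k g" "Ck k h" for k using assms by (auto simp: test_function_iff smooth_def)
  have "Ck k (%x :: 'd state. f (qq x) * g (pp x) * h (zz x))" for k
    by (intro Ck_mult Ck_linear_compose[OF bounded_linear_fst] sm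
        Ck_linear_compose[OF bounded_linear_compose[OF bounded_linear_fst bounded_linear_snd]]
        Ck_linear_compose[OF bounded_linear_compose[OF bounded_linear_snd bounded_linear_snd]])
  moreover have "csupp (%x :: 'd state. f (qq x) * g (pp x) * h (zz x))"
  proof (rule bounded_subset)
    show "bounded ({x. f x ~= 0} \<times> {x. g x ~= 0} \<times> {x. h x ~= 0})"
      using assms by (intro bounded_Times) (auto simp: test_function_iff)
  qed auto
  moreover have "tensor3 f g h = (%x. f (qq x) * g (pp x) * h (zz x))" by (auto simp: tensor3_def)
  ultimately show ?thesis unfolding test_function_iff smooth_def by metis
qed

lemma tensor3_flip_p: "tensor3 f (%p. g (- p)) h = (%x. tensor3 f g h (flip_p x))"
  by (auto simp: tensor3_def flip_p_eq)

section \<open>From the symmetry relation to a weak logarithmic gradient\<close>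

context langevin_weight
begin

lemma I_cong: "(!!x. f x = g x) ==> I f = I g" by (simp add: I_def)

lemma smooth_b: "smooth (%x :: 'd state. b (qq x) $ i)" by (rule smooth_force[OF b])

lemmas smooths = smooth_coordinates smooth_b smooth_intros

lemma pd_force_p: "pd (ep i) (%x. b (qq x) $ j) x = 0" "pd (ez i) (%x. b (qq x) $ j) x = 0"
  using pd_force[OF smooth_Ck1[OF b]] pd_vec_zero[OF Ck_component[OF smooth_Ck1[OF b]]] by auto

lemma pd_coord_mult: assumes "test_function th"
  shows "pd v (%x. pp x $ j * th x) x = pp x $ j * pd v th x + pp v $ j * th x"
    "pd v (%x. zz x $ j * th x) x = zz x $ j * pd v th x + zz v $ j * th x"
    "pd (ep i) (%x. b (qq x) $ j * th x) x = b (qq x) $ j * pd (ep i) th x"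
    "pd (ez i) (%x. b (qq x) $ j * th x) x = b (qq x) $ j * pd (ez i) th x"
  by (simp_all add: test_pd_mult_coord[OF _ assms] smooths pd_coordinates pd_force_p)

definition weak_q where "weak_q \<longleftrightarrow> (\<forall>th i. test_function th --> I (pd (eq i) th) = - \<beta> * I (%x. b (qq x) $ i * th x))"
definition weak_p where "weak_p \<longleftrightarrow> (\<forall>th i. test_function th --> I (pd (ep i) th) = \<beta> * I (%x. pp x $ i * th x))"
definition weak_z where "weak_z \<longleftrightarrow> (\<forall>th i. test_function th --> I (pd (ez i) th) = \<beta> * I (%x. zz x $ i * th x))"

text \<open>Taking both test functions equal to \<open>k\<close> kills the antisymmetric side. For
  the second identity \<open>k\<close> is paired with \<open>z_i k\<close>, which is again a product
  of one-variable test functions. The argument only produces squares of products, and this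
  limitation is removed later by mollification.\<close>

lemma symmetric_generatorD: assumes even: "even_in_p \<rho>" and sym: "symmetric_generator \<alpha> \<beta> b \<rho>"
    and t: "test_function f" "test_function g" "test_function h"
  defines "k \<equiv> tensor3 f g h" shows "I (%x. pd (transport b x) (%x. (k x)\<^sup>2) x) = 0"
    and "I (%x. pd (ez i) (%x. (k x)\<^sup>2) x - \<beta> * zz x $ i * (k x)\<^sup>2) = 0"
proof -
  have symD: "I (%x. \<phi> x * pd (transport b x) \<psi> x) + I (%x. \<psi> x * pd (transport b x) \<phi> x)
      = \<alpha> * (I (%x. \<psi> x * ou \<beta> \<phi> x) - I (%x. \<phi> x * ou \<beta> \<psi> x))"
    if tt: "test_function f1" "test_function f2" "test_function f3"
      "test_function g1" "test_function g2" "test_function g3" and "\<phi> = tensor3 f1 f2 f3" "\<psi> = tensor3 g1 g2 g3"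
    for \<phi> \<psi> f1 f2 f3 g1 g2 g3
  proof (rule sym_part_iff[OF even, THEN iffD1])
    show "test_function \<phi>" "test_function \<psi>" unfolding that by (intro test_function_tensor3 tt)+
    show "(LB x. \<phi> x * generator \<alpha> \<beta> b \<psi> x * \<rho> x)
      = (LB x. generator \<alpha> \<beta> b (%x. \<phi> (flip_p x)) x * \<psi> (flip_p x) * \<rho> x)"
      using sym tt unfolding symmetric_generator_def tensor3_flip_p that(7,8) by blast
  qed
  have kk: "k = tensor3 f g h" by (simp add: k_def)
  have k: "test_function k" unfolding k_def by (intro test_function_tensor3 t)
  note s = test_function_smooth[OF k]
  have "2 * I (%x. k x * pd (transport b x) k x) = 0" using symD[OF t t kk kk] by simp
  moreover have "I (%x. pd (transport b x) (%x. (k x)\<^sup>2) x) = I (%x. 2 * (k x * pd (transport b x) k x))"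
    unfolding power2_eq_square by (intro I_cong) (simp add: pd_mult smooth_Ck1 s)
  ultimately show "I (%x. pd (transport b x) (%x. (k x)\<^sup>2) x) = 0" by (simp add: I_cmult)
  let ?zk = "%x. zz x $ i * k x"
  have zk: "?zk = tensor3 f g (%z. z $ i * h z)" by (auto simp: k_def tensor3_def)
  have zh: "test_function (%z. z $ i * h z)"
    by (intro test_function_mult t) (simp add: smooth_def Ck_linear bounded_linear_vec_nth)
  \<comment> \<open>The relation is used for the pair in both orders: the left sides agree and the
    right sides are opposite, so both vanish.\<close>
  have "\<alpha> * (I (%x. k x * ou \<beta> ?zk x) - I (%x. ?zk x * ou \<beta> k x))
      = \<alpha> * (I (%x. ?zk x * ou \<beta> k x) - I (%x. k x * ou \<beta> ?zk x))"
    using symD[OF t t(1,2) zh kk zk] symD[OF t(1,2) zh t zk kk] by linarith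
  then have "I (%x. k x * ou \<beta> ?zk x) = I (%x. ?zk x * ou \<beta> k x)" using \<alpha> by simp
  \<comment> \<open>The commutator of \<open>ou\<close> with multiplication by \<open>z_i\<close> is
    a first-order operator.\<close>
  moreover have ou: "ou \<beta> ?zk x = zz x $ i * ou \<beta> k x + (2 / \<beta>) * pd (ez i) k x - zz x $ i * k x" for x
  proof -
    have 1: "pd (ez j) ?zk = (%x. zz x $ i * pd (ez j) k x + (if j = i then 1 else 0) * k x)" for j
      using pd_coord_mult(2)[OF k] by (auto simp: axis_component)
    have 2: "pd (ez j) (pd (ez j) ?zk) x = zz x $ i * pd (ez j) (pd (ez j) k) x
       + 2 * (if j = i then 1 else 0) * pd (ez j) k x" for j unfolding 1 by (subst pd_add)
        (auto intro!: smooth_Ck1 test_function_smooth[of "%x. _ x * _ x"] test_intros k s Ck_const Ck_mult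
          simp: pd_coord_mult(2)[OF test_function_pd[OF k]] axis_component pd_cmult smooth_Ck1 s)
    have "1 / \<beta> * pd (ez j) (pd (ez j) ?zk) x - zz x $ j * pd (ez j) ?zk x
      = zz x $ i * (1 / \<beta> * pd (ez j) (pd (ez j) k) x - zz x $ j * pd (ez j) k x)
        + (if j = i then (2 / \<beta>) * pd (ez i) k x - zz x $ i * k x else 0)" for j
      unfolding 2 unfolding fun_cong[OF 1] by (simp add: algebra_simps)
    then show ?thesis unfolding ou_def by (simp add: sum.distrib sum_distrib_left)
  qed
  \<comment> \<open>Multiplied by \<open>k\<close>, the commutator becomes an expression in
    \<open>k^2\<close> alone, because \<open>2 * k\<close> times the derivative of \<open>k\<close>
    is the derivative of \<open>k^2\<close>.\<close>
  moreover have "I (%x. k x * ou \<beta> ?zk x)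
      = I (%x. ?zk x * ou \<beta> k x + (1 / \<beta>) * (pd (ez i) (%x. (k x)\<^sup>2) x - \<beta> * zz x $ i * (k x)\<^sup>2))"
    unfolding ou power2_eq_square using \<beta> by (intro I_cong) (simp add: pd_mult smooth_Ck1 s field_simps)
  moreover have "... = I (%x. ?zk x * ou \<beta> k x)
      + I (%x. (1 / \<beta>) * (pd (ez i) (%x. (k x)\<^sup>2) x - \<beta> * zz x $ i * (k x)\<^sup>2))"
  proof (rule I_test_add)
    show "test_function (%x. ?zk x * ou \<beta> k x)" unfolding ou_def by (intro test_intros k)
    show "test_function (%x. (1 / \<beta>) * (pd (ez i) (%x. (k x)\<^sup>2) x - \<beta> * zz x $ i * (k x)\<^sup>2))"
      unfolding power2_eq_square by (intro test_intros k)
  qed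
  ultimately have "I (%x. (1 / \<beta>) * (pd (ez i) (%x. (k x)\<^sup>2) x - \<beta> * zz x $ i * (k x)\<^sup>2)) = 0" by linarith
  then show "I (%x. pd (ez i) (%x. (k x)\<^sup>2) x - \<beta> * zz x $ i * (k x)\<^sup>2) = 0" using \<beta> by (simp only: I_cmult) simp
qed

text \<open>The operator obtained from the transport operator by replacing the derivatives in \<open>z\<close>
  according to \<open>weak_z\<close>. It contains no derivative in \<open>z\<close>, so its commutator with
  differentiation in \<open>z\<close> yields the equation in \<open>p\<close>; the same
  argument applied to \<open>reduced_p\<close> then yields the equation in \<open>q\<close>.\<close>
definition reduced_z :: "('d state => real) => 'd state => real" where
  "reduced_z th x = (\<Sum>i\<in>UNIV. pp x $ i * pd (eq i) th x + (b (qq x) $ i * pd (ep i) th x + zz x $ i * pd (ep i) th x)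
     - \<beta> * (zz x $ i * (pp x $ i * th x)))"

definition reduced_p :: "('d state => real) => 'd state => real" where
  "reduced_p th x = (\<Sum>i\<in>UNIV. pp x $ i * pd (eq i) th x + \<beta> * (pp x $ i * (b (qq x) $ i * th x)))"

lemma test_reduced_z: "test_function th ==> test_function (reduced_z th)"
  unfolding reduced_z_def[abs_def] by (intro test_intros b)

lemma test_reduced_p: "test_function th ==> test_function (reduced_p th)"
  unfolding reduced_p_def[abs_def] by (intro test_intros b)

text \<open>The summands \<open>p_i * pd (ez i) th\<close> missing from \<open>reduced_z\<close> are
  the derivatives of \<open>p_i * th\<close>, to which \<open>weak_z\<close> applies; the
  replacement changes the integrand by something of integral zero.\<close>

lemma weak_reduced_z: assumes weak_z "!!th. test_function th ==> I (%x. pd (transport b x) th x) = 0"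
    and th: "test_function th" shows "I (reduced_z th) = 0"
proof -
  have e: "reduced_z th x = pd (transport b x) th x
      + (\<Sum>i\<in>UNIV. pd (ez i) (%x. pp x $ i * th x) x - \<beta> * (zz x $ i * (pp x $ i * th x)))" for x
    unfolding reduced_z_def pd_transport[OF smooth_Ck1[OF test_function_smooth[OF th]]] sum.distrib[symmetric]
    by (intro sum.cong refl) (simp only: pd_coord_mult[OF th], simp add: algebra_simps)
  have T: "test_function (%x. pd (transport b x) th x)"
    unfolding pd_transport[OF smooth_Ck1[OF test_function_smooth[OF th]]] by (intro test_intros b th)
  have "I (reduced_z th) = I (%x. pd (transport b x) th x)
      + I (%x. \<Sum>i\<in>UNIV. pd (ez i) (%x. pp x $ i * th x) x - \<beta> * (zz x $ i * (pp x $ i * th x)))"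
    unfolding e[abs_def] by (intro I_test_add T test_intros th)
  also have "I (%x. \<Sum>i\<in>UNIV. pd (ez i) (%x. pp x $ i * th x) x - \<beta> * (zz x $ i * (pp x $ i * th x)))
    = (\<Sum>i\<in>UNIV. I (%x. pd (ez i) (%x. pp x $ i * th x) x - \<beta> * (zz x $ i * (pp x $ i * th x))))"
    by (intro I_test_sum test_intros th)
  also have "... = (\<Sum>i\<in>UNIV. I (pd (ez i) (%x. pp x $ i * th x)) - \<beta> * I (%x. zz x $ i * (pp x $ i * th x)))"
    unfolding I_cmult[symmetric] by (intro sum.cong refl I_test_diff test_intros th)
  also have "... = 0" using assms(1) unfolding weak_z_def by (simp add: test_intros th)
  finally show ?thesis using assms(2)[OF th] by simp
qed

lemma pd_sum_test: assumes "!!i. i \<in> J ==> test_function (f i)"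
  shows "pd v (%x. \<Sum>i\<in>J. f i x) x = (\<Sum>i\<in>J. pd v (f i) x)"
  using assms by (intro pd_sum) (auto simp: test_function_iff smooth_Ck1)

lemma pd_add_test:
  "test_function f ==> test_function g ==> pd v (%x. f x + g x) x = pd v f x + pd v g x"
  "test_function f ==> test_function g ==> pd v (%x. f x - g x) x = pd v f x - pd v g x"
  "test_function g ==> pd v (%x. c * g x) x = c * pd v g x" for f g :: "'d state => real"
  by (auto intro!: pd_add pd_diff pd_cmult simp: test_function_iff smooth_Ck1)

text \<open>\<open>weak_z\<close> is applied to the test function \<open>reduced_z th\<close>.
  Multiplication by \<open>z_j\<close> commutes with \<open>reduced_z\<close>, so the right side
  vanishes. On the left, the commutator of \<open>pd (ez j)\<close> with \<open>reduced_z\<close> is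
  \<open>pd (ep j)\<close> minus multiplication by \<open>\<beta> * p_j\<close>, whose integral must
  therefore vanish.\<close>

lemma weak_p_if_reduced_z: assumes R: "!!th. test_function th ==> I (reduced_z th) = 0" and weak_z shows weak_p
  unfolding weak_p_def
proof (intro allI impI)
  fix th :: "'d state => real" and j assume th: "test_function th"
  have comm: "pd (ez j) (pd v th) x = pd v (pd (ez j) th) x" for v x
    using th by (intro pd_commute) (simp add: test_function_iff smooth_def)
  have d: "pd (ez j) (reduced_z th) x = reduced_z (pd (ez j) th) x + (pd (ep j) th x - \<beta> * (pp x $ j * th x))" for x
  proof -
    have "pd (ez j) (reduced_z th) x = (\<Sum>i\<in>UNIV. pd (ez j) (%x. pp x $ i * pd (eq i) th x
       + (b (qq x) $ i * pd (ep i) th x + zz x $ i * pd (ep i) th x) - \<beta> * (zz x $ i * (pp x $ i * th x))) x)"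
      unfolding reduced_z_def[abs_def] by (intro pd_sum_test test_intros th b)
    also have "... = (\<Sum>i\<in>UNIV. (pp x $ i * pd (eq i) (pd (ez j) th) x
       + (b (qq x) $ i * pd (ep i) (pd (ez j) th) x + zz x $ i * pd (ep i) (pd (ez j) th) x)
       - \<beta> * (zz x $ i * (pp x $ i * pd (ez j) th x)))
       + (if i = j then pd (ep i) th x - \<beta> * (pp x $ i * th x) else 0))" by (intro sum.cong refl)
        (simp only: pd_add_test pd_coord_mult test_intros th b comm,
          simp add: axis_component algebra_simps)
    also have "... = reduced_z (pd (ez j) th) x + (pd (ep j) th x - \<beta> * (pp x $ j * th x))"
      unfolding reduced_z_def sum.distrib by simp
    finally show ?thesis .
  qed
  have m: "zz x $ j * reduced_z th x = reduced_z (%x. zz x $ j * th x) x" for x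
    unfolding reduced_z_def sum_distrib_left
    by (intro sum.cong refl) (simp only: pd_coord_mult[OF th], simp add: algebra_simps)
  have "I (pd (ez j) (reduced_z th)) = \<beta> * I (%x. zz x $ j * reduced_z th x)"
    using \<open>weak_z\<close> test_reduced_z[OF th] unfolding weak_z_def by simp
  also have "... = 0" unfolding m by (simp add: R test_intros th)
  finally have "0 = I (%x. reduced_z (pd (ez j) th) x + (pd (ep j) th x - \<beta> * (pp x $ j * th x)))" unfolding d by simp
  also have "... = I (reduced_z (pd (ez j) th)) + (I (pd (ep j) th) - I (%x. \<beta> * (pp x $ j * th x)))"
    by (simp only: I_test_add I_test_diff test_reduced_z test_intros th)
  finally show "I (pd (ep j) th) = \<beta> * I (%x. pp x $ j * th x)" by (simp add: R test_intros th I_cmult)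
qed

text \<open>Replacing the \<open>p\<close>-derivatives according to \<open>weak_p\<close> cancels
  the terms with \<open>z_i p_i\<close>, so what remains contains neither \<open>z\<close> nor
  derivatives in \<open>p\<close> or \<open>z\<close>.\<close>

lemma weak_reduced_p: assumes R: "!!th. test_function th ==> I (reduced_z th) = 0" and weak_p and th: "test_function th"
  shows "I (reduced_p th) = 0"
proof -
  have e: "reduced_z th x = reduced_p th x
      + (\<Sum>i\<in>UNIV. pd (ep i) (%x. b (qq x) $ i * th x) x + pd (ep i) (%x. zz x $ i * th x) x
        - \<beta> * (pp x $ i * (b (qq x) $ i * th x) + pp x $ i * (zz x $ i * th x)))" for x
    unfolding reduced_z_def reduced_p_def sum.distrib[symmetric]
    by (intro sum.cong refl) (simp only: pd_coord_mult[OF th], simp add: algebra_simps)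
  have "I (reduced_z th) = I (reduced_p th)
      + I (%x. \<Sum>i\<in>UNIV. pd (ep i) (%x. b (qq x) $ i * th x) x + pd (ep i) (%x. zz x $ i * th x) x
        - \<beta> * (pp x $ i * (b (qq x) $ i * th x) + pp x $ i * (zz x $ i * th x)))"
    unfolding e[abs_def] by (intro I_test_add test_reduced_p test_intros th b)
  also have "I (%x. \<Sum>i\<in>UNIV. pd (ep i) (%x. b (qq x) $ i * th x) x + pd (ep i) (%x. zz x $ i * th x) x
        - \<beta> * (pp x $ i * (b (qq x) $ i * th x) + pp x $ i * (zz x $ i * th x)))
    = (\<Sum>i\<in>UNIV. I (%x. pd (ep i) (%x. b (qq x) $ i * th x) x + pd (ep i) (%x. zz x $ i * th x) x
        - \<beta> * (pp x $ i * (b (qq x) $ i * th x) + pp x $ i * (zz x $ i * th x))))"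
    by (intro I_test_sum test_intros th b)
  also have "... = (\<Sum>i\<in>UNIV. I (pd (ep i) (%x. b (qq x) $ i * th x)) + I (pd (ep i) (%x. zz x $ i * th x))
        - \<beta> * (I (%x. pp x $ i * (b (qq x) $ i * th x)) + I (%x. pp x $ i * (zz x $ i * th x))))"
    by (intro sum.cong refl) (simp only: I_cmult I_test_add I_test_diff test_intros th b)
  also have "... = 0" using \<open>weak_p\<close> unfolding weak_p_def by (simp add: test_intros th b distrib_left)
  finally show ?thesis using R[OF th] by simp
qed

text \<open>The commutator argument one level down: \<open>reduced_p\<close> commutes with
  multiplication by \<open>p_j\<close>, and its commutator with \<open>pd (ep j)\<close> is
  \<open>pd (eq j)\<close> plus multiplication by \<open>\<beta> * b_j\<close>.\<close>

lemma weak_q_if_reduced_p: assumes R: "!!th. test_function th ==> I (reduced_p th) = 0" and weak_p shows weak_q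
  unfolding weak_q_def
proof (intro allI impI)
  fix th :: "'d state => real" and j assume th: "test_function th"
  have comm: "pd (ep j) (pd v th) x = pd v (pd (ep j) th) x" for v x
    using th by (intro pd_commute) (simp add: test_function_iff smooth_def)
  have d: "pd (ep j) (reduced_p th) x
      = reduced_p (pd (ep j) th) x + (pd (eq j) th x + \<beta> * (b (qq x) $ j * th x))" for x
  proof -
    have "pd (ep j) (reduced_p th) x = (\<Sum>i\<in>UNIV. pd (ep j) (%x. pp x $ i * pd (eq i) th x
       + \<beta> * (pp x $ i * (b (qq x) $ i * th x))) x)"
      unfolding reduced_p_def[abs_def] by (intro pd_sum_test test_intros th b)
    also have "... = (\<Sum>i\<in>UNIV. (pp x $ i * pd (eq i) (pd (ep j) th) x
       + \<beta> * (pp x $ i * (b (qq x) $ i * pd (ep j) th x)))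
       + (if i = j then pd (eq i) th x + \<beta> * (b (qq x) $ i * th x) else 0))" by (intro sum.cong refl)
        (simp only: pd_add_test pd_coord_mult test_intros th b comm,
          simp add: axis_component algebra_simps)
    also have "... = reduced_p (pd (ep j) th) x + (pd (eq j) th x + \<beta> * (b (qq x) $ j * th x))"
      unfolding reduced_p_def sum.distrib by simp
    finally show ?thesis .
  qed
  have m: "pp x $ j * reduced_p th x = reduced_p (%x. pp x $ j * th x) x" for x
    unfolding reduced_p_def sum_distrib_left
    by (intro sum.cong refl) (simp only: pd_coord_mult[OF th], simp add: algebra_simps)
  have "I (pd (ep j) (reduced_p th)) = \<beta> * I (%x. pp x $ j * reduced_p th x)"
    using \<open>weak_p\<close> test_reduced_p[OF th] unfolding weak_p_def by simp
  also have "... = 0" unfolding m by (simp add: R test_intros th)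
  finally have "0 = I (%x. reduced_p (pd (ep j) th) x + (pd (eq j) th x + \<beta> * (b (qq x) $ j * th x)))"
    unfolding d by simp
  also have "... = I (reduced_p (pd (ep j) th)) + (I (pd (eq j) th) + I (%x. \<beta> * (b (qq x) $ j * th x)))"
    by (simp only: I_test_add test_reduced_p test_intros th b)
  finally show "I (pd (eq j) th) = - \<beta> * I (%x. b (qq x) $ j * th x)" by (simp add: R test_intros th I_cmult)
qed

lemma weak_coordinates: assumes weak_z "!!th. test_function th ==> I (%x. pd (transport b x) th x) = 0"
    and th: "test_function th" shows "I (%x. pd v th x + (gibbs_field \<beta> b x \<bullet> v) * th x) = 0"
proof -
  note R = weak_reduced_z[OF assms(1,2)]
  have wp: weak_p by (rule weak_p_if_reduced_z[OF R assms(1)])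
  have wq: weak_q by (rule weak_q_if_reduced_p[OF weak_reduced_p[OF R wp] wp])
  have v: "v = (\<Sum>i\<in>UNIV. qq v $ i *R eq i + pp v $ i *R ep i + zz v $ i *R ez i)"
    using vec_sum_axis[of "qq v"] vec_sum_axis[of "pp v"] vec_sum_axis[of "zz v"]
    by (simp add: prod_eq_iff fst_sum snd_sum)
  note C1 = smooth_Ck1[OF test_function_smooth[OF th]]
  have pv: "pd v th x = (\<Sum>i\<in>UNIV. qq v $ i * pd (eq i) th x + pp v $ i * pd (ep i) th x
      + zz v $ i * pd (ez i) th x)" for x
    by (subst v) (simp only: pd_vec_sum[OF C1] pd_vec_add[OF C1] pd_vec_scale[OF C1] real_scaleR_def)
  have gv: "gibbs_field \<beta> b x \<bullet> v = (\<Sum>i\<in>UNIV. qq v $ i * (\<beta> * b (qq x) $ i)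
      + pp v $ i * (- \<beta> * pp x $ i) + zz v $ i * (- \<beta> * zz x $ i))" for x
    by (subst v) (simp only: inner_sum_right inner_add_right inner_scaleR_right inner_gibbs_field)
  have "I (%x. pd v th x + (gibbs_field \<beta> b x \<bullet> v) * th x)
    = I (%x. \<Sum>i\<in>UNIV. qq v $ i * (pd (eq i) th x + \<beta> * (b (qq x) $ i * th x))
       + pp v $ i * (pd (ep i) th x - \<beta> * (pp x $ i * th x)) + zz v $ i * (pd (ez i) th x - \<beta> * (zz x $ i * th x)))"
    unfolding pv gv by (intro I_cong) (simp add: sum.distrib sum_distrib_left algebra_simps sum_subtractf sum_negf)
  also have "... = (\<Sum>i\<in>UNIV. I (%x. qq v $ i * (pd (eq i) th x + \<beta> * (b (qq x) $ i * th x))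
       + pp v $ i * (pd (ep i) th x - \<beta> * (pp x $ i * th x)) + zz v $ i * (pd (ez i) th x - \<beta> * (zz x $ i * th x))))"
    by (intro I_test_sum test_intros th b)
  also have "... = (\<Sum>i\<in>UNIV. qq v $ i * (I (pd (eq i) th) + \<beta> * I (%x. b (qq x) $ i * th x))
       + pp v $ i * (I (pd (ep i) th) - \<beta> * I (%x. pp x $ i * th x))
       + zz v $ i * (I (pd (ez i) th) - \<beta> * I (%x. zz x $ i * th x)))"
    by (intro sum.cong refl) (simp only: I_cmult I_test_add I_test_diff test_intros th b)
  also have "... = 0" using wp wq assms(1) th unfolding weak_q_def weak_p_def weak_z_def by simp
  finally show ?thesis .
qed

end

subsection \<open>Almost everywhere equality\<close>

lemma AE_lborel_continuous_eq:
  fixes f g :: "'a::euclidean_space => real"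
  assumes "continuous_on UNIV f" "continuous_on UNIV g" "AE x in lborel. f x = g x" shows "f = g"
proof (rule ccontr)
  assume "f ~= g"
  then obtain x where x: "f x ~= g x" by auto
  have op: "open {x. f x ~= g x}" using assms(1,2) by (intro open_Collect_neq)
  have "AE x in lborel. x \<notin> {x. f x ~= g x}" using assms(3) by auto
  then have "{x. f x ~= g x} \<in> null_sets lborel" using op by (subst (asm) AE_iff_null_sets[symmetric]) auto
  then have "negligible {x. f x ~= g x}" by (simp add: negligible_iff_null_sets null_sets_completionI)
  then show False using op x open_not_negligible by blast
qed

lemma AE_lborel_translate:
  fixes P :: "'a::euclidean_space => bool" assumes "AE x in lborel. P x" shows "AE x in lborel. P (x + v)"
proof -
  have "AE x in distr lborel borel ((+) v). P x" using assms by (subst lborel_distr_plus)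
  then have "AE x in lborel. P (v + x)" by (rule AE_distrD[rotated]) simp
  then show ?thesis by (simp add: add.commute)
qed

text \<open>The positive and the negative part of \<open>d\<close> are densities of two measures
  that are finite and equal on boxes. Boxes generate the Borel sets and are stable under
  intersection, so the measures and hence the two parts agree.\<close>

lemma AE_eq_0_of_box_integrals:
  fixes d :: "'a::euclidean_space => real" assumes d [measurable]: "d \<in> borel_measurable borel"
    and int: "!!l u. integrable lborel (%x. indicator (box l u) x * d x)"
    and zero: "!!l u. (LB x. indicator (box l u) x * d x) = 0" shows "AE x in lborel. d x = 0"
proof -
  let ?M = "density lborel (%x. ennreal (max 0 (d x)))"
  let ?N = "density lborel (%x. ennreal (max 0 (- d x)))"
  have max_int: "integrable lborel (%x. indicator (box l u) x * max 0 (d x))"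
    "integrable lborel (%x. indicator (box l u) x * max 0 (- d x))" for l u
    by (rule Bochner_Integration.integrable_bound[OF int[of l u]]; auto split: split_indicator)+
  have em: "emeasure ?M (box l u) = ennreal (LB x. indicator (box l u) x * max 0 (d x))"
    "emeasure ?N (box l u) = ennreal (LB x. indicator (box l u) x * max 0 (- d x))" for l u
    using max_int[of l u] by (subst emeasure_density; (subst nn_integral_eq_integral[symmetric])?;
        auto intro!: nn_integral_cong split: split_indicator)+
  have eq: "(LB x. indicator (box l u) x * max 0 (d x))
      = (LB x. indicator (box l u) x * max 0 (- d x))" for l u
  proof -
    have "(LB x. indicator (box l u) x * max 0 (d x)) - (LB x. indicator (box l u) x * max 0 (- d x))
      = (LB x. indicator (box l u) x * max 0 (d x) - indicator (box l u) x * max 0 (- d x))"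
      by (intro Bochner_Integration.integral_diff[symmetric] max_int)
    also have "... = (LB x. indicator (box l u) x * d x)"
      by (intro Bochner_Integration.integral_cong) (auto simp: max_def)
    finally show ?thesis using zero[of l u] by simp
  qed
  have "?M = ?N"
  proof (rule measure_eqI_generator_eq[where E = "range (%(l, u). box l u)" and \<Omega> = UNIV
        and A = "%n. box (- real n *R One) (real n *R One)"])
    show "Int_stable (range (%(l, u). box l u :: 'a set))" by (auto simp: Int_stable_def box_Int_box)
    show "sets ?M = sigma_sets UNIV (range (%(l, u). box l u))"
      "sets ?N = sigma_sets UNIV (range (%(l, u). box l u))" by (simp_all add: borel_eq_box)
    show "(\<Union>n. box (- real n *R One) (real n *R One)) = (UNIV :: 'a set)" using UN_box_eq_UNIV by simp
    show "emeasure ?M X = emeasure ?N X" if "X \<in> range (%(l, u). box l u)" for X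
    proof -
      from that obtain lu where "X = (%(l, u). box l u) lu" by (rule rangeE)
      then have X: "X = box (fst lu) (snd lu)" by (simp add: split_beta)
      show ?thesis unfolding X em eq ..
    qed
    show "emeasure ?M (box (- real n *R One) (real n *R One)) ~= \<infinity>" for n unfolding em by simp
  qed auto
  then have "AE x in lborel. ennreal (max 0 (d x)) = ennreal (max 0 (- d x))"
    by (intro sigma_finite_measure.density_unique[OF sigma_finite_lborel]) auto
  then show ?thesis
  proof eventually_elim
    case (elim x)
    then have "max 0 (d x) = max 0 (- d x)" by (subst (asm) ennreal_inj) auto
    then show ?case by (auto simp: max_def split: if_splits)
  qed
qed

lemma AE_eq_0_if_orthogonal:
  fixes d :: "'a::euclidean_space => real" assumes d [measurable]: "d \<in> borel_measurable borel"
    and int: "!!l u. integrable lborel (%x. indicator (box l u) x * d x)"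
    and orth: "!!\<kappa>. Ck 1 \<kappa> ==> csupp \<kappa> ==> (LB x. \<kappa> x * d x) = 0" shows "AE x in lborel. d x = 0"
proof (rule AE_eq_0_of_box_integrals[OF d int])
  fix l u :: 'a
  \<comment> \<open>These functions increase to the indicator of the box because the bump is
    positive precisely there, and they are as smooth and compactly supported as the bump.\<close>
  define \<kappa> where "\<kappa> = (%n x. 1 - exp (- (real n * box_bump l u x)))"
  have [measurable]: "box_bump l u \<in> borel_measurable borel"
    by (intro borel_measurable_continuous_onI Ck_continuous[of 0] Ck_box_bump)
  have "(%n. LB x. \<kappa> n x * d x) ----> (LB x. indicator (box l u) x * d x)"
  proof (rule integral_dominated_convergence[where w = "%x. norm (indicator (box l u) x * d x)"])
    show "integrable lborel (%x. norm (indicator (box l u) x * d x))" by (intro integrable_norm int)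
    show "AE x in lborel. (%n. \<kappa> n x * d x) ----> indicator (box l u) x * d x"
    proof (rule AE_I2)
      fix x
      show "(%n. \<kappa> n x * d x) ----> indicator (box l u) x * d x"
      proof (cases "x \<in> box l u")
        case True
        then have "0 < box_bump l u x" by (rule box_bump_pos)
        then have "(%n. \<kappa> n x) ----> 1" unfolding \<kappa>_def by real_asymp
        from tendsto_mult_right[OF this, of "d x"] show ?thesis using True by simp
      next
        case False
        then have "box_bump l u x = 0" by (simp add: box_bump_eq_0_iff)
        then show ?thesis using False by (simp add: \<kappa>_def)
      qed
    qed
    show "AE x in lborel. norm (\<kappa> n x * d x) <= norm (indicator (box l u) x * d x)" for n
    proof (rule AE_I2)
      fix x
      show "norm (\<kappa> n x * d x) <= norm (indicator (box l u) x * d x)"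
      proof (cases "x \<in> box l u")
        case True
        have "0 <= real n * box_bump l u x" by (simp add: box_bump_nonneg)
        then have "\<bar>\<kappa> n x\<bar> <= 1" by (simp add: \<kappa>_def)
        from mult_right_mono[OF this, of "\<bar>d x\<bar>"] show ?thesis using True by (simp add: abs_mult)
      next
        case False
        then have "box_bump l u x = 0" by (simp add: box_bump_eq_0_iff)
        then show ?thesis by (simp add: \<kappa>_def)
      qed
    qed
  qed (simp_all add: \<kappa>_def)
  moreover have "(LB x. \<kappa> n x * d x) = 0" for n
  proof (rule orth)
    show "Ck 1 (\<kappa> n)" unfolding \<kappa>_def by (intro Ck_diff Ck_const Ck_exp Ck_minus Ck_mult Ck_box_bump)
    show "csupp (\<kappa> n)" by (rule csupp_mono[OF csupp_box_bump[of l u]]) (simp add: \<kappa>_def)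
  qed
  ultimately show "(LB x. indicator (box l u) x * d x) = 0" using LIMSEQ_unique[OF _ tendsto_const] by simp
qed

lemma integrable_box_mult:
  fixes f \<rho> :: "'a::euclidean_space => real" assumes f: "continuous_on UNIV f" and \<rho>: "integrable lborel \<rho>"
  shows "integrable lborel (%x. indicator (box l u) x * (f x * \<rho> x))"
proof -
  have "compact (f ` cbox l u)" using f by (intro compact_continuous_image compact_cbox continuous_on_subset[OF f]) auto
  then obtain C where C: "\<forall>x\<in>cbox l u. \<bar>f x\<bar> <= C" by (auto dest!: compact_imp_bounded simp: bounded_iff)
  have [measurable]: "f \<in> borel_measurable borel" "\<rho> \<in> borel_measurable borel"
    using f \<rho> by (auto intro: borel_measurable_continuous_onI)
  show ?thesis
  proof (rule Bochner_Integration.integrable_bound)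
    show "integrable lborel (%x. C * \<rho> x)" using \<rho> by simp
    have "norm (indicator (box l u) x * (f x * \<rho> x)) <= norm (C * \<rho> x)" for x
    proof (cases "x \<in> box l u")
      case True
      then have "\<bar>f x\<bar> <= C" using C box_subset_cbox by blast
      then have "\<bar>f x\<bar> * \<bar>\<rho> x\<bar> <= \<bar>C\<bar> * \<bar>\<rho> x\<bar>" by (intro mult_right_mono) auto
      then show ?thesis using True by (simp add: abs_mult)
    qed simp
    then show "AE x in lborel. norm (indicator (box l u) x * (f x * \<rho> x)) <= norm (C * \<rho> x)" by simp
  qed simp
qed

subsection \<open>Mollification\<close>

text \<open>Supplies the integrability needed for Fubini: integrability in \<open>x\<close> comes
  from \<open>\<rho>\<close>, integrability in \<open>y\<close> from the bounded support.\<close>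

lemma integrable_pair_bounded:
  fixes f :: "'a::euclidean_space \<times> 'b::euclidean_space => real" and \<rho> :: "'a => real"
  assumes [measurable]: "f \<in> borel_measurable borel" and \<rho>: "integrable lborel \<rho>"
    and C: "!!x y. \<bar>f (x, y)\<bar> <= C" and R: "!!x y. f (x, y) ~= 0 ==> norm y <= R"
  shows "integrable (lborel \<Otimes>\<^sub>M lborel) (%(x, y). f (x, y) * \<rho> x)"
proof -
  have [measurable]: "\<rho> \<in> borel_measurable borel" using \<rho> by auto
  have [measurable]: "cball (0 :: 'b) R \<in> sets borel" by simp
  have C0: "0 <= C" using C[of undefined undefined] by linarith
  have ball: "integrable lborel (indicator (cball 0 R) :: 'b => real)"
    using emeasure_lborel_cball_finite by (intro integrable_real_indicator) auto
  have dom: "integrable (lborel \<Otimes>\<^sub>M lborel) (%(x, y::'b). C * \<rho> x * indicator (cball 0 R) y)"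
  proof (rule lborel_pair.Fubini_integrable)
    show "AE x in lborel. integrable lborel (%y. case (x, y) of (x, y::'b) => C * \<rho> x * indicator (cball 0 R) y)"
      using ball by simp
    show "integrable lborel (%x. LB y. norm (case (x, y) of (x, y::'b) => C * \<rho> x * indicator (cball 0 R) y))"
      using \<rho> by (simp add: abs_mult)
  qed measurable
  have [measurable]: "f \<in> borel_measurable (borel \<Otimes>\<^sub>M borel)" by (simp add: borel_prod)
  show ?thesis
  proof (rule Bochner_Integration.integrable_bound[OF dom])
    have "norm (f (x, y) * \<rho> x) <= norm (C * \<rho> x * indicator (cball 0 R) y)" for x y
    proof (cases "f (x, y) = 0")
      case False
      then show ?thesis using R[OF False] mult_right_mono[OF C[of x y], of "\<bar>\<rho> x\<bar>"] C0 by (simp add: abs_mult)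
    qed simp
    then show "AE xy in lborel \<Otimes>\<^sub>M lborel. norm (case xy of (x, y) => f (x, y) * \<rho> x)
        <= norm (case xy of (x, y) => C * \<rho> x * indicator (cball 0 R) y)" by (intro AE_I2) auto
  qed measurable
qed


lemma integral_scale_reflect:
  fixes g :: "'a::euclidean_space => real" assumes [measurable]: "g \<in> borel_measurable borel" and "s > 0"
  shows "(LB y. g y) = (LB u. g (x - (1 / s) *R u)) / s ^ DIM('a)"
proof -
  have "lborel = density (distr lborel borel (%u. x + (- 1 / s) *R u)) (%_. ennreal (\<bar>- 1 / s\<bar> ^ DIM('a)))"
    using lborel_affine[of "- 1 / s" x] \<open>s > 0\<close> by (simp add: ennreal_power)
  then have "(LB y. g y) = (\<integral>y. g y \<partial>density (distr lborel borel (%u. x + (- 1 / s) *R u)) (%_. ennreal (\<bar>- 1 / s\<bar> ^ DIM('a))))"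
    by simp
  also have "... = (LB u. \<bar>- 1 / s\<bar> ^ DIM('a) * g (x + (- 1 / s) *R u))"
    by (subst integral_density; (subst integral_distr)?; simp)
  finally show ?thesis using \<open>s > 0\<close> by (simp add: power_divide)
qed

lemma integral_pos_of_bump:
  fixes \<eta> :: "'a::euclidean_space => real"
  assumes c: "continuous_on UNIV \<eta>" "csupp \<eta>" and pos: "!!x. 0 <= \<eta> x" "\<eta> 0 > 0" shows "(LB x. \<eta> x) > 0"
proof -
  have "(LB x. \<eta> x) ~= 0"
  proof
    assume "(LB x. \<eta> x) = 0"
    then have "AE x in lborel. \<eta> x = 0" using integral_nonneg_eq_0_iff_AE[OF integrable_csupp[OF c]] pos(1) by simp
    then have "\<eta> = (%_. 0)" by (intro AE_lborel_continuous_eq c) auto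
    then show False using pos(2) by simp
  qed
  moreover have "(LB x. \<eta> x) >= 0" using pos(1) by simp
  ultimately show ?thesis by simp
qed

lemma continuous_on_pd_joint:
  fixes th :: "'a::euclidean_space => real" assumes th: "Ck 1 th" and f: "continuous_on S f" and g: "continuous_on S g"
  shows "continuous_on S (%x. pd (f x) th (g x))"
proof -
  have "continuous_on S (%x. pd e th (g x))" for e
    by (rule continuous_on_compose2[OF Ck1_continuous_pd[OF th] g]) simp
  moreover have "(%x. pd (f x) th (g x)) = (%x. \<Sum>e\<in>Basis. (f x \<bullet> e) *R pd e th (g x))"
    by (rule ext) (rule pd_basis[OF th])
  ultimately show ?thesis by (simp only:) (intro continuous_intros f)
qed

text \<open>The identity is known only for translates and dilates of one bump \<open>\<eta>\<close>
  and is extended to every \<open>th\<close>. It is multiplied by \<open>th y\<close> and integrated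
  over \<open>y\<close>. Since \<open>a\<close> and \<open>c\<close> depend on \<open>x\<close>
  only, integrating by parts in \<open>y\<close> moves the derivative from \<open>\<eta>\<close> to
  \<open>th\<close>, and concentration of the kernel as \<open>s\<close> grows sets
  \<open>y = x\<close>. In particular \<open>a\<close> is never differentiated.\<close>

lemma mollified_weak_identity:
  fixes \<eta> \<rho> c :: "'a::euclidean_space => real" and a :: "'a => 'a"
  assumes \<eta>: "Ck 1 \<eta>" "csupp \<eta>" "!!x. 0 <= \<eta> x" "\<eta> 0 > 0"
    and a: "continuous_on UNIV a" and c: "continuous_on UNIV c" and \<rho>: "integrable lborel \<rho>"
    and weak: "!!s y. s > 0 ==> (LB x. (pd (a x) (%x. \<eta> (s *R (x - y))) x
        + c x * \<eta> (s *R (x - y))) * \<rho> x) = 0" and th: "Ck 1 th" "csupp th"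
  shows "(LB x. (pd (a x) th x + c x * th x) * \<rho> x) = 0"
proof -
  have cont: "continuous_on UNIV \<eta>" "continuous_on UNIV th" using \<eta> th Ck_continuous by auto
  have [measurable]: "\<eta> \<in> borel_measurable borel" "th \<in> borel_measurable borel"
    "a \<in> borel_measurable borel" "c \<in> borel_measurable borel" "\<rho> \<in> borel_measurable borel"
    using cont a c \<rho> by (auto intro: borel_measurable_continuous_onI)
  obtain R1 where R1: "closure {x. \<eta> x ~= 0} \<subseteq> cball 0 R1" by (rule bounded_cball_0[OF bounded_closure[OF \<eta>(2)]])
  obtain R2 where R2: "closure {x. th x ~= 0} \<subseteq> cball 0 R2" by (rule bounded_cball_0[OF bounded_closure[OF th(2)]])
  have out1: "\<eta> x = 0 & pd v \<eta> x = 0" if "norm x > R1" for x v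
  proof -
    have "x \<notin> closure {x. \<eta> x ~= 0}" using R1 that by (auto dest: subsetD)
    then show ?thesis using pd_eq_0_outside closure_subset[THEN subsetD, of x "{x. \<eta> x ~= 0}"] by blast
  qed
  have out2: "th x = 0 & pd v th x = 0" if "norm x > R2" for x v
  proof -
    have "x \<notin> closure {x. th x ~= 0}" using R2 that by (auto dest: subsetD)
    then show ?thesis using pd_eq_0_outside closure_subset[THEN subsetD, of x "{x. th x ~= 0}"] by blast
  qed
  \<comment> \<open>Coefficients at \<open>x\<close>, test function at \<open>y\<close>; the claim
    concerns the diagonal.\<close>
  define h where "h = (%x y. pd (a x) th y + c x * th y)"
  have hc: "continuous_on S (%x. h (f x) (g x))" if "continuous_on S f" "continuous_on S g"
    for S and f g :: "'b::topological_space => 'a" unfolding h_def using that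
    by (intro continuous_intros continuous_on_pd_joint[OF th(1)] continuous_on_compose2[OF a]
        continuous_on_compose2[OF c] continuous_on_compose2[OF cont(2)]) auto
  have h0: "h x y = 0" if "norm y > R2" for x y using out2[OF that] by (simp add: h_def)
  have pds: "pd v (%x. \<eta> (s *R (x - y))) x = s * pd v \<eta> (s *R (x - y))" for v s x y
    using pd_affine[OF bounded_linear_scaleR_right \<eta>(1), where v = v and x = x and c = "- s *R y"]
    by (simp add: algebra_simps pd_vec_scale[OF \<eta>(1)])
  have pdr: "pd v (%y. \<eta> (s *R (x - y))) y = - s * pd v \<eta> (s *R (x - y))" for v s x y
    using pd_affine[OF bounded_linear_scaleR_right \<eta>(1), where v = v and x = y and c = "s *R x" and r1 = "- s"]
      pd_vec_scale[OF \<eta>(1), where c = "- s" and v = v and x = "s *R (x - y)"] by (simp add: algebra_simps)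
  have main: "(LB x. LB u. h x (x - (1 / s) *R u) * \<eta> u * \<rho> x) = 0" if s: "s > 0" for s
  proof -
    define G where "G = (%x y. th y * (s * pd (a x) \<eta> (s *R (x - y)) + c x * \<eta> (s *R (x - y))))"
    have Gc: "continuous_on UNIV (%xy. G (fst xy) (snd xy))" unfolding G_def
      by (intro continuous_intros continuous_on_pd_joint[OF \<eta>(1)] continuous_on_compose2[OF a]
        continuous_on_compose2[OF c] continuous_on_compose2[OF cont(1)] continuous_on_compose2[OF cont(2)]) auto
    have Gs: "norm y <= R2 & norm x <= R2 + R1 / s" if "G x y ~= 0" for x y
    proof -
      have y: "norm y <= R2" using that out2[of y] by (force simp: G_def)
      have "norm (s *R (x - y)) <= R1" using that out1[of "s *R (x - y)"] by (force simp: G_def)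
      then have "norm (x - y) <= R1 / s" using s unfolding norm_scaleR by (simp add: pos_le_divide_eq mult.commute)
      then show ?thesis using y norm_triangle_sub[of x y] by linarith
    qed
    have "csupp (%xy. G (fst xy) (snd xy))" by (rule bounded_subset[of "cball 0 (R2 + R1 / s) \<times> cball 0 R2"])
        (use Gs in \<open>auto intro: bounded_Times\<close>)
    then obtain C where C: "!!xy. \<bar>G (fst xy) (snd xy)\<bar> <= C" using bounded_of_csupp[OF Gc] by blast
    have intG: "integrable (lborel \<Otimes>\<^sub>M lborel) (%(x, y). G x y * \<rho> x)"
      using integrable_pair_bounded[OF borel_measurable_continuous_onI[OF Gc] \<rho>, of C R2] C Gs
      by (simp add: split_beta) (metis (no_types, lifting) fst_conv snd_conv)
    have "0 = (LB y. th y * (LB x. (pd (a x) (%x. \<eta> (s *R (x - y))) x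
        + c x * \<eta> (s *R (x - y))) * \<rho> x))" by (simp add: weak[OF s])
    also have "... = (LB y. LB x. G x y * \<rho> x)" unfolding G_def pds by (simp add: mult.assoc)
    also have "... = (LB x. LB y. G x y * \<rho> x)" by (rule lborel_pair.Fubini_integral[OF intG])
    also have "... = (LB x. (LB u. h x (x - (1 / s) *R u) * \<eta> u) / s ^ DIM('a) * \<rho> x)"
    proof (rule Bochner_Integration.integral_cong[OF refl])
      fix x
      have eC: "Ck 1 (%y. \<eta> (s *R (x - y)))"
        using Ck_affine_compose[OF bounded_linear_scaleR_right \<eta>(1), where c = "s *R x" and r1 = "- s"]
        by (simp add: algebra_simps)
      have "(LB y. pd (a x) (%y. th y * \<eta> (s *R (x - y))) y) = 0"
        by (intro integral_pd_eq_0 Ck_mult th eC csupp_mult_right)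
      then have z: "(LB y. pd (a x) th y * \<eta> (s *R (x - y)) - th y * (s * pd (a x) \<eta> (s *R (x - y)))) = 0"
        by (simp add: pd_mult[OF th(1) eC] pdr)
      have t: "continuous_on UNIV (%y. s *R (x - y))" by (intro continuous_intros)
      have i1: "integrable lborel (%y. G x y)" unfolding G_def
        by (intro integrable_csupp csupp_mult_right th continuous_intros cont
          continuous_on_pd_joint[OF \<eta>(1)] continuous_on_compose2[OF cont(1)]) auto
      have i2: "integrable lborel (%y. pd (a x) th y * \<eta> (s *R (x - y)) - th y * (s * pd (a x) \<eta> (s *R (x - y))))"
        by (intro integrable_csupp csupp_diff csupp_mult_right th continuous_intros cont csupp_pd
          continuous_on_pd_joint[OF \<eta>(1)] continuous_on_pd_joint[OF th(1)] continuous_on_compose2[OF cont(1)]) auto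
      \<comment> \<open>The added term is the \<open>y\<close>-derivative of
        \<open>th y * \<eta> (s (x - y))\<close> in the fixed direction \<open>a x\<close>, so its
        integral is zero.\<close>
      have "(LB y. G x y) = (LB y. G x y + (pd (a x) th y * \<eta> (s *R (x - y)) - th y * (s * pd (a x) \<eta> (s *R (x - y)))))"
        by (subst Bochner_Integration.integral_add[OF i1 i2]) (simp add: z)
      also have "... = (LB y. h x y * \<eta> (s *R (x - y)))"
        by (intro Bochner_Integration.integral_cong) (auto simp: G_def h_def algebra_simps)
      also have "... = (LB u. h x (x - (1 / s) *R u) * \<eta> (s *R (x - (x - (1 / s) *R u)))) / s ^ DIM('a)"
        by (rule integral_scale_reflect[OF _ s])
          (intro borel_measurable_times borel_measurable_continuous_onI hc continuous_intros
            continuous_on_compose2[OF cont(1)]; simp)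
      finally show "(LB y. G x y * \<rho> x) = (LB u. h x (x - (1 / s) *R u) * \<eta> u) / s ^ DIM('a) * \<rho> x"
        using s by simp
    qed
    also have "... = (LB x. LB u. h x (x - (1 / s) *R u) * \<eta> u * \<rho> x) / s ^ DIM('a)" by simp
    finally show ?thesis using s by simp
  qed
  \<comment> \<open>The scales are \<open>s = 1 + n\<close>. As \<open>1 / s\<close> is at most 1,
    the supports of all \<open>K n\<close> lie in a common bounded set.\<close>
  define K where "K = (%n xu. h (fst xu) (fst xu - (1 / (1 + real n)) *R snd xu) * \<eta> (snd xu))"
  have Kc: "continuous_on UNIV (K n)" for n
    unfolding K_def by (intro continuous_intros hc continuous_on_compose2[OF cont(1)]) auto
  have Ks: "norm (snd xu) <= R1 & norm (fst xu - (1 / (1 + real n)) *R snd xu) <= R2 & norm (fst xu) <= R2 + R1"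
    if "K n xu ~= 0" for n xu
  proof -
    let ?t = "1 / (1 + real n)"
    have 1: "norm (snd xu) <= R1" using that out1[of "snd xu"] by (force simp: K_def)
    have 2: "norm (fst xu - ?t *R snd xu) <= R2" using that h0[of "fst xu - ?t *R snd xu" "fst xu"] by (force simp: K_def)
    have "norm (?t *R snd xu) <= norm (snd xu)" by (simp add: divide_simps algebra_simps)
    then show ?thesis using 1 2 norm_triangle_sub[of "fst xu" "?t *R snd xu"] by linarith
  qed
  have "bounded ((%(x, y, u). h x y * \<eta> u) ` (cball 0 (R2 + R1) \<times> cball 0 R2 \<times> cball 0 R1))" unfolding split_beta
    by (intro compact_imp_bounded compact_continuous_image compact_Times compact_cball continuous_intros hc
      continuous_on_compose2[OF cont(1)]) auto
  then obtain C where C: "!!x y u. norm x <= R2 + R1 ==> norm y <= R2 ==> norm u <= R1 ==> \<bar>h x y * \<eta> u\<bar> <= C"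
    unfolding bounded_iff by fastforce
  have KC: "\<bar>K n xu\<bar> <= max C 0" for n xu
  proof (cases "K n xu = 0")
    case False
    then show ?thesis using Ks[OF False] C[of "fst xu" "fst xu - (1 / (1 + real n)) *R snd xu" "snd xu"] unfolding K_def by simp
  qed simp
  let ?D = "%xu. h (fst xu) (fst xu) * \<eta> (snd xu) * \<rho> (fst xu)"
  let ?P = "lborel \<Otimes>\<^sub>M lborel :: ('a \<times> 'a) measure"
  define B where "B = (%xu :: 'a \<times> 'a. max C 0 * indicator (cball 0 R1) (snd xu) * \<bar>\<rho> (fst xu)\<bar> :: real)"
  have Bint: "integrable ?P B"
  proof -
    have "integrable ?P (%(x, u). max C 0 * indicator (cball 0 R1) (snd (x, u)) * \<bar>\<rho> x\<bar>)"
      by (rule integrable_pair_bounded[where f = "%xu. max C 0 * indicator (cball 0 R1) (snd xu)" and C = "max C 0" and R = R1])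
        (use \<rho> in \<open>auto simp: indicator_def borel_prod[symmetric] split: if_splits\<close>)
    moreover have "B = (%(x, u). max C 0 * indicator (cball 0 R1) (snd (x, u)) * \<bar>\<rho> x\<bar>)" by (auto simp: B_def)
    ultimately show ?thesis by simp
  qed
  have Km: "(%xu. K n xu * \<rho> (fst xu)) \<in> borel_measurable ?P" for n
  proof -
    have "K n \<in> borel_measurable (borel \<Otimes>\<^sub>M borel)"
      using borel_measurable_continuous_onI[OF Kc] by (simp add: borel_prod)
    then show ?thesis by measurable
  qed
  have KB: "\<bar>K n xu * \<rho> (fst xu)\<bar> <= B xu" for n xu
  proof (cases "K n xu = 0")
    case False
    then show ?thesis using Ks[OF False] mult_right_mono[OF KC[of n xu], of "\<bar>\<rho> (fst xu)\<bar>"]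
      by (simp add: B_def abs_mult)
  qed (simp add: B_def)
  have Dlim: "(%n. K n xu * \<rho> (fst xu)) ----> ?D xu" for xu
  proof -
    have "(%n. 1 / (1 + real n)) ----> 0" by real_asymp
    then have "(%n. fst xu - (1 / (1 + real n)) *R snd xu) ----> fst xu - 0 *R snd xu" by (intro tendsto_intros)
    then have "(%n. h (fst xu) (fst xu - (1 / (1 + real n)) *R snd xu)) ----> h (fst xu) (fst xu)"
      using continuous_on_tendsto_compose[OF hc[OF continuous_on_const continuous_on_id, of UNIV "fst xu"], of _ "fst xu"] by simp
    then show ?thesis unfolding K_def by (intro tendsto_intros)
  qed
  have Dm: "?D \<in> borel_measurable ?P" by (rule borel_measurable_LIMSEQ_real[OF Dlim Km])
  have "(%n. \<integral>xu. K n xu * \<rho> (fst xu) \<partial>?P) ----> (\<integral>xu. ?D xu \<partial>?P)"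
    by (rule integral_dominated_convergence[where w = B, OF Dm Km Bint]) (use Dlim KB in auto)
  moreover have "(\<integral>xu. K n xu * \<rho> (fst xu) \<partial>?P) = 0" for n
  proof -
    have "integrable ?P (%xu. K n xu * \<rho> (fst xu))" using order_trans[OF KB abs_ge_self]
      by (intro Bochner_Integration.integrable_bound[OF Bint Km] AE_I2) (simp only: real_norm_def)
    from lborel_pair.integral_fst'[OF this] main[of "1 + real n"] show ?thesis by (simp add: K_def)
  qed
  ultimately have D0: "(\<integral>xu. ?D xu \<partial>?P) = 0" using LIMSEQ_unique[OF _ tendsto_const] by simp
  have "integrable ?P ?D"
  proof (rule Bochner_Integration.integrable_bound[OF Bint Dm], intro AE_I2)
    fix xu
    have "\<bar>?D xu\<bar> <= B xu" by (rule LIMSEQ_le_const2[OF tendsto_rabs[OF Dlim]]) (use KB in blast)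
    then show "norm (?D xu) <= norm (B xu)" by simp
  qed
  from lborel_pair.integral_fst'[OF this] D0
  have "(LB x. h x x * \<rho> x * (LB u. \<eta> u)) = 0" by (simp add: mult.commute mult.left_commute)
  then show ?thesis using integral_pos_of_bump[OF cont(1) \<eta>(2-4)] by (simp add: h_def)
qed

subsection \<open>Densities with a weak logarithmic gradient\<close>

lemma AE_lborel_ex:
  fixes P :: "'a::euclidean_space => bool" assumes "AE x in lborel. P x" shows "\<exists>x. P x"
proof (rule ccontr)
  assume "~ (\<exists>x. P x)"
  then have "AE x :: 'a in lborel. False" using assms by simp
  then have "emeasure lborel (space lborel :: 'a set) = 0" by (subst (asm) AE_iff_measurable[OF _ refl]) auto
  then show False by simp
qed

text \<open>Differentiation under the integral sign for averages along a family of affine maps. It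
  serves twice: to build a primitive along parallel lines and to average a test function over its
  translates.\<close>

lemma parametric_integral:
  fixes g :: "'a::euclidean_space => real" and L :: "real => 'a => 'a" and c :: "real => 'a"
  assumes g: "Ck 1 g" and L: "!!r. bounded_linear (L r)"
    and Lc: "continuous_on UNIV (%x. L (fst x) (snd x))" and c: "continuous_on UNIV c"
  shows "Ck 1 (%y. integral {0..1} (%r. g (L r y + c r)))" (is "Ck 1 ?A")
    and "pd w (%y. integral {0..1} (%r. g (L r y + c r))) y = integral {0..1} (%r. pd (L r w) g (L r y + c r))"
proof -
  have Lc': "continuous_on S (%x. L (u x) (v x))" if "continuous_on S u" "continuous_on S v"
    for S :: "'b::topological_space set" and u v
    using continuous_on_compose2[OF Lc continuous_on_Pair[OF that]] by simp
  have cc: "continuous_on S (%x. c (u x))" if "continuous_on S u" for S :: "'b::topological_space set" and u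
    by (rule continuous_on_compose2[OF c that]) simp
  note gc = Ck_continuous[OF g]
  have pdc: "continuous_on S (%x. pd (L (u x) w) g (L (u x) (v x) + c (u x)))"
    if "continuous_on S u" "continuous_on S v" for S :: "'b::topological_space set" and u v w
    by (intro continuous_on_pd_joint[OF g] continuous_intros Lc' cc that)
  define D where "D = (%y r. Blinfun (%w. pd (L r w) g (L r y + c r)))"
  have bl: "bounded_linear (%w. pd (L r w) g x)" for r x
    by (rule bounded_linear_compose[OF has_derivative_bounded_linear[OF Ck1_has_derivative[OF g]] L])
  have D: "blinfun_apply (D y r) w = pd (L r w) g (L r y + c r)" for y r w
    unfolding D_def by (simp add: bounded_linear_Blinfun_apply[OF bl])
  have Dc: "continuous_on S (%x. D (u x) (v x))" if "continuous_on S u" "continuous_on S v"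
    for S :: "'b::t2_space set" and u v by (rule continuous_on_blinfun_componentwise) (simp add: D pdc that)
  have der: "(?A has_derivative blinfun_apply (integral {0..1} (D y))) (at y)" for y
  proof -
    have "((%y. g (L t y + c t)) has_derivative (%w. pd (L t w) g (L t x + c t))) (at x)" for x t
      by (rule has_derivative_compose[OF _ Ck1_has_derivative[OF g]])
        (auto intro!: derivative_eq_intros bounded_linear_imp_has_derivative L)
    then have 1: "((%y. g (L t y + c t)) has_derivative blinfun_apply (D x t)) (at x)" for x t unfolding D .
    have 2: "(%r. g (L r x + c r)) integrable_on cbox 0 1" for x
      by (intro integrable_continuous continuous_on_compose2[OF gc] continuous_intros Lc' cc) auto
    have 3: "continuous_on (UNIV \<times> cbox 0 1) (%(x, t). D x t)" unfolding split_beta by (intro Dc continuous_intros)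
    show ?thesis using leibniz_rule[of UNIV 0 1 "%y r. g (L r y + c r)" D y, OF 1 2 3] by simp
  qed
  have int: "blinfun_apply (integral {0..1} (D y)) w = integral {0..1} (%r. pd (L r w) g (L r y + c r))" for y w
  proof -
    have "D y integrable_on {0..1}" by (intro integrable_continuous_real Dc continuous_intros)
    from integral_linear[OF this blinfun.bounded_linear_left, of w] show ?thesis by (simp add: o_def D)
  qed
  show "pd w ?A y = integral {0..1} (%r. pd (L r w) g (L r y + c r))" unfolding pd_eq[OF der] int ..
  show "Ck 1 ?A" unfolding One_nat_def
  proof (rule Ck_SucI[OF der])
    fix w
    have "continuous_on UNIV (%y. integral (cbox 0 1) (%r. pd (L r w) g (L r y + c r)))"
      by (rule integral_continuous_on_param) (unfold split_beta, intro pdc continuous_intros)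
    then show "Ck 0 (%y. blinfun_apply (integral {0..1} (D y)) w)" by (simp add: int)
  qed
qed

lemma integral_DERIV:
  fixes f :: "real => real" assumes "!!t. (f has_real_derivative f' t) (at t)" shows "integral {0..1} f' = f 1 - f 0"
  by (rule integral_unique, rule fundamental_theorem_of_calculus)
    (auto simp: has_real_derivative_iff_has_vector_derivative[symmetric]
      intro: has_field_derivative_at_within[OF assms])

lemma integrable_lborel_translate:
  fixes f :: "'a::euclidean_space => real" assumes "integrable lborel f" shows "integrable lborel (%x. f (x + v))"
proof -
  have "integrable (distr lborel borel ((+) v)) f" using assms by (subst lborel_distr_plus)
  then show ?thesis by (subst (asm) integrable_distr_eq) (use assms in \<open>auto simp: add.commute\<close>)
qed

text \<open>A function \<open>B\<close> with derivative \<open>F x \<bullet> v\<close> in direction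
  \<open>v\<close> is constructed; then \<open>exp (- B) * \<rho>\<close> has vanishing weak
  derivative along \<open>v\<close>. Its invariance under translation by \<open>v\<close> follows by
  duality, since \<open>\<kappa> y - \<kappa> (y - v)\<close> is itself a derivative along
  \<open>v\<close> of a compactly supported function. The factor in the claim is the increment of
  \<open>B\<close>.\<close>

lemma weak_gradient_translate:
  fixes \<rho> :: "'a::euclidean_space => real"
  assumes w: "weak_gradient F \<rho>" and \<rho>: "integrable lborel \<rho>" and F: "Ck 1 (%x. F x \<bullet> v)"
  shows "AE x in lborel. \<rho> (x + v) = \<rho> x * exp (integral {0..1} (%r. F (x + r *R v) \<bullet> v))"
proof (cases "v = 0")
  case False
  define g where "g = (%x. F x \<bullet> v)"
  have g: "Ck 1 g" using F by (simp add: g_def)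
  \<comment> \<open>The coordinate along \<open>v\<close>, normalized so that it is 1 at
    \<open>v\<close>.\<close>
  define s where "s = (%y. y \<bullet> v / (v \<bullet> v))"
  have s: "bounded_linear s"
    unfolding s_def by (intro bounded_linear_inner_left bounded_linear_divide[THEN bounded_linear_compose])
  have sv: "s v = 1" using False by (simp add: s_def)
  have s_cont: "continuous_on S (%x. s (f x))" if "continuous_on S f" for S :: "'b::topological_space set" and f
    unfolding s_def by (intro continuous_intros that) (use False in auto)
  \<comment> \<open>\<open>L r\<close> scales the component along \<open>v\<close> by
    \<open>r\<close>: at \<open>r = 0\<close> it projects to the hyperplane where \<open>s\<close>
    vanishes, at \<open>r = 1\<close> it is the identity. Thus \<open>B y\<close> below is the line
    integral of \<open>F\<close> from the projection of \<open>y\<close> to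
    \<open>y\<close>.\<close>
  define L where "L = (%r y. y - ((1 - r) * s y) *R v)"
  have L: "bounded_linear (L r)" for r unfolding L_def
    by (intro bounded_linear_sub bounded_linear_ident bounded_linear_scaleR_const
        bounded_linear_const_mult s)
  have Lc: "continuous_on UNIV (%x. L (fst x) (snd x))" unfolding L_def by (intro continuous_intros s_cont)
  define A where "A = (%y. integral {0..1} (%r. g (L r y + 0)))"
  have A: "Ck 1 A" "pd w A y = integral {0..1} (%r. pd (L r w) g (L r y + 0))" for w y
    unfolding A_def using parametric_integral[OF g L Lc continuous_on_const] by blast+
  define B where "B = (%y. s y * A y)"
  have B: "Ck 1 B" unfolding B_def by (intro Ck_mult A Ck_linear s)
  have pdB: "pd v B y = g y" for y
  proof -
    have Lv: "L r v = r *R v" for r by (simp add: L_def sv algebra_simps)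
    have Lline: "L r y = y - s y *R v + r *R (s y *R v)" for r by (simp add: L_def algebra_simps)
    \<comment> \<open>The integrand of \<open>pd v B\<close> is the derivative of
      \<open>r * g (L r y)\<close>, so the integral over the unit interval is
      \<open>g y\<close>.\<close>
    have "((%r. r * g (L r y)) has_real_derivative (g (L r y) + r * (s y * pd v g (L r y)))) (at r)" for r
      using DERIV_mult[OF DERIV_ident DERIV_line[OF g, of "y - s y *R v" "s y *R v" r UNIV]]
      by (simp add: Lline pd_vec_scale[OF g] algebra_simps)
    from integral_DERIV[OF this]
    have "integral {0..1} (%r. g (L r y) + r * (s y * pd v g (L r y))) = g y" by (simp add: L_def)
    moreover have "(%r. g (L r y)) integrable_on {0..1}" "(%r. r * (s y * pd v g (L r y))) integrable_on {0..1}"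
      unfolding L_def by (intro integrable_continuous_real continuous_intros
        continuous_on_compose2[OF Ck_continuous[OF g]] continuous_on_pd_joint[OF g]; simp)+
    ultimately have "integral {0..1} (%r. g (L r y)) + integral {0..1} (%r. r * (s y * pd v g (L r y))) = g y"
      by (simp add: Henstock_Kurzweil_Integration.integral_add)
    moreover have "pd v B y = s y * integral {0..1} (%r. r * pd v g (L r y)) + A y" unfolding B_def
      by (simp add: pd_mult[OF Ck_linear[OF s] A(1)] A(2) pd_bounded_linear[OF s] sv Lv pd_vec_scale[OF g])
    ultimately show ?thesis by (simp add: A_def mult.left_commute[of _ "s y"])
  qed
  have Bline: "B (x + v) - B x = integral {0..1} (%r. F (x + r *R v) \<bullet> v)" for x
    using integral_DERIV[OF DERIV_line[OF B, of x v _ UNIV]] by (simp add: pdB g_def)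
  define \<sigma> where "\<sigma> = (%y. exp (- B y) * \<rho> y)"
  have [measurable]: "\<rho> \<in> borel_measurable borel" "B \<in> borel_measurable borel"
    using \<rho> Ck_continuous[OF B] by (auto intro: borel_measurable_continuous_onI)
  have Bc: "continuous_on UNIV (%y. exp (- B y))" "continuous_on UNIV (%y. exp (- B (y + v)))"
    by (intro continuous_intros continuous_on_compose2[OF Ck_continuous[OF B]]; simp)+
  have weak\<sigma>: "(LB y. pd v th y * \<sigma> y) = 0" if th: "Ck 1 th" "csupp th" for th
  proof -
    have E: "Ck 1 (%y. exp (- B y))" by (intro Ck_exp Ck_minus B)
    have "(LB x. (pd v (%y. th y * exp (- B y)) x + (F x \<bullet> v) * (th x * exp (- B x))) * \<rho> x) = 0"
      by (rule w[unfolded weak_gradient_def, rule_format,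
            OF conjI[OF Ck_mult[OF th(1) E] csupp_mult_right[OF th(2)]]])
    moreover have "pd v (%y. th y * exp (- B y)) x = pd v th x * exp (- B x) - th x * (exp (- B x) * g x)" for x
      using pd_cmult[OF B, where v = v and c = "-1"]
      by (simp add: pd_mult[OF th(1) E] pd_exp[OF Ck_minus[OF B]] pdB algebra_simps)
    ultimately show ?thesis by (simp add: \<sigma>_def g_def algebra_simps)
  qed
  have "AE x in lborel. \<sigma> (x + v) - \<sigma> x = 0"
  proof (rule AE_eq_0_if_orthogonal)
    show "(%x. \<sigma> (x + v) - \<sigma> x) \<in> borel_measurable borel" unfolding \<sigma>_def by measurable
    have b: "integrable lborel (%x. indicator (box l u) x * \<sigma> (x + v))"
      "integrable lborel (%x. indicator (box l u) x * \<sigma> x)" for l u unfolding \<sigma>_def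
      using integrable_box_mult[OF Bc(2) integrable_lborel_translate[OF \<rho>]] integrable_box_mult[OF Bc(1) \<rho>] by auto
    show "integrable lborel (%x. indicator (box l u) x * (\<sigma> (x + v) - \<sigma> x))" for l u
      unfolding right_diff_distrib by (intro Bochner_Integration.integrable_diff b)
    fix \<kappa> :: "'a => real" assume \<kappa>: "Ck 1 \<kappa>" "csupp \<kappa>"
    note \<kappa>c = Ck_continuous[OF \<kappa>(1)]
    have [measurable]: "\<kappa> \<in> borel_measurable borel" using \<kappa>c by (rule borel_measurable_continuous_onI)
    \<comment> \<open>The average of the translates of \<open>\<kappa>\<close> along the segment;
      its derivative along \<open>v\<close> telescopes to
      \<open>\<kappa> y - \<kappa> (y - v)\<close>.\<close>
    define th where "th = (%y. integral {0..1} (%r. \<kappa> (y + - r *R v)))"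
    have id: "bounded_linear (%y::'a. y)" "continuous_on UNIV (%x::real \<times> 'a. snd x)" "continuous_on UNIV (%r. - r *R v)"
      by (intro bounded_linear_ident continuous_intros)+
    have th: "Ck 1 th" "pd w th y = integral {0..1} (%r. pd w \<kappa> (y + - r *R v))" for w y
      unfolding th_def using parametric_integral[OF \<kappa>(1), of "%_ y. y", OF id] by blast+
    have pdth: "pd v th y = \<kappa> y - \<kappa> (y - v)" for y
    proof -
      have "((%r. - \<kappa> (y + r *R - v)) has_real_derivative pd v \<kappa> (y + r *R - v)) (at r)" for r
        using DERIV_minus[OF DERIV_line[OF \<kappa>(1), of y "- v" r UNIV]] by (simp add: pd_vec_minus[OF \<kappa>(1)])
      from integral_DERIV[OF this] show ?thesis by (simp add: th(2))
    qed
    obtain R where R: "{x. \<kappa> x ~= 0} \<subseteq> cball 0 R" by (rule bounded_cball_0[OF \<kappa>(2)])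
    have "csupp th"
    proof (rule bounded_subset[OF bounded_cball[of 0 "R + norm v"]], rule subsetI)
      fix y assume "y \<in> {x. th x ~= 0}"
      have "\<exists>r\<in>{0..1}. \<kappa> (y + - r *R v) ~= 0"
      proof (rule ccontr)
        assume "~ ?thesis"
        then have "th y = integral {0..1} (%_::real. 0)"
          unfolding th_def by (intro Henstock_Kurzweil_Integration.integral_cong) blast
        then show False using \<open>y \<in> {x. th x ~= 0}\<close> by simp
      qed
      then obtain r where r: "r \<in> {0..1}" "\<kappa> (y + - r *R v) ~= 0" by blast
      then have "norm (y + - r *R v) <= R" using R by auto
      moreover have "norm (r *R v) <= norm v" using r(1) by (simp add: mult_left_le_one_le)
      ultimately have "norm y <= R + norm v" using norm_triangle_sub[of y "r *R v"] by simp
      then show "y \<in> cball 0 (R + norm v)" by simp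
    qed
    from weak\<sigma>[OF th(1) this] have z: "(LB y. (\<kappa> y - \<kappa> (y - v)) * \<sigma> y) = 0" by (simp add: pdth)
    have csv: "csupp (%y. \<kappa> (y - v))" using csupp_translate[OF \<kappa>(2), of "- v"] by simp
    have cv: "continuous_on UNIV (%y. \<kappa> (y - v))" by (intro continuous_on_compose2[OF \<kappa>c] continuous_intros) auto
    have i: "integrable lborel (%y. \<kappa> y * \<sigma> y)" "integrable lborel (%y. \<kappa> (y - v) * \<sigma> y)"
      using integrable_csupp_mult[OF continuous_on_mult[OF \<kappa>c Bc(1)] csupp_mult_right[OF \<kappa>(2)] \<rho>]
        integrable_csupp_mult[OF continuous_on_mult[OF cv Bc(1)] csupp_mult_right[OF csv] \<rho>]
      by (auto simp: \<sigma>_def mult.assoc)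
    have m: "(%y. \<kappa> (y - v) * \<sigma> y) \<in> borel_measurable borel" unfolding \<sigma>_def by measurable
    have t: "(LB x. \<kappa> x * \<sigma> (x + v)) = (LB y. \<kappa> (y - v) * \<sigma> y)"
      using lborel_integral_translate[OF m, of v] by simp
    have it: "integrable lborel (%x. \<kappa> x * \<sigma> (x + v))" using integrable_lborel_translate[OF i(2), of v] by simp
    have "(LB x. \<kappa> x * (\<sigma> (x + v) - \<sigma> x)) = (LB x. \<kappa> x * \<sigma> (x + v)) - (LB x. \<kappa> x * \<sigma> x)"
      unfolding right_diff_distrib by (rule Bochner_Integration.integral_diff[OF it i(1)])
    also have "... = - (LB y. (\<kappa> y - \<kappa> (y - v)) * \<sigma> y)"
      unfolding t left_diff_distrib by (simp add: Bochner_Integration.integral_diff[OF i])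
    finally show "(LB x. \<kappa> x * (\<sigma> (x + v) - \<sigma> x)) = 0" by (simp add: z)
  qed
  then show ?thesis
  proof eventually_elim
    case (elim x)
    then have "exp (- B (x + v)) * \<rho> (x + v) = exp (- B x) * \<rho> x" by (simp add: \<sigma>_def)
    then have "\<rho> (x + v) = \<rho> x * exp (B (x + v) - B x)" by (simp add: exp_diff exp_minus field_simps)
    then show ?case by (simp add: Bline)
  qed
qed simp

text \<open>The translation formula holds for each \<open>v\<close> at almost every
  \<open>x\<close>. By Fubini some base point \<open>x0\<close> works for almost every
  \<open>v\<close>, and the formula started from \<open>x0\<close> defines a continuous version. Its
  derivative is then read off from the translation formula at each point.\<close>

lemma weak_gradient_version:
  fixes \<rho> :: "'a::euclidean_space => real"
  assumes w: "weak_gradient F \<rho>" and \<rho>: "integrable lborel \<rho>" and pos: "!!x. \<rho> x > 0"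
    and F: "!!v. Ck 1 (%x. F x \<bullet> v)" shows "\<exists>r. (AE x in lborel. \<rho> x = r x) & (\<forall>x. r x > 0) &
    (\<forall>x. (r has_derivative (%v. (F x \<bullet> v) * r x)) (at x))"
proof -
  have Fc: "continuous_on UNIV F" using Ck_continuous[OF F] by (subst continuous_on_componentwise) auto
  have Fc': "continuous_on S (%x. F (f x))" if "continuous_on S f" for S :: "'b::topological_space set" and f
    by (rule continuous_on_compose2[OF Fc that]) simp
  have [measurable]: "\<rho> \<in> borel_measurable borel" using \<rho> by auto
  define J where "J = (%x v. integral {0..1} (%r. F (x + r *R v) \<bullet> v))"
  have Jc: "continuous_on UNIV (%xv. J (fst xv) (snd xv))"
  proof -
    have "continuous_on UNIV (%xv. integral (cbox 0 1) (%r. F (fst xv + r *R snd xv) \<bullet> snd xv))"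
      by (rule integral_continuous_on_param) (unfold split_beta, intro continuous_intros Fc')
    then show ?thesis by (simp add: J_def)
  qed
  have Jc': "continuous_on S (%x. J (f x) (g x))" if "continuous_on S f" "continuous_on S g"
    for S :: "'b::topological_space set" and f g
    using continuous_on_compose2[OF Jc continuous_on_Pair[OF that]] by simp
  have [measurable]: "(%xv. J (fst xv) (snd xv)) \<in> borel_measurable (borel \<Otimes>\<^sub>M borel)"
    using borel_measurable_continuous_onI[OF Jc] by (simp add: borel_prod)
  have "AE v in lborel. AE x in lborel. \<rho> (x + v) = \<rho> x * exp (J x v)"
    unfolding J_def by (rule AE_I2) (rule weak_gradient_translate[OF w \<rho> F])
  then have "AE x in lborel. AE v in lborel. \<rho> (x + v) = \<rho> x * exp (J x v)"
    by (subst lborel_pair.AE_commute) measurable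
  then obtain x0 where x0: "AE v in lborel. \<rho> (x0 + v) = \<rho> x0 * exp (J x0 v)" using AE_lborel_ex by blast
  define r where "r = (%y. \<rho> x0 * exp (J x0 (y - x0)))"
  have r_pos: "r x > 0" for x using pos by (simp add: r_def)
  have rc: "continuous_on UNIV r" unfolding r_def by (intro continuous_intros Jc')
  have \<rho>r: "AE x in lborel. \<rho> x = r x" using AE_lborel_translate[OF x0, of "- x0"] by (simp add: r_def)
  \<comment> \<open>Both sides are continuous in \<open>x\<close>, so the almost everywhere identity
    for the version holds everywhere.\<close>
  have r_add: "r (x + v) = r x * exp (J x v)" for x v
  proof -
    have "AE x in lborel. r (x + v) = r x * exp (J x v)"
      using weak_gradient_translate[OF w \<rho> F, of v] \<rho>r AE_lborel_translate[OF \<rho>r, of v]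
      by eventually_elim (simp add: J_def)
    then have "(%x. r (x + v)) = (%x. r x * exp (J x v))"
      by (intro AE_lborel_continuous_eq continuous_intros Jc' rc continuous_on_compose2[OF rc]) auto
    then show ?thesis by meson
  qed
  have "(r has_derivative (%v. (F x \<bullet> v) * r x)) (at x)" for x
  proof -
    have J0: "J x 0 = 0" by (simp add: J_def)
    \<comment> \<open>Only the continuity of \<open>F\<close> at \<open>x\<close> enters here: the
      average of \<open>F\<close> over the segment is close to \<open>F x\<close>.\<close>
    have "((%y. J x (y - x)) has_derivative (%v. F x \<bullet> v)) (at x)" unfolding has_derivative_at_alt
    proof (intro conjI allI impI)
      show "bounded_linear ((\<bullet>) (F x))" by (rule bounded_linear_inner_right)
      fix e :: real assume "e > 0"
      then obtain d where d: "d > 0" "!!y. dist y x < d ==> dist (F y) (F x) < e"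
        using Fc unfolding continuous_on_iff by (metis UNIV_I)
      have "norm (J x (y - x) - J x (x - x) - F x \<bullet> (y - x)) <= e * norm (y - x)" if "norm (y - x) < d" for y
      proof -
        let ?v = "y - x"
        have c: "continuous_on {0..1} (%r. F (x + r *R ?v) \<bullet> ?v)" by (intro continuous_intros Fc')
        have i: "((%r. F (x + r *R ?v) \<bullet> ?v - F x \<bullet> ?v) has_integral (J x ?v - (1 - 0) *R (F x \<bullet> ?v))) {0..1}"
          unfolding J_def using has_integral_const_real[of "F x \<bullet> ?v" 0 1]
          by (intro has_integral_diff integrable_integral integrable_continuous_real c) simp
        have "norm (J x ?v - (1 - 0) *R (F x \<bullet> ?v)) <= e * norm ?v * measure lborel {0..1::real}"
        proof (rule has_integral_bound_real[where S = "{}", OF _ _ i])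
          fix r :: real assume r: "r \<in> {0..1} - {}"
          then have "norm (r *R ?v) <= norm ?v" by (simp add: mult_left_le_one_le)
          then have "dist (F (x + r *R ?v)) (F x) < e" using that by (intro d(2)) (simp add: dist_norm)
          then have "norm (F (x + r *R ?v) - F x) * norm ?v <= e * norm ?v"
            by (intro mult_right_mono) (auto simp: dist_norm)
          then show "norm (F (x + r *R ?v) \<bullet> ?v - F x \<bullet> ?v) <= e * norm ?v"
            using Cauchy_Schwarz_ineq2[of "F (x + r *R ?v) - F x" ?v] by (simp add: inner_diff_left)
        qed (use \<open>e > 0\<close> in auto)
        then show ?thesis by (simp add: J0)
      qed
      then show "\<exists>d>0. \<forall>y. norm (y - x) < d -->
          norm (J x (y - x) - J x (x - x) - F x \<bullet> (y - x)) <= e * norm (y - x)" using d(1) by blast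
    qed
    from has_derivative_mult_right[OF has_derivative_exp[OF this], of "r x"]
    have "((%y. r x * exp (J x (y - x))) has_derivative (%v. (F x \<bullet> v) * r x)) (at x)"
      by (simp add: J0 mult.commute)
    moreover have "r x * exp (J x (y - x)) = r y" for y using r_add[of x "y - x"] by simp
    ultimately show ?thesis by simp
  qed
  then show ?thesis using \<rho>r r_pos by blast
qed

subsection \<open>The potential condition\<close>

text \<open>On the segment from \<open>x0\<close> to \<open>x\<close> the function solves a scalar
  linear differential equation, so it is its initial value times an exponential. Positivity at one
  point thus spreads to all points.\<close>

lemma positive_of_log_gradient:
  fixes r :: "'a::euclidean_space => real" assumes der: "!!x. (r has_derivative (%v. (F x \<bullet> v) * r x)) (at x)"
    and F: "continuous_on UNIV F" and pos: "r x0 > 0" shows "r x > 0"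
proof -
  define w where "w = x - x0"
  define c where "c = (%t. F (x0 + t *R w) \<bullet> w)"
  have c: "continuous_on {0..1} c" unfolding c_def by (intro continuous_intros continuous_on_compose2[OF F]) auto
  have C: "((%t. integral {0..t} c) has_real_derivative c t) (at t within {0..1})" if "t \<in> {0..1}" for t
    using integral_has_real_derivative[OF c that] .
  have u: "((%t. r (x0 + t *R w)) has_real_derivative c t * r (x0 + t *R w)) (at t within {0..1})" for t
  proof -
    have "((%t. r (x0 + t *R w)) has_derivative (%s. (F (x0 + t *R w) \<bullet> (s *R w)) * r (x0 + t *R w))) (at t within {0..1})"
      by (rule has_derivative_compose[OF _ der]) (auto intro!: derivative_eq_intros)
    then show ?thesis unfolding has_field_derivative_def by (rule has_derivative_eq_rhs) (auto simp: c_def)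
  qed
  have "\<exists>k. \<forall>t\<in>{0..1}. r (x0 + t *R w) * exp (- integral {0..t} c) = k"
  proof (rule has_field_derivative_zero_constant)
    fix t :: real assume t: "t \<in> {0..1}"
    show "((%t. r (x0 + t *R w) * exp (- integral {0..t} c)) has_real_derivative 0) (at t within {0..1})"
      by (rule derivative_eq_intros u C[OF t] refl)+ (simp add: algebra_simps)
  qed simp
  then obtain k where k: "!!t. t \<in> {0..1} ==> r (x0 + t *R w) * exp (- integral {0..t} c) = k" by blast
  have "r x0 = r x * exp (- integral {0..1} c)" using k[of 0] k[of 1] by (simp add: w_def)
  then show ?thesis using pos by (simp add: zero_less_mult_iff)
qed

lemma continuous_gibbs_field: assumes "continuous_on UNIV b" shows "continuous_on UNIV (gibbs_field \<beta> b)"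
  unfolding gibbs_field_def[abs_def] by (intro continuous_intros continuous_on_compose2[OF assms]) auto

lemma inner_gibbs_field_vec:
  "gibbs_field \<beta> b x \<bullet> v = \<beta> * (b (qq x) \<bullet> qq v - pp x \<bullet> pp v - zz x \<bullet> zz v)"
  by (simp add: gibbs_field_def inner_prod_def algebra_simps)

lemma hamiltonian_eq: "hamiltonian U x = U (qq x) + (pp x \<bullet> pp x) / 2 + (zz x \<bullet> zz x) / 2"
  by (simp add: hamiltonian_def split_beta power2_norm_eq_inner)

lemma hamiltonian_has_derivative: assumes "!!q. GDERIV U q :> - b q"
  shows "(hamiltonian U has_derivative (%v. - (b (qq x) \<bullet> qq v) + pp x \<bullet> pp v + zz x \<bullet> zz v)) (at x)"
proof -
  have "((%x. U (qq x)) has_derivative (%v. qq v \<bullet> - b (qq x))) (at x)"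
    by (rule has_derivative_compose[OF _ assms[unfolded gderiv_def]])
      (rule bounded_linear_imp_has_derivative[OF bounded_linear_fst])
  then show ?thesis unfolding hamiltonian_eq[abs_def] by (auto intro!: derivative_eq_intros simp: inner_commute)
qed

lemma boltzmann_has_derivative: assumes "!!q. GDERIV U q :> - b q"
  shows "((%x. c * exp (- \<beta> * hamiltonian U x)) has_derivative
    (%v. (gibbs_field \<beta> b x \<bullet> v) * (c * exp (- \<beta> * hamiltonian U x)))) (at x)"
  by (rule derivative_eq_intros hamiltonian_has_derivative[OF assms] refl)+
    (auto simp: inner_gibbs_field_vec algebra_simps)

lemma Ck_potential: assumes "!!q. GDERIV U q :> - b q" "smooth b" shows "Ck k U"
proof -
  have "Ck (Suc k) U" using assms unfolding gderiv_def smooth_def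
    by (intro Ck_SucI[of U "%q v. v \<bullet> - b q"] Ck_inner Ck_minus Ck_const) auto
  then show ?thesis by (rule Ck_Suc)
qed

lemma Ck_hamiltonian: assumes "!!q. GDERIV U q :> - b q" "smooth b" shows "Ck k (hamiltonian U)"
proof -
  have "Ck k (%x. U (qq x) + (1 / 2) * (pp x \<bullet> pp x) + (1 / 2) * (zz x \<bullet> zz x))"
    by (intro Ck_add Ck_mult Ck_inner Ck_const Ck_linear_compose[OF bounded_linear_fst Ck_potential[OF assms]]
        Ck_linear bounded_linear_compose[OF bounded_linear_fst bounded_linear_snd]
        bounded_linear_compose[OF bounded_linear_snd bounded_linear_snd])
  then show ?thesis by (simp add: hamiltonian_eq[abs_def])
qed

lemma hamiltonian_flip_p: "hamiltonian U (flip_p x) = hamiltonian U x" by (simp add: hamiltonian_eq flip_p_eq)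

text \<open>With the Gibbs field as logarithmic gradient, \<open>ln r + \<beta> H\<close> has
  derivative zero for the potential read off from \<open>r\<close> on the slice
  \<open>p = z = 0\<close>.\<close>

lemma potential_conditionI:
  fixes r \<rho> :: "'d::finite state => real" assumes \<beta>: "\<beta> > 0" and b: "continuous_on UNIV b"
    and der: "!!x. (r has_derivative (%v. (gibbs_field \<beta> b x \<bullet> v) * r x)) (at x)"
    and r0: "r x0 > 0" and \<rho>r: "AE x in lborel. \<rho> x = r x" and \<rho>: "integrable lborel \<rho>" "(LB x. \<rho> x) = 1"
  shows "potential_condition \<beta> b \<rho>"
proof -
  have pos: "r x > 0" for x by (rule positive_of_log_gradient[OF der continuous_gibbs_field[OF b] r0])
  \<comment> \<open>The additive constant of the potential is fixed so that \<open>r\<close> equals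
    \<open>exp (- \<beta> H)\<close> without a prefactor; the partition function is then 1.\<close>
  define U where "U = (%q. - (1 / \<beta>) * ln (r (q, 0, 0)))"
  have lnr: "((%x. ln (r x)) has_derivative (%v. gibbs_field \<beta> b x \<bullet> v)) (at x)" for x
    by (rule has_derivative_eq_rhs[OF has_derivative_ln[OF pos der]])
      (use pos[of x] in \<open>auto simp: divide_inverse\<close>)
  have U: "GDERIV U q :> - b q" for q
  proof -
    have "((%q. ln (r (q, 0, 0))) has_derivative (%v. gibbs_field \<beta> b (q, 0, 0) \<bullet> (v, 0, 0))) (at q)"
      by (rule has_derivative_compose[OF _ lnr, of "%q. (q, 0, 0)"])
        (auto intro!: bounded_linear_imp_has_derivative bounded_linear_state)
    then have "((%q. - (1 / \<beta>) * ln (r (q, 0, 0))) has_derivative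
        (%v. - (1 / \<beta>) * (gibbs_field \<beta> b (q, 0, 0) \<bullet> (v, 0, 0)))) (at q)" by (rule has_derivative_mult_right)
    then show ?thesis unfolding gderiv_def U_def
      by (rule has_derivative_eq_rhs) (use \<beta> in \<open>simp add: inner_gibbs_field_vec inner_commute[of "b q"] fun_eq_iff\<close>)
  qed
  have "\<exists>k. \<forall>x\<in>UNIV. ln (r x) + \<beta> * hamiltonian U x = k"
  proof (rule has_derivative_zero_constant)
    fix x
    show "((%x. ln (r x) + \<beta> * hamiltonian U x) has_derivative (%h. 0)) (at x within UNIV)"
      by (rule has_derivative_eq_rhs[OF has_derivative_add[OF lnr
            has_derivative_mult_right[OF hamiltonian_has_derivative[OF U]]]])
        (auto simp: inner_gibbs_field_vec algebra_simps)
  qed simp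
  then obtain k where k: "!!x. ln (r x) + \<beta> * hamiltonian U x = k" by auto
  have "k = 0" using k[of 0] \<beta> by (simp add: hamiltonian_eq U_def zero_prod_def)
  then have ln_r: "ln (r x) = - \<beta> * hamiltonian U x" for x using k[of x] by simp
  have r: "r x = exp (- \<beta> * hamiltonian U x)" for x using pos[of x] exp_ln[of "r x"] unfolding ln_r by simp
  have rc: "continuous_on UNIV r"
    by (intro continuous_at_imp_continuous_on ballI has_derivative_continuous[OF der])
  have rm: "r \<in> borel_measurable lborel" "\<rho> \<in> borel_measurable lborel"
    using borel_measurable_continuous_onI[OF rc] \<rho> by auto
  have r': "r = (%x. exp (- \<beta> * hamiltonian U x))" using r by auto
  have "integrable lborel r" using \<rho>(1) integrable_cong_AE[OF rm(2,1) \<rho>r] by simp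
  moreover have "(LB x. r x) = 1" using \<rho>(2) integral_cong_AE[OF rm(2,1) \<rho>r] by simp
  ultimately show ?thesis unfolding potential_condition_def using U \<rho>r unfolding r' by (intro exI[of _ U]) simp
qed

lemma AE_flip_p:
  fixes P :: "'d::finite state => bool" assumes "AE x in lborel. P x" shows "AE x in lborel. P (flip_p x)"
  using assms by (subst (asm) distr_lborel_flip_p[symmetric]) (rule AE_distrD[rotated], auto)

text \<open>The divergence in \<open>z\<close> of \<open>z r\<close> plus \<open>1 / \<beta>\<close>
  times the gradient of \<open>r\<close> in \<open>z\<close>, written out: the formal adjoint of
  \<open>ou\<close>. The summand \<open>r x\<close> in each coordinate stems from differentiating
  \<open>z_i r\<close>.\<close>

definition ou_adjoint :: "real => ('d::finite state => real) => 'd state => real" where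
  "ou_adjoint \<beta> r x = (\<Sum>i\<in>UNIV. r x + zz x $ i * pd (ez i) r x + 1 / \<beta> * pd (ez i) (pd (ez i) r) x)"

lemma fokker_planck_eq:
  fixes r :: "'d::finite state => real" assumes "Ck 2 r"
  shows "fokker_planck \<alpha> \<beta> b r x = - pd (transport b x) r x + \<alpha> * ou_adjoint \<beta> r x"
proof -
  obtain q p z where x: "x = (q, p, z)" by (cases x)
  have C: "Ck 1 r" "Ck 1 (pd v r)" for v
    using assms Ck1[of 1 r] Ck_pd[of 1 r] by (auto simp: numeral_2_eq_2 One_nat_def)
  have "pd (transport b x) r x = pd (p, 0, 0) r x + pd (0, b q, 0) r x + pd (0, z, 0) r x - pd (0, 0, p) r x"
  proof -
    have "transport b x = (p, 0, 0) + (0, b q, 0) + (0, z, 0) + - (0, 0, p)" by (simp add: transport_def x)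
    then show ?thesis by (simp only: pd_vec_add[OF C(1)] pd_vec_minus[OF C(1)])
  qed
  moreover have "divergence (%z'. r (q, p, z') *R z' + (1 / \<beta>) *R grad (%z''. r (q, p, z'')) z') z = ou_adjoint \<beta> r x"
  proof -
    have rz: "Ck 2 (%z. r (q, p, z))" "Ck 1 (%z. r (q, p, z))" by (intro Ck_slices assms C)+
    have gr: "Ck 1 (grad (%z. r (q, p, z)))" using rz(1) by (intro Ck_grad) (simp add: numeral_2_eq_2 One_nat_def)
    have F: "Ck 1 (%z'. r (q, p, z') *R z' + (1 / \<beta>) *R grad (%z''. r (q, p, z'')) z')"
      by (intro Ck_add Ck_scaleR Ck_const gr rz Ck_linear_intros)
    have "pd (axis i 1) (%z'. r (q, p, z') *R z' + (1 / \<beta>) *R grad (%z''. r (q, p, z'')) z') z $ i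
       = r x + z $ i * pd (ez i) r x + 1 / \<beta> * pd (ez i) (pd (ez i) r) x" for i
    proof -
      have zi: "Ck 1 (%z::real^'d. z $ i)" by (intro Ck_linear bounded_linear_vec_nth)
      have g: "grad (%z. r (q, p, z)) z' $ i = pd (ez i) r (q, p, z')" for z'
        by (simp add: grad_def pd_slices[OF C(1)])
      have "pd (axis i 1) (%z'. r (q, p, z') * z' $ i + (1 / \<beta>) * pd (ez i) r (q, p, z')) z
        = r (q, p, z) * pd (axis i 1) (%z'. z' $ i) z + pd (axis i 1) (%z. r (q, p, z)) z * z $ i
          + (1 / \<beta>) * pd (axis i 1) (%z. pd (ez i) r (q, p, z)) z"
        by (simp only: pd_add pd_mult Ck_mult Ck_const Ck_slices[OF C(2)] rz zi) (simp add: pd_const)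
      moreover have "pd (axis i 1) (%z'::real^'d. z' $ i) z = 1"
        by (simp add: pd_bounded_linear[OF bounded_linear_vec_nth])
      ultimately show ?thesis unfolding pd_component[OF F]
        using pd_slices(3)[OF C(1), where u = "axis i 1" and q = q and p = p and z = z]
          pd_slices(3)[OF C(2)[of "ez i"], where u = "axis i 1" and q = q and p = p and z = z] by (simp add: g x)
    qed
    then show ?thesis by (simp add: divergence_def ou_adjoint_def x)
  qed
  ultimately show ?thesis by (simp add: fokker_planck_def x inner_grad Ck_slices C pd_slices)
qed

locale langevin_density = langevin_weight +
  assumes \<rho>_pos: "!!x. \<rho> x > 0" and \<rho>_prob: "(LB x. \<rho> x) = 1"
begin

lemma b_continuous: "continuous_on UNIV b" by (rule Ck_continuous[OF Ck_b])

lemma Ck_gibbs_field: "Ck k (%x. gibbs_field \<beta> b x \<bullet> v)" unfolding inner_gibbs_field_vec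
  by (intro Ck_mult Ck_diff Ck_inner Ck_const Ck_linear_compose[OF bounded_linear_fst Ck_b]
        Ck_linear bounded_linear_compose[OF bounded_linear_fst bounded_linear_snd]
        bounded_linear_compose[OF bounded_linear_snd bounded_linear_snd])

text \<open>The sign of the normalizing factor is obtained from the positivity of the density at a
  single point where the Gibbs formula holds.\<close>

lemma potential_conditionD: assumes "potential_condition \<beta> b \<rho>" shows "\<exists>U c. (\<forall>q. GDERIV U q :> - b q) & c > 0 &
    (AE x in lborel. \<rho> x = c * exp (- \<beta> * hamiltonian U x))"
proof -
  obtain U where U: "!!q. GDERIV U q :> - b q"
    and \<rho>: "AE x in lborel. \<rho> x = 1 / (LB y. exp (- \<beta> * hamiltonian U y)) * exp (- \<beta> * hamiltonian U x)"
    using assms unfolding potential_condition_def by blast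
  let ?Z = "LB y. exp (- \<beta> * hamiltonian U y)"
  obtain x where "\<rho> x = 1 / ?Z * exp (- \<beta> * hamiltonian U x)" using AE_lborel_ex[OF \<rho>] by blast
  then have "0 < 1 / ?Z" using \<rho>_pos[of x] by (simp add: zero_less_mult_iff zero_less_divide_iff)
  then show ?thesis using U \<rho> by blast
qed

lemma boltzmann_props: assumes U: "!!q. GDERIV U q :> - b q" shows "Ck k (%x. c * exp (- \<beta> * hamiltonian U x))"
    "pd v (%x. c * exp (- \<beta> * hamiltonian U x)) x = (gibbs_field \<beta> b x \<bullet> v) * (c * exp (- \<beta> * hamiltonian U x))"
  by (intro Ck_mult Ck_const Ck_exp Ck_hamiltonian[OF U b]) (rule pd_eq[OF boltzmann_has_derivative[OF U]])

text \<open>The mollifier is the square of a product bump, so every translate and dilate of it is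
  the square of a product of one-variable test functions, which is exactly what
  \<open>symmetric_generatorD\<close> covers.\<close>

lemma potential_of_symmetric: assumes even: "even_in_p \<rho>" and sym: "symmetric_generator \<alpha> \<beta> b \<rho>"
  shows "potential_condition \<beta> b \<rho>"
proof -
  define \<eta> :: "'a state => real" where "\<eta> = (%x. (tensor3 bump bump bump x)\<^sup>2)"
  have bt: "test_function (bump :: real^'a => real)" by (simp add: test_function_iff smooth_def Ck_bump csupp_bump)
  have k: "test_function (tensor3 bump bump bump :: 'a state => real)" by (intro test_function_tensor3 bt)
  have \<eta>t: "test_function \<eta>" unfolding \<eta>_def power2_eq_square
    by (intro test_function_mult k test_function_smooth[OF k])
  have \<eta>: "Ck 1 \<eta>" "csupp \<eta>" "!!x. 0 <= \<eta> x" "\<eta> 0 > 0" using \<eta>t bump_0_pos[where 'a = "real^'a"]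
    by (auto simp: test_function_iff smooth_Ck1) (auto simp: \<eta>_def tensor3_def zero_prod_def)
  have scaled: "(%x. \<eta> (s *R (x - y))) = (%x. (tensor3 (%q. bump (s *R (q - qq y)))
      (%p. bump (s *R (p - pp y))) (%z. bump (s *R (z - zz y))) x)\<^sup>2)" for s y
    by (auto simp: \<eta>_def tensor3_def split_beta)
  have bs: "test_function (%q::real^'a. bump (s *R (q - a)))" if "s > 0" for s a
    using that by (intro test_function_bump_scaled) auto
  have \<eta>s: "test_function (%x. \<eta> (s *R (x - y)))" if "s > 0" for s y unfolding scaled power2_eq_square
    by (intro test_function_mult test_function_smooth test_function_tensor3 bs that)
  have T: "continuous_on UNIV (transport b)"
    unfolding transport_def[abs_def] by (intro continuous_intros continuous_on_compose2[OF b_continuous]) auto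
  have A: "I (%x. pd (transport b x) th x) = 0" if "test_function th" for th
  proof -
    have "(LB x. (pd (transport b x) th x + 0 * th x) * \<rho> x) = 0"
    proof (rule mollified_weak_identity[OF \<eta> T continuous_on_const integrable_weight])
      fix s y assume s: "(s :: real) > 0"
      show "(LB x. (pd (transport b x) (%x. \<eta> (s *R (x - y))) x + 0 * \<eta> (s *R (x - y))) * \<rho> x) = 0"
        using symmetric_generatorD(1)[OF even sym bs[OF s] bs[OF s] bs[OF s], of "qq y" "pp y" "zz y"]
        unfolding scaled fun_cong[OF scaled] I_def by simp
    qed (use that in \<open>auto simp: test_function_iff smooth_Ck1\<close>)
    then show ?thesis by (simp add: I_def)
  qed
  have wz: weak_z unfolding weak_z_def
  proof (intro allI impI)
    fix th :: "'a state => real" and i assume th: "test_function th"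
    have "(LB x. (pd (ez i) th x + (- \<beta> * zz x $ i) * th x) * \<rho> x) = 0"
    proof (rule mollified_weak_identity[OF \<eta> continuous_on_const _ integrable_weight])
      show "continuous_on UNIV (%x::'a state. - \<beta> * zz x $ i)" by (intro continuous_intros)
      fix s y assume s: "(s :: real) > 0"
      show "(LB x. (pd (ez i) (%x. \<eta> (s *R (x - y))) x + (- \<beta> * zz x $ i) * \<eta> (s *R (x - y))) * \<rho> x) = 0"
        using symmetric_generatorD(2)[OF even sym bs[OF s] bs[OF s] bs[OF s], of "qq y" "pp y" "zz y" i]
        unfolding scaled fun_cong[OF scaled] I_def by simp
    qed (use th in \<open>auto simp: test_function_iff smooth_Ck1\<close>)
    then have "0 = I (%x. pd (ez i) th x - \<beta> * (zz x $ i * th x))" by (simp add: I_def algebra_simps)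
    also have "... = I (pd (ez i) th) - I (%x. \<beta> * (zz x $ i * th x))" by (intro I_test_diff test_intros th)
    finally show "I (pd (ez i) th) = \<beta> * I (%x. zz x $ i * th x)" by (simp add: I_cmult)
  qed
  \<comment> \<open>\<open>weak_coordinates\<close> is available for smooth test functions only; the
    same mollification, now with a constant direction, extends it to the \<open>C^1\<close> test
    functions in \<open>weak_gradient\<close>.\<close>
  have w: "weak_gradient (gibbs_field \<beta> b) \<rho>" unfolding weak_gradient_def
  proof (intro allI impI, elim conjE)
    fix th :: "'a state => real" and v assume th: "Ck 1 th" "csupp th"
    show "(LB x. (pd v th x + (gibbs_field \<beta> b x \<bullet> v) * th x) * \<rho> x) = 0"
      by (rule mollified_weak_identity[OF \<eta> continuous_on_const Ck_continuous[OF Ck_gibbs_field] integrable_weight _ th])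
        (use weak_coordinates[OF wz A \<eta>s] in \<open>simp add: I_def\<close>)
  qed
  obtain r where r: "AE x in lborel. \<rho> x = r x" "!!x. r x > 0"
    "!!x. (r has_derivative (%v. (gibbs_field \<beta> b x \<bullet> v) * r x)) (at x)"
    using weak_gradient_version[OF w integrable_weight \<rho>_pos Ck_gibbs_field] by blast
  show ?thesis by (rule potential_conditionI[OF \<beta> b_continuous r(3) r(2) r(1) integrable_weight \<rho>_prob])
qed

lemma stationary_of_potential: assumes "potential_condition \<beta> b \<rho>" shows "stationary_density \<alpha> \<beta> b \<rho>"
proof -
  obtain U c where U: "!!q. GDERIV U q :> - b q" and c: "c > 0"
    and \<rho>: "AE x in lborel. \<rho> x = c * exp (- \<beta> * hamiltonian U x)" using potential_conditionD[OF assms] by blast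
  define r where "r = (%x. c * exp (- \<beta> * hamiltonian U x))"
  have C: "Ck k r" and pdr: "pd v r x = (gibbs_field \<beta> b x \<bullet> v) * r x" for k v x
    unfolding r_def by (rule boltzmann_props[OF U])+
  have z: "pd (ez i) r = (%x. - \<beta> * (zz x $ i * r x))" for i by (auto simp: pdr inner_gibbs_field)
  have zz: "pd (ez i) (pd (ez i) r) x = - \<beta> * (r x + zz x $ i * (- \<beta> * (zz x $ i * r x)))" for i x unfolding z
    using pd_mult[OF Ck_coordinates(3)[of 1 i] C, where v = "ez i" and x = x] fun_cong[OF z[of i], of x]
      pd_cmult[OF Ck_mult[OF Ck_coordinates(3)[of 1 i] C], where v = "ez i" and c = "- \<beta>" and x = x]
    by (simp add: pd_coordinates)
  have "fokker_planck \<alpha> \<beta> b r x = 0" for x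
  proof -
    have "pd (transport b x) r x = 0"
      by (simp add: pdr inner_gibbs_field_vec transport_def inner_commute algebra_simps)
    moreover have "ou_adjoint \<beta> r x = 0"
      unfolding ou_adjoint_def zz unfolding fun_cong[OF z] using \<beta> by (intro sum.neutral) (simp add: field_simps)
    ultimately show ?thesis by (simp add: fokker_planck_eq[OF C])
  qed
  moreover have "AE x in lborel. \<rho> x = r x" using \<rho> by (simp add: r_def)
  ultimately show ?thesis unfolding stationary_density_def using C[of 2] by blast
qed

lemma separated_of_potential: assumes "potential_condition \<beta> b \<rho>" shows "separated_variables \<rho>"
proof -
  obtain U c where U: "!!q. GDERIV U q :> - b q" and c: "c > 0"
    and \<rho>: "AE x in lborel. \<rho> x = c * exp (- \<beta> * hamiltonian U x)" using potential_conditionD[OF assms] by blast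
  let ?g = "%y::real^'a. exp (- \<beta> * (norm y)\<^sup>2 / 2)"
  have "c * exp (- \<beta> * hamiltonian U x) = tensor3 (%q. c * exp (- \<beta> * U q)) ?g ?g x" for x
    by (simp add: tensor3_def hamiltonian_def split_beta exp_add[symmetric] algebra_simps)
  with \<rho> c show ?thesis unfolding separated_variables_def
    by (intro exI[of _ "%q. c * exp (- \<beta> * U q)"] exI[of _ ?g]) auto
qed

end

subsection \<open>A Liouville property of the Ornstein-Uhlenbeck operator\<close>

lemma Ck_inverse:
  fixes f :: "'a::euclidean_space => real" assumes "!!x. f x ~= 0" shows "Ck k f ==> Ck k (%x. inverse (f x))"
proof (induction k)
  case 0
  then show ?case using assms by (auto intro!: continuous_intros)
next
  case (Suc k)
  show ?case
  proof (rule Ck_SucI[of _ "%x v. - (inverse (f x) * pd v f x * inverse (f x))"])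
    fix x show "((%x. inverse (f x)) has_derivative (%v. - (inverse (f x) * pd v f x * inverse (f x)))) (at x)"
      by (rule Deriv.has_derivative_inverse[OF assms Ck_has_derivative[OF Suc.prems]])
  next
    fix v show "Ck k (%x. - (inverse (f x) * pd v f x * inverse (f x)))"
      by (intro Ck_minus Ck_mult Suc.IH Ck_Suc[OF Suc.prems] Ck_pd[OF Suc.prems])
  qed
qed

lemma pd_inverse:
  fixes f :: "'a::euclidean_space => real" assumes "!!x. f x ~= 0" "Ck 1 f"
  shows "pd v (%x. inverse (f x)) x = - (pd v f x) / (f x)\<^sup>2"
  using pd_eq[OF Deriv.has_derivative_inverse[OF assms(1) Ck1_has_derivative[OF assms(2)]]]
  by (simp add: power2_eq_square divide_inverse mult.commute mult.left_commute)

definition gauss :: "real => real^'d => real" where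
  "gauss \<beta> z = exp (- (\<beta> / 2) * (z \<bullet> z))"

lemma Ck_gauss: "Ck k (gauss \<beta>)"
  unfolding gauss_def[abs_def] by (intro Ck_exp Ck_mult Ck_const Ck_inner Ck_linear_intros)

lemma pd_gauss: "pd v (gauss \<beta>) z = - \<beta> * (z \<bullet> v) * gauss \<beta> z"
proof -
  have "(gauss \<beta> has_derivative (%v. - \<beta> * (z \<bullet> v) * gauss \<beta> z)) (at z)" unfolding gauss_def[abs_def]
    by (rule derivative_eq_intros refl)+ (auto simp: inner_commute algebra_simps)
  then show ?thesis by (rule pd_eq)
qed

lemma integrable_gauss: assumes "\<beta> > 0" shows "integrable lborel (gauss \<beta> :: real^'d => real)"
proof (rule integrableI_nonneg)
  have 1: "(NN x. ennreal (exp (- (\<beta> / 2) * x\<^sup>2))) < \<infinity>"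
  proof -
    have "integrable lborel (%x. sqrt (2 * pi / \<beta>) * normal_density 0 (1 / sqrt \<beta>) x)"
      using assms by (intro integrable_mult_right integrable_normal_density) auto
    moreover have "sqrt (2 * pi / \<beta>) * normal_density 0 (1 / sqrt \<beta>) x = exp (- (\<beta> / 2) * x\<^sup>2)" for x
      using assms by (simp add: normal_density_def power_divide real_sqrt_divide real_sqrt_mult)
    ultimately have "integrable lborel (%x. exp (- (\<beta> / 2) * x\<^sup>2))" by simp
    then show ?thesis by (subst nn_integral_eq_integral) auto
  qed
  have g: "gauss \<beta> z = (\<Prod>b\<in>Basis. exp (- (\<beta> / 2) * (z \<bullet> b)\<^sup>2))" for z :: "real^'d"
    unfolding gauss_def euclidean_inner[of z z] by (simp add: sum_distrib_left exp_sum power2_eq_square)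
  have "(\<integral>\<^sup>+z. ennreal (gauss \<beta> z) \<partial>(lborel :: (real^'d) measure))
      = (\<integral>\<^sup>+z. (\<Prod>b\<in>Basis. ennreal (exp (- (\<beta> / 2) * (z \<bullet> b)\<^sup>2))) \<partial>(lborel :: (real^'d) measure))"
    by (intro nn_integral_cong) (simp only: g prod_ennreal exp_ge_zero)
  also have "... = (\<Prod>b\<in>(Basis :: (real^'d) set). NN x. ennreal (exp (- (\<beta> / 2) * x\<^sup>2)))"
    by (rule nn_integral_lborel_prod[where f = "%b x. ennreal (exp (- (\<beta> / 2) * x\<^sup>2))"]) auto
  also have "... < \<infinity>" using 1 by (simp add: power_less_top_ennreal)
  finally show "(\<integral>\<^sup>+z. ennreal (gauss \<beta> z) \<partial>(lborel :: (real^'d) measure)) < \<infinity>" .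
  show "gauss \<beta> \<in> borel_measurable lborel"
    using borel_measurable_continuous_onI[OF Ck_continuous[OF Ck_gauss[of 0]]] by simp
qed (simp add: gauss_def)


text \<open>Caccioppoli's argument: with \<open>w = gauss \<beta>\<close> and \<open>h = u / w\<close> the equation says that the
  divergence of \<open>w \<nabla>h\<close> vanishes. Testing it with \<open>\<chi>\<^sup>2 / (1 + h)\<close>, where \<open>\<chi>\<close> is a cutoff at scale \<open>R\<close>,
  bounds the integral of \<open>\<chi>\<^sup>2 w |\<nabla>h|\<^sup>2 / (1 + h)\<^sup>2\<close> by \<open>O(1 / R\<^sup>2)\<close>. Below, \<open>G i\<close> is the \<open>i\<close>-th component
  of \<open>w \<nabla>h\<close>.\<close>
lemma liouville:
  fixes u :: "real^'d => real" assumes \<beta>: "\<beta> > 0" and u: "Ck 2 u" and nonneg: "!!z. u z >= 0"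
    and eq: "!!z. (\<Sum>i\<in>UNIV. u z + z $ i * pd (axis i 1) u z + 1 / \<beta> * pd (axis i 1) (pd (axis i 1) u) z) = 0"
  shows "pd (axis i 1) u z = - \<beta> * z $ i * u z"
proof -
  let ?e = "%i. axis i 1 :: real^'d"
  define w :: "real^'d => real" where "w = gauss \<beta>"
  define G where "G = (%i z. pd (?e i) u z + \<beta> * (z $ i * u z))"
  \<comment> \<open>This is \<open>1 / (1 + h)\<close> with \<open>h = u / w\<close>. The form
    avoids differentiating a quotient by \<open>w\<close>.\<close>
  define k where "k = (%z. w z * inverse (w z + u z))"
  define cut :: "nat => real^'d => real" where "cut = (%n z. bump (inverse (1 + real n) *R z))"
  have Cu: "Ck 1 u" "Ck 1 (pd v u)" for v
    using u Ck1[of 1 u] Ck_pd[of 1 u] by (auto simp: numeral_2_eq_2 One_nat_def)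
  have Cz: "Ck m (%z::real^'d. z $ i)" for m i by (intro Ck_linear bounded_linear_vec_nth)
  have Cw: "Ck m w" for m unfolding w_def by (rule Ck_gauss)
  have w_pos: "w z > 0" for z by (simp add: w_def gauss_def)
  have wu: "w z + u z > 0" for z using w_pos[of z] nonneg[of z] by linarith
  have wu0: "w z + u z ~= 0" for z using wu[of z] by simp
  have CG: "Ck 1 (G i)" for i unfolding G_def by (intro Ck_add Ck_mult Ck_const Cu Cz)
  have Cwu: "Ck 1 (%z. w z + u z)" by (intro Ck_add Cw Cu)
  have Ck': "Ck 1 k" unfolding k_def by (intro Ck_mult Cw Ck_inverse[OF wu0] Cwu)
  have pdw: "pd (?e i) w z = - \<beta> * z $ i * w z" for i z by (simp add: w_def pd_gauss inner_axis)
  have pdk: "pd (?e i) k z = - (w z * G i z / (w z + u z)\<^sup>2)" for i z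
  proof -
    have "pd (?e i) k z = w z * pd (?e i) (%z. inverse (w z + u z)) z + pd (?e i) w z * inverse (w z + u z)"
      unfolding k_def by (rule pd_mult[OF Cw Ck_inverse[OF wu0 Cwu]])
    also have "... = w z * (- (pd (?e i) w z + pd (?e i) u z) / (w z + u z)\<^sup>2) + pd (?e i) w z * inverse (w z + u z)"
      by (simp only: pd_inverse[OF wu0 Cwu] pd_add[OF Cw Cu(1)])
    also have "... = - (w z * G i z / (w z + u z)\<^sup>2)"
    proof -
      have "w z * (- (pd (?e i) w z + pd (?e i) u z) / (w z + u z)\<^sup>2) + pd (?e i) w z * inverse (w z + u z)
        = (pd (?e i) w z * (w z + u z) - w z * (pd (?e i) w z + pd (?e i) u z)) / (w z + u z)\<^sup>2"
        using wu0[of z] by (simp add: divide_simps power2_eq_square) (simp add: algebra_simps)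
      also have "pd (?e i) w z * (w z + u z) - w z * (pd (?e i) w z + pd (?e i) u z) = - (w z * G i z)"
        by (simp add: pdw G_def algebra_simps)
      finally show ?thesis by simp
    qed
    finally show ?thesis .
  qed
  have pdG: "(\<Sum>i\<in>UNIV. pd (?e i) (G i) z) = 0" for z
  proof -
    have "pd (?e i) (G i) z = \<beta> * (u z + z $ i * pd (?e i) u z + 1 / \<beta> * pd (?e i) (pd (?e i) u) z)" for i
    proof -
      have "pd (?e i) (G i) z = pd (?e i) (pd (?e i) u) z + \<beta> * (z $ i * pd (?e i) u z + pd (?e i) (%z. z $ i) z * u z)"
        unfolding G_def by (simp only: pd_add[OF Cu(2) Ck_mult[OF Ck_const Ck_mult[OF Cz Cu(1)]]]
          pd_cmult[OF Ck_mult[OF Cz Cu(1)]] pd_mult[OF Cz Cu(1)])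
      then show ?thesis using \<beta> by (simp add: pd_bounded_linear[OF bounded_linear_vec_nth] field_simps)
    qed
    then show ?thesis using eq[of z] by (simp add: sum_distrib_left[symmetric])
  qed
  have Ccut: "Ck 1 (cut n)" "csupp (cut n)" for n
    unfolding cut_def by (rule Ck_scale[OF Ck_bump], rule csupp_scale[OF csupp_bump]) simp
  define P where "P = (%n z. \<Sum>i\<in>UNIV. w z * (cut n z * G i z / (w z + u z))\<^sup>2)"
  define Q where "Q = (%n z. \<Sum>i\<in>UNIV. w z * (pd (?e i) (cut n) z)\<^sup>2)"
  have cont: "continuous_on UNIV (cut n)" "continuous_on UNIV (G i)" "continuous_on UNIV w" "continuous_on UNIV u"
    "continuous_on UNIV (pd v (cut n))" for n i v by (intro Ck_continuous[of 1] Ccut CG Cw Cu Ck1_continuous_pd)+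
  have intP: "integrable lborel (P n)" for n unfolding P_def power2_eq_square
    by (intro integrable_csupp csupp_sum csupp_mult_left csupp_mono[OF Ccut(2)[of n]] continuous_intros cont)
      (use wu0 in auto)
  have intQ: "integrable lborel (Q n)" for n unfolding Q_def power2_eq_square
    by (intro integrable_csupp csupp_sum csupp_mult_left csupp_pd Ccut continuous_intros cont)
  have PQ: "(LB z. P n z) <= 4 * (LB z. Q n z)" for n
  proof -
    \<comment> \<open>The vector field whose divergence integrates to zero: the flux
      \<open>G\<close> weighted by the test function of the Caccioppoli estimate.\<close>
    let ?Y = "%i z. (cut n z)\<^sup>2 * (G i z * k z)"
    have CY: "Ck 1 (?Y i)" for i by (intro Ck_mult Ck_power Ccut CG Ck')
    have csY: "csupp (?Y i)" for i by (rule csupp_mono[OF Ccut(2)[of n]]) simp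
    have pdY: "(\<Sum>i\<in>UNIV. pd (?e i) (?Y i) z)
       = (\<Sum>i\<in>UNIV. 2 * cut n z * pd (?e i) (cut n) z * G i z * k z) - P n z" for z
    proof -
      have "pd (?e i) (?Y i) z = (cut n z)\<^sup>2 * k z * pd (?e i) (G i) z
          + 2 * cut n z * pd (?e i) (cut n) z * G i z * k z - w z * (cut n z * G i z / (w z + u z))\<^sup>2" for i
      proof -
        have "pd (?e i) (?Y i) z = (cut n z)\<^sup>2 * (G i z * pd (?e i) k z + pd (?e i) (G i) z * k z)
            + (cut n z * pd (?e i) (cut n) z + pd (?e i) (cut n) z * cut n z) * (G i z * k z)"
          unfolding power2_eq_square
          by (simp only: pd_mult[OF Ck_mult[OF Ccut(1) Ccut(1)] Ck_mult[OF CG Ck']] pd_mult[OF CG Ck'] pd_mult[OF Ccut(1) Ccut(1)])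
        then show ?thesis by (simp add: pdk power2_eq_square algebra_simps)
      qed
      then show ?thesis by (simp add: P_def sum.distrib sum_subtractf pdG sum_distrib_left[symmetric])
    qed
    have "0 = (LB z. (\<Sum>i\<in>UNIV. pd (?e i) (?Y i) z))" by (subst Bochner_Integration.integral_sum)
        (auto intro!: integrable_csupp Ck1_continuous_pd CY csupp_pd csY sum.neutral[symmetric] simp: integral_pd_eq_0[OF CY csY])
    also have "... = (LB z. (\<Sum>i\<in>UNIV. 2 * cut n z * pd (?e i) (cut n) z * G i z * k z) - P n z)"
      unfolding pdY ..
    also have "... <= (LB z. 2 * Q n z - 1 / 2 * P n z)"
    proof (rule integral_mono)
      have "continuous_on UNIV k" by (rule Ck_continuous[OF Ck'])
      then show "integrable lborel (%z. (\<Sum>i\<in>UNIV. 2 * cut n z * pd (?e i) (cut n) z * G i z * k z) - P n z)"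
        by (intro Bochner_Integration.integrable_diff intP integrable_csupp csupp_sum csupp_mono[OF Ccut(2)[of n]] continuous_intros cont) auto
      show "integrable lborel (%z. 2 * Q n z - 1 / 2 * P n z)" by (intro Bochner_Integration.integrable_diff integrable_mult_right intP intQ)
      fix z
      have "2 * cut n z * pd (?e i) (cut n) z * G i z * k z
          <= 2 * (w z * (pd (?e i) (cut n) z)\<^sup>2) + 1 / 2 * (w z * (cut n z * G i z / (w z + u z))\<^sup>2)" for i
      proof -
        \<comment> \<open>Young's inequality with weights 2 and 1/2: half of \<open>P\<close> is
          absorbed on the left, which leads to the factor 4 in \<open>PQ\<close>.\<close>
        have sq: "2 * (W * (x * y)) <= 2 * (W * y\<^sup>2) + 1 / 2 * (W * x\<^sup>2)" if "W > 0" for W x y :: real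
        proof -
          have "0 <= W / 2 * (x - 2 * y)\<^sup>2" using that by simp
          then show ?thesis by (simp add: power2_eq_square algebra_simps)
        qed
        have "2 * cut n z * pd (?e i) (cut n) z * G i z * k z
            = 2 * (w z * ((cut n z * G i z / (w z + u z)) * pd (?e i) (cut n) z))"
          by (simp add: k_def divide_inverse)
        also note sq[OF w_pos]
        finally show ?thesis .
      qed
      then have "(\<Sum>i\<in>UNIV. 2 * cut n z * pd (?e i) (cut n) z * G i z * k z) <= 2 * Q n z + 1 / 2 * P n z"
        unfolding P_def Q_def sum_distrib_left sum.distrib[symmetric] by (rule sum_mono)
      then show "(\<Sum>i\<in>UNIV. 2 * cut n z * pd (?e i) (cut n) z * G i z * k z) - P n z <= 2 * Q n z - 1 / 2 * P n z" by simp
    qed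
    also have "... = 2 * (LB z. Q n z) - 1 / 2 * (LB z. P n z)"
      using intP intQ by (subst Bochner_Integration.integral_diff) auto
    finally show ?thesis by simp
  qed
  obtain C where C: "C >= 0" "!!i z. \<bar>pd (?e i) bump z\<bar> <= C"
  proof -
    have "\<exists>C\<ge>0. \<forall>z. \<bar>pd (?e i) bump z\<bar> <= C" for i
      by (intro bounded_of_csupp Ck1_continuous_pd Ck_bump csupp_pd csupp_bump)
    then obtain C where C: "!!i. C i >= 0" "!!i z. \<bar>pd (?e i) bump z\<bar> <= C i" by metis
    have "C i <= (\<Sum>i\<in>UNIV. C i)" for i using C(1) by (intro member_le_sum) auto
    then show ?thesis using C that[of "\<Sum>i\<in>UNIV. C i"] by (meson order_trans sum_nonneg)
  qed
  define K where "K = real CARD('d) * C\<^sup>2 * (LB z. w z)"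
  have wint: "integrable lborel w" unfolding w_def by (rule integrable_gauss[OF \<beta>])
  have QK: "(LB z. Q n z) <= (inverse (1 + real n))\<^sup>2 * K" for n
  proof -
    have "(LB z. Q n z) <= (LB z. ((inverse (1 + real n))\<^sup>2 * (real CARD('d) * C\<^sup>2)) * w z)"
    proof (rule integral_mono[OF intQ integrable_mult_right[OF wint]])
      fix z
      let ?s = "inverse (1 + real n)"
      have "w z * (pd (?e i) (cut n) z)\<^sup>2 <= w z * (?s\<^sup>2 * C\<^sup>2)" for i
      proof -
        have "pd (?e i) (cut n) z = ?s * pd (?e i) bump (?s *R z)"
          using pd_affine[OF bounded_linear_scaleR_right[of ?s] Ck_bump[of 1], where v = "?e i" and c = 0 and x = z]
          unfolding cut_def by (simp add: pd_vec_scale[OF Ck_bump])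
        then have "(pd (?e i) (cut n) z)\<^sup>2 = ?s\<^sup>2 * \<bar>pd (?e i) bump (?s *R z)\<bar>\<^sup>2" by (simp add: power_mult_distrib)
        also have "... <= ?s\<^sup>2 * C\<^sup>2" using C by (intro mult_left_mono power_mono) auto
        finally show ?thesis using w_pos[of z] by (intro mult_left_mono) auto
      qed
      then have "Q n z <= (\<Sum>i\<in>(UNIV::'d set). w z * (?s\<^sup>2 * C\<^sup>2))" unfolding Q_def by (rule sum_mono)
      then show "Q n z <= (?s\<^sup>2 * (real CARD('d) * C\<^sup>2)) * w z" by (simp add: algebra_simps)
    qed
    then show ?thesis by (simp add: K_def mult.assoc)
  qed
  \<comment> \<open>As the cutoff scale grows, the cutoff tends to the value of the bump at the
    origin, a positive constant that is not normalized to 1.\<close>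
  define Pinf where "Pinf = (%z. \<Sum>i\<in>UNIV. w z * (bump (0 :: real^'d) * G i z / (w z + u z))\<^sup>2)"
  have P_nonneg: "0 <= P n z" "0 <= Pinf z" for n z
    unfolding P_def Pinf_def using w_pos[of z] by (auto intro!: sum_nonneg)
  have Plim: "(%n. P n z) ----> Pinf z" for z
  proof -
    have "(%n. inverse (1 + real n)) ----> 0" by real_asymp
    then have "(%n. inverse (1 + real n) *R z) ----> 0 *R z" by (intro tendsto_intros)
    then have "(%n. cut n z) ----> bump (0 :: real^'d)"
      unfolding cut_def using continuous_on_tendsto_compose[OF Ck_continuous[OF Ck_bump[of 1]], of _ "0 :: real^'d"] by simp
    then show ?thesis unfolding P_def Pinf_def by (intro tendsto_intros) (use wu0 in auto)
  qed
  have PintP: "(NN z. ennreal (P n z)) <= ennreal (4 * ((inverse (1 + real n))\<^sup>2 * K))" for n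
    using PQ[of n] QK[of n] P_nonneg by (subst nn_integral_eq_integral[OF intP]) (auto intro!: ennreal_leI)
  have Pinf_cont: "continuous_on UNIV Pinf" unfolding Pinf_def by (intro continuous_intros cont) (use wu0 in auto)
  \<comment> \<open>Fatou's lemma suffices for passing to the limit, as only an upper bound for the
    integral of \<open>Pinf\<close> is wanted.\<close>
  have "(NN z. ennreal (Pinf z)) = (NN z. liminf (%n. ennreal (P n z)))"
    using Plim by (intro nn_integral_cong lim_imp_Liminf[symmetric] tendsto_ennrealI) auto
  also have "... <= liminf (%n. NN z. ennreal (P n z))" using intP by (intro nn_integral_liminf) auto
  also have "... <= liminf (%n. ennreal (4 * ((inverse (1 + real n))\<^sup>2 * K)))"
    by (intro Liminf_mono always_eventually allI PintP)
  also have "... = 0"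
  proof -
    have "(%n. 4 * ((inverse (1 + real n))\<^sup>2 * K)) ----> 0" by real_asymp
    then have "(%n. ennreal (4 * ((inverse (1 + real n))\<^sup>2 * K))) ----> ennreal 0" by (rule tendsto_ennrealI)
    then show ?thesis by (intro lim_imp_Liminf) auto
  qed
  finally have "(NN z. ennreal (Pinf z)) = 0" by simp
  then have "AE z in lborel. Pinf z = 0" using borel_measurable_continuous_onI[OF Pinf_cont] P_nonneg(2)
    by (subst (asm) nn_integral_0_iff_AE) (auto elim!: eventually_mono simp: ennreal_eq_0_iff intro: antisym)
  then have "Pinf = (%_. 0)" by (intro AE_lborel_continuous_eq Pinf_cont) auto
  then have "Pinf z = 0" by simp
  then have "w z * (bump (0 :: real^'d) * G i z / (w z + u z))\<^sup>2 = 0"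
    unfolding Pinf_def using w_pos[of z] by (subst (asm) sum_nonneg_eq_0_iff) auto
  then have "G i z = 0" using w_pos[of z] wu0[of z] bump_0_pos[where 'a = "real^'d"] by auto
  then show ?thesis by (simp add: G_def)
qed

subsection \<open>Stationary densities that are even or separated\<close>

lemma pd_vec_expand:
  fixes V :: "real^'d => real" assumes "Ck 1 V" "!!i. pd (axis i 1) V x = F $ i * V x"
  shows "pd v V x = (F \<bullet> v) * V x"
  by (subst pd_cart[OF assms(1)]) (simp add: assms(2) inner_vec_def sum_distrib_left mult_ac)

text \<open>Along the line in direction \<open>e\<close> the logarithmic derivative is the constant
  \<open>c\<close>. The lemma produces the translation factors that
  \<open>no_translation_factor\<close> excludes for an integrable density.\<close>

lemma translate_of_log_gradient:
  fixes V :: "'a::euclidean_space => real" assumes V: "Ck 1 V" and e: "!!x. pd e V x = c * V x"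
  shows "V (x + e) = exp c * V x"
proof -
  have "\<exists>k. \<forall>t\<in>UNIV. V (x + t *R e) * exp (- c * t) = k"
  proof (rule has_field_derivative_zero_constant)
    fix t
    show "((%t. V (x + t *R e) * exp (- c * t)) has_real_derivative 0) (at t within UNIV)"
      by (rule derivative_eq_intros DERIV_line[OF V] refl)+ (simp add: e algebra_simps)
  qed simp
  then obtain k where k: "!!t. V (x + t *R e) * exp (- c * t) = k" by blast
  have "V x = V (x + e) * exp (- c)" using k[of 0] k[of 1] by simp
  then show ?thesis by (simp add: exp_minus field_simps)
qed

text \<open>Comparing the integral with its translates gives \<open>k = 1\<close>; then the translates of
  \<open>r x * arctan (x \<bullet> e)\<close> show that \<open>r\<close> integrates a positive function to zero.\<close>
lemma no_translation_factor:
  fixes r :: "'a::euclidean_space => real"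
  assumes r: "integrable lborel r" and pos: "AE x in lborel. r x > 0" and e: "e ~= 0"
    and tr: "!!x. r (x + e) = k * r x" shows False
proof -
  have [measurable]: "r \<in> borel_measurable borel" using r by auto
  have nn: "AE x in lborel. 0 <= r x" using pos by eventually_elim simp
  have r_int: "(LB x. r x) > 0"
  proof -
    have "(LB x. r x) ~= 0"
    proof
      assume "(LB x. r x) = 0"
      then have "AE x in lborel. r x = 0" using integral_nonneg_eq_0_iff_AE[OF r nn] by simp
      with pos have "AE x in lborel :: 'a measure. False" by eventually_elim simp
      then show False using AE_lborel_ex[of "%_. False"] by simp
    qed
    moreover have "(LB x. r x) >= 0" using pos by (intro integral_nonneg_AE) (auto elim: eventually_mono)
    ultimately show ?thesis by simp
  qed
  have "(LB x. r (x + e)) = (LB x. r x)" by (rule lborel_integral_translate) simp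
  then have k: "k = 1" using r_int by (simp add: tr)
  have int: "integrable lborel (%x. r x * arctan (x \<bullet> e + c))" for c
  proof (rule Bochner_Integration.integrable_bound[OF integrable_mult_left[OF r, of pi]])
    show "AE x in lborel. norm (r x * arctan (x \<bullet> e + c)) <= norm (r x * pi)"
    proof (intro AE_I2)
      fix x
      have "\<bar>arctan (x \<bullet> e + c)\<bar> <= pi" using arctan_bounded[of "x \<bullet> e + c"] pi_gt_zero by linarith
      then show "norm (r x * arctan (x \<bullet> e + c)) <= norm (r x * pi)" by (simp add: abs_mult mult_left_mono)
    qed
  qed simp
  have "(LB x. r (x + e) * arctan ((x + e) \<bullet> e + 0)) = (LB x. r x * arctan (x \<bullet> e + 0))"
    by (rule lborel_integral_translate[where f = "%x. r x * arctan (x \<bullet> e + 0)"]) simp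
  then have "(LB x. r x * arctan (x \<bullet> e + e \<bullet> e) - r x * arctan (x \<bullet> e + 0)) = 0"
    by (subst Bochner_Integration.integral_diff[OF int int]) (simp add: tr k inner_add_left)
  then have zero: "(LB x. r x * (arctan (x \<bullet> e + e \<bullet> e) - arctan (x \<bullet> e))) = 0"
    by (simp add: right_diff_distrib)
  have dpos: "arctan (x \<bullet> e + e \<bullet> e) - arctan (x \<bullet> e) > 0" for x using e by (simp add: arctan_less_iff)
  have "integrable lborel (%x. r x * (arctan (x \<bullet> e + e \<bullet> e) - arctan (x \<bullet> e)))"
    using Bochner_Integration.integrable_diff[OF int int, of "e \<bullet> e" 0] by (simp add: right_diff_distrib)
  moreover have "AE x in lborel. 0 <= r x * (arctan (x \<bullet> e + e \<bullet> e) - arctan (x \<bullet> e))"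
    using pos by eventually_elim (use dpos in \<open>auto intro: mult_nonneg_nonneg less_imp_le\<close>)
  ultimately have "AE x in lborel. r x * (arctan (x \<bullet> e + e \<bullet> e) - arctan (x \<bullet> e)) = 0"
    using integral_nonneg_eq_0_iff_AE zero by blast
  with pos have "AE x in lborel :: 'a measure. False"
  proof eventually_elim
    case (elim x)
    then show False using mult_pos_pos[OF elim(1) dpos[of x]] unfolding elim(2) by simp
  qed
  then show False using AE_lborel_ex[of "%_. False"] by simp
qed

text \<open>\<open>A\<close> and \<open>W\<close> are arbitrary positive functions.
  Cross-multiplication eliminates them, and the identity that remains concerns \<open>r\<close>
  alone and passes from almost all points to all points by continuity. The last clause retains the
  product form on the slice at \<open>q0\<close>, so the lemma can be applied again to split
  \<open>p\<close> from \<open>z\<close>.\<close>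

lemma factorization_of_AE_product:
  fixes r :: "'a::euclidean_space \<times> 'b::euclidean_space => real"
  assumes r: "continuous_on UNIV r" and A: "!!x. A x > 0" and W: "!!y. W y > 0"
    and prod: "AE x in lborel. r x = A (fst x) * W (snd x)"
  shows "\<exists>q0 y0. r (q0, y0) > 0 & (\<forall>q y. r (q, y) * r (q0, y0) = r (q, y0) * r (q0, y))
    & (AE y in lborel. r (q0, y) = A q0 * W y)"
proof -
  have "AE x in lborel \<Otimes>\<^sub>M lborel. r x = A (fst x) * W (snd x)" using prod by (subst lborel_prod)
  from lborel_pair.AE_pair[OF this]
  have q: "AE q in lborel. AE y in lborel. r (q, y) = A q * W y" by simp
  obtain q0 where q0: "AE y in lborel. r (q0, y) = A q0 * W y" using AE_lborel_ex[OF q] by blast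
  obtain y0 where y0: "r (q0, y0) = A q0 * W y0" using AE_lborel_ex[OF q0] by blast
  have rc: "continuous_on S (%x. r (f x, g x))" if "continuous_on S f" "continuous_on S g"
    for S :: "'c::topological_space set" and f g
    by (rule continuous_on_compose2[OF r continuous_on_Pair[OF that]]) simp
  have "r (q, y) * r (q0, y0) = r (q, y0) * r (q0, y)" for q y
  proof -
    have "AE q in lborel. r (q, y) * r (q0, y0) = r (q, y0) * r (q0, y)" using q
    proof eventually_elim
      case (elim q)
      have "AE y in lborel. r (q, y) * A q0 = r (q0, y) * A q" using elim q0 by eventually_elim simp
      then have "(%y. r (q, y) * A q0) = (%y. r (q0, y) * A q)"
        by (intro AE_lborel_continuous_eq continuous_intros rc)
      then have e: "r (q, y) * A q0 = r (q0, y) * A q" for y by meson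
      have "(r (q, y) * A q0) * (r (q0, y0) * A q) = (r (q0, y) * A q) * (r (q, y0) * A q0)"
        using e[of y] e[of y0] by simp
      then show ?case using A[of q0] A[of q] by simp
    qed
    then have "(%q. r (q, y) * r (q0, y0)) = (%q. r (q, y0) * r (q0, y))"
      by (intro AE_lborel_continuous_eq continuous_intros rc)
    then show ?thesis by meson
  qed
  then show ?thesis using q0 y0 A[of q0] W[of y0] by (intro exI[of _ q0] exI[of _ y0]) auto
qed

lemma pd_state_expand:
  fixes r :: "'d::finite state => real" assumes C: "Ck 1 r"
  shows "pd v r x = (\<Sum>i\<in>UNIV. qq v $ i * pd (eq i) r x + pp v $ i * pd (ep i) r x + zz v $ i * pd (ez i) r x)"
proof -
  have v: "v = (\<Sum>i\<in>UNIV. qq v $ i *R eq i + pp v $ i *R ep i + zz v $ i *R ez i)"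
    using vec_sum_axis[of "qq v"] vec_sum_axis[of "pp v"] vec_sum_axis[of "zz v"]
    by (simp add: prod_eq_iff fst_sum snd_sum)
  show ?thesis by (subst v) (simp only: pd_vec_sum[OF C] pd_vec_add[OF C] pd_vec_scale[OF C] real_scaleR_def)
qed

lemma gibbs_gradient_of_coordinates:
  fixes r :: "'d::finite state => real" assumes C: "Ck 1 r" and "!!i x. pd (eq i) r x = \<beta> * b (qq x) $ i * r x"
    and "!!i x. pd (ep i) r x = - \<beta> * pp x $ i * r x" and "!!i x. pd (ez i) r x = - \<beta> * zz x $ i * r x"
  shows "(r has_derivative (%v. (gibbs_field \<beta> b x \<bullet> v) * r x)) (at x)"
proof -
  have "pd v r x = (gibbs_field \<beta> b x \<bullet> v) * r x" for v
    unfolding pd_state_expand[OF C, where v = v and x = x] assms(2-4)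
    by (simp add: inner_gibbs_field_vec inner_vec_def sum_distrib_left sum_distrib_right
        sum_subtractf sum.distrib algebra_simps sum_negf)
  then have "frechet_derivative r (at x) = (%v. (gibbs_field \<beta> b x \<bullet> v) * r x)" by auto
  then show ?thesis using Ck1_has_derivative[OF C, of x] by simp
qed

section \<open>Stationary densities that are even in the momentum\<close>

context langevin_density
begin

text \<open>Continuity upgrades positivity almost everywhere to nonnegativity everywhere. Strict
  positivity everywhere is not claimed here; later it comes out of the logarithmic gradient.\<close>

lemma stationary_version: assumes "stationary_density \<alpha> \<beta> b \<rho>"
  shows "\<exists>r. (AE x in lborel. \<rho> x = r x) & Ck 2 r & (\<forall>x. r x >= 0) & (AE x in lborel. r x > 0) & integrable lborel r
     & (\<forall>x. - pd (transport b x) r x + \<alpha> * ou_adjoint \<beta> r x = 0)"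
proof -
  obtain r where r: "AE x in lborel. \<rho> x = r x" "Ck 2 r" "!!x. fokker_planck \<alpha> \<beta> b r x = 0"
    using assms unfolding stationary_density_def by blast
  have rc: "continuous_on UNIV r" by (rule Ck_continuous[OF r(2)])
  have pos: "AE x in lborel. r x > 0" using r(1) by eventually_elim (use \<rho>_pos in metis)
  then have "AE x in lborel. r x = max (r x) 0" by eventually_elim simp
  then have "r = (%x. max (r x) 0)" by (intro AE_lborel_continuous_eq continuous_intros rc)
  then have nonneg: "r x >= 0" for x by (metis max.cobounded2)
  have "integrable lborel r" using integrable_weight r(1) borel_measurable_continuous_onI[OF rc]
    by (subst integrable_cong_AE[of _ _ \<rho>]) (auto elim: eventually_mono)
  then show ?thesis using r nonneg pos fokker_planck_eq[OF r(2)] by (intro exI[of _ r]) auto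
qed

lemma potential_of_version: assumes "AE x in lborel. \<rho> x = r x" "AE x in lborel. r x > 0" "Ck 1 r"
    and "!!i x. pd (eq i) r x = \<beta> * b (qq x) $ i * r x" and "!!i x. pd (ep i) r x = - \<beta> * pp x $ i * r x"
    and "!!i x. pd (ez i) r x = - \<beta> * zz x $ i * r x" shows "potential_condition \<beta> b \<rho>"
proof -
  obtain x0 where "r x0 > 0" using AE_lborel_ex[OF assms(2)] by blast
  then show ?thesis by (intro potential_conditionI[OF \<beta> b_continuous _ _ assms(1) integrable_weight \<rho>_prob]
        gibbs_gradient_of_coordinates assms(3-6))
qed

lemma potential_of_even_stationary: assumes even: "even_in_p \<rho>" and st: "stationary_density \<alpha> \<beta> b \<rho>"
  shows "potential_condition \<beta> b \<rho>"
proof -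
  obtain r where r: "AE x in lborel. \<rho> x = r x" "Ck 2 r" "!!x. r x >= 0" "AE x in lborel. r x > 0"
    and fp: "!!x. - pd (transport b x) r x + \<alpha> * ou_adjoint \<beta> r x = 0" using stationary_version[OF st] by blast
  have C: "Ck 1 r" "Ck 1 (pd v r)" for v
    using r(2) Ck1[of 1 r] Ck_pd[of 1 r] by (auto simp: numeral_2_eq_2 One_nat_def)
  have "AE x in lborel. r x = r (flip_p x)"
    using r(1) AE_flip_p[OF r(1)] even[unfolded even_in_p_iff] by eventually_elim simp
  then have "r = (%x. r (flip_p x))"
    by (intro AE_lborel_continuous_eq Ck_continuous[OF C(1)] Ck_continuous[OF Ck_flip_p[OF C(1)]])
  then have flip: "r (flip_p x) = r x" for x by metis
  have pdf: "pd v r (flip_p x) = pd (flip_p v) r x" for v x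
    using pd_flip_p[OF C(1), where v = v and x = "flip_p x"] by (simp add: flip)
  have pdf2: "pd (ez i) (pd (ez i) r) (flip_p x) = pd (ez i) (pd (ez i) r) x" for i x
    using pd_flip_p[OF C(2)[of "ez i"], where v = "ez i" and x = "flip_p x"] by (simp add: pdf flip_p_ez)
  have T: "pd (transport b (flip_p x)) r (flip_p x) = - pd (transport b x) r x" for x
    by (simp add: pdf transport_flip_p pd_vec_minus[OF C(1)])
  have O: "ou_adjoint \<beta> r (flip_p x) = ou_adjoint \<beta> r x" for x
    by (simp add: ou_adjoint_def flip pdf pdf2 flip_p_ez) (simp add: flip_p_eq)
  \<comment> \<open>Under momentum reversal the transport term is odd and the other term is even, so
    the equations at \<open>x\<close> and at \<open>flip_p x\<close> separate them.\<close>
  have "ou_adjoint \<beta> r x = 0" "pd (transport b x) r x = 0" for x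
    using fp[of x] fp[of "flip_p x"] \<alpha> unfolding T O by auto
  note OT = this
  have z: "pd (ez i) r x = - \<beta> * zz x $ i * r x" for i x
  proof -
    obtain q p z where x: "x = (q, p, z)" by (cases x)
    have "pd (axis i 1) (%z. r (q, p, z)) z = - \<beta> * z $ i * r (q, p, z)"
    proof (rule liouville[OF \<beta> Ck_slices(3)[OF r(2)]])
      fix z
      show "(\<Sum>i\<in>UNIV. r (q, p, z) + z $ i * pd (axis i 1) (%z. r (q, p, z)) z
        + 1 / \<beta> * pd (axis i 1) (pd (axis i 1) (%z. r (q, p, z))) z) = 0"
        using OT(1)[of "(q, p, z)"] by (simp add: ou_adjoint_def pd_slices[OF C(1)] pd_slices[OF C(2)])
    qed (simp add: r(3))
    then show ?thesis by (simp add: x pd_slices[OF C(1)])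
  qed
  have gz: "r (q, p, z) = gauss \<beta> z * r (q, p, 0)" for q p z
  proof -
    have "\<exists>k. \<forall>z\<in>UNIV. r (q, p, z) * inverse (gauss \<beta> z) = k"
    proof (rule has_derivative_zero_constant)
      fix z :: "real^'a"
      have g0: "gauss \<beta> z ~= 0" for z :: "real^'a" by (simp add: gauss_def)
      have c: "Ck 1 (%z. r (q, p, z))" by (rule Ck_slices[OF C(1)])
      have ci: "Ck 1 (%z::real^'a. inverse (gauss \<beta> z))" by (rule Ck_inverse[OF g0 Ck_gauss])
      have pv: "pd v (%z. r (q, p, z)) z = (- \<beta> *R z \<bullet> v) * r (q, p, z)" for v
        by (rule pd_vec_expand[OF c]) (simp add: pd_slices[OF C(1)] z)
      have "pd v (%z. r (q, p, z) * inverse (gauss \<beta> z)) z = 0" for v using g0[of z]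
        by (subst pd_mult[OF c ci], subst pd_inverse[OF g0 Ck_gauss])
          (simp add: pd_gauss pv power2_eq_square field_simps)
      then have "frechet_derivative (%z. r (q, p, z) * inverse (gauss \<beta> z)) (at z) = (%v. 0)" by auto
      then show "((%z. r (q, p, z) * inverse (gauss \<beta> z)) has_derivative (%v. 0)) (at z within UNIV)"
        using Ck1_has_derivative[OF Ck_mult[OF c ci], of z] by simp
    qed simp
    then obtain k where k: "!!z. r (q, p, z) * inverse (gauss \<beta> z) = k" by blast
    have "r (q, p, z) * inverse (gauss \<beta> z) = r (q, p, 0) * inverse (gauss \<beta> (0 :: real^'a))" by (simp only: k)
    then show ?thesis by (simp add: gauss_def exp_minus field_simps)
  qed
  have gpd: "pd (v, w, 0) r (q, p, z) = gauss \<beta> z * pd (v, w, 0) r (q, p, 0)" for v w q p z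
  proof -
    have 1: "pd (v, 0, 0) r (q, p, z) = gauss \<beta> z * pd (v, 0, 0) r (q, p, 0)"
      using pd_cmult[OF Ck_slices(1)[OF C(1)], where c = "gauss \<beta> z" and v = v and x = q and p1 = p and z1 = 0]
      by (simp add: gz[of _ p z, symmetric] pd_slices[OF C(1)])
    have 2: "pd (0, w, 0) r (q, p, z) = gauss \<beta> z * pd (0, w, 0) r (q, p, 0)"
      using pd_cmult[OF Ck_slices(2)[OF C(1)], where c = "gauss \<beta> z" and v = w and x = p and q1 = q and z1 = 0]
      by (simp add: gz[of q _ z, symmetric] pd_slices[OF C(1)])
    have "pd ((v, 0, 0) + (0, w, 0)) r y = pd (v, 0, 0) r y + pd (0, w, 0) r y" for y by (rule pd_vec_add[OF C(1)])
    then show ?thesis using 1 2 by (simp add: distrib_left)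
  qed
  \<comment> \<open>After the Gaussian factor in \<open>z\<close> is divided out, the transport
    equation involves \<open>r\<close> only on the slice \<open>z = 0\<close> and is affine in
    \<open>z\<close>; comparing coefficients gives \<open>T00\<close> and \<open>p0\<close>.\<close>
  have T0: "pd (p, b q + z, 0) r (q, p, 0) + \<beta> * (p \<bullet> z) * r (q, p, 0) = 0" for q p z
  proof -
    have 1: "pd ((p, b q + z, 0) + - (0, 0, p)) r (q, p, z) = pd (p, b q + z, 0) r (q, p, z) - pd (0, 0, p) r (q, p, z)"
      by (simp only: pd_vec_add[OF C(1)] pd_vec_minus[OF C(1)])
    have 2: "pd (0, 0, p) r (q, p, z) = - \<beta> * (p \<bullet> z) * r (q, p, z)"
      by (subst pd_state_expand[OF C(1), where v = "(0, 0, p)" and x = "(q, p, z)"])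
        (simp add: z inner_vec_def sum_distrib_left sum_distrib_right sum_negf mult_ac)
    have "gauss \<beta> z * (pd (p, b q + z, 0) r (q, p, 0) + \<beta> * (p \<bullet> z) * r (q, p, 0))
      = pd (p, b q + z, 0) r (q, p, z) - pd (0, 0, p) r (q, p, z)"
      unfolding 2 gpd[where v = p and w = "b q + z" and q = q and p = p and z = z] gz[of q p z] by (simp only: distrib_left) (simp add: mult_ac)
    also have "... = 0" using OT(2)[of "(q, p, z)"] 1 by (simp add: transport_def)
    finally have "gauss \<beta> z * (pd (p, b q + z, 0) r (q, p, 0) + \<beta> * (p \<bullet> z) * r (q, p, 0)) = 0" .
    then show ?thesis by (simp add: gauss_def)
  qed
  have T00: "pd (p, b q, 0) r (q, p, 0) = 0" for q p using T0[where q = q and p = p and z = 0] by simp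
  have p0: "pd (0, z, 0) r (q, p, 0) = - \<beta> * (p \<bullet> z) * r (q, p, 0)" for q p z
  proof -
    have "pd ((p, b q, 0) + (0, z, 0)) r (q, p, 0) = pd (p, b q, 0) r (q, p, 0) + pd (0, z, 0) r (q, p, 0)"
      by (rule pd_vec_add[OF C(1)])
    then show ?thesis using T0[where q = q and p = p and z = z] T00[where q = q and p = p] by simp
  qed
  \<comment> \<open>At the point \<open>(q, p, 0)\<close> only the \<open>q\<close>-derivative in
    the direction \<open>p\<close> is obtained. The Gaussian dependence on \<open>p\<close>, proved
    next, transfers it to \<open>p = 0\<close>, where \<open>p\<close> can be chosen as any
    direction.\<close>
  have q0: "pd (p, 0, 0) r (q, p, 0) = \<beta> * (b q \<bullet> p) * r (q, p, 0)" for q p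
  proof -
    have "pd ((p, 0, 0) + (0, b q, 0)) r (q, p, 0) = pd (p, 0, 0) r (q, p, 0) + pd (0, b q, 0) r (q, p, 0)"
      by (rule pd_vec_add[OF C(1)])
    then show ?thesis using T00[where q = q and p = p] by (simp add: p0 inner_commute)
  qed
  have gp: "r (q, p, 0) = gauss \<beta> p * r (q, 0, 0)" for q p
  proof -
    have "\<exists>k. \<forall>p\<in>UNIV. r (q, p, 0) * inverse (gauss \<beta> p) = k"
    proof (rule has_derivative_zero_constant)
      fix p :: "real^'a"
      have g0: "gauss \<beta> p ~= 0" for p :: "real^'a" by (simp add: gauss_def)
      have c: "Ck 1 (%p. r (q, p, 0))" by (rule Ck_slices[OF C(1)])
      have ci: "Ck 1 (%p::real^'a. inverse (gauss \<beta> p))" by (rule Ck_inverse[OF g0 Ck_gauss])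
      have "pd v (%p. r (q, p, 0) * inverse (gauss \<beta> p)) p = 0" for v using g0[of p]
        by (subst pd_mult[OF c ci], subst pd_inverse[OF g0 Ck_gauss])
          (simp add: pd_gauss pd_slices[OF C(1)] p0 power2_eq_square field_simps)
      then have "frechet_derivative (%p. r (q, p, 0) * inverse (gauss \<beta> p)) (at p) = (%v. 0)" by auto
      then show "((%p. r (q, p, 0) * inverse (gauss \<beta> p)) has_derivative (%v. 0)) (at p within UNIV)"
        using Ck1_has_derivative[OF Ck_mult[OF c ci], of p] by simp
    qed simp
    then obtain k where k: "!!p. r (q, p, 0) * inverse (gauss \<beta> p) = k" by blast
    have "r (q, p, 0) * inverse (gauss \<beta> p) = r (q, 0, 0) * inverse (gauss \<beta> (0 :: real^'a))" by (simp only: k)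
    then show ?thesis by (simp add: gauss_def exp_minus field_simps)
  qed
  have gq: "pd (v, 0, 0) r (q, p, 0) = gauss \<beta> p * pd (v, 0, 0) r (q, 0, 0)" for v q p
    using pd_cmult[OF Ck_slices(1)[OF C(1)], where c = "gauss \<beta> p" and v = v and x = q and p1 = 0 and z1 = 0]
    by (simp add: gp[of _ p, symmetric] pd_slices[OF C(1)])
  have q00: "pd (v, 0, 0) r (q, 0, 0) = \<beta> * (b q \<bullet> v) * r (q, 0, 0)" for v q using q0[where q = q and p = v]
      gq[where v = v and q = q and p = v] gp[of q v] by (simp add: gauss_def)
  show ?thesis
  proof (rule potential_of_version[OF r(1) r(4) C(1) _ _ z])
    fix i and x :: "'a state"
    obtain q p z where x: "x = (q, p, z)" by (cases x)
    show "pd (eq i) r x = \<beta> * b (qq x) $ i * r x"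
      using gpd[where v = "axis i 1" and w = 0 and q = q and p = p and z = z]
        gq[where v = "axis i 1" and q = q and p = p] by (simp add: x q00 gz[of q p z] gp[of q p] inner_axis)
    show "pd (ep i) r x = - \<beta> * pp x $ i * r x"
      using gpd[where v = 0 and w = "axis i 1" and q = q and p = p and z = z] by (simp add: x p0 gz[of q p z] inner_axis)
  qed
qed

end

section \<open>Stationary product densities\<close>

lemma has_derivative_of_pd: assumes "Ck 1 V" "!!v. pd v V x = f v" shows "(V has_derivative f) (at x)"
proof -
  have "frechet_derivative V (at x) = f" using assms(2) by auto
  then show ?thesis using Ck1_has_derivative[OF assms(1), of x] by simp
qed

lemma inner_grad_eq: "Ck 1 V ==> grad V x \<bullet> v = pd v V x" by (metis inner_commute inner_grad)

lemma vec_eqI_inner: "(!!v. v \<bullet> x = v \<bullet> y) ==> x = (y :: 'a::real_inner)"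
  by (metis inner_diff_right inner_eq_zero_iff right_minus_eq)

context langevin_density
begin

lemma potential_of_separated_stationary: assumes sep: "separated_variables \<rho>" and st: "stationary_density \<alpha> \<beta> b \<rho>"
  shows "potential_condition \<beta> b \<rho>"
proof -
  obtain r where r: "AE x in lborel. \<rho> x = r x" "Ck 2 r" "!!x. r x >= 0" "AE x in lborel. r x > 0"
    and r_int: "integrable lborel r" and fp: "!!x. - pd (transport b x) r x + \<alpha> * ou_adjoint \<beta> r x = 0"
    using stationary_version[OF st] by blast
  obtain U1 U2 U3 :: "real^'a => real" where U: "!!x. U1 x > 0" "!!x. U2 x > 0" "!!x. U3 x > 0"
    and \<rho>U: "AE x in lborel. \<rho> x = tensor3 U1 U2 U3 x" using sep unfolding separated_variables_def by blast
  have C: "Ck 1 r" "Ck 1 (pd v r)" for v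
    using r(2) Ck1[of 1 r] Ck_pd[of 1 r] by (auto simp: numeral_2_eq_2 One_nat_def)
  have rc: "continuous_on UNIV r" by (rule Ck_continuous[OF C(1)])
  have "AE x in lborel. r x = U1 (fst x) * (%y. U2 (fst y) * U3 (snd y)) (snd x)"
    using r(1) \<rho>U by eventually_elim (simp add: tensor3_def split_beta)
  from factorization_of_AE_product[OF rc U(1) _ this] obtain q0 y0 where
    q0: "r (q0, y0) > 0" "!!q y. r (q, y) * r (q0, y0) = r (q, y0) * r (q0, y)"
    and q0AE: "AE y in lborel. r (q0, y) = U1 q0 * (U2 (fst y) * U3 (snd y))" using U by (auto simp: mult_pos_pos)
  have rq0: "continuous_on UNIV (%y. r (q0, y))" by (intro continuous_on_compose2[OF rc] continuous_intros) auto
  have "AE y in lborel. r (q0, y) = (%p. U1 q0 * U2 p) (fst y) * U3 (snd y)" using q0AE by eventually_elim simp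
  from factorization_of_AE_product[OF rq0 _ U(3) this] obtain p0 z0 where
    p0: "r (q0, p0, z0) > 0" "!!p z. r (q0, p, z) * r (q0, p0, z0) = r (q0, p, z0) * r (q0, p0, z)"
    using U by (auto simp: mult_pos_pos)
  \<comment> \<open>The factors are slices of the continuous version, normalized so that
    \<open>V1\<close> is 1 at \<open>q0\<close> and \<open>V3\<close> is 1 at \<open>z0\<close>;
    unlike the given factors they inherit its regularity.\<close>
  define V1 where "V1 = (%q. inverse (r (q0, y0)) * r (q, y0))"
  define V2 where "V2 = (%p. r (q0, p, z0))"
  define V3 where "V3 = (%z. inverse (r (q0, p0, z0)) * r (q0, p0, z))"
  have rV: "r (q, p, z) = V1 q * V2 p * V3 z" for q p z
  proof -
    have "r (q, p, z) = V1 q * r (q0, p, z)" using q0(2)[of q "(p, z)"] q0(1) by (simp add: V1_def field_simps)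
    also have "r (q0, p, z) = V2 p * V3 z" using p0(2)[of p z] p0(1) by (simp add: V2_def V3_def field_simps)
    finally show ?thesis by simp
  qed
  have CV2: "Ck 2 V1" "Ck 2 V2" "Ck 2 V3" using Ck_slices[OF r(2)] unfolding V1_def V2_def V3_def
    by (cases y0; auto intro!: Ck_mult Ck_const)+
  have CV: "Ck 1 V1" "Ck 1 V2" "Ck 1 V3" "Ck 1 (pd v V3)" for v
    using CV2 Ck1[of 1] Ck_pd[of 1 V3] by (auto simp: numeral_2_eq_2 One_nat_def)
  have at0: "V1 q0 = 1" "V2 p0 > 0" "V3 z0 = 1" using q0(1) p0(1) by (auto simp: V1_def V2_def V3_def)
  have pdr: "pd (v, 0, 0) r (q, p, z) = pd v V1 q * (V2 p * V3 z)"
    "pd (0, v, 0) r (q, p, z) = pd v V2 p * (V1 q * V3 z)"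
    "pd (0, 0, v) r (q, p, z) = pd v V3 z * (V1 q * V2 p)" for v q p z unfolding pd_slices[OF C(1), symmetric] rV
    using pd_cmult[OF CV(1), where c = "V2 p * V3 z" and v = v and x = q]
      pd_cmult[OF CV(2), where c = "V1 q * V3 z" and v = v and x = p]
      pd_cmult[OF CV(3), where c = "V1 q * V2 p" and v = v and x = z] by (simp_all add: mult_ac)
  have pdr2: "pd (0, 0, v) (pd (0, 0, v) r) (q, p, z) = pd v (pd v V3) z * (V1 q * V2 p)" for v q p z
    unfolding pd_slices[OF C(2), symmetric] pdr
    using pd_cmult[OF CV(4)[of v], where c = "V1 q * V2 p" and x = z and v = v] by (simp add: mult_ac)
  define S where "S = (%z. \<Sum>i\<in>UNIV. V3 z + z $ i * pd (axis i 1) V3 z + 1 / \<beta> * pd (axis i 1) (pd (axis i 1) V3) z)"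
  have FP: "pd p V1 q * V2 p * V3 z + V1 q * pd (b q + z) V2 p * V3 z - V1 q * V2 p * pd p V3 z
      = \<alpha> * (V1 q * V2 p * S z)" for q p z
  proof -
    have "pd ((p, 0, 0) + (0, b q + z, 0) + - (0, 0, p)) r (q, p, z)
      = pd (p, 0, 0) r (q, p, z) + pd (0, b q + z, 0) r (q, p, z) - pd (0, 0, p) r (q, p, z)"
      by (simp only: pd_vec_add[OF C(1)] pd_vec_minus[OF C(1)])
    moreover have "ou_adjoint \<beta> r (q, p, z) = V1 q * V2 p * S z" unfolding ou_adjoint_def S_def sum_distrib_left
      by (intro sum.cong refl) (simp add: rV pdr pdr2 algebra_simps)
    ultimately show ?thesis using fp[of "(q, p, z)"] by (simp add: transport_def pdr algebra_simps)
  qed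
  define a where "a = grad V1 q0"
  have E: "(a \<bullet> p) * V2 p * V3 z + pd (b q0 + z) V2 p * V3 z - V2 p * pd p V3 z = \<alpha> * (V2 p * S z)" for p z
    using FP[where q = q0 and p = p and z = z] by (simp add: at0 a_def inner_grad_eq[OF CV(1)])
  define u where "u = (%p. inverse (V2 p) *R grad V2 p)"
  have u: "pd v V2 p = (u p \<bullet> v) * V2 p" if "V2 p > 0" for v p
    using that by (simp add: u_def inner_grad_eq[OF CV(2)])
  have E': "(a \<bullet> p) * V3 z + (u p \<bullet> (b q0 + z)) * V3 z - pd p V3 z = \<alpha> * S z" if "V2 p > 0" for p z
  proof -
    have "V2 p * ((a \<bullet> p) * V3 z + (u p \<bullet> (b q0 + z)) * V3 z - pd p V3 z) = V2 p * (\<alpha> * S z)"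
      using E[of p z] by (simp add: u[OF that] algebra_simps)
    then show ?thesis using that by simp
  qed
  have "open {p. V2 p > 0}" using Ck_continuous[OF CV(2)] by (intro open_Collect_less continuous_intros)
  then obtain d where d: "d > 0" "!!p. dist p p0 < d ==> V2 p > 0" using at0(2) unfolding open_dist by fastforce
  \<comment> \<open>\<open>E'\<close> results from dividing by \<open>V2\<close>, whose positivity
    is so far known only near \<open>p0\<close>; half the radius keeps the shifted points in that
    neighbourhood.\<close>
  define \<epsilon> where "\<epsilon> = d / 2"
  have \<epsilon>: "\<epsilon> > 0" "V2 (p0 + \<epsilon> *R axis j 1) > 0" for j using d(1) by (auto simp: \<epsilon>_def dist_norm intro!: d(2))
  \<comment> \<open>\<open>E'\<close> at \<open>p0 + \<epsilon> e_j\<close> minus \<open>E'\<close>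
    at \<open>p0\<close> eliminates \<open>S\<close> and isolates one derivative of
    \<open>V3\<close>. The finite difference quotients \<open>N j\<close> become the rows of the
    linear part \<open>L\<close> of the logarithmic gradient of \<open>V3\<close>.\<close>
  define N where "N = (%j. inverse \<epsilon> *R (u (p0 + \<epsilon> *R axis j 1) - u p0))"
  define v0 where "v0 = (\<chi> j. a $ j + N j \<bullet> b q0)"
  define L where "L = (%z. \<chi> j. N j \<bullet> z)"
  have pdV3_axis: "pd (axis j 1) V3 z = (v0 + L z) $ j * V3 z" for j z
  proof -
    have "pd (p0 + \<epsilon> *R axis j 1) V3 z = pd p0 V3 z + \<epsilon> * pd (axis j 1) V3 z"
      by (simp add: pd_vec_add[OF CV(3)] pd_vec_scale[OF CV(3)])
    then have e1: "\<epsilon> * pd (axis j 1) V3 z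
      = \<epsilon> * (a $ j * V3 z) + ((u (p0 + \<epsilon> *R axis j 1) - u p0) \<bullet> (b q0 + z)) * V3 z"
      using E'[OF \<epsilon>(2)[of j], of z] E'[OF at0(2), of z]
      by (simp add: inner_add_right inner_axis inner_diff_left algebra_simps)
    have e2: "(u (p0 + \<epsilon> *R axis j 1) - u p0) \<bullet> (b q0 + z) = \<epsilon> * (N j \<bullet> (b q0 + z))"
      using \<epsilon>(1) unfolding N_def inner_scaleR_left by simp
    have "\<epsilon> * pd (axis j 1) V3 z = \<epsilon> * ((a $ j + N j \<bullet> (b q0 + z)) * V3 z)"
      unfolding e1 e2 by (simp add: algebra_simps)
    then have "pd (axis j 1) V3 z = (a $ j + N j \<bullet> (b q0 + z)) * V3 z" using \<epsilon>(1) by simp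
    then show ?thesis by (simp add: v0_def L_def inner_add_right algebra_simps)
  qed
  have pdV3: "pd v V3 z = ((v0 + L z) \<bullet> v) * V3 z" for v z by (rule pd_vec_expand[OF CV(3) pdV3_axis])
  have L_lin: "L (x + y) = L x + L y" "L (c *R x) = c *R L x" "L (- x) = - L x" "L 0 = 0" for x y c
    by (auto simp: L_def vec_eq_iff inner_add_right)
  have L_cont: "continuous_on UNIV L" unfolding L_def by (intro continuous_on_vec_lambda continuous_intros)
  have V3_pos: "V3 z > 0" for z
  proof (rule positive_of_log_gradient[where F = "%x. v0 + L x"])
    show "(V3 has_derivative (%v. ((v0 + L x) \<bullet> v) * V3 x)) (at x)" for x
      by (rule has_derivative_of_pd[OF CV(3) pdV3])
    show "continuous_on UNIV (%x. v0 + L x)" by (intro continuous_intros L_cont)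
    show "V3 z0 > 0" by (simp add: at0)
  qed
  have pdV3_2: "pd (axis i 1) (pd (axis j 1) V3) z = (N j $ i + (v0 + L z) $ j * (v0 + L z) $ i) * V3 z" for i j z
  proof -
    have lin: "bounded_linear (%z. N j \<bullet> z)" by (rule bounded_linear_inner_right)
    have c: "Ck 1 (%z. v0 $ j + N j \<bullet> z)" by (intro Ck_add Ck_const Ck_linear lin)
    have e: "pd (axis j 1) V3 = (%z. (v0 $ j + N j \<bullet> z) * V3 z)" using pdV3_axis by (auto simp: L_def)
    have "pd (axis i 1) (%z. v0 $ j + N j \<bullet> z) z = N j $ i"
      by (simp add: pd_add[OF Ck_const Ck_linear[OF lin]] pd_const pd_bounded_linear[OF lin] inner_axis)
    then show ?thesis unfolding e by (simp add: pd_mult[OF c CV(3)] pdV3_axis) (simp add: L_def algebra_simps)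
  qed
  \<comment> \<open>Second derivatives of \<open>V3\<close> commute, and their remaining part is a
    symmetric product, so the matrix of \<open>L\<close> is symmetric.\<close>
  have sym: "N j $ i = N i $ j" for i j
    using pd_commute[OF CV2(3), where v = "axis i 1" and w = "axis j 1" and x = z0]
    by (simp add: pdV3_2 at0 mult.commute)
  have L_sym: "L x \<bullet> y = x \<bullet> L y" for x y
  proof -
    have "L x \<bullet> y = (\<Sum>j\<in>UNIV. \<Sum>i\<in>UNIV. N j $ i * x $ i * y $ j)"
      by (simp add: L_def inner_vec_def sum_distrib_right)
    also have "... = (\<Sum>i\<in>UNIV. \<Sum>j\<in>UNIV. N i $ j * x $ i * y $ j)" by (subst sum.swap) (simp add: sym)
    also have "... = x \<bullet> L y" by (simp add: L_def inner_vec_def sum_distrib_left mult_ac)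
    finally show ?thesis .
  qed
  define s where "s = (%z. \<Sum>i\<in>UNIV. 1 + z $ i * (v0 + L z) $ i + 1 / \<beta> * (N i $ i + (v0 + L z) $ i * (v0 + L z) $ i))"
  have S: "S z = s z * V3 z" for z unfolding S_def s_def sum_distrib_right
    by (intro sum.cong refl) (simp only: pdV3_2, simp add: pdV3_axis algebra_simps)
  have s_diff: "s z - s 0 = z \<bullet> v0 + z \<bullet> L z + 1 / \<beta> * (2 * (v0 \<bullet> L z) + L z \<bullet> L z)" for z
    by (simp add: s_def L_lin inner_vec_def sum.distrib sum_distrib_left sum_subtractf[symmetric] algebra_simps)
  have E2: "(a \<bullet> p) * V2 p + pd (b q0 + z) V2 p - ((v0 + L z) \<bullet> p) * V2 p = \<alpha> * (s z * V2 p)" for p z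
  proof -
    have "((a \<bullet> p) * V2 p + pd (b q0 + z) V2 p - ((v0 + L z) \<bullet> p) * V2 p) * V3 z = \<alpha> * (s z * V2 p) * V3 z"
      using E[of p z] by (simp add: S pdV3 algebra_simps)
    then show ?thesis using V3_pos[of z] by simp
  qed
  \<comment> \<open>Subtracting the equation at \<open>z = 0\<close> removes the terms that do not
    depend on \<open>z\<close>.\<close>
  have E3: "pd z V2 p = (L z \<bullet> p + \<alpha> * (s z - s 0)) * V2 p" for p z
    using E2[of p z] E2[of p 0] by (simp add: pd_vec_add[OF CV(2)] L_lin inner_add_left algebra_simps)
  define u0 where "u0 = u p0 - L p0"
  \<comment> \<open>At \<open>p = p0\<close> all other terms of \<open>E3\<close> are linear in
    \<open>z\<close>, so the quadratic function \<open>s z - s 0\<close> must be linear as well. Its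
    even part then vanishes, which is the quadratic equation for \<open>L\<close>.\<close>
  have s_lin: "\<alpha> * (s z - s 0) = z \<bullet> u0" for z using E3[of p0 z] u[OF at0(2), of z] at0(2) L_sym[of z p0]
    by (simp add: u0_def inner_diff_right inner_commute)
  have pdV2: "pd z V2 p = ((u0 + L p) \<bullet> z) * V2 p" for p z
    using E3[of p z] L_sym[of z p] by (simp add: s_lin inner_add_left inner_add_right inner_commute add.commute)
  have V2_pos: "V2 p > 0" for p
  proof (rule positive_of_log_gradient[where F = "%x. u0 + L x"])
    show "(V2 has_derivative (%v. ((u0 + L x) \<bullet> v) * V2 x)) (at x)" for x
      by (rule has_derivative_of_pd[OF CV(2) pdV2])
    show "continuous_on UNIV (%x. u0 + L x)" by (intro continuous_intros L_cont)
    show "V2 p0 > 0" by (rule at0)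
  qed
  have even: "z \<bullet> L z + 1 / \<beta> * (L z \<bullet> L z) = 0" for z
  proof -
    have "\<alpha> * (s z - s 0) + \<alpha> * (s (- z) - s 0) = 0" by (simp add: s_lin)
    then have "\<alpha> * (2 * (z \<bullet> L z + 1 / \<beta> * (L z \<bullet> L z))) = 0" unfolding s_diff by (simp add: L_lin algebra_simps)
    then show ?thesis using \<alpha> by simp
  qed
  have odd: "\<alpha> * (z \<bullet> v0 + 2 / \<beta> * (v0 \<bullet> L z)) = z \<bullet> u0" for z
  proof -
    have "s z - s 0 = z \<bullet> v0 + 2 / \<beta> * (v0 \<bullet> L z) + (z \<bullet> L z + 1 / \<beta> * (L z \<bullet> L z))"
      by (simp add: s_diff algebra_simps)
    then show ?thesis using s_lin[of z] unfolding even by simp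
  qed
  have LL: "L y + (1 / \<beta>) *R L (L y) = 0" for y
  proof (rule vec_eqI_inner)
    fix x
    have "x \<bullet> L y + y \<bullet> L x + 1 / \<beta> * (2 * (L x \<bullet> L y)) = 0" using even[of "x + y"] even[of x] even[of y]
      by (simp add: L_lin inner_add_left inner_add_right inner_commute algebra_simps)
    moreover have "y \<bullet> L x = x \<bullet> L y" using L_sym[of x y] by (simp add: inner_commute)
    moreover have "L x \<bullet> L y = x \<bullet> L (L y)" by (rule L_sym)
    ultimately show "x \<bullet> (L y + (1 / \<beta>) *R L (L y)) = x \<bullet> 0" by (simp add: inner_add_right)
  qed
  have L_eq: "L x = - \<beta> *R x" for x
  proof (rule ccontr)
    \<comment> \<open>By \<open>LL\<close> this vector lies in the kernel of \<open>L\<close>. If it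
      were nonzero, the density would be multiplied by a constant under translation by it in
      \<open>z\<close>, contradicting integrability.\<close>
    define e where "e = L x + \<beta> *R x"
    assume "L x ~= - \<beta> *R x"
    then have e: "e ~= 0" by (auto simp: e_def add_eq_0_iff)
    have "\<beta> *R (L x + (1 / \<beta>) *R L (L x)) = L e" using \<beta> by (simp add: e_def L_lin scaleR_add_right)
    then have Le: "L e = 0" by (simp add: LL)
    have "pd e V3 z = (v0 \<bullet> e) * V3 z" for z using L_sym[of z e] by (simp add: pdV3 Le inner_add_left)
    then have "V3 (z + e) = exp (v0 \<bullet> e) * V3 z" for z by (rule translate_of_log_gradient[OF CV(3)])
    then have tr: "r (x + (0, 0, e)) = exp (v0 \<bullet> e) * r x" for x by (cases x) (simp add: rV)
    have "(0, 0, e) ~= 0" using e by (simp add: zero_prod_def)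
    then show False by (rule no_translation_factor[OF r_int r(4) _ tr])
  qed
  have u0: "u0 = - \<alpha> *R v0"
  proof (rule vec_eqI_inner)
    fix z show "z \<bullet> u0 = z \<bullet> - \<alpha> *R v0" using odd[of z] \<beta> by (simp add: L_eq inner_commute)
  qed
  have s0: "s 0 = (v0 \<bullet> v0) / \<beta>"
  proof -
    have "N i $ i = - \<beta>" for i using L_eq[of "axis i 1"] by (simp add: L_def vec_eq_iff inner_axis axis_component)
    then show ?thesis using \<beta> by (simp add: s_def L_lin inner_vec_def sum_divide_distrib diff_divide_distrib)
  qed
  have FP0: "pd p V1 q + V1 q * (b q \<bullet> u0 - \<beta> * (b q \<bullet> p) - p \<bullet> v0 - \<alpha> * (v0 \<bullet> v0) / \<beta>) = 0" for p q
  proof -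
    have "(pd p V1 q + V1 q * (b q \<bullet> u0 - \<beta> * (b q \<bullet> p) - p \<bullet> v0 - \<alpha> * (v0 \<bullet> v0) / \<beta>)) * (V2 p * V3 0) = 0"
      using FP[where q = q and p = p and z = 0]
      by (simp add: pdV2 pdV3 S s0 L_eq inner_add_left inner_commute algebra_simps)
    then show ?thesis using V2_pos[of p] V3_pos[of 0] by simp
  qed
  have FP1: "V1 q * (b q \<bullet> u0 - \<alpha> * (v0 \<bullet> v0) / \<beta>) = 0" for q
    using FP0[where p = 0 and q = q] by (simp add: pd_vec_zero[OF CV(1)])
  have pdV1: "pd p V1 q = ((\<beta> *R b q + v0) \<bullet> p) * V1 q" for p q
    using FP0[where p = p and q = q] FP1[of q] by (simp add: inner_add_left inner_commute algebra_simps)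
  have V1_pos: "V1 q > 0" for q
  proof (rule positive_of_log_gradient[where F = "%x. \<beta> *R b x + v0"])
    show "(V1 has_derivative (%v. ((\<beta> *R b x + v0) \<bullet> v) * V1 x)) (at x)" for x
      by (rule has_derivative_of_pd[OF CV(1) pdV1])
    show "continuous_on UNIV (%x. \<beta> *R b x + v0)" by (intro continuous_intros b_continuous)
    show "V1 q0 > 0" by (simp add: at0)
  qed
  \<comment> \<open>The equation at \<open>p = 0\<close> fixes \<open>b q \<bullet> v0\<close> in
    such a way that the logarithmic derivative of \<open>V1\<close> along \<open>v0\<close> is zero.
    A nonzero \<open>v0\<close> would then leave the density invariant under a translation in
    \<open>q\<close>.\<close>
  have "v0 = 0"
  proof (rule ccontr)
    assume v0: "v0 ~= 0"
    have "\<beta> * (b q \<bullet> v0) + v0 \<bullet> v0 = 0" for q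
    proof -
      have "b q \<bullet> u0 - \<alpha> * (v0 \<bullet> v0) / \<beta> = 0" using FP1[of q] V1_pos[of q] by simp
      then have "\<alpha> * (\<beta> * (b q \<bullet> v0) + v0 \<bullet> v0) = 0" using \<beta> by (simp add: u0 field_simps)
      then show ?thesis using \<alpha> by simp
    qed
    then have "pd v0 V1 q = 0 * V1 q" for q by (simp add: pdV1 inner_add_left)
    then have "V1 (q + v0) = exp 0 * V1 q" for q by (rule translate_of_log_gradient[OF CV(1)])
    then have tr: "r (x + (v0, 0, 0)) = 1 * r x" for x by (cases x) (simp add: rV)
    have "(v0, 0, 0) ~= 0" using v0 by (simp add: zero_prod_def)
    then show False by (rule no_translation_factor[OF r_int r(4) _ tr])
  qed
  note v0 = this u0[unfolded this]
  show ?thesis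
  proof (rule potential_of_version[OF r(1) r(4) C(1)])
    fix i and x :: "'a state"
    obtain q p z where x: "x = (q, p, z)" by (cases x)
    show "pd (eq i) r x = \<beta> * b (qq x) $ i * r x" by (simp add: x pdr pdV1 v0 rV inner_axis)
    show "pd (ep i) r x = - \<beta> * pp x $ i * r x" by (simp add: x pdr pdV2 v0 rV inner_axis L_eq)
    show "pd (ez i) r x = - \<beta> * zz x $ i * r x" by (simp add: x pdr pdV3 v0 rV inner_axis L_eq)
  qed
qed

end

section \<open>Reversibility under the Gibbs measure\<close>

subsection \<open>A time-reversible discretization\<close>

definition kick :: "(real^'d => real^'d) => real => 'd::finite state => real^'d" where
  "kick b h x = pp x + (h / 2) *R (b (qq x) + zz x)"

text \<open>Half a kick, a drift in \<open>q\<close>, and half a kick with the new values. In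
  between, \<open>z\<close> follows the midpoint rule with the momentum frozen at \<open>p1\<close>;
  that implicit equation is linear and appears solved for \<open>z'\<close>. The argument
  \<open>y\<close> plays the role of a Brownian increment over time \<open>h\<close>.\<close>

definition step :: "(real^'d => real^'d) => real => real => real => 'd::finite state => real^'d => 'd state" where
  "step b \<alpha> \<sigma> h x y = (let p1 = kick b h x; q' = qq x + h *R p1;
      z' = (1 / (1 + \<alpha> * h / 2)) *R ((1 - \<alpha> * h / 2) *R zz x - h *R p1 + \<sigma> *R y)
    in (q', p1 + (h / 2) *R (b q' + z'), z'))"

text \<open>The density of a Brownian increment over time \<open>h\<close>, so \<open>h\<close> is
  the variance of each coordinate.\<close>

definition heat :: "real => real^'d => real" where
  "heat h y = (\<Prod>i\<in>UNIV. normal_density 0 (sqrt h) (y $ i))"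

lemma heat_eq:
  fixes y :: "real^'d" assumes "h > 0"
  shows "heat h y = (1 / sqrt (2 * pi * h)) ^ CARD('d) * exp (- (y \<bullet> y) / (2 * h))"
proof -
  have "heat h y = (\<Prod>i\<in>(UNIV::'d set). 1 / sqrt (2 * pi * h) * exp (- (y $ i)\<^sup>2 / (2 * h)))"
    using assms by (simp add: heat_def normal_density_def)
  also have "... = (1 / sqrt (2 * pi * h)) ^ CARD('d) * exp (\<Sum>i\<in>UNIV. - (y $ i)\<^sup>2 / (2 * h))"
    by (simp only: prod.distrib exp_sum[OF finite] prod_constant)
  also have "(\<Sum>i\<in>UNIV. - (y $ i)\<^sup>2 / (2 * h)) = - (y \<bullet> y) / (2 * h)"
    by (simp add: inner_vec_def power2_eq_square sum_divide_distrib sum_negf)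
  finally show ?thesis .
qed

lemma heat_measurable [measurable]: "heat h \<in> borel_measurable borel" unfolding heat_def[abs_def] by measurable

lemma heat_nonneg: "0 <= heat h y" by (auto simp: heat_def intro!: prod_nonneg)

lemma nn_integral_lborel_translate:
  fixes f :: "'a::euclidean_space => ennreal" assumes [measurable]: "f \<in> borel_measurable borel"
  shows "(NN x. f (x + c)) = (NN x. f x)"
proof -
  have "(NN x. f x) = (\<integral>\<^sup>+x. f x \<partial>distr lborel borel ((+) c))" by (simp add: lborel_distr_plus)
  also have "... = (NN x. f (c + x))" by (rule nn_integral_distr) auto
  finally show ?thesis by (simp add: add.commute)
qed

lemma nn_integral_lborel_affine:
  fixes f :: "'a::euclidean_space => ennreal" assumes [measurable]: "f \<in> borel_measurable borel" and "c ~= 0"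
  shows "(NN x. f x) = ennreal (\<bar>c\<bar> ^ DIM('a)) * (NN x. f (t + c *R x))"
proof -
  have "(NN x. f x) = (\<integral>\<^sup>+x. f x \<partial>density (distr lborel borel (%x. t + c *R x)) (%_. ennreal (\<bar>c\<bar> ^ DIM('a))))"
    using lborel_affine[OF \<open>c ~= 0\<close>, of t] by (simp add: ennreal_power)
  also have "... = (NN x. ennreal (\<bar>c\<bar> ^ DIM('a)) * f (t + c *R x))"
    by (subst nn_integral_density; (subst nn_integral_distr)?; simp)
  finally show ?thesis by (simp add: nn_integral_cmult)
qed

lemma borel_measurable_lborel_pair:
  fixes f :: "'a::euclidean_space \<times> 'b::euclidean_space => 'c::topological_space"
  assumes "f \<in> borel_measurable borel" shows "f \<in> borel_measurable (lborel \<Otimes>\<^sub>M lborel)"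
  using assms by (subst lborel_prod) simp

lemma nn_integral_state:
  fixes f :: "'d::finite state => ennreal" assumes [measurable]: "f \<in> borel_measurable borel"
  shows "(NN x. f x) = (NN q. NN p. NN z. f (q, p, z))"
proof -
  have "(NN x. f x) = (\<integral>\<^sup>+x. f x \<partial>(lborel \<Otimes>\<^sub>M lborel))" by (simp add: lborel_prod)
  also have "... = (NN q. NN y. f (q, y))"
    by (rule lborel.nn_integral_fst[symmetric]) (rule borel_measurable_lborel_pair[OF assms])
  also have "... = (NN q. \<integral>\<^sup>+y. f (q, y) \<partial>(lborel \<Otimes>\<^sub>M lborel))" by (simp add: lborel_prod)
  also have "... = (NN q. NN p. NN z. f (q, p, z))"
    by (intro nn_integral_cong lborel.nn_integral_fst[symmetric] borel_measurable_lborel_pair) measurable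
  finally show ?thesis .
qed

lemma swap_lborel:
  fixes f :: "'a::euclidean_space => 'b::euclidean_space => ennreal"
  assumes "(%x. f (fst x) (snd x)) \<in> borel_measurable borel"
  shows "(NN x. NN y. f x y) = (NN y. NN x. f x y)"
  using borel_measurable_lborel_pair[OF assms] by (intro lborel_pair.Fubini'[symmetric]) (simp add: split_beta)

locale reversible_scheme =
  fixes \<alpha> \<beta> \<sigma> h :: real and b :: "real^'d => real^'d"
  assumes \<alpha>: "\<alpha> > 0" and \<beta>: "\<beta> > 0" and \<sigma>: "\<sigma> = sqrt (2 * inverse \<beta> * \<alpha>)" and h: "h > 0"
    and b: "continuous_on UNIV b"
begin

lemma b_measurable [measurable]: "b \<in> borel_measurable borel" using b by (rule borel_measurable_continuous_onI)

lemma \<sigma>_pos: "\<sigma> > 0" using \<alpha> \<beta> by (simp add: \<sigma>)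

lemma \<sigma>_sq: "\<sigma> * \<sigma> = 2 * \<alpha> / \<beta>" using \<alpha> \<beta> by (simp add: \<sigma> divide_inverse)

definition c where "c = \<alpha> * h / 2"

lemma c_pos: "c > 0" using \<alpha> h by (simp add: c_def)

definition trans :: "real^'d => real^'d => real^'d => ennreal" where
  "trans p z z' = ennreal (heat h ((1 / \<sigma>) *R ((1 + c) *R z' - (1 - c) *R z + h *R p)))"

text \<open>\<open>left\<close> and \<open>right\<close> are the states before and after a step,
  parametrized by the old position, the momentum between the two kicks and the respective value of
  \<open>z\<close>. In these coordinates momentum reversal turns an end state into a start
  state.\<close>

definition left :: "real^'d => real^'d => real^'d => 'd state" where
  "left q p z = (q, p - (h / 2) *R (b q + z), z)"

definition right :: "real^'d => real^'d => real^'d => 'd state" where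
  "right q p z = (q + h *R p, p + (h / 2) *R (b (q + h *R p) + z), z)"

text \<open>The quotient of the backward by the forward transition density, see
  \<open>trans_reverse\<close>. Its exponent is \<open>\<beta>\<close> times a midpoint form of the
  energy gained through \<open>z\<close>.\<close>

definition tilt :: "'d state => 'd state => real" where
  "tilt x x' = exp (\<beta> * ((1 / 2) *R (zz x + zz x') \<bullet> (zz x' - zz x + h *R kick b h x)))"

lemma trans_measurable [measurable]:
  assumes [measurable]: "f \<in> borel_measurable M" "g \<in> borel_measurable M" "k \<in> borel_measurable M"
  shows "(%x. trans (f x) (g x) (k x)) \<in> borel_measurable M" unfolding trans_def by measurable

lemma left_measurable [measurable]:
  assumes [measurable]: "f \<in> borel_measurable M" "g \<in> borel_measurable M" "k \<in> borel_measurable M"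
  shows "(%x. left (f x) (g x) (k x)) \<in> borel_measurable M" unfolding left_def by measurable

lemma right_measurable [measurable]:
  assumes [measurable]: "f \<in> borel_measurable M" "g \<in> borel_measurable M" "k \<in> borel_measurable M"
  shows "(%x. right (f x) (g x) (k x)) \<in> borel_measurable M" unfolding right_def by measurable

lemma fst_borel [measurable]: "f \<in> borel_measurable M ==> (%x. fst (f x)) \<in> borel_measurable M"
  for f :: "'x => 'a::second_countable_topology \<times> 'b::second_countable_topology"
  by (simp add: borel_prod[symmetric])

lemma snd_borel [measurable]: "f \<in> borel_measurable M ==> (%x. snd (f x)) \<in> borel_measurable M"
  for f :: "'x => 'a::second_countable_topology \<times> 'b::second_countable_topology"
  by (simp add: borel_prod[symmetric])

lemma kick_measurable [measurable]: "kick b h \<in> borel_measurable borel" unfolding kick_def[abs_def] by measurable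

lemma step_measurable [measurable]: assumes [measurable]: "f \<in> borel_measurable M" "g \<in> borel_measurable M"
  shows "(%x. step b \<alpha> \<sigma> h (f x) (g x)) \<in> borel_measurable M" unfolding step_def Let_def by measurable

lemma tilt_measurable [measurable]: assumes [measurable]: "f \<in> borel_measurable M" "g \<in> borel_measurable M"
  shows "(%x. tilt (f x) (g x)) \<in> borel_measurable M" unfolding tilt_def by measurable

text \<open>Normal form of the law of one step: the kick is undone by a translation in \<open>p\<close> and the noise is
  replaced by the new value of \<open>z\<close>.\<close>
lemma step_law: assumes [measurable]: "(%x. G (fst x) (snd x)) \<in> borel_measurable borel"
  shows "(NN x. NN y. ennreal (heat h y) * G x (step b \<alpha> \<sigma> h x y))
    = ennreal (((1 + c) / \<sigma>) ^ CARD('d)) * (NN q. NN p. NN z. NN z'. trans p z z' * G (left q p z) (right q p z'))"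
proof -
  have Gm [measurable]: "(%x. G (f x) (g x)) \<in> borel_measurable M"
    if [measurable]: "f \<in> borel_measurable M" "g \<in> borel_measurable M" for f g and M :: "'x measure"
    using measurable_compose[OF borel_measurable_Pair[OF that] assms] by simp
  have "(NN x. NN y. ennreal (heat h y) * G x (step b \<alpha> \<sigma> h x y))
    = (NN q. NN p. NN z. NN y. ennreal (heat h y) * G (q, p, z) (step b \<alpha> \<sigma> h (q, p, z) y))"
    by (rule nn_integral_state) measurable
  also have "... = (NN q. NN z. NN p. NN y. ennreal (heat h y) * G (q, p, z) (step b \<alpha> \<sigma> h (q, p, z) y))"
    by (intro nn_integral_cong swap_lborel) measurable
  also have "... = (NN q. NN z. NN p. NN y. ennreal (heat h y) * G (left q p z) (step b \<alpha> \<sigma> h (left q p z) y))"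
  proof (rule nn_integral_cong, rule nn_integral_cong)
    fix q z :: "real^'d"
    have "(%p. NN y. ennreal (heat h y) * G (q, p, z) (step b \<alpha> \<sigma> h (q, p, z) y)) \<in> borel_measurable borel"
      by measurable
    from nn_integral_lborel_translate[OF this, of "- ((h / 2) *R (b q + z))"]
    show "(NN p. NN y. ennreal (heat h y) * G (q, p, z) (step b \<alpha> \<sigma> h (q, p, z) y))
      = (NN p. NN y. ennreal (heat h y) * G (left q p z) (step b \<alpha> \<sigma> h (left q p z) y))"
      by (simp add: left_def)
  qed
  also have "... = (NN q. NN z. NN p. ennreal (((1 + c) / \<sigma>) ^ CARD('d)) *
      (NN z'. trans p z z' * G (left q p z) (right q p z')))"
  proof (rule nn_integral_cong, rule nn_integral_cong, rule nn_integral_cong)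
    fix q z p :: "real^'d"
    let ?t = "(1 / \<sigma>) *R (h *R p - (1 - c) *R z)" and ?s = "(1 + c) / \<sigma>"
    have s: "?s ~= 0" "\<bar>?s\<bar> = ?s" using c_pos \<sigma>_pos by auto
    have k: "kick b h (left q p z) = p" by (simp add: kick_def left_def)
    have r: "step b \<alpha> \<sigma> h (left q p z) (?t + ?s *R z') = right q p z'" for z'
    proof -
      have "\<sigma> *R (?t + ?s *R z') = (h *R p - (1 - c) *R z) + (1 + c) *R z'"
        using \<sigma>_pos by (simp add: scaleR_add_right)
      then have "(1 - c) *R z - h *R p + \<sigma> *R (?t + ?s *R z') = (1 + c) *R z'" by simp
      then have "(1 / (1 + c)) *R ((1 - c) *R z - h *R p + \<sigma> *R (?t + ?s *R z')) = z'" using c_pos by simp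
      then show ?thesis unfolding step_def k Let_def c_def[symmetric] by (simp add: left_def right_def)
    qed
    have t: "ennreal (heat h (?t + ?s *R z')) = trans p z z'" for z'
      by (simp add: trans_def algebra_simps add_divide_distrib diff_divide_distrib)
    have m: "(%y. ennreal (heat h y) * G (left q p z) (step b \<alpha> \<sigma> h (left q p z) y)) \<in> borel_measurable borel"
      by measurable
    show "(NN y. ennreal (heat h y) * G (left q p z) (step b \<alpha> \<sigma> h (left q p z) y))
      = ennreal (?s ^ CARD('d)) * (NN z'. trans p z z' * G (left q p z) (right q p z'))"
      using nn_integral_lborel_affine[OF m s(1), of ?t] unfolding r t s(2) by simp
  qed
  also have "... = ennreal (((1 + c) / \<sigma>) ^ CARD('d)) * (NN q. NN z. NN p. NN z'. trans p z z' * G (left q p z) (right q p z'))" by (simp add: nn_integral_cmult)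
  also have "(NN q. NN z. NN p. NN z'. trans p z z' * G (left q p z) (right q p z'))
      = (NN q. NN p. NN z. NN z'. trans p z z' * G (left q p z) (right q p z'))"
    by (intro nn_integral_cong swap_lborel) measurable
  finally show ?thesis .
qed

text \<open>With \<open>S = z' + z\<close> and \<open>D = z' - z + h p\<close> the two Gaussian
  exponents contain the squares of \<open>c S - D\<close> and \<open>c S + D\<close>, which differ
  by \<open>4 c (S \<bullet> D)\<close>. The relation
  \<open>\<sigma>^2 = 2 \<alpha> / \<beta>\<close> makes the resulting coefficient
  \<open>\<beta> / 2\<close>.\<close>

lemma trans_reverse:
  "trans (- p) z' z * ennreal (exp (\<beta> * ((1 / 2) *R (z' + z) \<bullet> (z - z' + h *R - p)))) = trans p z z'"
proof -
  let ?A = "%y. y \<bullet> y"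
  have e: "- ?A ((1 / \<sigma>) *R ((1 + c) *R z - (1 - c) *R z' + h *R - p)) / (2 * h)
      + \<beta> * ((1 / 2) *R (z' + z) \<bullet> (z - z' + h *R - p))
    = - ?A ((1 / \<sigma>) *R ((1 + c) *R z' - (1 - c) *R z + h *R p)) / (2 * h)"
  proof -
    define D where "D = z' - z + h *R p"
    define S where "S = z' + z"
    have 1: "(1 + c) *R z - (1 - c) *R z' + h *R - p = c *R S - D"
      "(1 + c) *R z' - (1 - c) *R z + h *R p = c *R S + D"
      "z - z' + h *R - p = - D" by (simp_all add: D_def S_def algebra_simps)
    have "?A (c *R S + D) - ?A (c *R S - D) = 4 * c * (S \<bullet> D)"
      by (simp add: algebra_simps inner_add_left inner_add_right inner_diff_left inner_diff_right inner_commute)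
    moreover have "4 * c / (\<sigma> * \<sigma>) / (2 * h) = \<beta> / 2" using \<alpha> \<beta> h by (simp add: c_def \<sigma>_sq field_simps)
    ultimately have "(?A (c *R S + D) - ?A (c *R S - D)) / (\<sigma> * \<sigma>) / (2 * h) = \<beta> / 2 * (S \<bullet> D)"
      by (metis (no_types, lifting) times_divide_eq_left)
    then show ?thesis unfolding 1 S_def[symmetric] by (simp add: diff_divide_distrib)
  qed
  have mult: "ennreal (K * exp E) * ennreal (exp X) = ennreal (K * exp E')" if "E + X = E'" "K >= 0" for K E X E'
    using that by (auto simp: ennreal_mult[symmetric] exp_add mult.assoc)
  show ?thesis unfolding trans_def heat_eq[OF h] by (rule mult[OF e]) (use h in simp)
qed

text \<open>In the coordinates of \<open>step_law\<close> the reversal is the substitution that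
  moves \<open>q\<close> to the new position, negates \<open>p\<close> and exchanges
  \<open>z\<close> with \<open>z'\<close>. It preserves Lebesgue measure, and the transition density
  changes by the factor from \<open>trans_reverse\<close>.\<close>

lemma step_reverse: assumes [measurable]: "(%x. G (fst x) (snd x)) \<in> borel_measurable borel"
  shows "(NN x. NN y. ennreal (heat h y) * G x (step b \<alpha> \<sigma> h x y))
    = (NN x. NN y. ennreal (heat h y) * (G (flip_p (step b \<alpha> \<sigma> h x y)) (flip_p x)
        * ennreal (tilt x (step b \<alpha> \<sigma> h x y))))"
proof -
  have Gm [measurable]: "(%x. G (f x) (g x)) \<in> borel_measurable M"
    if [measurable]: "f \<in> borel_measurable M" "g \<in> borel_measurable M" for f g and M :: "'x measure"
    using measurable_compose[OF borel_measurable_Pair[OF that] assms] by simp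
  have flipm [measurable]: "(%x. flip_p (f x)) \<in> borel_measurable M" if "f \<in> borel_measurable M"
    for f :: "'x => 'd state" and M :: "'x measure" by (rule measurable_compose[OF that measurable_flip_p])
  let ?e = "%p z z'. ennreal (exp (\<beta> * ((1 / 2) *R (z + z') \<bullet> (z' - z + h *R p))))"
  let ?F = "%q p z z'. trans p z z' * (G (flip_p (right q p z')) (flip_p (left q p z)) * ?e p z z')"
  have "(NN q. NN p. NN z. NN z'. ?F q p z z')
    = (NN p. NN q. NN z. NN z'. ?F q p z z')" by (rule swap_lborel) measurable
  also have "... = (NN p. NN q. NN z. NN z'. ?F (q + - (h *R p)) p z z')"
    by (intro nn_integral_cong nn_integral_lborel_translate[symmetric]) measurable
  also have "... = (NN p. NN q. NN z. NN z'. ?F (q + - (h *R - p)) (- p) z z')"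
  proof -
    have m: "(%p. NN q. NN z. NN z'. ?F (q + - (h *R p)) p z z') \<in> borel_measurable borel"
      by measurable
    show ?thesis using nn_integral_lborel_affine[OF m, of "- 1" 0] by simp
  qed
  also have "... = (NN q. NN p. NN z. NN z'. ?F (q + - (h *R - p)) (- p) z z')"
    by (rule swap_lborel) measurable
  also have "... = (NN q. NN p. NN z'. NN z. ?F (q + - (h *R - p)) (- p) z z')"
    by (intro nn_integral_cong swap_lborel) measurable
  also have "... = (NN q. NN p. NN z. NN z'. trans p z z' * G (left q p z) (right q p z'))"
  proof (intro nn_integral_cong)
    fix q p z z' :: "real^'d"
    have l: "flip_p (right (q + - (h *R - p)) (- p) z) = left q p z"
      "flip_p (left (q + - (h *R - p)) (- p) z') = right q p z'" by (simp_all add: left_def right_def flip_p_eq)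
    show "?F (q + - (h *R - p)) (- p) z' z = trans p z z' * G (left q p z) (right q p z')"
      unfolding l trans_reverse[of p z' z, symmetric] by (simp only: mult_ac)
  qed
  finally have rev: "(NN q. NN p. NN z. NN z'. ?F q p z z') = ..." .
  have "tilt (left q p z) (right q p z') = exp (\<beta> * ((1 / 2) *R (z + z') \<bullet> (z' - z + h *R p)))" for q p z z'
    by (simp add: tilt_def left_def right_def kick_def)
  then have t: "?F q p z z' = trans p z z' * (G (flip_p (right q p z')) (flip_p (left q p z)) * ennreal (tilt (left q p z) (right q p z')))" for q p z z'
    by simp
  show ?thesis unfolding step_law[OF assms] rev[symmetric] t
    by (rule step_law[symmetric, where G = "%x x'. G (flip_p x') (flip_p x) * ennreal (tilt x x')"]) measurable
qed

end

section \<open>The energy error of one step\<close>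

lemma norm_state:
  fixes x :: "'a::real_normed_vector \<times> 'b::real_normed_vector \<times> 'c::real_normed_vector"
  shows "norm (fst x) <= norm x" "norm (fst (snd x)) <= norm x" "norm (snd (snd x)) <= norm x"
  using norm_fst_le[of "fst x" "snd x"] norm_snd_le[of "snd x" "fst x"]
    norm_fst_le[of "fst (snd x)" "snd (snd x)"] norm_snd_le[of "snd (snd x)" "fst (snd x)"] by auto

lemma norm_flip_p: "norm (flip_p x) = norm x" by (cases x) (simp add: flip_p_eq norm_Pair)

locale potential_scheme = reversible_scheme \<alpha> \<beta> \<sigma> h b
  for \<alpha> \<beta> \<sigma> h :: real and b :: "real^'d => real^'d" +
  fixes U :: "real^'d => real" assumes U: "!!q. GDERIV U q :> - b q" and h1: "h <= 1"
begin

text \<open>The kinetic increment contains the work of the averaged force along the drift, and the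
  potential increment cancels it up to the difference between the average of \<open>b\<close> at the
  end points and an intermediate value. What survives at first order is the exponent of
  \<open>tilt\<close> divided by \<open>\<beta>\<close>. The bound uses only that both end states
  lie in the ball, so it is uniform in the noise \<open>y\<close>.\<close>

lemma energy_error: assumes L: "L >= 0" "!!q q'. norm q <= R ==> norm q' <= R ==> norm (b q - b q') <= L * norm (q - q')"
    and K: "!!q. norm q <= R ==> norm (b q) <= K" and x: "norm x <= R" and x': "norm (step b \<alpha> \<sigma> h x y) <= R"
  defines "x' \<equiv> step b \<alpha> \<sigma> h x y" shows "\<bar>hamiltonian U x' - hamiltonian U x
      - (1 / 2) *R (zz x + zz x') \<bullet> (zz x' - zz x + h *R kick b h x)\<bar>
    <= h\<^sup>2 * ((K + R)\<^sup>2 / 2 + L * (K + 2 * R)\<^sup>2)"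
proof -
  define p1 where "p1 = kick b h x"
  have xR: "norm (qq x) <= R" "norm (pp x) <= R" "norm (zz x) <= R" using norm_state[of x] x by linarith+
  have x'R: "norm (qq x') <= R" "norm (pp x') <= R" "norm (zz x') <= R"
    using norm_state[of x'] x' unfolding x'_def by linarith+
  have R: "R >= 0" using x norm_ge_zero[of x] by linarith
  have K0: "K >= 0" using order_trans[OF norm_ge_zero K[of 0]] R by simp
  have q': "qq x' = qq x + h *R p1" and p': "pp x' = p1 + (h / 2) *R (b (qq x') + zz x')"
    by (simp_all add: x'_def step_def Let_def p1_def)
  have p: "pp x = p1 - (h / 2) *R (b (qq x) + zz x)" by (simp add: p1_def kick_def)
  have p1: "norm p1 <= K + 2 * R"
  proof -
    have "norm p1 <= norm (pp x) + norm ((h / 2) *R (b (qq x) + zz x))"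
      unfolding p1_def kick_def by (rule norm_triangle_ineq)
    also have "norm ((h / 2) *R (b (qq x) + zz x)) <= 1 * norm (b (qq x) + zz x)"
      unfolding norm_scaleR using h h1 by (intro mult_right_mono) auto
    also have "norm (b (qq x) + zz x) <= K + R"
      using norm_triangle_ineq[of "b (qq x)" "zz x"] K[OF xR(1)] xR(3) by linarith
    finally show ?thesis using xR(2) by simp
  qed
  define bm where "bm = (1 / 2) *R (b (qq x) + b (qq x'))"
  define zm where "zm = (1 / 2) *R (zz x + zz x')"
  define d where "d = b (qq x') - b (qq x) + (zz x' - zz x)"
  \<comment> \<open>The two half kicks nearly cancel in the average of the end momenta, so it
    differs from \<open>p1\<close> only by a multiple of \<open>h\<close>.\<close>
  have pdiff: "pp x' - pp x = h *R (bm + zm)" "(1 / 2) *R (pp x' + pp x) = p1 + (h / 4) *R d"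
    unfolding p p' bm_def zm_def d_def by (auto simp: vec_eq_iff field_simps)
  have "(pp x' \<bullet> pp x' - pp x \<bullet> pp x) / 2 = (pp x' - pp x) \<bullet> ((1 / 2) *R (pp x' + pp x))"
    by (simp add: inner_diff_left inner_diff_right inner_add_left inner_add_right inner_commute field_simps)
  also have "... = h * (bm \<bullet> p1) + h * (zm \<bullet> p1) + h * (h / 4) * ((bm + zm) \<bullet> d)"
    unfolding pdiff by (simp add: inner_add_left inner_add_right algebra_simps)
  finally have P: "(pp x' \<bullet> pp x' - pp x \<bullet> pp x) / 2 = ..." .
  have Z: "(zz x' \<bullet> zz x' - zz x \<bullet> zz x) / 2 = zm \<bullet> (zz x' - zz x)" unfolding zm_def inner_scaleR_left
    by (simp add: inner_diff_left inner_diff_right inner_add_left inner_add_right inner_commute field_simps)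
  obtain t where t: "0 < t" "t < 1" "U (qq x') - U (qq x) = - (b (qq x + t *R (h *R p1)) \<bullet> (h *R p1))"
  proof -
    have "((%t. U (qq x + t *R (h *R p1))) has_real_derivative
        - (b (qq x + t *R (h *R p1)) \<bullet> (h *R p1))) (at t)" for t
    proof -
      have "((%t. U (qq x + t *R (h *R p1))) has_derivative
          (%s. (s *R (h *R p1)) \<bullet> - b (qq x + t *R (h *R p1)))) (at t)"
        by (rule has_derivative_compose[OF _ U[unfolded gderiv_def]]) (auto intro!: derivative_eq_intros)
      then show ?thesis
        unfolding has_field_derivative_def by (rule has_derivative_eq_rhs) (auto simp: inner_commute)
    qed
    from MVT2[OF zero_less_one this] show ?thesis using that by (auto simp: q')
  qed
  define qt where "qt = qq x + t *R (h *R p1)"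
  have qt: "norm qt <= R"
  proof -
    have "qt = (1 - t) *R qq x + t *R qq x'" by (simp add: qt_def q' algebra_simps)
    then have "norm qt <= (1 - t) * norm (qq x) + t * norm (qq x')"
      using norm_triangle_ineq[of "(1 - t) *R qq x" "t *R qq x'"] t by simp
    also have "... <= (1 - t) * R + t * R" using t xR x'R by (intro add_mono mult_left_mono) auto
    finally show ?thesis by (simp add: algebra_simps)
  qed
  have bq: "norm (bm - b qt) <= L * (h * norm p1)"
  proof -
    have 1: "norm (b (qq x) - b qt) <= L * (h * norm p1)"
    proof -
      have "norm (qq x - qt) = t * (h * norm p1)" using t h by (simp add: qt_def)
      also have "... <= h * norm p1" using t h by (intro mult_left_le_one_le) auto
      finally show ?thesis using L(2)[OF xR(1) qt] mult_left_mono[OF _ L(1)] by fastforce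
    qed
    have 2: "norm (b (qq x') - b qt) <= L * (h * norm p1)"
    proof -
      have "qq x' - qt = (1 - t) *R (h *R p1)" by (simp add: qt_def q' algebra_simps)
      then have "norm (qq x' - qt) = (1 - t) * (h * norm p1)" using t h by simp
      also have "... <= h * norm p1" using t h by (intro mult_left_le_one_le) auto
      finally show ?thesis using L(2)[OF x'R(1) qt] mult_left_mono[OF _ L(1)] by fastforce
    qed
    have "bm - b qt = (1 / 2) *R ((b (qq x) - b qt) + (b (qq x') - b qt))"
      by (simp add: bm_def vec_eq_iff field_simps)
    then have "norm (bm - b qt) = 1 / 2 * norm ((b (qq x) - b qt) + (b (qq x') - b qt))" by simp
    then show ?thesis using 1 2 norm_triangle_ineq[of "b (qq x) - b qt" "b (qq x') - b qt"] by linarith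
  qed
  \<comment> \<open>Both remaining terms carry a factor \<open>h^2\<close>: the first because
    \<open>bm - b qt\<close> is of order \<open>h\<close>, the second explicitly.\<close>
  have e: "hamiltonian U x' - hamiltonian U x - zm \<bullet> (zz x' - zz x + h *R p1)
    = h * ((bm - b qt) \<bullet> p1) + h * (h / 4) * ((bm + zm) \<bullet> d)"
  proof -
    have "hamiltonian U x' - hamiltonian U x = (U (qq x') - U (qq x))
        + (pp x' \<bullet> pp x' - pp x \<bullet> pp x) / 2 + (zz x' \<bullet> zz x' - zz x \<bullet> zz x) / 2"
      by (simp add: hamiltonian_eq diff_divide_distrib)
    then show ?thesis
      unfolding P Z t(3) qt_def[symmetric] by (simp add: inner_add_right inner_diff_left right_diff_distrib)
  qed
  have e1: "\<bar>h * ((bm - b qt) \<bullet> p1)\<bar> <= h\<^sup>2 * (L * (K + 2 * R)\<^sup>2)"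
  proof -
    have "\<bar>(bm - b qt) \<bullet> p1\<bar> <= L * (h * norm p1) * norm p1"
      using Cauchy_Schwarz_ineq2[of "bm - b qt" p1] mult_right_mono[OF bq norm_ge_zero[of p1]] by linarith
    also have "... = h * (L * (norm p1)\<^sup>2)" by (simp add: power2_eq_square)
    also have "... <= h * (L * (K + 2 * R)\<^sup>2)" using h L(1) p1 by (intro mult_left_mono power_mono) auto
    finally have "h * \<bar>(bm - b qt) \<bullet> p1\<bar> <= h * (h * (L * (K + 2 * R)\<^sup>2))" using h by (intro mult_left_mono) auto
    then show ?thesis using h by (simp add: abs_mult power2_eq_square)
  qed
  have e2: "\<bar>h * (h / 4) * ((bm + zm) \<bullet> d)\<bar> <= h\<^sup>2 * ((K + R)\<^sup>2 / 2)"
  proof -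
    have "norm (bm + zm) <= K + R"
    proof -
      have "norm bm <= K" unfolding bm_def using norm_triangle_ineq[of "b (qq x)" "b (qq x')"] K[OF xR(1)] K[OF x'R(1)] by simp
      moreover have "norm zm <= R" unfolding zm_def using norm_triangle_ineq[of "zz x" "zz x'"] xR x'R by simp
      ultimately show ?thesis using norm_triangle_ineq[of bm zm] by linarith
    qed
    moreover have "norm d <= 2 * (K + R)"
    proof -
      have "norm d <= norm (b (qq x') - b (qq x)) + norm (zz x' - zz x)"
        unfolding d_def by (rule norm_triangle_ineq)
      also have "... <= (K + K) + (R + R)" by (intro add_mono order_trans[OF norm_triangle_ineq4] K xR x'R)
      finally show ?thesis by simp
    qed
    ultimately have "norm (bm + zm) * norm d <= (K + R) * (2 * (K + R))" using K0 R by (intro mult_mono) auto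
    moreover have "(K + R) * (2 * (K + R)) = 2 * (K + R)\<^sup>2" by (simp add: power2_eq_square algebra_simps)
    ultimately have "\<bar>(bm + zm) \<bullet> d\<bar> <= 2 * (K + R)\<^sup>2" using Cauchy_Schwarz_ineq2[of "bm + zm" d] by simp
    then have "h * (h / 4) * \<bar>(bm + zm) \<bullet> d\<bar> <= h * (h / 4) * (2 * (K + R)\<^sup>2)" using h by (intro mult_left_mono) auto
    then show ?thesis using h by (simp add: abs_mult power2_eq_square)
  qed
  have "\<bar>hamiltonian U x' - hamiltonian U x - zm \<bullet> (zz x' - zz x + h *R p1)\<bar>
      <= h\<^sup>2 * (L * (K + 2 * R)\<^sup>2) + h\<^sup>2 * ((K + R)\<^sup>2 / 2)"
    unfolding e by (rule order_trans[OF abs_triangle_ineq add_mono[OF e1 e2]])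
  then show ?thesis unfolding zm_def p1_def by (simp only: distrib_left add.commute)
qed

section \<open>The transition operator and the reversal of a whole chain\<close>

definition T :: "('d state => ennreal) => 'd state => ennreal" where
  "T f x = (NN y. ennreal (heat h y) * f (step b \<alpha> \<sigma> h x y))"

definition boltz :: "'d state => ennreal" where
  "boltz x = ennreal (exp (- \<beta> * hamiltonian U x))"

lemma boltz_measurable [measurable]: "boltz \<in> borel_measurable borel"
proof -
  have "continuous_on UNIV (hamiltonian U)"
    by (intro continuous_at_imp_continuous_on ballI has_derivative_continuous[OF hamiltonian_has_derivative[OF U]])
  then have [measurable]: "hamiltonian U \<in> borel_measurable borel" by (rule borel_measurable_continuous_onI)
  show ?thesis unfolding boltz_def[abs_def] by measurable
qed

lemma boltz_flip_p: "boltz (flip_p x) = boltz x" by (simp add: boltz_def hamiltonian_flip_p)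

lemma T_measurable [measurable]:
  assumes [measurable]: "f \<in> borel_measurable borel" shows "T f \<in> borel_measurable borel"
  unfolding T_def[abs_def] by measurable

lemma measurable_flip [measurable]:
  assumes "f \<in> borel_measurable M" shows "(%x. flip_p (f x :: 'd state)) \<in> borel_measurable M"
  by (rule measurable_compose[OF assms measurable_flip_p])

definition chain_error :: "real => real => bool" where
  "chain_error R \<epsilon> \<longleftrightarrow> (\<forall>x y. norm x <= R & norm (step b \<alpha> \<sigma> h x y) <= R -->
     \<bar>hamiltonian U (step b \<alpha> \<sigma> h x y) - hamiltonian U x
      - (1 / 2) *R (zz x + zz (step b \<alpha> \<sigma> h x y)) \<bullet> (zz (step b \<alpha> \<sigma> h x y) - zz x + h *R kick b h x)\<bar> <= \<epsilon>)"

text \<open>Reversing one step leaves the Boltzmann weight at the new state times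
  \<open>tilt\<close>, which by the energy estimate is at most
  \<open>exp (\<beta> * \<epsilon>)\<close> times the weight at the old state. The supports of
  \<open>a\<close> and \<open>f\<close> confine both states to the ball in which that estimate
  holds.\<close>

lemma T_reverse_le: assumes [measurable]: "a \<in> borel_measurable borel" "f \<in> borel_measurable borel"
    and a: "!!x. norm x > R ==> a x = 0" and f: "!!x. norm x > R ==> f x = 0" and err: "chain_error R \<epsilon>"
  shows "(NN x. boltz x * (a x * T f x))
    <= ennreal (exp (\<beta> * \<epsilon>)) * (NN x. boltz x * (f (flip_p x) * T (%x. a (flip_p x)) x))"
proof -
  have "(NN x. boltz x * (a x * T f x))
    = (NN x. NN y. ennreal (heat h y) * (boltz x * a x * f (step b \<alpha> \<sigma> h x y)))"
    unfolding T_def by (subst nn_integral_cmult[symmetric], simp, subst nn_integral_cmult[symmetric], simp)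
      (simp add: mult_ac)
  also have "... = (NN x. NN y. ennreal (heat h y) * (boltz (flip_p (step b \<alpha> \<sigma> h x y)) * a (flip_p (step b \<alpha> \<sigma> h x y)) * f (flip_p x)
      * ennreal (tilt x (step b \<alpha> \<sigma> h x y))))"
    by (rule step_reverse[where G = "%x x'. boltz x * a x * f x'"]) measurable
  also have "... <= (NN x. NN y. ennreal (exp (\<beta> * \<epsilon>)) * (boltz x * (f (flip_p x) * (ennreal (heat h y) * a (flip_p (step b \<alpha> \<sigma> h x y))))))"
  proof (intro nn_integral_mono)
    fix x y
    let ?x' = "step b \<alpha> \<sigma> h x y"
    show "ennreal (heat h y) * (boltz (flip_p ?x') * a (flip_p ?x') * f (flip_p x) * ennreal (tilt x ?x'))
      <= ennreal (exp (\<beta> * \<epsilon>)) * (boltz x * (f (flip_p x) * (ennreal (heat h y) * a (flip_p ?x'))))"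
    proof (cases "norm x <= R & norm ?x' <= R")
      case True
      then have "\<bar>hamiltonian U ?x' - hamiltonian U x
        - (1 / 2) *R (zz x + zz ?x') \<bullet> (zz ?x' - zz x + h *R kick b h x)\<bar> <= \<epsilon>"
        using err unfolding chain_error_def by blast
      then have "\<beta> * ((1 / 2) *R (zz x + zz ?x') \<bullet> (zz ?x' - zz x + h *R kick b h x) + hamiltonian U x - hamiltonian U ?x') <= \<beta> * \<epsilon>"
        using \<beta> by (intro mult_left_mono) linarith+
      then have le: "- \<beta> * hamiltonian U ?x' + \<beta> * ((1 / 2) *R (zz x + zz ?x') \<bullet> (zz ?x' - zz x + h *R kick b h x)) <= \<beta> * \<epsilon> + - \<beta> * hamiltonian U x"
        by (simp add: algebra_simps)
      have "boltz (flip_p ?x') * ennreal (tilt x ?x') <= ennreal (exp (\<beta> * \<epsilon>)) * boltz x"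
        unfolding boltz_flip_p unfolding boltz_def tilt_def
        by (subst (1 2) ennreal_mult[symmetric]) (auto simp only: exp_add[symmetric] exp_le_cancel_iff exp_ge_zero intro!: ennreal_leI le)
      then have "(boltz (flip_p ?x') * ennreal (tilt x ?x')) * (ennreal (heat h y) * a (flip_p ?x') * f (flip_p x))
        <= (ennreal (exp (\<beta> * \<epsilon>)) * boltz x) * (ennreal (heat h y) * a (flip_p ?x') * f (flip_p x))"
        by (rule mult_right_mono) simp
      then show ?thesis by (simp add: mult_ac)
    next
      case False
      then have "f (flip_p x) = 0 | a (flip_p ?x') = 0"
        using a[of "flip_p ?x'"] f[of "flip_p x"] by (auto simp: norm_flip_p)
      then show ?thesis by auto
    qed
  qed
  also have "... = ennreal (exp (\<beta> * \<epsilon>)) * (NN x. boltz x * (f (flip_p x) * T (%x. a (flip_p x)) x))"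
    unfolding T_def by (simp add: nn_integral_cmult)
  finally show ?thesis .
qed

text \<open>\<open>fwd fs x\<close> is the expectation of the product of the observables in
  \<open>fs\<close> along consecutive states of the chain started at \<open>x\<close>.\<close>

fun fwd :: "('d state => ennreal) list => 'd state => ennreal" where
  "fwd [] = (%_. 1)"
| "fwd [f] = f"
| "fwd (f # g # fs) = (%x. f x * T (fwd (g # fs)) x)"

text \<open>The traversal of the list in the opposite direction. The last argument is an accumulator
  holding the part of the chain that has already been reversed.\<close>

fun bwd :: "('d state => ennreal) list => ('d state => ennreal) => ('d state => ennreal) => 'd state => ennreal" where
  "bwd [] f g = (%x. f (flip_p x) * g x)"
| "bwd (f' # fs) f g = bwd fs f' (T (%x. f (flip_p x) * g x))"

lemma fwd_measurable: "\<forall>f\<in>set fs. f \<in> borel_measurable borel ==> fwd fs \<in> borel_measurable borel"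
proof (induction fs rule: fwd.induct)
  case (3 f g fs)
  then have [measurable]: "f \<in> borel_measurable borel" "fwd (g # fs) \<in> borel_measurable borel" by auto
  show ?case by simp
qed auto

lemma fwd_vanish: "f x = 0 ==> fwd (f # fs) x = 0" by (cases fs) auto

lemma bwd_eq_fwd: "gs ~= [] ==> bwd fs f (T (fwd gs)) = fwd (map (%f x. f (flip_p x)) (rev (f # fs)) @ gs)"
proof (induction fs arbitrary: f gs)
  case Nil
  then show ?case by (cases gs) auto
next
  case (Cons f' fs)
  have "(%x. f (flip_p x) * T (fwd gs) x) = fwd ((%x. f (flip_p x)) # gs)" using Cons.prems by (cases gs) auto
  then show ?case using Cons.IH[of "(%x. f (flip_p x)) # gs" f'] by simp
qed

lemma bwd_1_eq_fwd: "bwd fs f (%_. 1) = fwd (map (%f x. f (flip_p x)) (rev (f # fs)))"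
  using bwd_eq_fwd[of "[%x. f (flip_p x)]"] by (cases fs) auto

text \<open>Each inductive step reverses one transition by \<open>T_reverse_le\<close> and moves the
  leading observable into the accumulator \<open>g\<close>, at the cost of one factor
  \<open>exp (\<beta> * \<epsilon>)\<close>. The flip in \<open>g (flip_p x)\<close> is what makes
  the statement reproduce itself.\<close>

lemma chain_reverse_le: assumes err: "chain_error R \<epsilon>"
  shows "\<forall>f\<in>set (f # fs). f \<in> borel_measurable borel & (\<forall>x. norm x > R --> f x = 0) ==> g \<in> borel_measurable borel ==>
    (NN x. boltz x * (fwd (f # fs) x * g (flip_p x)))
    <= ennreal (exp (\<beta> * \<epsilon>)) ^ length fs * (NN x. boltz x * bwd fs f g x)"
proof (induction fs arbitrary: f g)
  case Nil
  then have [measurable]: "f \<in> borel_measurable borel" "g \<in> borel_measurable borel" by auto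
  show ?case using nn_integral_flip_p[of "%x. boltz x * (f x * g (flip_p x))"] by (simp add: boltz_flip_p)
next
  case (Cons f' fs)
  then have [measurable]: "f \<in> borel_measurable borel" "g \<in> borel_measurable borel" by auto
  have [measurable]: "fwd (f' # fs) \<in> borel_measurable borel" using Cons.prems by (intro fwd_measurable) auto
  have "(NN x. boltz x * (fwd (f # f' # fs) x * g (flip_p x)))
    = (NN x. boltz x * ((f x * g (flip_p x)) * T (fwd (f' # fs)) x))" by (simp add: mult_ac)
  also have "... <= ennreal (exp (\<beta> * \<epsilon>)) * (NN x. boltz x * (fwd (f' # fs) (flip_p x) * T (%x. f (flip_p x) * g (flip_p (flip_p x))) x))"
    by (rule T_reverse_le[OF _ _ _ _ err]) (use Cons.prems in \<open>auto intro: fwd_vanish\<close>)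
  also have "(NN x. boltz x * (fwd (f' # fs) (flip_p x) * T (%x. f (flip_p x) * g (flip_p (flip_p x))) x))
    = (NN x. boltz x * (fwd (f' # fs) x * T (%x. f (flip_p x) * g x) (flip_p x)))"
    using nn_integral_flip_p[of "%x. boltz x * (fwd (f' # fs) x * T (%x. f (flip_p x) * g x) (flip_p x))"]
    by (simp add: boltz_flip_p)
  finally have 1: "(NN x. boltz x * (fwd (f # f' # fs) x * g (flip_p x))) <= ennreal (exp (\<beta> * \<epsilon>)) * ..." .
  have 2: "(NN x. boltz x * (fwd (f' # fs) x * T (%x. f (flip_p x) * g x) (flip_p x)))
    <= ennreal (exp (\<beta> * \<epsilon>)) ^ length fs * (NN x. boltz x * bwd fs f' (T (%x. f (flip_p x) * g x)) x)"
    using Cons.prems by (intro Cons.IH) auto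
  show ?case using order_trans[OF 1 mult_left_mono[OF 2]] by (simp add: mult.assoc)
qed

lemma fwd_reverse_le:
  assumes "chain_error R \<epsilon>" and "\<forall>f\<in>set fs. f \<in> borel_measurable borel & (\<forall>x. norm x > R --> f x = 0)" and "fs ~= []"
  shows "(NN x. boltz x * fwd fs x)
    <= ennreal (exp (\<beta> * \<epsilon>)) ^ (length fs - 1) * (NN x. boltz x * fwd (map (%f x. f (flip_p x)) (rev fs)) x)"
proof (cases fs)
  case (Cons f fs')
  then show ?thesis using chain_reverse_le[OF assms(1), of f fs' "%_. 1"] assms(2) unfolding bwd_1_eq_fwd by simp
qed (use assms in simp)

end

subsection \<open>Pathwise convergence of the discretization\<close>

lemma locally_lipschitz:
  fixes b :: "'a::euclidean_space => 'b::real_normed_vector" assumes "Ck 1 b"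
  shows "\<exists>L\<ge>0. \<forall>x y. norm x <= R & norm y <= R --> norm (b x - b y) <= L * norm (x - y)"
proof -
  have "\<exists>C. \<forall>x. norm x <= R --> norm (pd e b x) <= C" for e
  proof -
    have "compact (pd e b ` cball 0 R)"
      by (intro compact_continuous_image compact_cball continuous_on_subset[OF Ck1_continuous_pd[OF assms]]) simp
    then obtain C where "\<forall>y\<in>pd e b ` cball 0 R. norm y <= C" using compact_imp_bounded bounded_iff by metis
    then show ?thesis by (intro exI[of _ C]) auto
  qed
  then obtain C where C: "!!e x. norm x <= R ==> norm (pd e b x) <= C e" by metis
  define L where "L = (\<Sum>e\<in>Basis. \<bar>C e\<bar>)"
  have on: "onorm (frechet_derivative b (at x)) <= L" if "norm x <= R" for x
  proof (rule onorm_le)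
    fix v
    have "norm (pd v b x) <= (\<Sum>e\<in>Basis. norm ((v \<bullet> e) *R pd e b x))"
      unfolding pd_basis[OF assms, where v = v and x = x] by (rule norm_sum)
    also have "... <= (\<Sum>e\<in>Basis. norm v * \<bar>C e\<bar>)"
    proof (rule sum_mono)
      fix e :: 'a assume "e \<in> Basis"
      then show "norm ((v \<bullet> e) *R pd e b x) <= norm v * \<bar>C e\<bar>"
        using C[OF that, of e] Basis_le_norm[of e v] by (auto intro!: mult_mono)
    qed
    finally show "norm (pd v b x) <= L * norm v" by (simp add: L_def sum_distrib_left mult.commute)
  qed
  have "norm (b x - b y) <= L * norm (x - y)" if "norm x <= R" "norm y <= R" for x y
    by (rule differentiable_bound[of "cball 0 R" b "%x. frechet_derivative b (at x)"])
      (use that on Ck1_has_derivative[OF assms] in \<open>auto intro: has_derivative_at_withinI\<close>)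
  moreover have "L >= 0" by (simp add: L_def sum_nonneg)
  ultimately show ?thesis by blast
qed

primrec traj :: "(real^'d => real^'d) => real => real => real => 'd::finite state => (nat => real^'d) => nat => 'd state" where
  "traj b \<alpha> \<sigma> h x w 0 = x"
| "traj b \<alpha> \<sigma> h x w (Suc k) = step b \<alpha> \<sigma> h (traj b \<alpha> \<sigma> h x w k) (w k)"

definition err :: "'d::finite state => 'd state => real" where
  "err x y = norm (qq x - qq y) + norm (pp x - pp y) + norm (zz x - zz y)"

lemma err_triangle: "err x z <= err x y + err y z"
  using norm_triangle_ineq[of "qq x - qq y" "qq y - qq z"] norm_triangle_ineq[of "pp x - pp y" "pp y - pp z"]
    norm_triangle_ineq[of "zz x - zz y" "zz y - zz z"] by (simp add: err_def)

lemma dist_le_err: "dist x y <= err x y"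
proof -
  obtain q p z q' p' z' where xy: "x = (q, p, z)" "y = (q', p', z')" by (metis surj_pair)
  show ?thesis using norm_Pair_le[of "q - q'" "(p - p', z - z')"] norm_Pair_le[of "p - p'" "z - z'"]
    by (simp add: err_def dist_norm xy)
qed

text \<open>The constant does not involve \<open>\<alpha>\<close>: in the \<open>z\<close> component
  the damping \<open>\<bar>1 - a\<bar>\<close> is at most \<open>1 + a\<close>, which the division
  by \<open>1 + a\<close> compensates. The bound \<open>h <= 1\<close> turns terms of order
  \<open>h^2\<close> into terms of order \<open>h\<close>.\<close>

lemma step_lipschitz: assumes L: "L >= 0" "!!q q'. norm (b q - b q') <= L * norm (q - q')"
    and \<alpha>: "\<alpha> >= 0" and h: "0 < h" "h <= 1"
  shows "err (step b \<alpha> \<sigma> h x y) (step b \<alpha> \<sigma> h x' y) <= (1 + (2 * (L + 2) + (L + 1) * (L + 4)) * h) * err x x'"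
proof -
  define E where "E = err x x'"
  define dq dp dz where "dq = norm (qq x - qq x')" and "dp = norm (pp x - pp x')" and "dz = norm (zz x - zz x')"
  have E: "E = dq + dp + dz" and nn: "dq >= 0" "dp >= 0" "dz >= 0" by (auto simp: E_def err_def dq_def dp_def dz_def)
  have E0: "E >= 0" using nn E by linarith
  define u v where "u = step b \<alpha> \<sigma> h x y" and "v = step b \<alpha> \<sigma> h x' y"
  define p1 p1' where "p1 = kick b h x" and "p1' = kick b h x'"
  have aux: "norm (c *R (b q - b q' + (z - z'))) <= c * (L * norm (q - q') + norm (z - z'))" if "c >= 0" for c q q' z z'
  proof -
    have "norm (b q - b q' + (z - z')) <= L * norm (q - q') + norm (z - z')"
      using norm_triangle_ineq[of "b q - b q'" "z - z'"] L(2)[of q q'] by linarith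
    from mult_left_mono[OF this that] show ?thesis using that by (simp only: norm_scaleR abs_of_nonneg)
  qed
  have h2: "h / 2 >= 0" using h by simp
  have d1: "norm (p1 - p1') <= dp + h * ((L + 1) * E)"
  proof -
    have e: "p1 - p1' = (pp x - pp x') + (h / 2) *R (b (qq x) - b (qq x') + (zz x - zz x'))"
      by (simp add: p1_def p1'_def kick_def algebra_simps)
    have "norm (p1 - p1') <= dp + (h / 2) * (L * dq + dz)"
      using norm_triangle_ineq[of "pp x - pp x'" "(h / 2) *R (b (qq x) - b (qq x') + (zz x - zz x'))"]
        aux[of "h / 2" "qq x" "qq x'" "zz x" "zz x'", OF h2] unfolding e dp_def dq_def dz_def by linarith
    moreover have "(h / 2) * (L * dq + dz) <= h * ((L + 1) * E)"
    proof (rule mult_mono)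
      have "L * dq <= L * E" using L(1) nn E by (intro mult_left_mono) auto
      then show "L * dq + dz <= (L + 1) * E" using nn E by (simp add: algebra_simps)
    qed (use h nn L in auto)
    ultimately show ?thesis by linarith
  qed
  have d1': "norm (p1 - p1') <= (L + 2) * E"
  proof -
    have "h * ((L + 1) * E) <= 1 * ((L + 1) * E)" using h L(1) E0 by (intro mult_right_mono) auto
    then show ?thesis using d1 nn E by (simp add: algebra_simps)
  qed
  have q: "norm (qq u - qq v) <= dq + h * ((L + 2) * E)"
  proof -
    have "qq u - qq v = (qq x - qq x') + h *R (p1 - p1')"
      by (simp add: u_def v_def step_def Let_def p1_def p1'_def algebra_simps)
    then have "norm (qq u - qq v) <= dq + h * norm (p1 - p1')"
      using norm_triangle_ineq[of "qq x - qq x'" "h *R (p1 - p1')"] h by (simp add: dq_def)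
    then show ?thesis using mult_left_mono[OF d1', of h] h by linarith
  qed
  have z: "norm (zz u - zz v) <= dz + h * ((L + 2) * E)"
  proof -
    let ?a = "\<alpha> * h / 2"
    have a: "?a >= 0" using \<alpha> h by simp
    have "zz u - zz v = (1 / (1 + ?a)) *R ((1 - ?a) *R (zz x - zz x') - h *R (p1 - p1'))"
      unfolding u_def v_def step_def Let_def p1_def[symmetric] p1'_def[symmetric]
      by (simp add: scaleR_diff_right[symmetric]) (simp add: algebra_simps)
    then have eq: "norm (zz u - zz v) = norm ((1 - ?a) *R (zz x - zz x') - h *R (p1 - p1')) / (1 + ?a)"
      using a by simp
    have "norm ((1 - ?a) *R (zz x - zz x') - h *R (p1 - p1')) <= (1 + ?a) * dz + h * norm (p1 - p1')"
    proof -
      have "\<bar>1 - ?a\<bar> <= 1 + ?a" using a by (simp add: abs_le_iff)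
      from mult_right_mono[OF this nn(3)]
      have "\<bar>1 - ?a\<bar> * norm (zz x - zz x') <= (1 + ?a) * dz" by (simp add: dz_def)
      then show ?thesis using norm_triangle_ineq4[of "(1 - ?a) *R (zz x - zz x')" "h *R (p1 - p1')"] h by simp
    qed
    also have "... <= (1 + ?a) * (dz + h * ((L + 2) * E))"
    proof -
      have "h * norm (p1 - p1') <= h * ((L + 2) * E)" using h d1' by (intro mult_left_mono) auto
      also have "... <= (1 + ?a) * (h * ((L + 2) * E))" using a h L(1) E0 mult_right_mono[of 1 "1 + ?a" "h * ((L + 2) * E)"] by simp
      finally show ?thesis by (simp add: distrib_left)
    qed
    finally have "norm (zz u - zz v) <= (1 + ?a) * (dz + h * ((L + 2) * E)) / (1 + ?a)"
      unfolding eq using a by (intro divide_right_mono) auto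
    then show ?thesis using a by simp
  qed
  have big: "L * norm (qq u - qq v) + norm (zz u - zz v) <= 2 * ((L + 1) * (L + 3) * E)"
  proof -
    have "h * ((L + 2) * E) <= 1 * ((L + 2) * E)" using h L(1) E0 by (intro mult_right_mono) auto
    then have 1: "norm (qq u - qq v) <= (L + 3) * E" "norm (zz u - zz v) <= (L + 3) * E"
      using q z nn E by (simp_all add: algebra_simps)
    have "L * norm (qq u - qq v) <= L * ((L + 3) * E)" using L(1) 1(1) by (intro mult_left_mono)
    moreover have "0 <= (L + 1) * (L + 3) * E" using L(1) E0 by simp
    moreover have "L * ((L + 3) * E) + (L + 3) * E = (L + 1) * (L + 3) * E" by (simp add: algebra_simps)
    ultimately show ?thesis using 1(2) by linarith
  qed
  have p: "norm (pp u - pp v) <= dp + h * ((L + 1) * E) + h * ((L + 1) * (L + 3) * E)"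
  proof -
    have e: "pp u - pp v = (p1 - p1') + (h / 2) *R (b (qq u) - b (qq v) + (zz u - zz v))"
      by (simp add: u_def v_def step_def Let_def p1_def p1'_def algebra_simps)
    have "norm (pp u - pp v) <= norm (p1 - p1') + (h / 2) * (L * norm (qq u - qq v) + norm (zz u - zz v))"
      using norm_triangle_ineq[of "p1 - p1'" "(h / 2) *R (b (qq u) - b (qq v) + (zz u - zz v))"]
        aux[of "h / 2" "qq u" "qq v" "zz u" "zz v", OF h2] unfolding e by linarith
    moreover have "(h / 2) * (2 * ((L + 1) * (L + 3) * E)) = h * ((L + 1) * (L + 3) * E)" by simp
    ultimately show ?thesis using d1 mult_left_mono[OF big h2] by linarith
  qed
  show ?thesis unfolding u_def[symmetric] v_def[symmetric] E_def[symmetric]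
    using q z p E by (simp add: err_def algebra_simps)
qed

text \<open>The deterministic integral equation driven by one fixed noise path \<open>W\<close>,
  which isolates the pathwise analysis from probability.\<close>

definition path_solution ::
    "(real^'d => real^'d) => real => real => (real => real^'d) => real => (real => 'd::finite state) => bool" where
  "path_solution b \<alpha> \<sigma> W t1 X \<longleftrightarrow> continuous_on {0..t1} X & (\<forall>t\<in>{0..t1}.
     ((%s. pp (X s)) has_integral (qq (X t) - qq (X 0))) {0..t} &
     ((%s. b (qq (X s)) + zz (X s)) has_integral (pp (X t) - pp (X 0))) {0..t} &
     ((%s. - (\<alpha> *R zz (X s) + pp (X s))) has_integral (zz (X t) - zz (X 0) - \<sigma> *R (W t - W 0))) {0..t})"

lemma has_integral_increment:
  fixes f :: "real => 'a::euclidean_space"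
  assumes "!!t. t \<in> {0..u} ==> (f has_integral (F t - F 0)) {0..t}" and "0 <= s" "s <= t" "t <= u"
  shows "(f has_integral (F t - F s)) {s..t}"
proof -
  have i: "(f has_integral (F t - F 0)) {0..t}" "(f has_integral (F s - F 0)) {0..s}" using assms by auto
  have int: "f integrable_on {0..t}" using has_integral_integrable[OF i(1)] .
  from int have "f integrable_on {s..t}" by (rule integrable_on_subinterval) (use assms in auto)
  moreover have "integral {0..s} f + integral {s..t} f = integral {0..t} f"
    using assms int by (intro Henstock_Kurzweil_Integration.integral_combine) auto
  moreover have "integral {0..t} f = F t - F 0" "integral {0..s} f = F s - F 0" using i by (simp_all add: integral_unique)
  ultimately have "f integrable_on {s..t}" "integral {s..t} f = F t - F s" by (simp_all add: algebra_simps)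
  then show ?thesis using integrable_integral by metis
qed

lemma norm_integral_increment:
  fixes f :: "real => 'a::euclidean_space"
  assumes "(f has_integral J) {s..t}" "s <= t" and "!!r. r \<in> {s..t} ==> norm (f r - c) <= D" "D >= 0"
  shows "norm (J - (t - s) *R c) <= (t - s) * D"
proof -
  have "((%r. f r - c) has_integral (J - (t - s) *R c)) {s..t}"
    using has_integral_const_real[of c s t] assms(2) by (intro has_integral_diff assms(1)) simp
  from has_integral_bound_real[where S = "{}", OF assms(4) _ this] assms(2,3) show ?thesis
    by (simp add: mult.commute)
qed

text \<open>The local error is measured by the oscillation \<open>\<eta>\<close> of the path over a
  step, because the path is merely continuous. It is \<open>h\<close> times a quantity that vanishes
  with \<open>h\<close>, just enough to be summed over \<open>1 / h\<close> steps.\<close>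

lemma step_consistent:
  assumes sol: "path_solution b \<alpha> \<sigma> W t1 X" and L: "L >= 0" "!!q q'. norm (b q - b q') <= L * norm (q - q')"
    and \<alpha>: "\<alpha> >= 0" and h: "0 < h" "h <= 1" and s: "0 <= s" "s + h <= t1"
    and mod: "!!r. r \<in> {s..s + h} ==> err (X r) (X s) <= \<eta>" and K: "norm (b (qq (X s)) + zz (X s)) <= K"
  shows "err (step b \<alpha> \<sigma> h (X s) (W (s + h) - W s)) (X (s + h)) <= h * ((\<eta> + h * K) * (3 * L + 4 * \<alpha> + 5))"
proof -
  define t where "t = s + h"
  have t: "s <= t" "t <= t1" "t - s = h" using h s by (auto simp: t_def)
  define D where "D = \<eta> + h * K"
  have \<eta>0: "\<eta> >= 0" using mod[of s] h by (simp add: err_def)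
  have K0: "K >= 0" using K norm_ge_zero order_trans by blast
  have D0: "D >= 0" using \<eta>0 K0 h by (simp add: D_def)
  have comp: "norm (qq (X r) - qq (X s)) <= \<eta>" "norm (pp (X r) - pp (X s)) <= \<eta>" "norm (zz (X r) - zz (X s)) <= \<eta>"
    if "r \<in> {s..t}" for r using mod[of r] that unfolding err_def t_def
    using norm_ge_zero[of "qq (X r) - qq (X s)"] norm_ge_zero[of "pp (X r) - pp (X s)"] norm_ge_zero[of "zz (X r) - zz (X s)"]
    by linarith+
  note I = sol[unfolded path_solution_def, THEN conjunct2, THEN bspec]
  have Iq: "((%s. pp (X s)) has_integral (qq (X t) - qq (X s))) {s..t}"
    using I s(1) t by (intro has_integral_increment[where u = t1 and F = "%t. qq (X t)", OF I[THEN conjunct1]])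
  have Ip: "((%s. b (qq (X s)) + zz (X s)) has_integral (pp (X t) - pp (X s))) {s..t}"
    using I s(1) t by (intro has_integral_increment[where u = t1 and F = "%t. pp (X t)", OF I[THEN conjunct2, THEN conjunct1]])
  have Iz: "((%s. - (\<alpha> *R zz (X s) + pp (X s))) has_integral ((zz (X t) - \<sigma> *R W t) - (zz (X s) - \<sigma> *R W s))) {s..t}"
  proof (rule has_integral_increment[where u = t1 and F = "%t. zz (X t) - \<sigma> *R W t"])
    fix r assume "r \<in> {0..t1}"
    from I[OF this, THEN conjunct2, THEN conjunct2]
    show "((%s. - (\<alpha> *R zz (X s) + pp (X s))) has_integral (zz (X r) - \<sigma> *R W r - (zz (X 0) - \<sigma> *R W 0))) {0..r}"
      by (rule back_subst[where P = "%J. (_ has_integral J) _"]) (simp add: algebra_simps)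
  qed (use s t in auto)
  define u where "u = step b \<alpha> \<sigma> h (X s) (W t - W s)"
  define g where "g = b (qq (X s)) + zz (X s)"
  define p1 where "p1 = pp (X s) + (h / 2) *R g"
  have p1: "kick b h (X s) = p1" by (simp add: kick_def p1_def g_def)
  have hg: "norm ((h * h / 2) *R g) <= h * (h * K)"
  proof -
    have "norm ((h * h / 2) *R g) = h * h / 2 * norm g" using h by simp
    also have "... <= h * h * K" using K h unfolding g_def by (intro mult_mono) auto
    finally show ?thesis by (simp add: mult.assoc)
  qed
  have rq: "norm (qq (X t) - qq u) <= h * D"
  proof -
    have "norm (qq (X t) - qq (X s) - h *R pp (X s)) <= h * \<eta>"
      using norm_integral_increment[OF Iq t(1), of "pp (X s)" \<eta>] comp \<eta>0 t(3) by simp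
    moreover have e: "qq (X t) - qq u = (qq (X t) - qq (X s) - h *R pp (X s)) - (h * h / 2) *R g"
      by (simp add: u_def step_def Let_def p1 p1_def algebra_simps)
    ultimately show ?thesis
      using hg norm_triangle_ineq4[of "qq (X t) - qq (X s) - h *R pp (X s)" "(h * h / 2) *R g"]
      unfolding e D_def distrib_left by linarith
  qed
  have rz: "norm (zz (X t) - zz u) <= h * ((2 * \<alpha> + 1) * D)"
  proof -
    let ?a = "\<alpha> * h / 2"
    have a: "?a >= 0" using \<alpha> h by simp
    let ?J = "(zz (X t) - \<sigma> *R W t) - (zz (X s) - \<sigma> *R W s) - h *R - (\<alpha> *R zz (X s) + pp (X s))"
    have J: "norm ?J <= h * ((\<alpha> + 1) * \<eta>)"
    proof -
      have "norm (- (\<alpha> *R zz (X r) + pp (X r)) - - (\<alpha> *R zz (X s) + pp (X s))) <= (\<alpha> + 1) * \<eta>" if "r \<in> {s..t}" for r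
      proof -
        have e: "- (\<alpha> *R zz (X r) + pp (X r)) - - (\<alpha> *R zz (X s) + pp (X s)) = - (\<alpha> *R (zz (X r) - zz (X s)) + (pp (X r) - pp (X s)))"
          by (simp add: algebra_simps)
        have "norm (- (\<alpha> *R zz (X r) + pp (X r)) - - (\<alpha> *R zz (X s) + pp (X s))) <= \<alpha> * norm (zz (X r) - zz (X s)) + norm (pp (X r) - pp (X s))"
          using norm_triangle_ineq[of "\<alpha> *R (zz (X r) - zz (X s))" "pp (X r) - pp (X s)"] \<alpha> unfolding e norm_minus_cancel by simp
        also have "... <= \<alpha> * \<eta> + \<eta>" using comp[OF that] \<alpha> by (intro add_mono mult_left_mono)
        finally show ?thesis by (simp add: algebra_simps)
      qed
      from norm_integral_increment[OF Iz t(1) this] show ?thesis using \<eta>0 \<alpha> t(3) by simp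
    qed
    have uz: "zz u = (1 / (1 + ?a)) *R ((1 - ?a) *R zz (X s) - h *R p1 + \<sigma> *R (W t - W s))"
      by (simp add: u_def step_def Let_def p1)
    have zu: "(1 + ?a) *R zz u = (1 - ?a) *R zz (X s) - h *R p1 + \<sigma> *R (W t - W s)"
      unfolding uz using a by simp
    have "(1 + ?a) *R (zz (X t) - zz u) = ?J + ?a *R (zz (X t) - zz (X s)) + (h * h / 2) *R g"
      unfolding scaleR_diff_right[of "1 + ?a"] zu
    proof (subst vec_eq_iff, rule allI)
      fix i
      show "((1 + ?a) *R zz (X t) - ((1 - ?a) *R zz (X s) - h *R p1 + \<sigma> *R (W t - W s))) $ i
        = (?J + ?a *R (zz (X t) - zz (X s)) + (h * h / 2) *R g) $ i" by (simp add: p1_def field_simps)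
    qed
    then have "(1 + ?a) * norm (zz (X t) - zz u) = norm (?J + ?a *R (zz (X t) - zz (X s)) + (h * h / 2) *R g)"
      using a by (metis abs_of_nonneg add_nonneg_nonneg norm_scaleR zero_le_one)
    also have "... <= norm ?J + norm (?a *R (zz (X t) - zz (X s))) + norm ((h * h / 2) *R g)"
      by (intro order_trans[OF norm_triangle_ineq] add_mono norm_triangle_ineq order_refl)
    also have "... <= h * ((\<alpha> + 1) * \<eta>) + ?a * \<eta> + h * (h * K)"
      using J hg comp(3)[of t] t a by (intro add_mono) (auto intro!: mult_left_mono)
    also have "... <= h * ((2 * \<alpha> + 1) * D)"
    proof -
      have "0 <= h * (\<alpha> * \<eta>)" "0 <= h * (\<alpha> * (h * K))" using h \<alpha> \<eta>0 K0 by auto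
      then show ?thesis by (simp add: D_def algebra_simps)
    qed
    finally have "(1 + ?a) * norm (zz (X t) - zz u) <= h * ((2 * \<alpha> + 1) * D)" .
    moreover have "1 * norm (zz (X t) - zz u) <= (1 + ?a) * norm (zz (X t) - zz u)" using a by (intro mult_right_mono) auto
    ultimately show ?thesis by linarith
  qed
  have rp: "norm (pp (X t) - pp u) <= h * ((3 * L + 2 * \<alpha> + 3) * D)"
  proof -
    let ?J = "pp (X t) - pp (X s) - h *R g"
    have J: "norm ?J <= h * ((L + 1) * \<eta>)"
    proof -
      have "norm (b (qq (X r)) + zz (X r) - g) <= (L + 1) * \<eta>" if "r \<in> {s..t}" for r
      proof -
        have "b (qq (X r)) + zz (X r) - g = (b (qq (X r)) - b (qq (X s))) + (zz (X r) - zz (X s))" by (simp add: g_def)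
        then have "norm (b (qq (X r)) + zz (X r) - g) <= norm (b (qq (X r)) - b (qq (X s))) + norm (zz (X r) - zz (X s))"
          using norm_triangle_ineq by metis
        also have "... <= L * \<eta> + \<eta>" using comp[OF that] L by (intro add_mono order_trans[OF L(2)] mult_left_mono)
        finally show ?thesis by (simp add: algebra_simps)
      qed
      from norm_integral_increment[OF Ip t(1) this] show ?thesis using \<eta>0 L t(3) by simp
    qed
    let ?e = "(b (qq (X s)) - b (qq (X t))) + (zz (X s) - zz (X t)) + ((b (qq (X t)) - b (qq u)) + (zz (X t) - zz u))"
    have pu: "pp u = p1 + (h / 2) *R (b (qq u) + zz u)" by (simp add: u_def step_def Let_def p1)
    have "pp (X t) - pp u = ?J + (h / 2) *R ?e" unfolding pu by (simp add: p1_def g_def vec_eq_iff field_simps)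
    then have "norm (pp (X t) - pp u) <= norm ?J + norm ((h / 2) *R ?e)" using norm_triangle_ineq by metis
    moreover have "norm ?e <= (L * \<eta> + \<eta>) + (L * (h * D) + h * ((2 * \<alpha> + 1) * D))" using comp[of t] t rq rz L
      by (intro order_trans[OF norm_triangle_ineq] add_mono order_trans[OF L(2)] mult_left_mono)
        (auto simp: norm_minus_commute)
    moreover have "norm ((h / 2) *R ?e) = h / 2 * norm ?e" using h by simp
    ultimately have 1: "norm (pp (X t) - pp u) <= h * ((L + 1) * \<eta>) + h / 2 * ((L * \<eta> + \<eta>) + (L * (h * D) + h * ((2 * \<alpha> + 1) * D)))"
      using J mult_left_mono[of "norm ?e" "(L * \<eta> + \<eta>) + (L * (h * D) + h * ((2 * \<alpha> + 1) * D))" "h / 2"] h by linarith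
    have \<eta>D: "\<eta> <= D" using h K0 by (simp add: D_def)
    have "h * ((L + 1) * \<eta>) <= h * ((L + 1) * D)" using h L(1) \<eta>D by (intro mult_left_mono) auto
    moreover have "h / 2 * ((L * \<eta> + \<eta>) + (L * (h * D) + h * ((2 * \<alpha> + 1) * D)))
        <= h * ((L * D + D) + (L * D + (2 * \<alpha> + 1) * D))"
    proof (rule mult_mono)
      have "L * \<eta> <= L * D" using L(1) \<eta>D by (intro mult_left_mono)
      moreover have "L * (h * D) <= L * D" using L(1) h D0 by (intro mult_left_mono mult_left_le_one_le) auto
      moreover have "h * ((2 * \<alpha> + 1) * D) <= (2 * \<alpha> + 1) * D" using h \<alpha> D0 by (intro mult_left_le_one_le) auto
      ultimately show "(L * \<eta> + \<eta>) + (L * (h * D) + h * ((2 * \<alpha> + 1) * D)) <= (L * D + D) + (L * D + (2 * \<alpha> + 1) * D)"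
        using \<eta>D by linarith
    qed (use h L(1) \<eta>0 D0 \<alpha> in auto)
    ultimately show ?thesis using 1 by (simp add: algebra_simps)
  qed
  have "err u (X t) <= h * D + h * ((3 * L + 2 * \<alpha> + 3) * D) + h * ((2 * \<alpha> + 1) * D)"
    using rq rz rp by (simp add: err_def norm_minus_commute)
  then show ?thesis unfolding u_def t_def D_def[symmetric] by (simp add: algebra_simps)
qed

text \<open>A discrete Gronwall argument: the error after \<open>k\<close> steps grows by the
  Lipschitz factor \<open>1 + C h\<close>, at most \<open>exp (C h)\<close>, and by one local
  error.\<close>

lemma traj_error:
  assumes sol: "path_solution b \<alpha> \<sigma> W t1 X" and L: "L >= 0" "!!q q'. norm (b q - b q') <= L * norm (q - q')"
    and \<alpha>: "\<alpha> >= 0" and h: "0 < h" "h <= 1"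
    and mod: "!!r s. r \<in> {0..t1} ==> s \<in> {0..t1} ==> \<bar>r - s\<bar> <= h ==> err (X r) (X s) <= \<eta>" and \<eta>: "\<eta> >= 0"
    and K: "!!s. s \<in> {0..t1} ==> norm (b (qq (X s)) + zz (X s)) <= K" and K0: "K >= 0"
  defines "C \<equiv> 2 * (L + 2) + (L + 1) * (L + 4)" and "D \<equiv> (\<eta> + h * K) * (3 * L + 4 * \<alpha> + 5)"
  shows "real k * h <= t1 ==> err (traj b \<alpha> \<sigma> h (X 0) (%k. W (real (Suc k) * h) - W (real k * h)) k) (X (real k * h))
    <= real k * h * D * exp (C * (real k * h))"
proof (induction k)
  case 0
  then show ?case by (simp add: err_def)
next
  case (Suc k)
  have C0: "C >= 0" and D0: "D >= 0" using L(1) \<alpha> \<eta> K0 h by (auto simp: C_def D_def)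
  let ?t = "real k * h"
  let ?x = "traj b \<alpha> \<sigma> h (X 0) (%k. W (real (Suc k) * h) - W (real k * h)) k"
  have t: "?t >= 0" "real (Suc k) * h = ?t + h" "?t + h <= t1" using h Suc.prems by (auto simp: distrib_right)
  let ?w = "W (?t + h) - W ?t"
  have "err (step b \<alpha> \<sigma> h ?x ?w) (X (?t + h)) <= err (step b \<alpha> \<sigma> h ?x ?w) (step b \<alpha> \<sigma> h (X ?t) ?w) + err (step b \<alpha> \<sigma> h (X ?t) ?w) (X (?t + h))"
    by (rule err_triangle)
  also have "err (step b \<alpha> \<sigma> h ?x ?w) (step b \<alpha> \<sigma> h (X ?t) ?w) <= (1 + C * h) * err ?x (X ?t)"
    unfolding C_def by (rule step_lipschitz[OF L \<alpha> h])
  also have "(1 + C * h) * err ?x (X ?t) <= exp (C * h) * (?t * D * exp (C * ?t))"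
    using Suc.IH t h C0 D0 exp_ge_add_one_self[of "C * h"] by (intro mult_mono) (auto simp: err_def)
  also have "err (step b \<alpha> \<sigma> h (X ?t) ?w) (X (?t + h)) <= h * D"
    unfolding D_def by (rule step_consistent[OF sol L \<alpha> h t(1,3)]) (use t h order_trans[OF t(1)] in \<open>auto intro!: mod K\<close>)
  also have "h * D <= h * D * exp (C * (?t + h))"
    using mult_left_mono[of 1 "exp (C * (?t + h))" "h * D"] h C0 D0 t(1) by simp
  also have "exp (C * h) * (?t * D * exp (C * ?t)) + h * D * exp (C * (?t + h)) = (?t + h) * D * exp (C * (?t + h))"
    by (simp add: distrib_left distrib_right exp_add mult_ac)
  finally show ?case by (simp only: t(2) traj.simps)
qed

lemma interval_norm_bound:
  fixes f :: "real => 'a::real_normed_vector"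
  assumes "continuous_on {a..c} f" shows "\<exists>K\<ge>0. \<forall>s\<in>{a..c}. norm (f s) <= K"
proof -
  have "bounded (f ` {a..c})" by (intro compact_imp_bounded compact_continuous_image assms compact_Icc)
  then obtain K where "\<forall>y\<in>f ` {a..c}. norm y <= K" unfolding bounded_iff by blast
  then show ?thesis by (intro exI[of _ "max K 0"]) auto
qed

lemma err_le_dist: "err x y <= 3 * dist x y" using norm_state[of "x - y"] by (simp add: err_def dist_norm)

lemma traj_converges_lipschitz:
  assumes sol: "path_solution b \<alpha> \<sigma> W t1 X" and L: "L >= 0" "!!q q'. norm (b q - b q') <= L * norm (q - q')"
    and \<alpha>: "\<alpha> >= 0" and t1: "t1 > 0" and \<epsilon>: "\<epsilon> > 0"
  shows "\<forall>\<^sub>F n in sequentially. \<forall>k\<le>n. err (traj b \<alpha> \<sigma> (t1 / real n) (X 0)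
      (%k. W (real (Suc k) * (t1 / real n)) - W (real k * (t1 / real n))) k) (X (real k * (t1 / real n))) <= \<epsilon>"
proof -
  have cX: "continuous_on {0..t1} X" using sol by (simp add: path_solution_def)
  have "continuous_on UNIV b"
    using L by (intro lipschitz_on_continuous_on[of L]) (auto simp: lipschitz_on_def dist_norm)
  then have "continuous_on {0..t1} (%s. b (qq (X s)))"
    by (rule continuous_on_compose2[OF _ continuous_on_fst[OF cX]]) simp
  then have "continuous_on {0..t1} (%s. b (qq (X s)) + zz (X s))" using cX by (auto intro!: continuous_intros)
  from interval_norm_bound[OF this] obtain K where K0: "K >= 0"
    and K: "!!s. s \<in> {0..t1} ==> norm (b (qq (X s)) + zz (X s)) <= K" by blast
  define A where "A = t1 * (3 * L + 4 * \<alpha> + 5) * exp ((2 * (L + 2) + (L + 1) * (L + 4)) * t1)"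
  have A: "A > 0" using t1 L(1) \<alpha> by (simp add: A_def)
  \<comment> \<open>The total error is at most \<open>(\<eta> + h K) A\<close>, and the mesh is
    taken so fine that \<open>h K\<close> is at most \<open>\<eta>\<close>.\<close>
  define \<eta> where "\<eta> = \<epsilon> / (2 * A)"
  have \<eta>: "\<eta> > 0" using A \<epsilon> by (simp add: \<eta>_def)
  have "uniformly_continuous_on {0..t1} X" using cX by (intro compact_uniformly_continuous) auto
  \<comment> \<open>The third of \<open>\<eta>\<close> compensates the factor 3 in
    \<open>err_le_dist\<close>.\<close>
  then obtain \<delta> where \<delta>: "\<delta> > 0" "!!r s. r \<in> {0..t1} ==> s \<in> {0..t1} ==> dist r s < \<delta> ==> dist (X r) (X s) < \<eta> / 3"
    unfolding uniformly_continuous_on_def using \<eta> by (metis divide_pos_pos dist_commute zero_less_numeral)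
  have lim: "(%n. t1 / real n) ----> 0" by (rule lim_const_over_n)
  have "\<forall>\<^sub>F n in sequentially. t1 / real n < min (min 1 \<delta>) (\<eta> / (K + 1))"
  proof (rule order_tendstoD(2)[OF lim])
    have "\<eta> / (K + 1) > 0" using \<eta> K0 by (intro divide_pos_pos) auto
    then show "0 < min (min 1 \<delta>) (\<eta> / (K + 1))" using \<delta>(1) by simp
  qed
  then show ?thesis using eventually_gt_at_top[of 0]
  proof eventually_elim
    case (elim n)
    let ?h = "t1 / real n"
    have h: "0 < ?h" "?h <= 1" "?h < \<delta>" "?h < \<eta> / (K + 1)" using elim t1 by auto
    have hK: "?h * K <= \<eta>"
    proof -
      have "?h * (K + 1) < \<eta>" using h(4) K0 by (simp add: pos_less_divide_eq)
      then show ?thesis using h(1) by (simp add: distrib_left)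
    qed
    show ?case
    proof (intro allI impI)
      fix k assume k: "k <= n"
      have kh: "real k * ?h <= t1" using k elim t1 by (simp add: field_simps)
      have kh0: "0 <= real k * ?h" using h(1) by (intro mult_nonneg_nonneg) auto
      have "err (traj b \<alpha> \<sigma> ?h (X 0) (%k. W (real (Suc k) * ?h) - W (real k * ?h)) k) (X (real k * ?h))
        <= real k * ?h * ((\<eta> + ?h * K) * (3 * L + 4 * \<alpha> + 5)) * exp ((2 * (L + 2) + (L + 1) * (L + 4)) * (real k * ?h))"
      proof (rule traj_error[OF sol L \<alpha> h(1,2) _ _ K K0 kh])
        fix r s assume "r \<in> {0..t1}" "s \<in> {0..t1}" "\<bar>r - s\<bar> <= ?h"
        then have "dist (X r) (X s) < \<eta> / 3" using h(3) by (intro \<delta>(2)) (auto simp: dist_real_def)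
        then show "err (X r) (X s) <= \<eta>" using err_le_dist[of "X r" "X s"] by linarith
      qed (use \<eta> in auto)
      also have "... <= t1 * ((2 * \<eta>) * (3 * L + 4 * \<alpha> + 5)) * exp ((2 * (L + 2) + (L + 1) * (L + 4)) * t1)"
      proof (intro mult_mono)
        show "exp ((2 * (L + 2) + (L + 1) * (L + 4)) * (real k * ?h)) <= exp ((2 * (L + 2) + (L + 1) * (L + 4)) * t1)"
          using kh L(1) by (intro iffD2[OF exp_le_cancel_iff] mult_left_mono) auto
      qed (use kh kh0 hK L(1) \<alpha> t1 \<eta> h K0 in auto)
      also have "... = 2 * \<eta> * A" by (simp add: A_def mult_ac)
      also have "... = \<epsilon>" using A by (simp add: \<eta>_def)
      finally show "err (traj b \<alpha> \<sigma> ?h (X 0) (%k. W (real (Suc k) * ?h) - W (real k * ?h)) k) (X (real k * ?h)) <= \<epsilon>" .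
    qed
  qed
qed

text \<open>A step evaluates the drift only at the old and the new position; this allows a drift to
  be exchanged for one that agrees with it near the path.\<close>

lemma step_cong: assumes "b (qq x) = b' (qq x)" and "b (qq (step b' \<alpha> \<sigma> h x y)) = b' (qq (step b' \<alpha> \<sigma> h x y))"
  shows "step b \<alpha> \<sigma> h x y = step b' \<alpha> \<sigma> h x y"
proof -
  have k: "kick b h x = kick b' h x" using assms(1) by (simp add: kick_def)
  have q: "qq (step b' \<alpha> \<sigma> h x y) = qq x + h *R kick b' h x" by (simp add: step_def Let_def)
  show ?thesis using assms(2)[unfolded q] by (simp add: step_def Let_def k)
qed

text \<open>Along a bounded path only the values of the drift on a ball matter, and there it agrees with
  a globally Lipschitz function.\<close>
lemma traj_converges: assumes sol: "path_solution b \<alpha> \<sigma> W t1 X" and b: "Ck 1 b"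
    and \<alpha>: "\<alpha> >= 0" and t1: "t1 > 0" and \<epsilon>: "\<epsilon> > 0"
  shows "\<forall>\<^sub>F n in sequentially. \<forall>k\<le>n. err (traj b \<alpha> \<sigma> (t1 / real n) (X 0)
      (%k. W (real (Suc k) * (t1 / real n)) - W (real k * (t1 / real n))) k) (X (real k * (t1 / real n))) <= \<epsilon>"
proof -
  have cX: "continuous_on {0..t1} X" using sol by (simp add: path_solution_def)
  from interval_norm_bound[OF this] obtain R0 where R0_0: "R0 >= 0" and R0: "!!s. s \<in> {0..t1} ==> norm (X s) <= R0" by blast
  have R: "norm (qq (X s)) <= R0" if "s \<in> {0..t1}" for s using R0[OF that] norm_state(1)[of "X s"] by linarith
  let ?S = "cball (0::real^'a) (R0 + 1)"
  \<comment> \<open>Projection onto a ball is a contraction, so the local Lipschitz constant of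
    \<open>b\<close> on the ball becomes global.\<close>
  define b' where "b' = b \<circ> closest_point ?S"
  have b'_eq: "b' q = b q" if "norm q <= R0 + 1" for q using that by (simp add: b'_def closest_point_self)
  obtain L where L: "L >= 0" "!!x y. norm x <= R0 + 1 ==> norm y <= R0 + 1 ==> norm (b x - b y) <= L * norm (x - y)"
    using locally_lipschitz[OF b, of "R0 + 1"] by blast
  have ne: "?S ~= {}" using R0_0 by simp
  have L': "norm (b' q - b' q') <= L * norm (q - q')" for q q'
  proof -
    have in_S: "closest_point ?S q \<in> ?S" for q using ne by (intro closest_point_in_set) auto
    have "norm (b' q - b' q') <= L * norm (closest_point ?S q - closest_point ?S q')"
      unfolding b'_def o_def using in_S[of q] in_S[of q'] by (intro L(2)) (auto simp: dist_norm)
    also have "... <= L * norm (q - q')"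
      using closest_point_lipschitz[of ?S q q'] ne L(1) by (intro mult_left_mono) (auto simp: dist_norm)
    finally show ?thesis .
  qed
  have sol': "path_solution b' \<alpha> \<sigma> W t1 X" unfolding path_solution_def
  proof (intro conjI ballI)
    fix t assume t: "t \<in> {0..t1}"
    note I = sol[unfolded path_solution_def, THEN conjunct2, THEN bspec, OF t]
    show "((%s. b' (qq (X s)) + zz (X s)) has_integral pp (X t) - pp (X 0)) {0..t}"
    proof (rule has_integral_eq[OF _ I[THEN conjunct2, THEN conjunct1]])
      fix s assume "s \<in> {0..t}"
      then have "norm (qq (X s)) <= R0 + 1" using R[of s] t by auto
      then show "b (qq (X s)) + zz (X s) = b' (qq (X s)) + zz (X s)" by (simp add: b'_eq)
    qed
  qed (use sol in \<open>auto simp: path_solution_def\<close>)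
  \<comment> \<open>The bound by 1 keeps the discrete trajectory inside the ball of radius
    \<open>R0 + 1\<close>, where \<open>b'\<close> and \<open>b\<close> agree.\<close>
  have "\<forall>\<^sub>F n in sequentially. \<forall>k\<le>n. err (traj b' \<alpha> \<sigma> (t1 / real n) (X 0)
      (%k. W (real (Suc k) * (t1 / real n)) - W (real k * (t1 / real n))) k) (X (real k * (t1 / real n))) <= min \<epsilon> 1"
    using \<epsilon> by (intro traj_converges_lipschitz[OF sol' L(1) L' \<alpha> t1]) auto
  then show ?thesis using eventually_gt_at_top[of 0]
  proof eventually_elim
    case (elim n)
    let ?h = "t1 / real n"
    let ?w = "%k. W (real (Suc k) * ?h) - W (real k * ?h)"
    have near: "norm (qq (traj b' \<alpha> \<sigma> ?h (X 0) ?w k)) <= R0 + 1" if "k <= n" for k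
    proof -
      have "real k * ?h <= t1" using that elim t1 by (simp add: field_simps)
      then have "real k * ?h \<in> {0..t1}" using t1 by auto
      then have "norm (qq (X (real k * ?h))) <= R0" by (rule R)
      moreover have "norm (qq (traj b' \<alpha> \<sigma> ?h (X 0) ?w k) - qq (X (real k * ?h))) <= 1"
      proof -
        have "err (traj b' \<alpha> \<sigma> ?h (X 0) ?w k) (X (real k * ?h)) <= 1" using elim that by auto
        then show ?thesis unfolding err_def
          using norm_ge_zero[of "pp (traj b' \<alpha> \<sigma> ?h (X 0) ?w k) - pp (X (real k * ?h))"]
            norm_ge_zero[of "zz (traj b' \<alpha> \<sigma> ?h (X 0) ?w k) - zz (X (real k * ?h))"] by linarith
      qed
      ultimately show ?thesis
        using norm_triangle_sub[of "qq (traj b' \<alpha> \<sigma> ?h (X 0) ?w k)" "qq (X (real k * ?h))"] by linarith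
    qed
    have "traj b \<alpha> \<sigma> ?h (X 0) ?w k = traj b' \<alpha> \<sigma> ?h (X 0) ?w k" if "k <= n" for k using that
    proof (induction k)
      case (Suc k)
      show ?case using Suc near[of k] near[of "Suc k"]
        by (simp only: traj.simps) (intro step_cong b'_eq[symmetric]; simp)
    qed simp
    with elim show ?case by auto
  qed
qed

subsection \<open>The law of the scheme\<close>

lemma traj_cong:
  "(!!j. j < k ==> w j = w' j) ==> traj b \<alpha> \<sigma> h x w k = traj b \<alpha> \<sigma> h x w' k" by (induction k) auto

context reversible_scheme
begin

abbreviation noise :: "(real^'d) measure" where
  "noise \<equiv> density lborel (%y. ennreal (heat h y))"

lemma traj_measurable:
  assumes [measurable]: "f \<in> borel_measurable N" and "!!j. j < k ==> (%om. w om j) \<in> borel_measurable N"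
  shows "(%om. traj b \<alpha> \<sigma> h (f om) (w om) k) \<in> borel_measurable N" using assms(2) by (induction k) auto

end

context potential_scheme
begin

lemma map_upt_eq_append:
  "map f [0..<Suc n] = map f [0..<n] @ [f n]" "map f [0..<Suc (Suc n)] = map f [0..<n] @ [f n, f (Suc n)]" by auto

lemma fwd_append: "fwd (fs @ [f, g]) = fwd (fs @ [%x. f x * T g x])" by (induction fs rule: fwd.induct) auto

text \<open>Only the last state depends on the last noise variable. Integrating it out turns the
  last observable into a factor of the preceding one, which matches
  \<open>fwd_append\<close>.\<close>

lemma scheme_law: assumes noise: "prob_space noise" and "!!k. k <= n ==> f k \<in> borel_measurable borel"
  shows "(\<integral>\<^sup>+w. (\<Prod>k\<le>n. f k (traj b \<alpha> \<sigma> h x w k)) \<partial>PiM {..<n} (%_. noise)) = fwd (map f [0..<Suc n]) x"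
  using assms(2)
proof (induction n arbitrary: f)
  case 0
  interpret product_sigma_finite "%_::nat. noise" using noise by (simp add: product_sigma_finite_def prob_space_imp_sigma_finite)
  show ?case unfolding lessThan_0 by (subst nn_integral_empty) auto
next
  case (Suc n)
  interpret product_sigma_finite "%_::nat. noise" using noise by (simp add: product_sigma_finite_def prob_space_imp_sigma_finite)
  have comp: "(%w. w j) \<in> borel_measurable (PiM I (%_. noise))" if "j \<in> I" for j and I :: "nat set"
    using measurable_component_singleton[OF that, of "%_. noise"] by simp
  have fm: "f k \<in> borel_measurable borel" if "k <= Suc n" for k using Suc.prems that .
  have [measurable]: "f (Suc n) \<in> borel_measurable borel" "f n \<in> borel_measurable borel" by (auto intro!: fm)
  have tm: "(%w. traj b \<alpha> \<sigma> h x w k) \<in> borel_measurable (PiM {..<m} (%_. noise))" if "k <= m" for k m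
    using that by (intro traj_measurable comp) auto
  have "(\<integral>\<^sup>+w. (\<Prod>k\<le>Suc n. f k (traj b \<alpha> \<sigma> h x w k)) \<partial>PiM {..<Suc n} (%_. noise))
    = (\<integral>\<^sup>+w. (\<integral>\<^sup>+y. (\<Prod>k\<le>Suc n. f k (traj b \<alpha> \<sigma> h x (w(n := y)) k)) \<partial>noise) \<partial>PiM {..<n} (%_. noise))"
    unfolding lessThan_Suc
  proof (rule product_nn_integral_insert)
    show "(%w. \<Prod>k\<le>Suc n. f k (traj b \<alpha> \<sigma> h x w k)) \<in> borel_measurable (PiM (insert n {..<n}) (%_. noise))"
      unfolding lessThan_Suc[symmetric] by (intro borel_measurable_prod_ennreal measurable_compose[OF tm fm]) auto
  qed auto
  also have "... = (\<integral>\<^sup>+w. (\<Prod>k\<le>n. (f(n := %x. f n x * T (f (Suc n)) x)) k (traj b \<alpha> \<sigma> h x w k)) \<partial>PiM {..<n} (%_. noise))"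
  proof (rule nn_integral_cong)
    fix w
    have 1: "traj b \<alpha> \<sigma> h x (w(n := y)) k = traj b \<alpha> \<sigma> h x w k" if "k <= n" for k y
      using that by (intro traj_cong) auto
    let ?P = "\<Prod>k<n. f k (traj b \<alpha> \<sigma> h x w k)" and ?x = "traj b \<alpha> \<sigma> h x w n"
    have "(\<integral>\<^sup>+y. (\<Prod>k\<le>Suc n. f k (traj b \<alpha> \<sigma> h x (w(n := y)) k)) \<partial>noise)
      = (\<integral>\<^sup>+y. (?P * f n ?x) * f (Suc n) (step b \<alpha> \<sigma> h ?x y) \<partial>noise)"
    proof (rule nn_integral_cong)
      fix y
      have "(\<Prod>k\<le>Suc n. f k (traj b \<alpha> \<sigma> h x (w(n := y)) k)) = (\<Prod>k\<le>n. f k (traj b \<alpha> \<sigma> h x w k)) * f (Suc n) (step b \<alpha> \<sigma> h ?x y)"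
        unfolding atMost_Suc by (subst prod.insert) (auto simp: 1 mult.commute intro!: prod.cong arg_cong2[where f = "(*)"])
      then show "(\<Prod>k\<le>Suc n. f k (traj b \<alpha> \<sigma> h x (w(n := y)) k)) = (?P * f n ?x) * f (Suc n) (step b \<alpha> \<sigma> h ?x y)"
        by (simp add: lessThan_Suc_atMost[symmetric])
    qed
    also have "... = (?P * f n ?x) * T (f (Suc n)) ?x"
      unfolding T_def by (subst nn_integral_density, simp, simp, subst nn_integral_cmult[symmetric], simp) (simp add: mult_ac)
    also have "... = (\<Prod>k\<le>n. (f(n := %x. f n x * T (f (Suc n)) x)) k (traj b \<alpha> \<sigma> h x w k))"
      by (simp add: lessThan_Suc_atMost[symmetric] mult.assoc)
    finally show "(\<integral>\<^sup>+y. (\<Prod>k\<le>Suc n. f k (traj b \<alpha> \<sigma> h x (w(n := y)) k)) \<partial>noise)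
      = (\<Prod>k\<le>n. (f(n := %x. f n x * T (f (Suc n)) x)) k (traj b \<alpha> \<sigma> h x w k))" .
  qed
  also have "... = fwd (map (f(n := %x. f n x * T (f (Suc n)) x)) [0..<Suc n]) x" by (rule Suc.IH) (use fm in auto)
  also have "map (f(n := %x. f n x * T (f (Suc n)) x)) [0..<Suc n] = map f [0..<n] @ [%x. f n x * T (f (Suc n)) x]"
    unfolding map_upt_eq_append by simp
  also have "fwd ... = fwd (map f [0..<Suc (Suc n)])" by (simp only: map_upt_eq_append(2) fwd_append)
  finally show ?case .
qed

end

subsection \<open>Solutions of the Langevin equation\<close>

text \<open>Independence is given for the sigma-algebra of the whole Brownian path; it applies to
  \<open>W\<close> because \<open>W\<close> factors measurably through that path as
  \<open>g\<close>.\<close>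

lemma distr_pair_of_independent_of_process: assumes M: "prob_space M" and ind: "independent_of_process M Y B"
    and Y: "Y \<in> borel_measurable M" and W: "W \<in> measurable M N"
    and W': "W = (%om. g (\<lambda>t\<in>{0..}. B t om))" and g: "g \<in> measurable (PiM {0..} (%_. borel)) N"
  shows "distr M borel Y \<Otimes>\<^sub>M distr M N W = distr M (borel \<Otimes>\<^sub>M N) (%om. (Y om, W om))"
proof -
  interpret prob_space M by fact
  interpret Y: prob_space "distr M borel Y" by (rule prob_space_distr[OF Y])
  interpret W: prob_space "distr M N W" by (rule prob_space_distr[OF W])
  let ?V = "vimage_algebra (space M) (%om. \<lambda>t\<in>{0..}. B t om) (PiM {0..} (%_. borel))"
  have "(%om. \<lambda>t\<in>{0..}. B t om) \<in> measurable ?V (PiM {0..} (%_. borel))"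
    by (rule measurable_vimage_algebra1) (auto simp: space_PiM)
  from measurable_compose[OF this g] have WV: "W \<in> measurable ?V N" unfolding W' .
  show ?thesis
  proof (rule pair_measure_eqI)
    fix A C assume A: "A \<in> sets (distr M borel Y)" and C: "C \<in> sets (distr M N W)"
    have "Y -` A \<inter> space M \<in> sets (vimage_algebra (space M) Y borel)" using A by (intro in_vimage_algebra) simp
    moreover have "W -` C \<inter> space M \<in> sets ?V" using measurable_sets[OF WV, of C] C by simp
    ultimately have "prob ((Y -` A \<inter> space M) \<inter> (W -` C \<inter> space M)) = prob (Y -` A \<inter> space M) * prob (W -` C \<inter> space M)"
      using ind unfolding independent_of_process_def by (intro indep_setD)
    moreover have "(%om. (Y om, W om)) -` (A \<times> C) \<inter> space M = (Y -` A \<inter> space M) \<inter> (W -` C \<inter> space M)" by auto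
    moreover have "(%om. (Y om, W om)) \<in> measurable M (borel \<Otimes>\<^sub>M N)" using Y W by simp
    ultimately show "emeasure (distr M borel Y) A * emeasure (distr M N W) C
        = emeasure (distr M (borel \<Otimes>\<^sub>M N) (%om. (Y om, W om))) (A \<times> C)"
      using A C Y W by (simp add: emeasure_distr emeasure_eq_measure ennreal_mult)
  qed (auto intro!: sets_pair_measure_cong Y.sigma_finite_measure_axioms W.sigma_finite_measure_axioms)
qed

locale langevin_process = prob_space M
  for M :: "'w measure" +
  fixes B q p z :: "real => 'w => real^'d" and b :: "real^'d => real^'d" and \<alpha> \<beta> :: real and \<rho> :: "'d state => real"
  assumes \<alpha>: "\<alpha> > 0" and \<beta>: "\<beta> > 0" and smooth_b: "smooth b" and brownian: "brownian_motion M B"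
    and solution: "sde_solution \<alpha> \<beta> b M B q p z"
    and initial: "distributed M lborel (state_process q p z 0) (%x. ennreal (\<rho> x))" and \<rho>_pos: "!!x. \<rho> x > 0"
begin

abbreviation X where "X \<equiv> state_process q p z"

definition \<sigma> where "\<sigma> = sqrt (2 * inverse \<beta> * \<alpha>)"

lemma X_measurable: "t >= 0 ==> X t \<in> borel_measurable M"
  using solution unfolding sde_solution_def state_process_def[abs_def] by (intro borel_measurable_Pair) auto

lemma B_measurable: "t >= 0 ==> B t \<in> borel_measurable M" using brownian unfolding brownian_motion_def by auto

lemma AE_path_solution: "AE om in M. \<forall>T. path_solution b \<alpha> \<sigma> (%t. B t om) T (%t. X t om)"
proof -
  have "AE om in M. continuous_on {0..} (%t. X t om) & (\<forall>t\<ge>0. ((%s. p s om) has_integral (q t om - q 0 om)) {0..t} &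
           ((%s. b (q s om) + z s om) has_integral (p t om - p 0 om)) {0..t} &
           ((%s. - (\<alpha> *R z s om + p s om)) has_integral
              (z t om - z 0 om - sqrt (2 * inverse \<beta> * \<alpha>) *R (B t om - B 0 om))) {0..t})"
    using solution unfolding sde_solution_def by simp
  then show ?thesis
  proof eventually_elim
    case (elim om)
    have "continuous_on {0..T} (%t. X t om)" for T using elim by (auto intro: continuous_on_subset)
    with elim show ?case by (simp add: path_solution_def state_process_def \<sigma>_def)
  qed
qed

lemma AE_continuous: "AE om in M. continuous_on {0..} (%t. X t om)"
  using solution unfolding sde_solution_def by (auto elim: eventually_mono)

text \<open>The increments are jointly a product of Gaussians and independent of the initial value,
  so an expectation over the process space becomes an iterated integral against
  \<open>\<rho>\<close> and the noise.\<close>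

lemma increments_law:
  assumes h: "h > 0" and G [measurable]: "(%y. G (fst y) (snd y)) \<in> borel_measurable (borel \<Otimes>\<^sub>M PiM {..<n} (%_. borel))"
    and n: "n > 0"
  defines "N \<equiv> density lborel (%y. ennreal (heat h y))" shows "prob_space N"
    and "(\<integral>\<^sup>+om. G (X 0 om) (\<lambda>k\<in>{..<n}. B (real (Suc k) * h) om - B (real k * h) om) \<partial>M)
      = (NN x. ennreal (\<rho> x) * (\<integral>\<^sup>+w. G x w \<partial>PiM {..<n} (%_. N)))"
proof -
  let ?w = "%k om. B (real (Suc k) * h) om - B (real k * h) om"
  have wm [measurable]: "?w k \<in> borel_measurable M" for k
    using B_measurable[of "real (Suc k) * h"] B_measurable[of "real k * h"] h by simp
  have dw: "distributed M lborel (?w k) (%y. ennreal (heat h y))" for k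
  proof -
    have "0 <= real k * h & real k * h < real (Suc k) * h" using h by (simp add: distrib_right)
    then have "distributed M lborel (?w k)
      (%x. ennreal (\<Prod>i\<in>UNIV. normal_density 0 (sqrt (real (Suc k) * h - real k * h)) (x $ i)))"
      using brownian unfolding brownian_motion_def by blast
    moreover have "real (Suc k) * h - real k * h = h" by (simp add: distrib_right)
    ultimately show ?thesis by (simp add: heat_def)
  qed
  have dN: "distr M borel (?w k) = N" for k
  proof -
    have "distr M borel (?w k) = distr M lborel (?w k)" by (rule distr_cong) auto
    then show ?thesis using distributed_distr_eq_density[OF dw[of k]] by (simp add: N_def)
  qed
  have pN: "prob_space N" unfolding dN[of 0, symmetric] by (rule prob_space_distr) (rule wm)
  then show "prob_space N" .
  interpret N: prob_space N by (rule pN)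
  interpret P: product_prob_space "%_::nat. N" "{..<n}" by unfold_locales
  have setsN: "sets (PiM {..<n} (%_. N)) = sets (PiM {..<n} (%_. borel))" by (rule sets_PiM_cong) (auto simp: N_def)
  let ?W = "%om. \<lambda>k\<in>{..<n}. ?w k om"
  have Wm [measurable]: "?W \<in> measurable M (PiM {..<n} (%_. borel))" by (rule measurable_restrict) (rule wm)
  have "strict_mono (%k. real k * h)" using h by (auto simp: strict_mono_def)
  then have "indep_vars (%_. borel) (%i om. B (real (Suc i) * h) om - B (real i * h) om) {..<n}"
    using brownian unfolding brownian_motion_def by (auto dest!: spec[of _ n] dest: spec[of _ "%k. real k * h"])
  then have "distr M (PiM {..<n} (%_. borel)) ?W = PiM {..<n} (%k. distr M borel (?w k))"
    by (subst (asm) indep_vars_iff_distr_eq_PiM') (use n wm in auto)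
  then have dW: "distr M (PiM {..<n} (%_. borel)) ?W = PiM {..<n} (%_. N)" by (simp only: dN)
  have X0 [measurable]: "X 0 \<in> borel_measurable M" by (rule X_measurable) simp
  have "distr M borel (X 0) \<Otimes>\<^sub>M distr M (PiM {..<n} (%_. borel)) ?W
    = distr M (borel \<Otimes>\<^sub>M PiM {..<n} (%_. borel)) (%om. (X 0 om, ?W om))"
  proof (rule distr_pair_of_independent_of_process[OF prob_space_axioms _ X0 Wm])
    show "independent_of_process M (X 0) B" using solution by (simp add: sde_solution_def)
    show "?W = (%om. (%y. \<lambda>k\<in>{..<n}. y (real (Suc k) * h) - y (real k * h)) (\<lambda>t\<in>{0..}. B t om))"
      using h by (auto simp: fun_eq_iff restrict_def)
    show "(%y. \<lambda>k\<in>{..<n}. y (real (Suc k) * h) - y (real k * h)) \<in> measurable (PiM {0..} (%_. borel :: (real^'d) measure)) (PiM {..<n} (%_. borel))"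
    proof (rule measurable_restrict)
      fix k assume "k \<in> {..<n}"
      have c: "(%y. y t) \<in> borel_measurable (PiM {0..} (%_. borel :: (real^'d) measure))" if "t >= 0" for t :: real
        using that by (intro measurable_component_singleton) simp
      show "(%y. y (real (Suc k) * h) - y (real k * h)) \<in> borel_measurable (PiM {0..} (%_. borel :: (real^'d) measure))"
        using h by (intro borel_measurable_diff c mult_nonneg_nonneg) auto
    qed
  qed
  note joint = this[unfolded dW]
  have dX: "distr M borel (X 0) = density lborel (%x. ennreal (\<rho> x))"
  proof -
    have "distr M borel (X 0) = distr M lborel (X 0)" by (rule distr_cong) auto
    then show ?thesis using distributed_distr_eq_density[OF initial] by simp
  qed
  have \<rho>m: "(%x. ennreal (\<rho> x)) \<in> borel_measurable lborel" using initial by (rule distributed_borel_measurable)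
  have Gm: "(%y. G (fst y) (snd y)) \<in> borel_measurable (borel \<Otimes>\<^sub>M PiM {..<n} (%_. N))"
    using G by (simp cong: measurable_cong_sets sets_pair_measure_cong add: setsN)
  have "(\<integral>\<^sup>+om. G (X 0 om) (?W om) \<partial>M) = (\<integral>\<^sup>+y. G (fst y) (snd y) \<partial>(distr M borel (X 0) \<Otimes>\<^sub>M PiM {..<n} (%_. N)))"
    unfolding joint by (subst nn_integral_distr[OF measurable_Pair[OF X0 Wm]]) (use G in simp_all)
  also have "... = (\<integral>\<^sup>+x. \<integral>\<^sup>+w. G x w \<partial>PiM {..<n} (%_. N) \<partial>distr M borel (X 0))"
    by (subst P.nn_integral_fst[symmetric]) (use Gm in \<open>auto simp: measurable_cong_sets[OF sets_pair_measure_cong[OF sets_distr refl] refl]\<close>)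
  also have "... = (NN x. ennreal (\<rho> x) * (\<integral>\<^sup>+w. G x w \<partial>PiM {..<n} (%_. N)))" unfolding dX
    by (rule nn_integral_density) (use \<rho>m P.borel_measurable_nn_integral[of "%x w. G x w"] Gm in \<open>auto simp: case_prod_beta'\<close>)
  finally show "(\<integral>\<^sup>+om. G (X 0 om) (?W om) \<partial>M) = (NN x. ennreal (\<rho> x) * (\<integral>\<^sup>+w. G x w \<partial>PiM {..<n} (%_. N)))" .
qed

end

lemma grid_le: assumes "t <= T" "T > 0" shows "nat \<lfloor>t * real n / T\<rfloor> <= n"
proof -
  have "t * real n / T <= real n" using assms by (simp add: divide_le_eq mult.commute mult_right_mono)
  then have "\<lfloor>t * real n / T\<rfloor> <= int n" by linarith
  then show ?thesis by simp
qed

lemma grid_limit: assumes t: "0 <= t" and T: "T > 0" shows "(%n. real (nat \<lfloor>t * real n / T\<rfloor>) * (T / real n)) ----> t"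
proof -
  have "\<bar>real (nat \<lfloor>t * real n / T\<rfloor>) * (T / real n) - t\<bar> <= T / real n" if "n > 0" for n
  proof -
    let ?y = "t * real n / T" and ?k = "real (nat \<lfloor>t * real n / T\<rfloor>)"
    have "0 <= ?y" using t T by simp
    then have "\<bar>?k - ?y\<bar> <= 1" by linarith
    then have "\<bar>?k - ?y\<bar> * (T / real n) <= 1 * (T / real n)" using T by (intro mult_right_mono) auto
    moreover have "\<bar>?k - ?y\<bar> * (T / real n) = \<bar>(?k - ?y) * (T / real n)\<bar>" using T by (simp add: abs_mult)
    moreover have "(?k - ?y) * (T / real n) = ?k * (T / real n) - t"
      using T that by (simp add: left_diff_distrib diff_divide_distrib)
    ultimately show ?thesis by (metis mult_1)
  qed
  then have "\<forall>\<^sub>F n in sequentially. norm (real (nat \<lfloor>t * real n / T\<rfloor>) * (T / real n) - t) <= T / real n"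
    by (intro eventually_sequentiallyI[of 1]) auto
  from Lim_null_comparison[OF this lim_const_over_n] show ?thesis by (simp add: LIM_zero_iff)
qed

section \<open>Passage to the limit in the reversed chain\<close>

context langevin_process
begin

lemma nn_integral_initial: assumes "f \<in> borel_measurable borel"
  shows "(\<integral>\<^sup>+om. f (X 0 om) \<partial>M) = (NN x. ennreal (\<rho> x) * f x)"
  using distributed_nn_integral[OF initial, of f] assms by simp

definition euler :: "real => 'w => nat => 'd state" where
  "euler h om = traj b \<alpha> \<sigma> h (X 0 om) (%k. B (real (Suc k) * h) om - B (real k * h) om)"

lemma b_continuous: "continuous_on UNIV b" using smooth_Ck[OF smooth_b, of 0] by simp

lemma reversible_scheme: "h > 0 ==> reversible_scheme \<alpha> \<beta> \<sigma> h b"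
  using \<alpha> \<beta> b_continuous by (simp add: reversible_scheme_def \<sigma>_def)

lemma euler_measurable: assumes "h > 0" shows "(%om. euler h om k) \<in> borel_measurable M"
proof -
  interpret reversible_scheme \<alpha> \<beta> \<sigma> h b using assms by (rule reversible_scheme)
  show ?thesis unfolding euler_def
    using assms by (intro traj_measurable X_measurable borel_measurable_diff B_measurable) auto
qed

lemma euler_converges: assumes "T > 0"
  shows "AE om in M. \<forall>\<epsilon>>0. \<forall>\<^sub>F n in sequentially. \<forall>k\<le>n. err (euler (T / real n) om k) (X (real k * (T / real n)) om) <= \<epsilon>"
  using AE_path_solution
proof eventually_elim
  case (elim om)
  have "path_solution b \<alpha> \<sigma> (%t. B t om) T (%t. X t om)" using elim by blast
  from traj_converges[OF this smooth_Ck[OF smooth_b] less_imp_le[OF \<alpha>] assms] show ?case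
    by (simp only: euler_def) blast
qed

text \<open>The constant depends on the radius of the supports only, not on the mesh or the number
  of steps. The normalization \<open>c\<close> of the Gibbs density appears on both sides in the
  same way.\<close>

lemma scheme_reverse_le: assumes U: "!!q. GDERIV U q :> - b q" and c: "c > 0"
    and gibbs: "AE x in lborel. \<rho> x = c * exp (- \<beta> * hamiltonian U x)"
  shows "\<exists>C. \<forall>h n f. 0 < h & h <= 1 & 0 < n & (\<forall>k. f k \<in> borel_measurable borel & (\<forall>x. norm x > R --> f k x = (0::ennreal))) -->
     (\<integral>\<^sup>+om. (\<Prod>k\<le>n. f k (euler h om k)) \<partial>M)
     <= ennreal (exp (\<beta> * (h\<^sup>2 * C))) ^ n * (\<integral>\<^sup>+om. (\<Prod>k\<le>n. f (n - k) (flip_p (euler h om k))) \<partial>M)"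
proof -
  obtain L where L: "L >= 0" "!!x y. norm x <= R ==> norm y <= R ==> norm (b x - b y) <= L * norm (x - y)"
    using locally_lipschitz[OF smooth_Ck[OF smooth_b], of R] by blast
  have "bounded (b ` cball 0 R)"
    by (intro compact_imp_bounded compact_continuous_image continuous_on_subset[OF b_continuous] compact_cball) auto
  then obtain K where "\<forall>y\<in>b ` cball 0 R. norm y <= K" unfolding bounded_iff by blast
  then have K: "norm (b q) <= K" if "norm q <= R" for q using that by auto
  define C where "C = (K + R)\<^sup>2 / 2 + L * (K + 2 * R)\<^sup>2"
  have "(\<integral>\<^sup>+om. (\<Prod>k\<le>n. f k (euler h om k)) \<partial>M)
     <= ennreal (exp (\<beta> * (h\<^sup>2 * C))) ^ n * (\<integral>\<^sup>+om. (\<Prod>k\<le>n. f (n - k) (flip_p (euler h om k))) \<partial>M)"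
    if h: "0 < h" "h <= 1" and n: "0 < n" and f: "!!k. f k \<in> borel_measurable borel" "!!k x. norm x > R ==> f k x = 0"
    for h n and f :: "nat => 'd state => ennreal"
  proof -
    interpret potential_scheme \<alpha> \<beta> \<sigma> h b U
      using reversible_scheme[OF h(1)] U h(2) by (simp add: potential_scheme_def potential_scheme_axioms_def)
    have law: "(\<integral>\<^sup>+om. (\<Prod>k\<le>n. f k (euler h om k)) \<partial>M) = ennreal c * (NN x. boltz x * fwd (map f [0..<Suc n]) x)"
      if f: "!!k. f k \<in> borel_measurable borel" for f
    proof -
      have fw: "fwd (map f [0..<Suc n]) \<in> borel_measurable borel" using f by (intro fwd_measurable) auto
      define G where "G x w = (\<Prod>k\<le>n. f k (traj b \<alpha> \<sigma> h x w k))" for x w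
      have Gm: "(%y. G (fst y) (snd y)) \<in> borel_measurable (borel \<Otimes>\<^sub>M PiM {..<n} (%_. borel))" unfolding G_def
        by (intro borel_measurable_prod_ennreal measurable_compose[OF traj_measurable f] measurable_fst
            measurable_compose[OF measurable_snd measurable_component_singleton]) auto
      have "(\<integral>\<^sup>+om. (\<Prod>k\<le>n. f k (euler h om k)) \<partial>M)
        = (\<integral>\<^sup>+om. G (X 0 om) (\<lambda>k\<in>{..<n}. B (real (Suc k) * h) om - B (real k * h) om) \<partial>M)" unfolding G_def euler_def
        by (intro nn_integral_cong prod.cong refl arg_cong[where f = "f _"] traj_cong) auto
      also have "... = (NN x. ennreal (\<rho> x) * (\<integral>\<^sup>+w. G x w \<partial>PiM {..<n} (%_. noise)))"
        by (rule increments_law(2)[OF h(1) Gm n])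
      also have "... = (NN x. ennreal (\<rho> x) * fwd (map f [0..<Suc n]) x)"
        unfolding G_def using f by (subst scheme_law[OF increments_law(1)[OF h(1) Gm n]]) auto
      also have "... = (NN x. ennreal c * (boltz x * fwd (map f [0..<Suc n]) x))"
      proof (rule nn_integral_cong_AE)
        show "AE x in lborel. ennreal (\<rho> x) * fwd (map f [0..<Suc n]) x = ennreal c * (boltz x * fwd (map f [0..<Suc n]) x)"
          using gibbs
        proof eventually_elim
          case (elim x)
          have "ennreal (\<rho> x) = ennreal c * boltz x" unfolding elim boltz_def using c by (intro ennreal_mult) auto
          then show ?case by (simp add: mult.assoc)
        qed
      qed
      also have "... = ennreal c * (NN x. boltz x * fwd (map f [0..<Suc n]) x)"
        using fw by (intro nn_integral_cmult) simp
      finally show ?thesis .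
    qed
    have "chain_error R (h\<^sup>2 * C)" unfolding chain_error_def C_def using energy_error[OF L K] by blast
    from fwd_reverse_le[OF this, of "map f [0..<Suc n]"]
    have "(NN x. boltz x * fwd (map f [0..<Suc n]) x)
      <= ennreal (exp (\<beta> * (h\<^sup>2 * C))) ^ n * (NN x. boltz x * fwd (map (%f x. f (flip_p x)) (rev (map f [0..<Suc n]))) x)"
      using f by (simp del: upt_Suc)
    moreover have "map (%f x. f (flip_p x)) (rev (map f [0..<Suc n])) = map (%k x. f (n - k) (flip_p x)) [0..<Suc n]"
      by (rule nth_equalityI) (auto simp: rev_nth simp del: upt_Suc)
    ultimately have le: "(NN x. boltz x * fwd (map f [0..<Suc n]) x)
      <= ennreal (exp (\<beta> * (h\<^sup>2 * C))) ^ n * (NN x. boltz x * fwd (map (%k x. f (n - k) (flip_p x)) [0..<Suc n]) x)"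
      by simp
    have fm: "(%x. f (n - k) (flip_p x)) \<in> borel_measurable borel" for k
      by (rule measurable_compose[OF measurable_flip_p f(1)])
    have "(\<integral>\<^sup>+om. (\<Prod>k\<le>n. f k (euler h om k)) \<partial>M) = ennreal c * (NN x. boltz x * fwd (map f [0..<Suc n]) x)"
      by (rule law[OF f(1)])
    also have "... <= ennreal c * (ennreal (exp (\<beta> * (h\<^sup>2 * C))) ^ n * (NN x. boltz x * fwd (map (%k x. f (n - k) (flip_p x)) [0..<Suc n]) x))"
      by (intro mult_left_mono le) simp
    also have "... = ennreal (exp (\<beta> * (h\<^sup>2 * C))) ^ n * (ennreal c * (NN x. boltz x * fwd (map (%k x. f (n - k) (flip_p x)) [0..<Suc n]) x))"
      by (simp only: mult.left_commute)
    also have "ennreal c * (NN x. boltz x * fwd (map (%k x. f (n - k) (flip_p x)) [0..<Suc n]) x)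
      = (\<integral>\<^sup>+om. (\<Prod>k\<le>n. f (n - k) (flip_p (euler h om k))) \<partial>M)" by (rule law[OF fm, symmetric])
    finally show ?thesis .
  qed
  then show ?thesis by (intro exI[of _ C]) blast
qed

text \<open>Two applications of Fatou's lemma: first the mesh of the scheme tends to zero, then the cutoff
  \<open>R\<close> tends to infinity.\<close>
lemma reversal_le: assumes U: "!!q. GDERIV U q :> - b q" and c: "c > 0"
    and gibbs: "AE x in lborel. \<rho> x = c * exp (- \<beta> * hamiltonian U x)"
    and T: "T > 0" and J: "finite J" "J \<subseteq> {0..T}"
    and \<phi>: "!!t. t \<in> J ==> continuous_on UNIV (\<phi> t)" "!!t x. t \<in> J ==> 0 <= \<phi> t x" "!!t x. t \<in> J ==> \<phi> t x <= (1::real)"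
  shows "(\<integral>\<^sup>+om. ennreal (\<Prod>t\<in>J. \<phi> t (X t om)) \<partial>M) <= (\<integral>\<^sup>+om. ennreal (\<Prod>t\<in>J. \<phi> t (flip_p (X (T - t) om))) \<partial>M)"
proof -
  have \<phi>m: "\<phi> t \<in> borel_measurable borel" if "t \<in> J" for t
    using \<phi>(1)[OF that] by (rule borel_measurable_continuous_onI)
  have flip_cont: "continuous_on UNIV (flip_p :: 'd state => 'd state)"
    unfolding flip_p_def split_beta' by (intro continuous_intros)
  \<comment> \<open>Index of the last grid point not after \<open>t\<close> on the grid of mesh
    \<open>T / n\<close>; its mirror image \<open>n - k n t\<close> belongs to a time near
    \<open>T - t\<close>.\<close>
  define k where "k n t = nat \<lfloor>t * real n / T\<rfloor>" for n :: nat and t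
  have k_le: "k n t <= n" if "t \<in> J" for n t unfolding k_def using J(2) that T by (intro grid_le) auto
  have k_lim: "(%n. real (k n t) * (T / real n)) ----> t" if "t \<in> J" for t
    unfolding k_def using J(2) that T by (intro grid_limit) auto
  have k_lim': "(%n. real (n - k n t) * (T / real n)) ----> T - t" if "t \<in> J" for t
  proof -
    have "(%n. T - real (k n t) * (T / real n)) ----> T - t" by (intro tendsto_intros k_lim that)
    moreover have "\<forall>\<^sub>F n in sequentially. T - real (k n t) * (T / real n) = real (n - k n t) * (T / real n)"
      using k_le[OF that] by (intro eventually_sequentiallyI[of 1]) (auto simp: of_nat_diff left_diff_distrib diff_divide_distrib)
    ultimately show ?thesis by (rule Lim_transform_eventually)
  qed
  \<comment> \<open>Stated for arbitrary sequences of indices whose times converge, so that it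
    serves both the forward and the mirrored indices outside one null set.\<close>
  have conv: "AE om in M. \<forall>m s. (\<forall>n. m n <= n) & s \<in> {0..T} & (%n. real (m n) * (T / real n)) ----> s
      --> (%n. euler (T / real n) om (m n)) ----> X s om" using euler_converges[OF T] AE_continuous
  proof eventually_elim
    case (elim om)
    show ?case
    proof (intro allI impI, elim conjE)
      fix m s assume m: "\<forall>n. m n <= n" and s: "s \<in> {0..T}" and lim: "(%n. real (m n) * (T / real n)) ----> s"
      have "(%n. X (real (m n) * (T / real n)) om) ----> X s om"
        using s T by (intro continuous_on_tendsto_compose[OF elim(2) lim]) auto
      moreover have "(%n. dist (euler (T / real n) om (m n)) (X (real (m n) * (T / real n)) om)) ----> 0"
      proof (rule tendstoI)
        fix e :: real assume "e > 0"
        then have "\<forall>\<^sub>F n in sequentially. \<forall>k\<le>n. err (euler (T / real n) om k) (X (real k * (T / real n)) om) <= e / 2"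
          by (intro elim(1)[rule_format]) simp
        then show "\<forall>\<^sub>F n in sequentially. dist (dist (euler (T / real n) om (m n)) (X (real (m n) * (T / real n)) om)) 0 < e"
        proof eventually_elim
          case (elim n)
          then have "err (euler (T / real n) om (m n)) (X (real (m n) * (T / real n)) om) <= e / 2" using m by blast
          then have "dist (euler (T / real n) om (m n)) (X (real (m n) * (T / real n)) om) < e"
            using dist_le_err \<open>e > 0\<close> by (smt (verit) field_sum_of_halves)
          then show ?case by simp
        qed
      qed
      ultimately have "(%n. dist (euler (T / real n) om (m n)) (X (real (m n) * (T / real n)) om)
          + dist (X (real (m n) * (T / real n)) om) (X s om)) ----> 0 + 0"
        by (intro tendsto_add iffD1[OF tendsto_dist_iff])
      then have lim0: "(%n. dist (euler (T / real n) om (m n)) (X (real (m n) * (T / real n)) om)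
          + dist (X (real (m n) * (T / real n)) om) (X s om)) ----> 0" by (simp only: add_0)
      have "(%n. dist (euler (T / real n) om (m n)) (X s om)) ----> 0"
        by (rule real_tendsto_sandwich[OF always_eventually always_eventually tendsto_const lim0])
          (intro allI zero_le_dist dist_triangle)+
      then show "(%n. euler (T / real n) om (m n)) ----> X s om" by (rule iffD2[OF tendsto_dist_iff])
    qed
  qed
  have lim1: "AE om in M. (%n. ennreal (\<Prod>t\<in>J. \<phi> t (euler (T / real n) om (k n t)))) ----> ennreal (\<Prod>t\<in>J. \<phi> t (X t om))"
    using conv
  proof eventually_elim
    case (elim om)
    show ?case
    proof (intro tendsto_ennrealI tendsto_prod)
      fix t assume t: "t \<in> J"
      have "(%n. euler (T / real n) om (k n t)) ----> X t om"
        using elim[rule_format, of "%n. k n t" t] k_le[OF t] k_lim[OF t] J(2) t by blast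
      then show "(%n. \<phi> t (euler (T / real n) om (k n t))) ----> \<phi> t (X t om)"
        by (intro continuous_on_tendsto_compose[OF \<phi>(1)[OF t]]) auto
    qed
  qed
  have lim2: "AE om in M. (%n. ennreal (\<Prod>t\<in>J. \<phi> t (flip_p (euler (T / real n) om (n - k n t)))))
      ----> ennreal (\<Prod>t\<in>J. \<phi> t (flip_p (X (T - t) om)))" using conv
  proof eventually_elim
    case (elim om)
    show ?case
    proof (intro tendsto_ennrealI tendsto_prod)
      fix t assume t: "t \<in> J"
      then have "T - t \<in> {0..T}" using J(2) by auto
      then have "(%n. euler (T / real n) om (n - k n t)) ----> X (T - t) om"
        using elim[rule_format, of "%n. n - k n t" "T - t"] k_lim'[OF t] by simp
      then show "(%n. \<phi> t (flip_p (euler (T / real n) om (n - k n t)))) ----> \<phi> t (flip_p (X (T - t) om))"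
        by (intro continuous_on_tendsto_compose[OF \<phi>(1)[OF t]] continuous_on_tendsto_compose[OF flip_cont]) auto
    qed
  qed
  have em: "(%om. euler (T / real n) om j) \<in> borel_measurable M" if "j <= n" for n j
  \<comment> \<open>For \<open>n = 0\<close> the mesh \<open>T / real n\<close> is 0 by convention,
    and only the initial state occurs.\<close>
  proof (cases "n = 0")
    case True
    then show ?thesis using that X_measurable[of 0] by (simp add: euler_def)
  next
    case False
    then show ?thesis using T by (intro euler_measurable) simp
  qed
  \<comment> \<open>Several times of \<open>J\<close> may share a grid point, so the observable at
    index \<open>j\<close> collects all of them; \<open>f\<close> adds the cutoff to the ball of
    radius \<open>r\<close> at every grid point.\<close>
  define \<psi> where "\<psi> n j y = (\<Prod>t\<in>J. if k n t = j then ennreal (\<phi> t y) else 1)" for n j y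
  define f where "f n r j y = \<psi> n j y * indicator (cball 0 r) y" for n r j and y :: "'d state"
  have \<psi>m: "\<psi> n j \<in> borel_measurable borel" for n j
    unfolding \<psi>_def using \<phi>m by (intro borel_measurable_prod_ennreal) auto
  have fm [measurable]: "f n r j \<in> borel_measurable borel" for n r j
  proof -
    have [measurable]: "\<psi> n j \<in> borel_measurable borel" by (rule \<psi>m)
    have [measurable]: "cball (0::'d state) r \<in> sets borel" by (intro borel_closed closed_cball)
    show ?thesis unfolding f_def by measurable
  qed
  have \<psi>_prod: "(\<Prod>j\<le>n. \<psi> n j (y j)) = ennreal (\<Prod>t\<in>J. \<phi> t (y (k n t)))" for n y
  proof -
    have "(\<Prod>j\<le>n. \<psi> n j (y j)) = (\<Prod>t\<in>J. \<Prod>j\<le>n. if k n t = j then ennreal (\<phi> t (y j)) else 1)"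
      unfolding \<psi>_def by (rule prod.swap)
    also have "... = (\<Prod>t\<in>J. ennreal (\<phi> t (y (k n t))))"
      by (intro prod.cong refl) (use k_le in \<open>auto simp: prod.delta'\<close>)
    finally show ?thesis using \<phi>(2) by (simp add: prod_ennreal)
  qed
  have ind_prod: "(\<Prod>j\<le>n. indicator (cball 0 r) (y j)) = (if \<forall>j\<le>n. norm (y j) <= r then 1 else 0 :: ennreal)"
    for n r and y :: "nat => 'd state"
  proof (cases "\<forall>j\<le>n. norm (y j) <= r")
    case False
    then obtain j where "j <= n" "~ norm (y j) <= r" by blast
    then have "(\<Prod>j\<le>n. indicator (cball 0 r) (y j)) = (0::ennreal)" by (intro prod_zero bexI[of _ j]) auto
    then show ?thesis using False by simp
  qed (auto intro!: prod.neutral)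
  define u where "u r n om = (\<Prod>j\<le>n. f n r j (euler (T / real n) om j))" for r n om
  define v where "v n om = ennreal (\<Prod>t\<in>J. \<phi> t (flip_p (euler (T / real n) om (n - k n t))))" for n om
  define V where "V om = ennreal (\<Prod>t\<in>J. \<phi> t (flip_p (X (T - t) om)))" for om
  have um: "u r n \<in> borel_measurable M" for r n
    unfolding u_def by (intro borel_measurable_prod_ennreal measurable_compose[OF em fm]) auto
  have vm: "v n \<in> borel_measurable M" for n unfolding v_def
    by (intro measurable_compose[OF _ measurable_ennreal] borel_measurable_prod measurable_compose[OF _ \<phi>m]
        measurable_compose[OF em measurable_flip_p]) auto
  have Vm: "V \<in> borel_measurable M" unfolding V_def using J(2)
    by (intro measurable_compose[OF _ measurable_ennreal] borel_measurable_prod measurable_compose[OF _ \<phi>m]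
        measurable_compose[OF X_measurable measurable_flip_p]) auto
  have u_eq: "u r n om = ennreal (\<Prod>t\<in>J. \<phi> t (euler (T / real n) om (k n t)))
      * (if \<forall>j\<le>n. norm (euler (T / real n) om j) <= r then 1 else 0)" for r n om
    unfolding u_def f_def prod.distrib \<psi>_prod ind_prod ..
  \<comment> \<open>On the reversed side the cutoff is dropped, which is allowed in an upper
    bound.\<close>
  have v_ge: "(\<Prod>j\<le>n. f n r (n - j) (flip_p (euler (T / real n) om j))) <= v n om" for r n om
  proof -
    have "(\<Prod>j\<le>n. \<psi> n (n - j) (flip_p (euler (T / real n) om j)))
      = (\<Prod>j\<le>n. \<psi> n j (flip_p (euler (T / real n) om (n - j))))"
      by (rule prod.reindex_bij_witness[of _ "%j. n - j" "%j. n - j"]) auto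
    also have "... = v n om" unfolding \<psi>_prod v_def ..
    finally show ?thesis unfolding f_def prod.distrib ind_prod by simp
  qed
  have fatou: "(\<integral>\<^sup>+om. liminf (%n. u r n om) \<partial>M) <= (\<integral>\<^sup>+om. V om \<partial>M)" for r
  proof -
    obtain C where C: "!!h n f. 0 < h ==> h <= 1 ==> 0 < n ==> (!!k. f k \<in> borel_measurable borel)
        ==> (!!k x. norm x > r ==> f k x = (0::ennreal)) ==> (\<integral>\<^sup>+om. (\<Prod>k\<le>n. f k (euler h om k)) \<partial>M)
     <= ennreal (exp (\<beta> * (h\<^sup>2 * C))) ^ n * (\<integral>\<^sup>+om. (\<Prod>k\<le>n. f (n - k) (flip_p (euler h om k))) \<partial>M)"
      using scheme_reverse_le[OF U c gibbs, of r] by blast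
    \<comment> \<open>The accumulated factor: \<open>n\<close> steps with exponent
      \<open>\<beta> * C * (T / n)^2\<close> each, which tends to 1.\<close>
    let ?E = "%n. ennreal (exp (\<beta> * C * T\<^sup>2 / real n))"
    have ev: "\<forall>\<^sub>F n in sequentially. (\<integral>\<^sup>+om. u r n om \<partial>M) <= ?E n * (\<integral>\<^sup>+om. v n om \<partial>M)"
    proof -
      have "\<forall>\<^sub>F n in sequentially. T / real n < 1" by (rule order_tendstoD(2)[OF lim_const_over_n]) simp
      then show ?thesis using eventually_gt_at_top[of 0]
      proof eventually_elim
        case (elim n)
        have "(\<integral>\<^sup>+om. u r n om \<partial>M) <= ennreal (exp (\<beta> * ((T / real n)\<^sup>2 * C))) ^ n
          * (\<integral>\<^sup>+om. (\<Prod>j\<le>n. f n r (n - j) (flip_p (euler (T / real n) om j))) \<partial>M)"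
          unfolding u_def using elim T by (intro C fm) (auto simp: f_def)
        also have "... <= ennreal (exp (\<beta> * ((T / real n)\<^sup>2 * C))) ^ n * (\<integral>\<^sup>+om. v n om \<partial>M)"
          by (intro mult_left_mono nn_integral_mono v_ge) simp
        also have "ennreal (exp (\<beta> * ((T / real n)\<^sup>2 * C))) ^ n = ?E n"
          using elim by (simp add: ennreal_power exp_of_nat_mult[symmetric] power2_eq_square)
        finally show ?case .
      qed
    qed
    have "(%n. \<integral>\<^sup>+om. v n om \<partial>M) ----> (\<integral>\<^sup>+om. V om \<partial>M)"
    proof (rule nn_integral_dominated_convergence[where w = "%_. 1", OF vm Vm])
      show "AE om in M. v j om <= 1" for j
        unfolding v_def ennreal_le_1 by (intro AE_I2 prod_le_1) (blast intro: \<phi>(2,3))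
      show "AE om in M. (%n. v n om) ----> V om" using lim2 by (simp only: v_def V_def)
    qed (auto simp: emeasure_space_1)
    moreover have "?E ----> ennreal (exp 0)" by (intro tendsto_ennrealI tendsto_exp lim_const_over_n)
    ultimately have "(%n. ?E n * (\<integral>\<^sup>+om. v n om \<partial>M)) ----> ennreal (exp 0) * (\<integral>\<^sup>+om. V om \<partial>M)"
      by (intro tendsto_mult_ennreal) auto
    then have L: "liminf (%n. ?E n * (\<integral>\<^sup>+om. v n om \<partial>M)) = (\<integral>\<^sup>+om. V om \<partial>M)" by (subst lim_imp_Liminf) auto
    have "(\<integral>\<^sup>+om. liminf (%n. u r n om) \<partial>M) <= liminf (%n. \<integral>\<^sup>+om. u r n om \<partial>M)" by (rule nn_integral_liminf) (rule um)
    also have "... <= liminf (%n. ?E n * (\<integral>\<^sup>+om. v n om \<partial>M))" by (rule Liminf_mono[OF ev])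
    finally show ?thesis unfolding L .
  qed
  have "(\<integral>\<^sup>+om. ennreal (\<Prod>t\<in>J. \<phi> t (X t om)) \<partial>M) = (\<integral>\<^sup>+om. liminf (%i. liminf (%n. u (real i) n om)) \<partial>M)"
  proof (rule nn_integral_cong_AE)
    show "AE om in M. ennreal (\<Prod>t\<in>J. \<phi> t (X t om)) = liminf (%i. liminf (%n. u (real i) n om))"
      using lim1 AE_continuous euler_converges[OF T]
    proof eventually_elim
      case (elim om)
      have "continuous_on {0..T} (%t. X t om)" using elim(2) by (rule continuous_on_subset) auto
      from interval_norm_bound[OF this] obtain K where K: "!!s. s \<in> {0..T} ==> norm (X s om) <= K" by blast
      \<comment> \<open>For a fixed path the cutoff is eventually inactive: the path is bounded by
        \<open>K\<close> on the interval, and the scheme stays within distance 1 of it.\<close>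
      have "liminf (%n. u (real i) n om) = ennreal (\<Prod>t\<in>J. \<phi> t (X t om))" if i: "real i >= K + 1" for i
      proof -
        have "\<forall>\<^sub>F n in sequentially. \<forall>j\<le>n. err (euler (T / real n) om j) (X (real j * (T / real n)) om) <= 1"
          using elim(3) zero_less_one by blast
        then have "\<forall>\<^sub>F n in sequentially. ennreal (\<Prod>t\<in>J. \<phi> t (euler (T / real n) om (k n t))) = u (real i) n om"
          using eventually_gt_at_top[of 0]
        proof eventually_elim
          case (elim n)
          have "norm (euler (T / real n) om j) <= real i" if "j <= n" for j
          proof -
            have "real j * (T / real n) \<in> {0..T}" using that elim T by (auto simp: field_simps)
            from K[OF this] have "norm (X (real j * (T / real n)) om) <= K" .
            moreover have "dist (euler (T / real n) om j) (X (real j * (T / real n)) om) <= 1"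
              using elim that dist_le_err order_trans by blast
            ultimately show ?thesis
              using i norm_triangle_sub[of "euler (T / real n) om j" "X (real j * (T / real n)) om"]
              unfolding dist_norm by linarith
          qed
          then show ?case unfolding u_eq by simp
        qed
        from Lim_transform_eventually[OF elim(1) this] show ?thesis by (intro lim_imp_Liminf) auto
      qed
      moreover have "\<forall>\<^sub>F i in sequentially. real i >= K + 1"
        using filterlim_real_sequentially by (simp add: filterlim_at_top)
      ultimately have "\<forall>\<^sub>F i in sequentially. ennreal (\<Prod>t\<in>J. \<phi> t (X t om)) = liminf (%n. u (real i) n om)"
        by (auto elim: eventually_mono)
      from Lim_transform_eventually[OF tendsto_const this] show ?case by (intro lim_imp_Liminf[symmetric]) auto
    qed
  qed
  also have "... <= liminf (%i. \<integral>\<^sup>+om. liminf (%n. u (real i) n om) \<partial>M)"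
    using um by (intro nn_integral_liminf borel_measurable_liminf)
  also have "... <= liminf (%i::nat. \<integral>\<^sup>+om. V om \<partial>M)" using fatou by (intro Liminf_mono) auto
  also have "... = (\<integral>\<^sup>+om. V om \<partial>M)" by (rule Liminf_const) simp
  finally show ?thesis by (simp only: V_def)
qed

end

subsection \<open>Finite-dimensional distributions\<close>

lemma closed_indicator_limit:
  fixes C :: "'a::metric_space set" assumes "closed C" "C ~= {}"
  shows "(%n. max 0 (1 - real n * infdist x C)) ----> indicator C x"
proof (cases "x \<in> C")
  case True
  then show ?thesis by simp
next
  case False
  then have d: "infdist x C > 0" using assms in_closed_iff_infdist_zero[of C x] infdist_nonneg[of x C] by auto
  have "\<forall>\<^sub>F n in sequentially. real n >= 1 / infdist x C"
    using filterlim_real_sequentially by (simp add: filterlim_at_top)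
  then have "\<forall>\<^sub>F n in sequentially. 0 = max 0 (1 - real n * infdist x C)"
    by eventually_elim (use d in \<open>simp add: divide_le_eq max_def\<close>)
  from Lim_transform_eventually[OF tendsto_const this] show ?thesis using False by simp
qed

text \<open>Continuous functions with values in the unit interval decrease to indicators of closed
  sets, and products of closed sets are an intersection-stable generator of the finite product
  sigma-algebra.\<close>

lemma (in prob_space) fdd_eqI:
  fixes Y Y' :: "real => 'a => 'x::metric_space"
  assumes J: "finite J" and Y: "!!t. t \<in> J ==> Y t \<in> borel_measurable M" "!!t. t \<in> J ==> Y' t \<in> borel_measurable M"
    and eq: "!!\<phi>. (!!t. continuous_on UNIV (\<phi> t)) ==> (!!t x. 0 <= \<phi> t x) ==> (!!t x. \<phi> t x <= (1::real)) ==>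
      (\<integral>\<^sup>+om. ennreal (\<Prod>t\<in>J. \<phi> t (Y t om)) \<partial>M) = (\<integral>\<^sup>+om. ennreal (\<Prod>t\<in>J. \<phi> t (Y' t om)) \<partial>M)"
  shows "fdd M Y J = fdd M Y' J"
proof -
  define g where "g n A x = max 0 (1 - real n * infdist x A)" for n and A :: "'x set" and x
  have gc: "continuous_on UNIV (g n A)" for n A unfolding g_def by (intro continuous_intros)
  have g01: "0 <= g n A x" "g n A x <= 1" for n A x by (auto simp: g_def infdist_nonneg)
  have lim: "(%n. \<integral>\<^sup>+om. ennreal (\<Prod>t\<in>J. g n (A t) (Z t om)) \<partial>M) ----> emeasure (fdd M Z J) (Pi\<^sub>E J A)"
    if Z: "!!t. t \<in> J ==> Z t \<in> borel_measurable M" and A: "!!t. t \<in> J ==> closed (A t)" "!!t. t \<in> J ==> A t ~= {}"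
    for Z :: "real => 'a => 'x" and A
  proof -
    have Zm: "(%om. \<lambda>t\<in>J. Z t om) \<in> measurable M (PiM J (%_. borel))" by (rule measurable_restrict) (rule Z)
    have PA: "Pi\<^sub>E J A \<in> sets (PiM J (%_. borel))" using J A by (intro sets_PiM_I_finite) auto
    have "(%n. \<integral>\<^sup>+om. ennreal (\<Prod>t\<in>J. g n (A t) (Z t om)) \<partial>M) ----> (\<integral>\<^sup>+om. indicator (Pi\<^sub>E J A) (\<lambda>t\<in>J. Z t om) \<partial>M)"
    proof (rule nn_integral_dominated_convergence[where w = "%_. 1"])
      show "(%om. ennreal (\<Prod>t\<in>J. g n (A t) (Z t om))) \<in> borel_measurable M" for n
        by (intro measurable_compose[OF _ measurable_ennreal] borel_measurable_prod
            measurable_compose[OF Z borel_measurable_continuous_onI[OF gc]])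
      show "(%om. indicator (Pi\<^sub>E J A) (\<lambda>t\<in>J. Z t om) :: ennreal) \<in> borel_measurable M"
        by (rule measurable_compose[OF Zm borel_measurable_indicator[OF PA]])
      show "AE om in M. ennreal (\<Prod>t\<in>J. g n (A t) (Z t om)) <= 1" for n
        unfolding ennreal_le_1 by (intro AE_I2 prod_le_1 conjI g01)
      have "(%n. ennreal (\<Prod>t\<in>J. g n (A t) (Z t om))) ----> ennreal (\<Prod>t\<in>J. indicator (A t) (Z t om))" for om
        unfolding g_def by (intro tendsto_ennrealI tendsto_prod closed_indicator_limit A)
      moreover have "ennreal (\<Prod>t\<in>J. indicator (A t) (Z t om)) = indicator (Pi\<^sub>E J A) (\<lambda>t\<in>J. Z t om)" for om
      proof (cases "\<forall>t\<in>J. Z t om \<in> A t")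
        case False
        then have "(\<Prod>t\<in>J. indicator (A t) (Z t om)) = (0::real)" using J by (intro prod_zero) (auto simp: indicator_def)
        then show ?thesis using False by (auto simp: indicator_def PiE_iff)
      qed (auto simp: indicator_def PiE_iff)
      ultimately show "AE om in M. (%n. ennreal (\<Prod>t\<in>J. g n (A t) (Z t om))) ----> indicator (Pi\<^sub>E J A) (\<lambda>t\<in>J. Z t om)"
        by simp
    qed (auto simp: emeasure_space_1)
    also have "(\<integral>\<^sup>+om. indicator (Pi\<^sub>E J A) (\<lambda>t\<in>J. Z t om) \<partial>M) = (\<integral>\<^sup>+y. indicator (Pi\<^sub>E J A) y \<partial>fdd M Z J)"
      unfolding fdd_def using PA by (intro nn_integral_distr[symmetric] Zm borel_measurable_indicator) simp
    also have "... = emeasure (fdd M Z J) (Pi\<^sub>E J A)" using PA by (simp add: fdd_def)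
    finally show ?thesis .
  qed
  let ?E = "{Pi\<^sub>E J A | A. \<forall>t\<in>J. closed (A t :: 'x set)}"
  have sets: "sets (PiM J (%_. borel :: 'x measure)) = sigma_sets (Pi\<^sub>E J (%_. UNIV)) ?E"
  proof -
    let ?P = "{{f \<in> Pi\<^sub>E J (%_. UNIV). \<forall>i\<in>j. f i \<in> A i} | A j. j \<in> {J} & A \<in> Pi j (%_. Collect closed)} :: (real => 'x) set set"
    have "sets (PiM J (%_. borel :: 'x measure)) = sets (sigma (Pi\<^sub>E J (%_. UNIV)) ?P)"
      unfolding borel_eq_closed using J by (intro sets_PiM_sigma) (auto intro!: exI[of _ "{UNIV}"])
    moreover have "{f \<in> Pi\<^sub>E J (%_. UNIV). \<forall>i\<in>J. f i \<in> A i} = Pi\<^sub>E J A" for A :: "real => 'x set"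
      by (auto simp: PiE_iff extensional_def)
    then have "?P = ?E" by (auto simp: Pi_iff)
    moreover have "?E \<subseteq> Pow (Pi\<^sub>E J (%_. UNIV))" by (auto simp: PiE_iff)
    ultimately show ?thesis by (simp only: sets_measure_of)
  qed
  show ?thesis
  proof (rule measure_eqI_generator_eq[where E = ?E and \<Omega> = "Pi\<^sub>E J (%_. UNIV)" and A = "%_. Pi\<^sub>E J (%_. UNIV)"])
    show "Int_stable ?E" unfolding Int_stable_def
    proof safe
      fix A A' assume "\<forall>t\<in>J. closed (A t :: 'x set)" "\<forall>t\<in>J. closed (A' t :: 'x set)"
      then show "\<exists>D. Pi\<^sub>E J A \<inter> Pi\<^sub>E J A' = Pi\<^sub>E J D & (\<forall>t\<in>J. closed (D t))"
        by (intro exI[of _ "%t. A t \<inter> A' t"]) (simp add: PiE_Int closed_Int)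
    qed
    fix S assume "S \<in> ?E"
    then obtain A where S: "S = Pi\<^sub>E J A" and A: "!!t. t \<in> J ==> closed (A t)" by blast
    show "emeasure (fdd M Y J) S = emeasure (fdd M Y' J) S"
    \<comment> \<open>The distance to the empty set is 0 by convention, so the approximating
      functions would be constantly 1; rectangles with an empty side are treated separately.\<close>
    proof (cases "\<exists>t\<in>J. A t = {}")
      case True
      then show ?thesis unfolding S by (auto simp: PiE_eq_empty_iff)
    next
      case False
      then have ne: "A t ~= {}" if "t \<in> J" for t using that by blast
      have "(\<integral>\<^sup>+om. ennreal (\<Prod>t\<in>J. g n (A t) (Y t om)) \<partial>M) = (\<integral>\<^sup>+om. ennreal (\<Prod>t\<in>J. g n (A t) (Y' t om)) \<partial>M)" for n
        by (intro eq gc g01)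
      then show ?thesis unfolding S using LIMSEQ_unique[OF lim[OF Y(1) A ne]] lim[OF Y(2) A ne] by simp
    qed
  next
    have "prob_space (fdd M Y J)" unfolding fdd_def by (intro prob_space_distr measurable_restrict Y)
    then show "emeasure (fdd M Y J) (Pi\<^sub>E J (%_. UNIV)) ~= \<infinity>" for i :: nat
      using finite_measure.emeasure_finite[OF prob_space.finite_measure] by simp
  qed (auto simp: fdd_def sets PiE_iff)
qed

context langevin_process
begin

lemma reversible_of_potential: assumes U: "!!q. GDERIV U q :> - b q" and c: "c > 0"
    and gibbs: "AE x in lborel. \<rho> x = c * exp (- \<beta> * hamiltonian U x)" shows "reversible_process M X"
proof -
  have flip_cont: "continuous_on UNIV (flip_p :: 'd state => 'd state)"
    unfolding flip_p_def split_beta' by (intro continuous_intros)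
  have rev: "(\<integral>\<^sup>+om. ennreal (\<Prod>t\<in>J. \<phi> t (flip_p (X (T - t) om))) \<partial>M) = (\<integral>\<^sup>+om. ennreal (\<Prod>t\<in>J. \<phi> t (X t om)) \<partial>M)"
    if T: "T > 0" and J: "finite J" "J \<subseteq> {0..T}"
      and \<phi>: "!!t. continuous_on UNIV (\<phi> t)" "!!t x. 0 <= \<phi> t x" "!!t x. \<phi> t x <= 1" for T J and \<phi> :: "real => 'd state => real"
  proof (rule antisym)
    \<comment> \<open>The opposite inequality is the same lemma for the mirrored times and the
      flipped observables, as reversing twice is the identity.\<close>
    let ?J = "(%t. T - t) ` J"
    have inj: "inj_on (%t. T - t) J" by (auto simp: inj_on_def)
    have "(\<integral>\<^sup>+om. ennreal (\<Prod>s\<in>?J. \<phi> (T - s) (flip_p (X s om))) \<partial>M)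
      <= (\<integral>\<^sup>+om. ennreal (\<Prod>s\<in>?J. \<phi> (T - s) (flip_p (flip_p (X (T - s) om)))) \<partial>M)" using J \<phi>(2,3)
      by (intro reversal_le[OF U c gibbs T, where \<phi> = "%s x. \<phi> (T - s) (flip_p x)"])
        (auto intro!: continuous_on_compose2[OF \<phi>(1) flip_cont])
    then show "(\<integral>\<^sup>+om. ennreal (\<Prod>t\<in>J. \<phi> t (flip_p (X (T - t) om))) \<partial>M) <= (\<integral>\<^sup>+om. ennreal (\<Prod>t\<in>J. \<phi> t (X t om)) \<partial>M)"
      by (simp add: prod.reindex[OF inj])
    show "(\<integral>\<^sup>+om. ennreal (\<Prod>t\<in>J. \<phi> t (X t om)) \<partial>M) <= (\<integral>\<^sup>+om. ennreal (\<Prod>t\<in>J. \<phi> t (flip_p (X (T - t) om))) \<partial>M)"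
      using J \<phi> by (intro reversal_le[OF U c gibbs T])
  qed
  show ?thesis unfolding reversible_process_def stationary_process_def
  proof (intro conjI allI impI)
    fix T :: real and J :: "real set" assume T: "T > 0" and J: "finite J & J \<subseteq> {0..T}"
    show "fdd M (%t om. flip_p (X (T - t) om)) J = fdd M X J"
      using J by (intro fdd_eqI rev T measurable_compose[OF X_measurable measurable_flip_p] X_measurable) auto
  next
    fix h :: real and J :: "real set" assume h: "h >= 0" and J: "finite J & J \<subseteq> {0..}"
    show "fdd M (%t. X (t + h)) J = fdd M X J"
    proof (rule fdd_eqI)
      fix \<phi> :: "real => 'd state => real"
      assume \<phi>: "!!t. continuous_on UNIV (\<phi> t)" "!!t x. 0 <= \<phi> t x" "!!t x. \<phi> t x <= 1"
      have "bounded J" using J finite_imp_bounded by blast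
      then obtain T0 where T0: "!!t. t \<in> J ==> norm t <= T0" unfolding bounded_iff by blast
      \<comment> \<open>The maximum with 1 makes the horizon positive even if \<open>J\<close> is
        empty or contains only 0.\<close>
      define T where "T = max T0 1"
      have T: "T > 0" "J \<subseteq> {0..T}" using T0 J by (auto simp: T_def subset_iff max_def dest!: T0)
      let ?J = "(%t. t + h) ` J"
      have inj: "inj_on (%t. t + h) J" by (auto simp: inj_on_def)
      \<comment> \<open>Reversal over \<open>T + h\<close> maps the shifted time
        \<open>t + h\<close> to \<open>T - t\<close>, which is also where reversal over
        \<open>T\<close> maps \<open>t\<close>.\<close>
      have "(\<integral>\<^sup>+om. ennreal (\<Prod>t\<in>?J. \<phi> (t - h) (flip_p (X (T + h - t) om))) \<partial>M) = (\<integral>\<^sup>+om. ennreal (\<Prod>t\<in>?J. \<phi> (t - h) (X t om)) \<partial>M)"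
        using T h J \<phi> by (intro rev[of "T + h" ?J "%t. \<phi> (t - h)"]) auto
      then have "(\<integral>\<^sup>+om. ennreal (\<Prod>t\<in>J. \<phi> t (flip_p (X (T - t) om))) \<partial>M) = (\<integral>\<^sup>+om. ennreal (\<Prod>t\<in>J. \<phi> t (X (t + h) om)) \<partial>M)"
        by (simp add: prod.reindex[OF inj])
      moreover have "(\<integral>\<^sup>+om. ennreal (\<Prod>t\<in>J. \<phi> t (flip_p (X (T - t) om))) \<partial>M) = (\<integral>\<^sup>+om. ennreal (\<Prod>t\<in>J. \<phi> t (X t om)) \<partial>M)"
        using T J \<phi> by (intro rev) auto
      ultimately show "(\<integral>\<^sup>+om. ennreal (\<Prod>t\<in>J. \<phi> t (X (t + h) om)) \<partial>M) = (\<integral>\<^sup>+om. ennreal (\<Prod>t\<in>J. \<phi> t (X t om)) \<partial>M)" by simp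
    qed (use J h in \<open>auto intro!: X_measurable\<close>)
  qed
qed

end

section \<open>The generator as a short-time limit\<close>

subsection \<open>Moments of the heat kernel\<close>

lemma has_bochner_integral_lborel_prod:
  fixes f :: "'a::euclidean_space => real => real" assumes f: "!!b. b \<in> Basis ==> integrable lborel (f b)"
  shows "has_bochner_integral lborel (%x. \<Prod>b\<in>Basis. f b (x \<bullet> b)) (\<Prod>b\<in>Basis. LB x. f b x)"
proof -
  interpret product_sigma_finite "%_::'a. lborel :: real measure"
    by (simp add: product_sigma_finite_def lborel.sigma_finite_measure_axioms)
  let ?P = "\<Pi>\<^sub>M b\<in>(Basis::'a set). (lborel :: real measure)" and ?S = "%y. \<Sum>b\<in>(Basis::'a set). y b *R b"
  have S: "?S \<in> measurable ?P borel" by (intro borel_measurable_sum borel_measurable_scaleR borel_measurable_const)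
      (use measurable_component_singleton[of _ Basis "%_. lborel :: real measure"] in simp)
  have m: "(%x. \<Prod>b\<in>Basis. f b (x \<bullet> b)) \<in> borel_measurable borel"
  proof (rule borel_measurable_prod)
    fix b :: 'a assume "b \<in> Basis"
    then have "f b \<in> borel_measurable borel" using borel_measurable_integrable[OF f] by simp
    then show "(%x. f b (x \<bullet> b)) \<in> borel_measurable borel" by measurable
  qed
  have eq: "(\<Prod>b\<in>Basis. f b (?S y \<bullet> b)) = (\<Prod>b\<in>Basis. f b (y b))" for y
    by (intro prod.cong refl) (simp add: inner_sum_left_Basis)
  have "integrable ?P (%y. \<Prod>b\<in>Basis. f b (y b))" by (intro product_integrable_prod f finite_Basis)
  then have "integrable lborel (%x. \<Prod>b\<in>Basis. f b (x \<bullet> b))"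
    unfolding lborel_eq[where 'a = 'a] using integrable_distr_eq[OF S m] by (simp only: eq)
  moreover have "(LB x. (\<Prod>b\<in>Basis. f b (x \<bullet> b))) = (\<Prod>b\<in>Basis. LB x. f b x)"
  proof -
    have "(\<integral>x. (\<Prod>b\<in>Basis. f b (x \<bullet> b)) \<partial>(lborel :: 'a measure)) = (\<integral>y. (\<Prod>b\<in>Basis. f b (y b)) \<partial>?P)"
      unfolding lborel_eq[where 'a = 'a] integral_distr[OF S m] by (simp only: eq)
    also have "... = (\<Prod>b\<in>Basis. LB x. f b x)" by (intro product_integral_prod f finite_Basis)
    finally show ?thesis .
  qed
  ultimately show ?thesis by (simp add: has_bochner_integral_iff)
qed

lemma prod_Basis_vec: "(\<Prod>b\<in>(Basis :: (real^'d) set). F b) = (\<Prod>k\<in>UNIV. F (axis k 1))"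
proof -
  have B: "(Basis :: (real^'d) set) = (%k. axis k 1) ` UNIV" by (auto simp: Basis_vec_def)
  have I: "inj (%k. axis k 1 :: real^'d)" by (auto simp: inj_on_def axis_eq_axis)
  show ?thesis unfolding B by (rule prod.reindex[OF I, unfolded o_def])
qed

lemma heat_moment:
  fixes m :: "'d::finite => nat" assumes t: "t > 0"
  shows "has_bochner_integral lborel (%y. heat t y * (\<Prod>k\<in>UNIV. (y $ k) ^ m k))
    (\<Prod>k\<in>UNIV. LB x. normal_density 0 (sqrt t) x * x ^ m k)"
proof -
  \<comment> \<open>The product formula is indexed by basis vectors; the description operator
    recovers the coordinate that belongs to each of them.\<close>
  define f where "f b x = normal_density 0 (sqrt t) x * x ^ m (THE k. b = axis k 1)" for b :: "real^'d" and x
  have the: "(THE k. axis i 1 = (axis k 1 :: real^'d)) = i" for i by (rule the_equality) (auto simp: axis_eq_axis)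
  have "integrable lborel (f b)" for b
    using integrable_normal_moment[of "sqrt t" 0] t by (simp add: f_def[abs_def])
  from has_bochner_integral_lborel_prod[of f, OF this] show ?thesis unfolding prod_Basis_vec f_def the
    by (simp add: heat_def prod.distrib inner_axis)
qed

lemma normal_moments: assumes "t > 0" shows "(LB x. normal_density 0 (sqrt t) x) = 1"
    "(LB x. normal_density 0 (sqrt t) x * x) = 0"
    "(LB x. normal_density 0 (sqrt t) x * x ^ 2) = t"
    "(LB x. normal_density 0 (sqrt t) x * x ^ 4) = 3 * t\<^sup>2"
proof -
  have s: "sqrt t > 0" "(sqrt t)\<^sup>2 = t" using assms by auto
  show "(LB x. normal_density 0 (sqrt t) x) = 1" using s(1) by (simp add: integral_normal_density)
  show "(LB x. normal_density 0 (sqrt t) x * x) = 0" using integral_normal_moment_nz_1[OF s(1), of 0] by simp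
  have "(LB x. normal_density 0 (sqrt t) x * (x - 0) ^ (2 * 1)) = fact (2 * 1) / ((2 / (sqrt t)\<^sup>2) ^ 1 * fact 1)"
    by (rule integral_normal_moment_even[OF s(1)])
  then show "(LB x. normal_density 0 (sqrt t) x * x ^ 2) = t" unfolding s(2) by (simp add: fact_numeral)
  have "(LB x. normal_density 0 (sqrt t) x * (x - 0) ^ (2 * 2)) = fact (2 * 2) / ((2 / (sqrt t)\<^sup>2) ^ 2 * fact 2)"
    by (rule integral_normal_moment_even[OF s(1)])
  then show "(LB x. normal_density 0 (sqrt t) x * x ^ 4) = 3 * t\<^sup>2"
    unfolding s(2) using assms by (simp add: fact_numeral power2_eq_square field_simps)
qed

lemma mult_if_delta': "c * (if i = j then 1 else 0) = (if i = j then c else (0::real))" by simp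

lemma prod_power_if: "(\<Prod>k\<in>UNIV. (y $ k) ^ (if k = i then n else 0)) = (y $ i) ^ n" for y :: "real^'d"
proof -
  have "(\<Prod>k\<in>UNIV. (y $ k) ^ (if k = i then n else 0)) = (\<Prod>k\<in>UNIV. if k = i then (y $ i) ^ n else 1)"
    by (intro prod.cong) auto
  then show ?thesis by simp
qed

lemma heat_moment_single:
  fixes i :: "'d::finite" assumes "t > 0"
  shows "has_bochner_integral lborel (%y. heat t y * (y $ i) ^ n) (LB x. normal_density 0 (sqrt t) x * x ^ n)"
proof -
  have "(\<Prod>k\<in>(UNIV::'d set). LB x. normal_density 0 (sqrt t) x * x ^ (if k = i then n else 0))
    = (\<Prod>k\<in>(UNIV::'d set). if k = i then (LB x. normal_density 0 (sqrt t) x * x ^ n) else 1)"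
    using normal_moments[OF assms] by (intro prod.cong) auto
  then show ?thesis using heat_moment[OF assms, of "%k. if k = i then n else 0"] by (simp add: prod_power_if)
qed

lemma heat_moment_pair:
  fixes i j :: "'d::finite" assumes "t > 0"
  shows "has_bochner_integral lborel (%y. heat t y * (y $ i * y $ j)) (if i = j then t else 0)"
proof (cases "i = j")
  case True
  then show ?thesis
    using heat_moment_single[OF assms, of i 2] normal_moments[OF assms] by (simp add: power2_eq_square)
next
  case False
  let ?m = "%k. (if k = i then 1 else 0) + (if k = j then 1 else 0::nat)"
  have z: "(\<Prod>k\<in>(UNIV::'d set). LB x. normal_density 0 (sqrt t) x * x ^ ?m k) = 0"
  proof (rule prod_zero[OF finite bexI[of _ i]])
    show "(LB x. normal_density 0 (sqrt t) x * x ^ ?m i) = 0" using False normal_moments[OF assms] by simp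
  qed simp
  have e: "(\<Prod>k\<in>UNIV. (y $ k) ^ ?m k) = y $ i * y $ j" for y :: "real^'d"
    unfolding power_add prod.distrib prod_power_if by simp
  show ?thesis using heat_moment[OF assms, of ?m] False unfolding z e by simp
qed

lemma integral_heat_scale:
  fixes F :: "real^'d => real" assumes [measurable]: "F \<in> borel_measurable borel" and s: "s > 0"
  shows "(LB y. heat (s\<^sup>2) y * F y) = (LB u. heat 1 u * F (s *R u))"
proof -
  have "lborel = density (distr lborel borel (%x::real^'d. 0 + s *R x)) (%_. ennreal (s ^ CARD('d)))"
    using lborel_affine[of s "0 :: real^'d"] s by (simp add: ennreal_power)
  then have "(LB y. heat (s\<^sup>2) y * F y)
    = (\<integral>y. heat (s\<^sup>2) y * F y \<partial>density (distr lborel borel (%x::real^'d. 0 + s *R x)) (%_. ennreal (s ^ CARD('d))))"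
    by (simp only: )
  also have "... = (\<integral>y. s ^ CARD('d) * (heat (s\<^sup>2) y * F y) \<partial>distr lborel borel (%x::real^'d. 0 + s *R x))"
    using s by (subst integral_density) auto
  also have "... = (LB u. s ^ CARD('d) * (heat (s\<^sup>2) (s *R u) * F (s *R u)))" by (subst integral_distr) auto
  also have "... = (LB u. heat 1 u * F (s *R u))"
  proof (rule Bochner_Integration.integral_cong[OF refl])
    fix u :: "real^'d"
    have "s ^ CARD('d) * heat (s\<^sup>2) (s *R u) = heat 1 u"
    proof -
      have a: "s * (1 / sqrt (2 * pi * s\<^sup>2)) = 1 / sqrt (2 * pi * 1)" using s by (simp add: real_sqrt_mult)
      have e: "- ((s *R u) \<bullet> (s *R u)) / (2 * s\<^sup>2) = - (u \<bullet> u) / (2 * 1)" using s by (simp add: power2_eq_square)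
      have "s\<^sup>2 > 0" using s by simp
      then show ?thesis
        unfolding heat_eq[OF \<open>s\<^sup>2 > 0\<close>] heat_eq[OF zero_less_one] e a[symmetric] power_mult_distrib by (simp only: mult.assoc)
    qed
    then show "s ^ CARD('d) * (heat (s\<^sup>2) (s *R u) * F (s *R u)) = heat 1 u * F (s *R u)"
      by (simp only: mult.assoc[symmetric])
  qed
  finally show ?thesis .
qed

subsection \<open>The noise\<close>

lemma pd_z:
  fixes g :: "'d::finite state => real" assumes "Ck 1 g" shows "pd (0, 0, v) g x = (\<Sum>i\<in>UNIV. v $ i * pd (ez i) g x)"
proof -
  obtain q p z where x: "x = (q, p, z)" by (metis surj_pair)
  have "pd (0, 0, v) g (q, p, z) = pd v (%z. g (q, p, z)) z" by (rule pd_slices(3)[OF assms, symmetric])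
  also have "... = (\<Sum>i\<in>UNIV. v $ i *R pd (axis i 1) (%z. g (q, p, z)) z)"
    by (rule pd_cart[OF Ck_slices(3)[OF assms]])
  also have "... = (\<Sum>i\<in>UNIV. v $ i * pd (ez i) g (q, p, z))" by (simp only: pd_slices(3)[OF assms] real_scaleR_def)
  finally show ?thesis unfolding x .
qed

lemma taylor_2:
  fixes g :: "'a::euclidean_space => real" assumes g: "Ck 2 g" and s: "s > 0"
  shows "\<exists>\<xi>. 0 < \<xi> & \<xi> < s & g (x + s *R w) = g x + s * pd w g x + s\<^sup>2 / 2 * pd w (pd w g) (x + \<xi> *R w)"
proof -
  have C: "Ck 1 g" "Ck 1 (pd w g)" using g Ck_le[of 1 2 g] Ck_pd[of 1 g w] by (auto simp: numeral_2_eq_2)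
  let ?d = "%(m::nat) t. if m = 0 then g (x + t *R w) else if m = 1 then pd w g (x + t *R w) else pd w (pd w g) (x + t *R w)"
  have "\<exists>\<xi>. 0 < \<xi> & \<xi> < s & g (x + s *R w) = (\<Sum>m<2. ?d m 0 / fact m * s ^ m) + ?d 2 \<xi> / fact 2 * s ^ 2"
  proof (rule Maclaurin[OF s, where diff = ?d])
    show "\<forall>m t. m < 2 & 0 <= t & t <= s --> DERIV (?d m) t :> ?d (Suc m) t"
    proof (intro allI impI)
      fix m :: nat and t assume "m < 2 & 0 <= t & t <= s"
      then have "m = 0 | m = 1" by auto
      then show "DERIV (?d m) t :> ?d (Suc m) t"
      proof
        assume m: "m = 0"
        show ?thesis unfolding m using DERIV_line[OF C(1), where x = x and v = w and t = t and S = UNIV] by simp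
      next
        assume m: "m = 1"
        show ?thesis unfolding m using DERIV_line[OF C(2), where x = x and v = w and t = t and S = UNIV] by simp
      qed
    qed
  qed auto
  then show ?thesis by (simp add: numeral_2_eq_2 One_nat_def power2_eq_square mult_ac)
qed

text \<open>The expected difference quotient of \<open>g\<close> when only the noise moves the
  state, over time \<open>t = s^2\<close>. Brownian scaling is built in: the increment is
  \<open>s\<close> times a standard Gaussian.\<close>

definition noise_quotient :: "real => ('d::finite state => real) => real => 'd state => real" where
  "noise_quotient \<sigma> g s x = (LB u. heat 1 u * ((g (x + s *R (0, 0, \<sigma> *R u)) - g x) / s\<^sup>2))"

context
  fixes g :: "'d::finite state => real" and \<sigma> :: real assumes g: "Ck 2 g" "csupp g" and \<sigma>: "\<sigma> >= 0"
begin

private lemma pd_w: "Ck 1 f ==> pd (0, 0, \<sigma> *R u) f x = (\<Sum>i\<in>UNIV. (\<sigma> * u $ i) * pd (ez i) f x)"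
  for f :: "'d state => real" using pd_z[where g = f and v = "\<sigma> *R u" and x = x] by simp

private lemma Cg: "Ck 1 g" "Ck 1 (pd w g)" using g Ck_le[of 1 2 g] Ck_pd[of 1 g w] by (auto simp: numeral_2_eq_2)

text \<open>The linear term of the Taylor expansion is removed. It is of order \<open>1 / s\<close>
  after division by \<open>s^2\<close> but has mean zero, and the rest is bounded uniformly in
  \<open>s\<close> by a multiple of the square of \<open>u\<close>.\<close>

definition remainder :: "real => 'd state => real^'d => real" where
  "remainder s x u = (g (x + s *R (0, 0, \<sigma> *R u)) - g x - s * pd (0, 0, \<sigma> *R u) g x) / s\<^sup>2"

lemma remainder_eq: assumes "s > 0" shows "\<exists>\<xi>. 0 < \<xi> & \<xi> < s & remainder s x u
    = \<sigma>\<^sup>2 / 2 * (\<Sum>i\<in>UNIV. \<Sum>j\<in>UNIV. u $ i * u $ j * pd (ez i) (pd (ez j) g) (x + \<xi> *R (0, 0, \<sigma> *R u)))"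
proof -
  let ?w = "(0, 0, \<sigma> *R u) :: 'd state"
  obtain \<xi> where \<xi>: "0 < \<xi>" "\<xi> < s" and e: "g (x + s *R ?w) = g x + s * pd ?w g x + s\<^sup>2 / 2 * pd ?w (pd ?w g) (x + \<xi> *R ?w)"
    using taylor_2[OF g(1) assms] by blast
  have "remainder s x u = pd ?w (pd ?w g) (x + \<xi> *R ?w) / 2" using assms unfolding remainder_def e by simp
  moreover have "pd ?w (pd ?w g) y = \<sigma>\<^sup>2 * (\<Sum>i\<in>UNIV. \<Sum>j\<in>UNIV. u $ i * u $ j * pd (ez i) (pd (ez j) g) y)" for y
  proof -
    have f: "pd ?w g = (%y. \<Sum>j\<in>UNIV. (\<sigma> * u $ j) * pd (ez j) g y)" using pd_w[OF Cg(1)] by (rule ext)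
    have "pd ?w (pd ?w g) y = (\<Sum>i\<in>UNIV. (\<sigma> * u $ i) * pd (ez i) (pd ?w g) y)" by (rule pd_w[OF Cg(2)])
    also have "... = (\<Sum>i\<in>UNIV. (\<sigma> * u $ i) * (\<Sum>j\<in>UNIV. (\<sigma> * u $ j) * pd (ez i) (pd (ez j) g) y))"
      unfolding f by (simp only: pd_sum[OF Ck_mult[OF Ck_const Cg(2)]] pd_cmult[OF Cg(2)])
    finally show ?thesis by (simp add: sum_distrib_left power2_eq_square mult_ac)
  qed
  ultimately show ?thesis using \<xi> by (intro exI[of _ \<xi>]) simp
qed

lemma remainder_bound: "\<exists>C\<ge>0. \<forall>s>0. \<forall>x u. \<bar>remainder s x u\<bar> <= C * (\<Sum>i\<in>UNIV. (u $ i)\<^sup>2)"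
proof -
  have ex: "\<exists>C. C >= 0 & (\<forall>x. \<bar>pd (ez i) (pd (ez j) g) x\<bar> <= C)" for i j
    by (rule bounded_of_csupp[OF Ck1_continuous_pd[OF Cg(2)] csupp_pd[OF csupp_pd[OF g(2)]]])
  have "\<exists>C. \<forall>i j. C i j >= 0 & (\<forall>x. \<bar>pd (ez i) (pd (ez j) g) x\<bar> <= C i j)" by (intro choice allI) (rule ex)
  then obtain C where C: "!!i j. C i j >= 0" "!!i j x. \<bar>pd (ez i) (pd (ez j) g) x\<bar> <= C i j" by blast
  define K where "K = (\<Sum>i\<in>UNIV. \<Sum>j\<in>UNIV. C i j)"
  have "\<bar>remainder s x u\<bar> <= \<sigma>\<^sup>2 / 2 * K * (\<Sum>i\<in>UNIV. (u $ i)\<^sup>2)" if s: "s > 0" for s x u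
  proof -
    let ?S = "\<Sum>i\<in>UNIV. (u $ i)\<^sup>2"
    obtain \<xi> where e: "remainder s x u
        = \<sigma>\<^sup>2 / 2 * (\<Sum>i\<in>UNIV. \<Sum>j\<in>UNIV. u $ i * u $ j * pd (ez i) (pd (ez j) g) (x + \<xi> *R (0, 0, \<sigma> *R u)))"
      using remainder_eq[OF s] by blast
    have sq: "(u $ i)\<^sup>2 <= ?S" for i by (rule member_le_sum) auto
    have le: "\<bar>u $ i * u $ j\<bar> <= ?S" for i j
    proof -
      have "2 * \<bar>u $ i * u $ j\<bar> <= (u $ i)\<^sup>2 + (u $ j)\<^sup>2"
        using sum_squares_bound[of "\<bar>u $ i\<bar>" "\<bar>u $ j\<bar>"] by (simp add: abs_mult)
      then show ?thesis using sq[of i] sq[of j] by linarith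
    qed
    have "\<bar>u $ i * u $ j * pd (ez i) (pd (ez j) g) y\<bar> <= ?S * C i j" for i j y
    proof -
      have "0 <= ?S" by (intro sum_nonneg) simp
      from mult_mono[OF le C(2) this abs_ge_zero] show ?thesis by (simp only: abs_mult)
    qed
    then have "\<bar>\<Sum>i\<in>UNIV. \<Sum>j\<in>UNIV. u $ i * u $ j * pd (ez i) (pd (ez j) g) y\<bar> <= (\<Sum>i\<in>UNIV. \<Sum>j\<in>UNIV. ?S * C i j)" for y
      by (intro order_trans[OF sum_abs] sum_mono)
    then have "\<sigma>\<^sup>2 / 2 * \<bar>\<Sum>i\<in>UNIV. \<Sum>j\<in>UNIV. u $ i * u $ j * pd (ez i) (pd (ez j) g) (x + \<xi> *R (0, 0, \<sigma> *R u))\<bar>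
      <= \<sigma>\<^sup>2 / 2 * (?S * K)" unfolding K_def sum_distrib_left[symmetric] by (intro mult_left_mono) auto
    then show ?thesis unfolding e by (simp add: abs_mult mult_ac)
  qed
  moreover have "\<sigma>\<^sup>2 / 2 * K >= 0" using C(1) by (auto simp: K_def intro!: sum_nonneg mult_nonneg_nonneg)
  ultimately show ?thesis by blast
qed

lemma remainder_measurable: "remainder s x \<in> borel_measurable borel"
proof -
  have [measurable]: "g \<in> borel_measurable borel"
    using Ck_continuous[OF g(1)] by (rule borel_measurable_continuous_onI)
  have "(%u. x + s *R (0, 0, \<sigma> *R u)) \<in> borel_measurable borel"
    by (intro borel_measurable_continuous_onI continuous_intros)
  from measurable_compose[OF this, of g borel] have "(%u. g (x + s *R (0, 0, \<sigma> *R u))) \<in> borel_measurable borel" by simp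
  moreover have "(%u. pd (0, 0, \<sigma> *R u) g x) \<in> borel_measurable borel" unfolding pd_w[OF Cg(1)] by measurable
  ultimately show ?thesis unfolding remainder_def[abs_def] by measurable
qed

lemma heat_second_moment: "integrable lborel (%u::real^'d. heat 1 u * (C * (\<Sum>i\<in>UNIV. (u $ i)\<^sup>2)))"
proof -
  have "integrable lborel (%u::real^'d. \<Sum>i\<in>UNIV. C * (heat 1 u * (u $ i)\<^sup>2))"
    using heat_moment_single[of 1 _ 2] by (intro Bochner_Integration.integrable_sum integrable_mult_right) (auto intro: integrable.intros)
  then show ?thesis by (simp add: sum_distrib_left mult_ac)
qed

lemma heat_remainder_bound:
  "\<exists>C. \<forall>s>0. \<forall>x u. norm (heat 1 u * remainder s x u) <= heat 1 u * (C * (\<Sum>i\<in>UNIV. (u $ i)\<^sup>2))"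
proof -
  obtain C where C: "!!s x u. s > 0 ==> \<bar>remainder s x u\<bar> <= C * (\<Sum>i\<in>UNIV. (u $ i)\<^sup>2)" using remainder_bound by blast
  have "norm (heat 1 u * remainder s x u) <= heat 1 u * (C * (\<Sum>i\<in>UNIV. (u $ i)\<^sup>2))" if s: "s > 0" for s x u
    unfolding real_norm_def abs_mult abs_of_nonneg[OF heat_nonneg] by (rule mult_left_mono[OF C[OF s] heat_nonneg])
  then show ?thesis by blast
qed

lemma integrable_remainder: assumes "s > 0" shows "integrable lborel (%u. heat 1 u * remainder s x u)"
proof -
  obtain C where C: "!!s x u. s > 0 ==> norm (heat 1 u * remainder s x u) <= heat 1 u * (C * (\<Sum>i\<in>UNIV. (u $ i)\<^sup>2))"
    using heat_remainder_bound by blast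
  note [measurable] = remainder_measurable[of s x]
  show ?thesis
  proof (rule Bochner_Integration.integrable_bound[OF heat_second_moment[of C]])
    show "AE u in lborel. norm (heat 1 u * remainder s x u) <= norm (heat 1 u * (C * (\<Sum>i\<in>UNIV. (u $ i)\<^sup>2)))"
      unfolding real_norm_def by (intro AE_I2 order_trans[OF C[OF assms, unfolded real_norm_def] abs_ge_self])
  qed measurable
qed

lemma noise_quotient_eq: assumes "s > 0" shows "noise_quotient \<sigma> g s x = (LB u. heat 1 u * remainder s x u)"
proof -
  have L: "has_bochner_integral lborel (%u. \<Sum>i\<in>UNIV. (\<sigma> / s * pd (ez i) g x) * (heat 1 u * (u $ i) ^ 1)) (\<Sum>i\<in>(UNIV::'d set). (\<sigma> / s * pd (ez i) g x) * 0)"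
    using heat_moment_single[of 1 _ 1] normal_moments(2)[of 1]
    by (intro has_bochner_integral_sum has_bochner_integral_mult_right) auto
  have "heat 1 u * ((g (x + s *R (0, 0, \<sigma> *R u)) - g x) / s\<^sup>2)
    = heat 1 u * remainder s x u + (\<Sum>i\<in>UNIV. (\<sigma> / s * pd (ez i) g x) * (heat 1 u * (u $ i) ^ 1))" for u
  proof -
    have "(\<Sum>i\<in>UNIV. (\<sigma> / s * pd (ez i) g x) * (heat 1 u * (u $ i) ^ 1)) = heat 1 u * (pd (0, 0, \<sigma> *R u) g x / s)"
      unfolding pd_w[OF Cg(1)] by (simp add: sum_distrib_left sum_divide_distrib mult_ac)
    moreover have "(g (x + s *R (0, 0, \<sigma> *R u)) - g x) / s\<^sup>2 = remainder s x u + pd (0, 0, \<sigma> *R u) g x / s"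
      using assms unfolding remainder_def by (simp add: field_simps power2_eq_square)
    ultimately show ?thesis by (simp only: distrib_left)
  qed
  then show ?thesis unfolding noise_quotient_def
    using L integrable_remainder[OF assms] by (simp add: has_bochner_integral_iff)
qed

lemma noise_quotient_bound: "\<exists>C. \<forall>s>0. \<forall>x. \<bar>noise_quotient \<sigma> g s x\<bar> <= C"
proof -
  obtain C where C: "!!s x u. s > 0 ==> norm (heat 1 u * remainder s x u) <= heat 1 u * (C * (\<Sum>i\<in>UNIV. (u $ i)\<^sup>2))"
    using heat_remainder_bound by blast
  have "norm (noise_quotient \<sigma> g s x) <= (\<integral>u. heat 1 u * (C * (\<Sum>i\<in>UNIV. (u $ i)\<^sup>2)) \<partial>(lborel :: (real^'d) measure))"
    if s: "s > 0" for s x unfolding noise_quotient_eq[OF s]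
    by (rule Bochner_Integration.integral_norm_bound_integral[OF integrable_remainder[OF s] heat_second_moment C[OF s]])
  then show ?thesis unfolding real_norm_def by blast
qed

lemma noise_quotient_limit: assumes s: "!!n. s n > 0" "s ----> 0"
  shows "(%n. noise_quotient \<sigma> g (s n) x) ----> \<sigma>\<^sup>2 / 2 * (\<Sum>i\<in>UNIV. pd (ez i) (pd (ez i) g) x)"
proof -
  obtain C where C: "!!s x u. s > 0 ==> norm (heat 1 u * remainder s x u) <= heat 1 u * (C * (\<Sum>i\<in>UNIV. (u $ i)\<^sup>2))"
    using heat_remainder_bound by blast
  let ?r = "%u. \<sigma>\<^sup>2 / 2 * (\<Sum>i\<in>UNIV. \<Sum>j\<in>UNIV. u $ i * u $ j * pd (ez i) (pd (ez j) g) x)"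
  note [measurable] = remainder_measurable
  have "(%n. LB u. heat 1 u * remainder (s n) x u) ----> (LB u. heat 1 u * ?r u)"
  proof (rule integral_dominated_convergence[OF _ _ heat_second_moment[of C]])
    show "AE u in lborel. (%n. heat 1 u * remainder (s n) x u) ----> heat 1 u * ?r u"
    proof (rule AE_I2)
      fix u :: "real^'d"
      let ?w = "(0, 0, \<sigma> *R u) :: 'd state"
      have "\<forall>n. \<exists>\<xi>. 0 < \<xi> & \<xi> < s n & remainder (s n) x u
        = \<sigma>\<^sup>2 / 2 * (\<Sum>i\<in>UNIV. \<Sum>j\<in>UNIV. u $ i * u $ j * pd (ez i) (pd (ez j) g) (x + \<xi> *R ?w))"
        using remainder_eq[OF s(1)] by blast
      from choice[OF this] obtain \<xi> where \<xi>: "!!n. 0 < \<xi> n" "!!n. \<xi> n < s n" and e: "!!n. remainder (s n) x u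
        = \<sigma>\<^sup>2 / 2 * (\<Sum>i\<in>UNIV. \<Sum>j\<in>UNIV. u $ i * u $ j * pd (ez i) (pd (ez j) g) (x + \<xi> n *R ?w))" by blast
      have "\<xi> ----> 0" by (rule real_tendsto_sandwich[OF always_eventually always_eventually tendsto_const s(2)])
          (use \<xi> in \<open>auto intro: less_imp_le\<close>)
      then have "(%n. x + \<xi> n *R ?w) ----> x + 0 *R ?w" by (intro tendsto_intros)
      then have l: "(%n. x + \<xi> n *R ?w) ----> x" by (simp only: scaleR_zero_left add_0_right)
      have "(%n. pd (ez i) (pd (ez j) g) (x + \<xi> n *R ?w)) ----> pd (ez i) (pd (ez j) g) x" for i j
        by (rule continuous_on_tendsto_compose[OF Ck1_continuous_pd[OF Cg(2)] l]) auto
      then show "(%n. heat 1 u * remainder (s n) x u) ----> heat 1 u * ?r u"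
        unfolding e by (intro tendsto_mult tendsto_const tendsto_sum)
    qed
    show "AE u in lborel. norm (heat 1 u * remainder (s n) x u) <= heat 1 u * (C * (\<Sum>i\<in>UNIV. (u $ i)\<^sup>2))" for n
      by (intro AE_I2 C s(1))
  qed measurable
  moreover have "(LB u. heat 1 u * ?r u) = \<sigma>\<^sup>2 / 2 * (\<Sum>i\<in>UNIV. pd (ez i) (pd (ez i) g) x)"
  proof -
    let ?c = "%i j. \<sigma>\<^sup>2 / 2 * pd (ez i) (pd (ez j) g) x"
    have I: "has_bochner_integral lborel (%u. \<Sum>i\<in>UNIV. \<Sum>j\<in>UNIV. ?c i j * (heat 1 u * (u $ i * u $ j)))
        (\<Sum>i\<in>UNIV. \<Sum>j\<in>UNIV. ?c i j * (if i = j then 1 else 0))"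
      by (intro has_bochner_integral_sum has_bochner_integral_mult_right heat_moment_pair) auto
    have e: "(\<Sum>i\<in>UNIV. \<Sum>j\<in>UNIV. ?c i j * (heat 1 u * (u $ i * u $ j))) = heat 1 u * ?r u" for u
      by (simp add: sum_distrib_left mult_ac)
    have d: "(\<Sum>j\<in>UNIV. ?c i j * (if i = j then 1 else 0)) = ?c i i" for i
      using sum.delta'[of UNIV i "?c i"] by (simp only: mult_if_delta' finite UNIV_I if_True)
    have "(LB u. heat 1 u * ?r u) = (\<Sum>i\<in>UNIV. ?c i i)"
      using has_bochner_integral_integral_eq[OF I] unfolding e d .
    then show ?thesis by (simp only: sum_distrib_left)
  qed
  ultimately show ?thesis by (simp only: noise_quotient_eq[OF s(1)])
qed

end

subsection \<open>A maximal inequality for Brownian motion\<close>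

text \<open>Every dyadic point is reached from 0 by at most one increment per level, and the
  geometric series of the thresholds sums to \<open>10 * \<delta>\<close>. Continuity extends the
  bound to all times.\<close>

lemma chaining_bound:
  fixes W :: "real => 'a::real_normed_vector" assumes W: "continuous_on {0..t} W" and t: "t > 0"
    and inc: "!!m k. k < 2 ^ m ==> norm (W (real (Suc k) * (t / 2 ^ m)) - W (real k * (t / 2 ^ m))) <= \<delta> * (9 / 10) ^ m"
    and s: "s \<in> {0..t}" shows "norm (W s - W 0) <= 10 * \<delta>"
proof -
  have \<delta>: "\<delta> >= 0" using order_trans[OF norm_ge_zero inc[of 0 0]] by simp
  have dyadic: "k <= 2 ^ m ==> norm (W (real k * (t / 2 ^ m)) - W 0) <= \<delta> * (\<Sum>j\<le>m. (9 / 10) ^ j)" for m k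
  proof (induction m arbitrary: k)
    case 0
    then have "k = 0 | k = 1" by auto
    then show ?case using inc[of 0 0] \<delta> by (auto simp: One_nat_def)
  next
    case (Suc m)
    have half: "real (2 * l) * (t / 2 ^ Suc m) = real l * (t / 2 ^ m)" for l by simp
    obtain l where l: "k = 2 * l | k = Suc (2 * l)" by (metis oddE evenE Suc_eq_plus1)
    then have "l <= 2 ^ m" using Suc.prems by auto
    from Suc.IH[OF this] have IH: "norm (W (real (2 * l) * (t / 2 ^ Suc m)) - W 0) <= \<delta> * (\<Sum>j\<le>m. (9 / 10) ^ j)"
      unfolding half .
    have "norm (W (real k * (t / 2 ^ Suc m)) - W (real (2 * l) * (t / 2 ^ Suc m))) <= \<delta> * (9 / 10) ^ Suc m" using l
    proof
      assume k: "k = Suc (2 * l)"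
      then have "2 * l < 2 ^ Suc m" using Suc.prems by simp
      from inc[OF this] show ?thesis unfolding k .
    qed (use \<delta> in simp)
    then have "norm (W (real k * (t / 2 ^ Suc m)) - W 0) <= \<delta> * (9 / 10) ^ Suc m + \<delta> * (\<Sum>j\<le>m. (9 / 10) ^ j)"
      using IH norm_triangle_ineq[of "W (real k * (t / 2 ^ Suc m)) - W (real (2 * l) * (t / 2 ^ Suc m))"
          "W (real (2 * l) * (t / 2 ^ Suc m)) - W 0"] by simp
    then show ?case by (simp add: distrib_left)
  qed
  have geom: "\<delta> * (\<Sum>j\<le>m. (9 / 10) ^ j) <= 10 * \<delta>" for m
  proof -
    have "(\<Sum>j\<le>m. (9 / 10 :: real) ^ j) = 10 - 10 * (9 / 10) ^ Suc m" by (induction m) auto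
    then have "(\<Sum>j\<le>m. (9 / 10 :: real) ^ j) <= 10" by simp
    from mult_left_mono[OF this \<delta>] show ?thesis by simp
  qed
  define k where "k m = nat \<lfloor>s * real (2 ^ m) / t\<rfloor>" for m :: nat
  have k: "k m <= 2 ^ m" for m unfolding k_def using s t by (intro grid_le) auto
  have "strict_mono (%m. 2 ^ m :: nat)" by (rule strict_monoI) simp
  from LIMSEQ_subseq_LIMSEQ[OF grid_limit[of s t] this]
  have lim: "(%m. real (k m) * (t / 2 ^ m)) ----> s" using s t by (simp add: k_def o_def)
  have in_t: "real (k m) * (t / 2 ^ m) \<in> {0..t}" for m
  proof -
    have "real (k m) <= 2 ^ m" using k[of m] of_nat_mono by fastforce
    then have "real (k m) * (t / 2 ^ m) <= 2 ^ m * (t / 2 ^ m)" using t by (intro mult_right_mono) auto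
    then show ?thesis using t by simp
  qed
  have "(%m. norm (W (real (k m) * (t / 2 ^ m)) - W 0)) ----> norm (W s - W 0)"
    using in_t s by (intro tendsto_intros continuous_on_tendsto_compose[OF W lim]) auto
  then show ?thesis by (rule LIMSEQ_le_const2) (use order_trans[OF dyadic[OF k] geom] in auto)
qed

lemma norm_power4_le:
  fixes y :: "real^'d" shows "norm y ^ 4 <= real CARD('d) * (\<Sum>i\<in>UNIV. (y $ i) ^ 4)"
proof -
  have "norm y ^ 4 = ((norm y)\<^sup>2)\<^sup>2" by (simp add: power_mult[symmetric])
  also have "(norm y)\<^sup>2 = (\<Sum>i\<in>UNIV. (y $ i)\<^sup>2)" by (simp only: power2_norm_eq_inner inner_vec_def inner_real_def) (simp only: power2_eq_square)
  also have "(\<Sum>i\<in>UNIV. (y $ i)\<^sup>2)\<^sup>2 <= real CARD('d) * (\<Sum>i\<in>UNIV. ((y $ i)\<^sup>2)\<^sup>2)"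
    using sum_squared_le_sum_of_squares[of "%i. (y $ i)\<^sup>2" UNIV] by (simp add: mult.commute)
  finally show ?thesis by (simp add: power_mult[symmetric])
qed

context langevin_process
begin

text \<open>Markov's inequality for the fourth moment. The second moment would give a bound linear
  in the time step, too weak for a union over \<open>2 ^ m\<close> dyadic intervals.\<close>

lemma increment_tail: assumes s: "0 <= s" "s < u" and a: "a > 0"
  shows "emeasure M {om \<in> space M. norm (B u om - B s om) > a} <= ennreal (3 * (real CARD('d))\<^sup>2 * (u - s)\<^sup>2 / a ^ 4)"
proof -
  have "distributed M lborel (%om. B u om - B s om) (%x. ennreal (\<Prod>i\<in>UNIV. normal_density 0 (sqrt (u - s)) (x $ i)))"
    using brownian s unfolding brownian_motion_def by blast
  then have d: "distributed M lborel (%om. B u om - B s om) (%y. ennreal (heat (u - s) y))" by (simp add: heat_def)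
  let ?A = "{y :: real^'d. norm y > a}" and ?c = "real CARD('d)"
  have A: "?A \<in> sets lborel" by simp
  have S: "has_bochner_integral lborel (%y::real^'d. \<Sum>i\<in>UNIV. (?c / a ^ 4) * (heat (u - s) y * (y $ i) ^ 4))
      (\<Sum>i\<in>(UNIV::'d set). (?c / a ^ 4) * (3 * (u - s)\<^sup>2))"
    using heat_moment_single[of "u - s" _ 4] normal_moments(4)[of "u - s"] s
    by (intro has_bochner_integral_sum has_bochner_integral_mult_right) auto
  have "emeasure M {om \<in> space M. norm (B u om - B s om) > a} = emeasure M ((%om. B u om - B s om) -` ?A \<inter> space M)"
    by (rule arg_cong[where f = "emeasure M"]) auto
  also have "... = (NN y. ennreal (heat (u - s) y) * indicator ?A y)" by (rule distributed_emeasure[OF d A])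
  also have "... <= (\<integral>\<^sup>+y. ennreal (\<Sum>i\<in>UNIV. (?c / a ^ 4) * (heat (u - s) y * (y $ i) ^ 4)) \<partial>(lborel :: (real^'d) measure))"
  proof (rule nn_integral_mono)
    fix y :: "real^'d"
    have e: "(\<Sum>i\<in>UNIV. (?c / a ^ 4) * (heat (u - s) y * (y $ i) ^ 4)) = heat (u - s) y * (?c * (\<Sum>i\<in>UNIV. (y $ i) ^ 4) / a ^ 4)"
      by (simp add: sum_distrib_left sum_divide_distrib mult_ac)
    show "ennreal (heat (u - s) y) * indicator ?A y <= ennreal (\<Sum>i\<in>UNIV. (?c / a ^ 4) * (heat (u - s) y * (y $ i) ^ 4))"
    proof (cases "y \<in> ?A")
      case True
      then have pw: "a ^ 4 <= norm y ^ 4" using a by (intro power_mono) auto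
      have "1 <= ?c * (\<Sum>i\<in>UNIV. (y $ i) ^ 4) / a ^ 4"
        using order_trans[OF pw norm_power4_le[of y]] a by (simp add: le_divide_eq)
      from mult_left_mono[OF this heat_nonneg[of "u - s" y]] show ?thesis
        unfolding e using True by (simp add: ennreal_leI)
    qed simp
  qed
  also have "... = ennreal (\<Sum>i\<in>(UNIV::'d set). (?c / a ^ 4) * (3 * (u - s)\<^sup>2))"
    using S by (subst nn_integral_eq_integral)
      (auto simp: has_bochner_integral_iff heat_nonneg intro!: AE_I2 sum_nonneg mult_nonneg_nonneg)
  also have "(\<Sum>i\<in>(UNIV::'d set). (?c / a ^ 4) * (3 * (u - s)\<^sup>2)) = 3 * ?c\<^sup>2 * (u - s)\<^sup>2 / a ^ 4"
    by (simp add: power2_eq_square)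
  finally show ?thesis .
qed

text \<open>The thresholds decay slowly enough for the fourth moments to be summable:
  \<open>2 * (9/10) ^ 4 > 1\<close>.\<close>
lemma small_oscillation: assumes \<delta>: "\<delta> > 0" shows "\<exists>C\<ge>0. \<forall>t>0. \<exists>N\<in>sets M. prob N <= C * t\<^sup>2 &
    (\<forall>om\<in>space M - N. continuous_on {0..t} (%s. B s om) --> (\<forall>s\<in>{0..t}. norm (B s om - B 0 om) <= \<delta>))"
proof -
  \<comment> \<open>The tolerance is \<open>\<delta> / 10\<close>, as chaining loses a factor
    10.\<close>
  define c where "c = 3 * (real CARD('d))\<^sup>2 / (\<delta> / 10) ^ 4"
  have c: "c >= 0" using \<delta> by (simp add: c_def)
  \<comment> \<open>At level \<open>m\<close> there are \<open>2 ^ m\<close> intervals of length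
    \<open>t / 2 ^ m\<close>, and the fourth power of the threshold contributes
    \<open>(9 / 10) ^ (4 m)\<close>; together this is \<open>t^2 * r ^ m\<close> up to a
    constant.\<close>
  define r :: real where "r = 1 / (2 * (9 / 10) ^ 4)"
  have r: "0 < r" "r < 1" by (auto simp: r_def power_divide)
  define C where "C = c / (1 - r)"
  have "\<exists>N\<in>sets M. prob N <= C * t\<^sup>2 &
    (\<forall>om\<in>space M - N. continuous_on {0..t} (%s. B s om) --> (\<forall>s\<in>{0..t}. norm (B s om - B 0 om) <= \<delta>))" if t: "t > 0" for t
  proof -
    define E where "E m k = {om \<in> space M. norm (B (real (Suc k) * (t / 2 ^ m)) om - B (real k * (t / 2 ^ m)) om) > \<delta> / 10 * (9 / 10) ^ m}"
      for m k :: nat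
    have Em: "E m k \<in> sets M" for m k
    proof -
      have [measurable]: "B (real (Suc k) * (t / 2 ^ m)) \<in> borel_measurable M" "B (real k * (t / 2 ^ m)) \<in> borel_measurable M"
        using t by (auto intro!: B_measurable)
      show ?thesis unfolding E_def by measurable
    qed
    define F where "F m = (\<Union>k<2 ^ m. E m k)" for m :: nat
    have Fm: "F m \<in> sets M" for m unfolding F_def using Em by auto
    have Fe: "emeasure M (F m) <= ennreal (c * t\<^sup>2 * r ^ m)" for m
    proof -
      have "emeasure M (F m) <= (\<Sum>k<2 ^ m. emeasure M (E m k))"
        unfolding F_def using Em by (intro emeasure_subadditive_finite) auto
      also have "... <= (\<Sum>k<(2::nat) ^ m. ennreal (c * (t / 2 ^ m)\<^sup>2 / ((9 / 10) ^ m) ^ 4))"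
      proof (rule sum_mono)
        fix k
        let ?s = "real k * (t / 2 ^ m)" and ?u = "real (Suc k) * (t / 2 ^ m)"
        have su: "0 <= ?s" "?s < ?u" "?u - ?s = t / 2 ^ m" proof -
          have e: "?u = ?s + t / 2 ^ m" by (simp add: distrib_right add_divide_distrib)
          show "0 <= ?s" using t by simp
          show "?s < ?u" "?u - ?s = t / 2 ^ m" unfolding e using t by auto
        qed
        have "emeasure M (E m k) <= ennreal (3 * (real CARD('d))\<^sup>2 * (?u - ?s)\<^sup>2 / (\<delta> / 10 * (9 / 10) ^ m) ^ 4)"
          unfolding E_def using \<delta> by (intro increment_tail su) simp
        also have "3 * (real CARD('d))\<^sup>2 * (?u - ?s)\<^sup>2 / (\<delta> / 10 * (9 / 10) ^ m) ^ 4 = c * (t / 2 ^ m)\<^sup>2 / ((9 / 10) ^ m) ^ 4"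
          unfolding su(3) c_def power_mult_distrib by simp
        finally show "emeasure M (E m k) <= ennreal (c * (t / 2 ^ m)\<^sup>2 / ((9 / 10) ^ m) ^ 4)" .
      qed
      also have "... = ennreal (2 ^ m * (c * (t / 2 ^ m)\<^sup>2 / ((9 / 10) ^ m) ^ 4))"
        unfolding sum_constant card_lessThan ennreal_of_nat_eq_real_of_nat using c
        by (subst ennreal_mult[symmetric]) auto
      also have "2 ^ m * (c * (t / 2 ^ m)\<^sup>2 / ((9 / 10) ^ m) ^ 4) = c * t\<^sup>2 * r ^ m"
      proof -
        have "r ^ m = 1 / (2 ^ m * ((9 / 10) ^ m) ^ 4)"
          unfolding r_def power_divide power_mult_distrib power_one by (simp only: power_mult[symmetric] mult.commute)
        then show ?thesis by (simp add: power_divide power2_eq_square)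
      qed
      finally show ?thesis .
    qed
    define N where "N = (\<Union>m. F m)"
    have "emeasure M N <= (\<Sum>m. emeasure M (F m))"
      unfolding N_def using Fm by (intro emeasure_subadditive_countably) auto
    also have "... <= (\<Sum>m. ennreal (c * t\<^sup>2 * r ^ m))" by (intro suminf_le Fe) auto
    also have "... = ennreal (c * t\<^sup>2 * (1 / (1 - r)))"
      using c r by (intro suminf_ennreal_eq sums_mult geometric_sums) auto
    finally have "emeasure M N <= ennreal (C * t\<^sup>2)" by (simp add: C_def mult.commute)
    then have "prob N <= C * t\<^sup>2" using c r unfolding emeasure_eq_measure by (subst (asm) ennreal_le_iff) (auto simp: C_def)
    moreover have "N \<in> sets M" unfolding N_def using Fm by auto
    moreover have "norm (B s om - B 0 om) <= \<delta>"
      if om: "om \<in> space M - N" and cont: "continuous_on {0..t} (%s. B s om)" and s: "s \<in> {0..t}" for om s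
    proof -
      have "norm (B (real (Suc k) * (t / 2 ^ m)) om - B (real k * (t / 2 ^ m)) om) <= \<delta> / 10 * (9 / 10) ^ m"
        if "k < 2 ^ m" for m k
      proof (rule ccontr)
        assume "~ ?thesis"
        then have "om \<in> E m k" using om by (simp add: E_def)
        then show False using om that unfolding N_def F_def by blast
      qed
      from chaining_bound[OF cont t this s] show ?thesis by simp
    qed
    ultimately show ?thesis by blast
  qed
  moreover have "C >= 0" using c r by (simp add: C_def)
  ultimately show ?thesis by blast
qed

end

subsection \<open>The drift\<close>

definition drift :: "(real^'d => real^'d) => real => 'd::finite state => 'd state" where
  "drift b \<alpha> x = (pp x, b (qq x) + zz x, - (\<alpha> *R zz x + pp x))"

text \<open>The increment of the path with its noise part removed, hence the integral of the drift.
  Unlike the increment itself it is of order \<open>t\<close>.\<close>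

definition displacement :: "real => (real => real^'d) => (real => 'd::finite state) => real => 'd state" where
  "displacement \<sigma> W X t = X t - X 0 - (0, 0, \<sigma> *R (W t - W 0))"

lemma drift_integral: assumes sol: "path_solution b \<alpha> \<sigma> W T X" and t: "t \<in> {0..T}"
  shows "((%s. drift b \<alpha> (X s)) has_integral displacement \<sigma> W X t) {0..t}"
proof -
  note I = sol[unfolded path_solution_def, THEN conjunct2, THEN bspec, OF t]
  have "((%s. (pp (X s), 0, 0) + (0, b (qq (X s)) + zz (X s), 0) + (0, 0, - (\<alpha> *R zz (X s) + pp (X s)))) has_integral
    (qq (X t) - qq (X 0), 0, 0) + (0, pp (X t) - pp (X 0), 0) + (0, 0, zz (X t) - zz (X 0) - \<sigma> *R (W t - W 0))) {0..t}"
    using has_integral_linear[OF I[THEN conjunct1] bounded_linear_state(1)]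
      has_integral_linear[OF I[THEN conjunct2, THEN conjunct1] bounded_linear_state(2)]
      has_integral_linear[OF I[THEN conjunct2, THEN conjunct2] bounded_linear_state(3)]
    unfolding o_def by (intro has_integral_add)
  moreover have "displacement \<sigma> W X t = (qq (X t) - qq (X 0), pp (X t) - pp (X 0), zz (X t) - zz (X 0) - \<sigma> *R (W t - W 0))"
    by (cases "X t"; cases "X 0") (simp add: displacement_def)
  ultimately show ?thesis by (simp add: drift_def)
qed

lemma drift_continuous: assumes "continuous_on UNIV b" shows "continuous_on UNIV (drift b \<alpha>)"
  unfolding drift_def by (intro continuous_intros continuous_on_compose2[OF assms continuous_on_fst[OF continuous_on_id]]) auto

text \<open>A continuity argument in place of a growth condition: as long as the path has not moved
  by more than 2, the drift is bounded by \<open>C\<close>. For times up to \<open>1 / (2 C)\<close>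
  the drift then contributes at most 1/2 and the noise at most 1, so the path never moves that
  far.\<close>

lemma displacement_bound: assumes b: "continuous_on UNIV b" and R: "R >= 0"
  shows "\<exists>C \<tau>. 0 < C & 0 < \<tau> & (\<forall>W X t. path_solution b \<alpha> \<sigma> W 1 X & norm (X 0) <= R & 0 < t & t <= \<tau> & t <= 1
      & (\<forall>s\<in>{0..t}. norm (\<sigma> *R (W s - W 0)) <= 1) --> norm (displacement \<sigma> W X t) <= C * t)"
proof -
  have "bounded (drift b \<alpha> ` cball 0 (R + 2))"
    by (intro compact_imp_bounded compact_continuous_image continuous_on_subset[OF drift_continuous[OF b]] compact_cball) auto
  then obtain C0 where "\<forall>y\<in>drift b \<alpha> ` cball 0 (R + 2). norm y <= C0" unfolding bounded_iff by blast
  then have C0: "norm (drift b \<alpha> x) <= C0" if "norm x <= R + 2" for x using that by auto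
  define C where "C = max C0 1"
  have C: "C > 0" "!!x. norm x <= R + 2 ==> norm (drift b \<alpha> x) <= C" using C0 by (force simp: C_def)+
  define \<tau> where "\<tau> = 1 / (2 * C)"
  have \<tau>: "\<tau> > 0" using C by (simp add: \<tau>_def)
  have main: "norm (displacement \<sigma> W X t) <= C * t"
    if sol: "path_solution b \<alpha> \<sigma> W 1 X" and X0: "norm (X 0) <= R" and t: "0 < t" "t <= \<tau>" "t <= 1"
      and W: "!!s. s \<in> {0..t} ==> norm (\<sigma> *R (W s - W 0)) <= 1" for W X t
  proof -
    have int: "((%s. drift b \<alpha> (X s)) has_integral displacement \<sigma> W X s) {0..s}" if "s \<in> {0..t}" for s
      using that t by (intro drift_integral[OF sol]) auto
    have stay: "norm (displacement \<sigma> W X s) <= C * s" if s: "s \<in> {0..t}" and near: "!!r. r \<in> {0..<s} ==> norm (X r - X 0) <= 2" for s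
    proof -
      have "norm (displacement \<sigma> W X s) <= C * measure lborel {0..s}"
      proof (rule has_integral_bound_real[where S = "{s}", OF less_imp_le[OF C(1)] _ int[OF s]])
        fix r assume "r \<in> {0..s} - {s}"
        then have "norm (X r - X 0) <= 2" by (intro near) auto
        then show "norm (drift b \<alpha> (X r)) <= C" using X0 norm_triangle_sub[of "X r" "X 0"] by (intro C(2)) linarith
      qed simp
      then show ?thesis using s by simp
    qed
    have X_le: "norm (X s - X 0) <= norm (displacement \<sigma> W X s) + 1" if s: "s \<in> {0..t}" for s
    proof -
      have "norm ((0, 0, \<sigma> *R (W s - W 0)) :: 'a state) <= 1" using W[OF s] by (simp add: norm_Pair)
      moreover have "X s - X 0 = displacement \<sigma> W X s + (0, 0, \<sigma> *R (W s - W 0))" by (simp add: displacement_def)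
      ultimately show ?thesis
        using norm_triangle_ineq[of "displacement \<sigma> W X s" "(0, 0, \<sigma> *R (W s - W 0))"] by simp
    qed
    have near: "norm (X s - X 0) < 2" if s: "s \<in> {0..t}" for s
    proof (rule ccontr)
      assume far: "~ ?thesis"
      \<comment> \<open>This set is compact, so a path that moves by 2 has a first time of doing so;
        up to that time the drift bound holds and contradicts the distance 2.\<close>
      let ?F = "{r \<in> {0..s}. 2 <= norm (X r - X 0)}"
      have cont: "continuous_on {0..s} (%r. norm (X r - X 0))"
        using sol s t unfolding path_solution_def by (intro continuous_intros) (auto intro: continuous_on_subset)
      have "closed ?F" by (rule continuous_on_closed_Collect_le[OF continuous_on_const cont closed_atLeastAtMost])
      moreover have "bounded ?F" by (rule bounded_subset[OF bounded_closed_interval[of 0 s]]) auto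
      ultimately have "compact ?F" by (simp only: compact_eq_bounded_closed)
      moreover have "s \<in> ?F" using s far by auto
      ultimately obtain r where r: "r \<in> ?F" "!!r'. r' \<in> ?F ==> r <= r'" using compact_attains_inf[of ?F] by blast
      have rt: "r \<in> {0..t}" using r(1) s by auto
      have "norm (displacement \<sigma> W X r) <= C * r"
      proof (rule stay[OF rt])
        fix r' assume r': "r' \<in> {0..<r}"
        then have "r' \<notin> ?F" using r(2)[of r'] by auto
        then show "norm (X r' - X 0) <= 2" using r' r(1) by auto
      qed
      also have "C * r <= C * \<tau>" using rt t C by (intro mult_left_mono) auto
      also have "C * \<tau> = 1 / 2" using C by (simp add: \<tau>_def)
      finally have "norm (X r - X 0) < 2" using X_le[OF rt] by linarith
      then show False using r(1) by simp
    qed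
    show ?thesis using near t by (intro stay) (auto intro: less_imp_le)
  qed
  show ?thesis
  proof (intro exI conjI allI impI)
    fix W X t
    assume h: "path_solution b \<alpha> \<sigma> W 1 X & norm (X 0) <= R & 0 < t & t <= \<tau> & t <= 1
      & (\<forall>s\<in>{0..t}. norm (\<sigma> *R (W s - W 0)) <= 1)"
    show "norm (displacement \<sigma> W X t) <= C * t" by (rule main) (use h in simp_all)
  qed (rule C(1) \<tau>)+
qed

lemma displacement_limit: assumes sol: "path_solution b \<alpha> \<sigma> W 1 X" and b: "continuous_on UNIV b"
    and t: "!!n. 0 < t n" "!!n. t n <= 1" "t ----> 0"
  shows "(%n. (1 / t n) *R displacement \<sigma> W X (t n)) ----> drift b \<alpha> (X 0)"
proof (rule tendstoI)
  fix e :: real assume e: "e > 0"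
  have "continuous_on {0..1} X" using sol by (simp add: path_solution_def)
  then have "continuous_on {0..1} (%s. drift b \<alpha> (X s))"
    by (rule continuous_on_compose2[OF drift_continuous[OF b]]) simp
  moreover have "(0::real) \<in> {0..1}" "e / 2 > 0" using e by auto
  ultimately obtain d where d: "d > 0" "!!s. s \<in> {0..1} ==> dist s 0 < d ==> dist (drift b \<alpha> (X s)) (drift b \<alpha> (X 0)) < e / 2"
    unfolding continuous_on_iff by blast
  have "\<forall>\<^sub>F n in sequentially. t n < d" using d(1) by (intro order_tendstoD(2)[OF t(3)])
  then show "\<forall>\<^sub>F n in sequentially. dist ((1 / t n) *R displacement \<sigma> W X (t n)) (drift b \<alpha> (X 0)) < e"
  proof eventually_elim
    case (elim n)
    have "norm (displacement \<sigma> W X (t n) - (t n - 0) *R drift b \<alpha> (X 0)) <= (t n - 0) * (e / 2)"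
    proof (rule norm_integral_increment[OF drift_integral[OF sol]])
      fix r assume "r \<in> {0..t n}"
      then show "norm (drift b \<alpha> (X r) - drift b \<alpha> (X 0)) <= e / 2"
        using d(2)[of r] elim t(2)[of n] by (force simp: dist_norm)
    qed (use t(1,2)[of n] e in auto)
    then have "(1 / t n) * norm (displacement \<sigma> W X (t n) - t n *R drift b \<alpha> (X 0)) <= (1 / t n) * (t n * (e / 2))"
      using t(1)[of n] by (intro mult_left_mono) auto
    also have "... < e" using t(1)[of n] e by simp
    also have "(1 / t n) * norm (displacement \<sigma> W X (t n) - t n *R drift b \<alpha> (X 0))
      = norm ((1 / t n) *R (displacement \<sigma> W X (t n) - t n *R drift b \<alpha> (X 0)))" using t(1)[of n] by simp
    also have "(1 / t n) *R (displacement \<sigma> W X (t n) - t n *R drift b \<alpha> (X 0)) = (1 / t n) *R displacement \<sigma> W X (t n) - drift b \<alpha> (X 0)"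
      using t(1)[of n] by (simp add: scaleR_diff_right)
    finally show ?case by (simp only: dist_norm)
  qed
qed

lemma mean_value_line:
  fixes g :: "'a::euclidean_space => real"
  assumes "Ck 1 g" shows "\<exists>th. 0 < th & th < 1 & g (y + d) - g y = pd d g (y + th *R d)"
  using MVT2[of 0 1 "%t. g (y + t *R d)" "%t. pd d g (y + t *R d)"] DERIV_line[OF assms, where x = y and v = d and S = UNIV]
  by auto

lemma increment_bound:
  fixes g :: "'a::euclidean_space => real" assumes g: "Ck 1 g" "csupp g"
  shows "\<exists>K\<ge>0. \<forall>y d. \<bar>g (y + d) - g y\<bar> <= K * norm d"
proof -
  have ex: "\<exists>K. K >= 0 & (\<forall>x. \<bar>pd e g x\<bar> <= K)" for e
    by (rule bounded_of_csupp[OF Ck1_continuous_pd[OF g(1)] csupp_pd[OF g(2)]])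
  have "\<exists>K. \<forall>e. K e >= 0 & (\<forall>x. \<bar>pd e g x\<bar> <= K e)" by (intro choice allI) (rule ex)
  then obtain K where K: "!!e. K e >= 0" "!!e x. \<bar>pd e g x\<bar> <= K e" by blast
  have "\<bar>g (y + d) - g y\<bar> <= (\<Sum>e\<in>Basis. K e) * norm d" for y d
  proof -
    obtain th where e: "g (y + d) - g y = pd d g (y + th *R d)" using mean_value_line[OF g(1)] by blast
    have "\<bar>pd d g x\<bar> <= (\<Sum>e\<in>Basis. K e) * norm d" for x
    proof -
      have "\<bar>pd d g x\<bar> <= (\<Sum>e\<in>Basis. \<bar>(d \<bullet> e) *R pd e g x\<bar>)"
        unfolding pd_basis[OF g(1), where v = d and x = x] by (rule sum_abs)
      also have "... <= (\<Sum>e\<in>Basis. K e * norm d)"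
      proof (rule sum_mono)
        fix e :: 'a assume "e \<in> Basis"
        have "\<bar>d \<bullet> e\<bar> * \<bar>pd e g x\<bar> <= norm d * K e"
          by (rule mult_mono[OF Basis_le_norm[OF \<open>e \<in> Basis\<close>] K(2) norm_ge_zero abs_ge_zero])
        then show "\<bar>(d \<bullet> e) *R pd e g x\<bar> <= K e * norm d" by (simp add: abs_mult mult.commute)
      qed
      finally show ?thesis by (simp add: sum_distrib_right)
    qed
    then show ?thesis unfolding e .
  qed
  moreover have "(\<Sum>e\<in>Basis. K e) >= 0" using K(1) by (intro sum_nonneg)
  ultimately show ?thesis by blast
qed

text \<open>The base point \<open>y n\<close> moves along with the increment, since in the
  application it is the state displaced by the noise alone. Convergence of \<open>d n / t n\<close>
  forces \<open>d n\<close> itself to vanish.\<close>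

lemma increment_limit:
  fixes g :: "'a::euclidean_space => real" assumes g: "Ck 1 g" and t: "!!n. 0 < t n" "t ----> 0"
    and y: "y ----> x" and d: "(%n. (1 / t n) *R d n) ----> v" shows "(%n. (g (y n + d n) - g (y n)) / t n) ----> pd v g x"
proof -
  have "\<forall>n. \<exists>th. 0 < th & th < 1 & g (y n + d n) - g (y n) = pd (d n) g (y n + th *R d n)"
    using mean_value_line[OF g] by blast
  from choice[OF this] obtain th where th: "!!n. 0 < th n" "!!n. th n < 1"
    and e: "!!n. g (y n + d n) - g (y n) = pd (d n) g (y n + th n *R d n)" by blast
  have "(%n. t n *R ((1 / t n) *R d n)) ----> 0 *R v" by (intro tendsto_scaleR t d)
  moreover have "t n *R ((1 / t n) *R d n) = d n" for n using t(1)[of n] by simp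
  ultimately have d0: "d ----> 0" by simp
  have thd: "(%n. th n *R d n) ----> 0"
  proof (rule Lim_null_comparison[OF always_eventually tendsto_norm_zero[OF d0]], rule allI)
    fix n
    show "norm (th n *R d n) <= norm (d n)" using th(1,2)[of n] mult_right_mono[of "th n" 1 "norm (d n)"] by simp
  qed
  have \<xi>: "(%n. y n + th n *R d n) ----> x" using tendsto_add[OF y thd] by simp
  have "(%n. \<Sum>e\<in>Basis. (((1 / t n) *R d n) \<bullet> e) *R pd e g (y n + th n *R d n)) ----> (\<Sum>e\<in>Basis. (v \<bullet> e) *R pd e g x)"
    by (intro tendsto_sum tendsto_scaleR tendsto_inner d tendsto_const
        continuous_on_tendsto_compose[OF Ck1_continuous_pd[OF g] \<xi>]) auto
  then have "(%n. pd ((1 / t n) *R d n) g (y n + th n *R d n)) ----> pd v g x"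
    by (simp only: pd_basis[OF g, symmetric])
  moreover have "pd ((1 / t n) *R d n) g (y n + th n *R d n) = (g (y n + d n) - g (y n)) / t n" for n
    unfolding e pd_vec_scale[OF g] by simp
  ultimately show ?thesis by simp
qed

subsection \<open>The short-time limit\<close>

lemma csupp_cball:
  fixes f :: "'a::euclidean_space => real" assumes "csupp f" shows "\<exists>R\<ge>0. \<forall>x. norm x > R --> f x = 0"
proof -
  obtain R where "{x. f x ~= 0} \<subseteq> cball 0 R" using bounded_cball_0[OF assms] by blast
  then show ?thesis by (intro exI[of _ "max R 0"]) (force simp: subset_iff)
qed

text \<open>The grouping in which the generator appears as a short-time limit: second order from the
  noise, first order from the whole drift including friction.\<close>

lemma generator_eq_drift: assumes g: "Ck 2 g"
  shows "generator \<alpha> \<beta> b g x = \<alpha> / \<beta> * (\<Sum>i\<in>UNIV. pd (ez i) (pd (ez i) g) x) + pd (drift b \<alpha> x) g x"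
proof -
  have C: "Ck 1 g" using g Ck_le[of 1 2 g] by simp
  have d: "drift b \<alpha> x = transport b x + (- \<alpha>) *R (0, 0, zz x)" by (simp add: drift_def transport_def)
  have "pd (drift b \<alpha> x) g x = pd (transport b x) g x + (- \<alpha>) *R pd (0, 0, zz x) g x"
    unfolding d by (simp only: pd_vec_add[OF C] pd_vec_scale[OF C])
  then have "pd (drift b \<alpha> x) g x = pd (transport b x) g x - \<alpha> * (\<Sum>i\<in>UNIV. zz x $ i * pd (ez i) g x)"
    by (simp only: pd_z[OF C, where v = "zz x"]) simp
  then show ?thesis
    unfolding generator_eq[OF g] ou_def by (simp add: sum_subtractf sum_distrib_left[symmetric] sum_divide_distrib[symmetric] right_diff_distrib)
qed

lemma continuous_pd_drift: assumes g: "Ck 1 g" and b: "continuous_on UNIV b"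
  shows "continuous_on UNIV (%x. pd (drift b \<alpha> x) g x)"
proof -
  have e: "pd (drift b \<alpha> x) g x = (\<Sum>e\<in>Basis. (drift b \<alpha> x \<bullet> e) *R pd e g x)" for x by (rule pd_basis[OF g])
  have "continuous_on UNIV (%x. (drift b \<alpha> x \<bullet> e) *R pd e g x)" for e
    by (rule continuous_on_scaleR[OF continuous_on_inner[OF drift_continuous[OF b] continuous_on_const] Ck1_continuous_pd[OF g]])
  then show ?thesis unfolding e by (rule continuous_on_sum)
qed

context langevin_process
begin

lemma \<sigma>_pos: "\<sigma> > 0" using \<alpha> \<beta> by (simp add: \<sigma>_def)

lemma \<sigma>_sq: "\<sigma>\<^sup>2 / 2 = \<alpha> / \<beta>"
proof -
  have "0 <= 2 * inverse \<beta> * \<alpha>" using \<alpha> \<beta> by simp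
  then have "\<sigma>\<^sup>2 = 2 * inverse \<beta> * \<alpha>" unfolding \<sigma>_def by (rule real_sqrt_pow2)
  then show ?thesis using \<beta> by (simp add: field_simps)
qed

text \<open>The intermediate state reached when only the noise acts. It splits the increment of the
  path into a part with an explicit Gaussian law and a part that is small pathwise.\<close>

definition perturbed :: "real => 'w => 'd state" where
  "perturbed t om = X 0 om + (0, 0, \<sigma> *R (B t om - B 0 om))"

lemma perturbed_measurable: "t >= 0 ==> perturbed t \<in> borel_measurable M" unfolding perturbed_def[abs_def]
  by (intro borel_measurable_add borel_measurable_Pair borel_measurable_scaleR borel_measurable_diff
      borel_measurable_const X_measurable B_measurable) auto

lemma noise_quotient_measurable:
  fixes g :: "'d state => real"
  assumes g: "continuous_on UNIV g" shows "noise_quotient \<sigma> g s \<in> borel_measurable borel"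
proof -
  have "continuous_on UNIV (%x :: 'd state \<times> (real^'d). (g (fst x + s *R (0, 0, \<sigma> *R snd x)) - g (fst x)) / s\<^sup>2)"
    unfolding divide_inverse
    by (intro continuous_on_mult continuous_on_diff continuous_on_const continuous_on_compose2[OF g continuous_on_fst[OF continuous_on_id] subset_UNIV]
        continuous_on_compose2[OF g _ subset_UNIV, of UNIV "%x. fst x + s *R (0, 0, \<sigma> *R snd x)"])
      (intro continuous_intros)
  then have [measurable]: "(%x :: 'd state \<times> (real^'d). (g (fst x + s *R (0, 0, \<sigma> *R snd x)) - g (fst x)) / s\<^sup>2) \<in> borel_measurable (borel \<Otimes>\<^sub>M borel)"
    unfolding borel_prod by (rule borel_measurable_continuous_onI)
  have "(%x :: 'd state \<times> (real^'d). heat 1 (snd x) * ((g (fst x + s *R (0, 0, \<sigma> *R snd x)) - g (fst x)) / s\<^sup>2))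
    \<in> borel_measurable (borel \<Otimes>\<^sub>M lborel)" by measurable
  then show ?thesis unfolding noise_quotient_def[abs_def]
    by (intro lborel.borel_measurable_lebesgue_integral) (simp add: split_beta')
qed

text \<open>The initial value and the Brownian increment have a product law, so the noise can be
  integrated out first; rescaling it to variance 1 gives \<open>noise_quotient\<close>.\<close>

lemma expectation_noise:
  assumes f: "continuous_on UNIV f" "csupp f" and g: "continuous_on UNIV g" "csupp g" and s: "s > 0"
  shows "(\<integral>om. f (X 0 om) * ((g (perturbed (s\<^sup>2) om) - g (X 0 om)) / s\<^sup>2) \<partial>M) = (\<integral>om. f (X 0 om) * noise_quotient \<sigma> g s (X 0 om) \<partial>M)"
proof -
  let ?N = "density lborel (%y :: real^'d. ennreal (heat (s\<^sup>2) y))" and ?W = "%om. B (s\<^sup>2) om - B 0 om"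
  define H where "H y = f (fst y) * ((g (fst y + (0, 0, \<sigma> *R snd y)) - g (fst y)) / s\<^sup>2)" for y :: "'d state \<times> (real^'d)"
  have X0: "X 0 \<in> borel_measurable M" by (rule X_measurable) simp
  have W: "?W \<in> borel_measurable M" by (intro borel_measurable_diff B_measurable) auto
  have "continuous_on UNIV H" unfolding H_def divide_inverse
    by (intro continuous_on_mult continuous_on_diff continuous_on_const continuous_on_compose2[OF f(1) continuous_on_fst[OF continuous_on_id] subset_UNIV]
        continuous_on_compose2[OF g(1) continuous_on_fst[OF continuous_on_id] subset_UNIV]
        continuous_on_compose2[OF g(1) _ subset_UNIV, of UNIV "%x. fst x + (0, 0, \<sigma> *R snd x)"])
      (intro continuous_intros)
  then have Hm: "H \<in> borel_measurable borel" by (rule borel_measurable_continuous_onI)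
  have Hp: "H \<in> borel_measurable (borel \<Otimes>\<^sub>M borel)" unfolding borel_prod by (rule Hm)
  have "\<exists>C\<ge>0. \<forall>x. \<bar>f x\<bar> <= C" "\<exists>C\<ge>0. \<forall>x. \<bar>g x\<bar> <= C" by (rule bounded_of_csupp[OF f] bounded_of_csupp[OF g])+
  then obtain Kf Kg where Kf: "Kf >= 0" "!!x. \<bar>f x\<bar> <= Kf" and Kg: "Kg >= 0" "!!x. \<bar>g x\<bar> <= Kg" by blast
  have Hb: "norm (H y) <= Kf * (2 * Kg / s\<^sup>2)" for y
  proof -
    have "\<bar>g a - g c\<bar> <= 2 * Kg" for a c using Kg(2)[of a] Kg(2)[of c] by linarith
    then have "\<bar>(g (fst y + (0, 0, \<sigma> *R snd y)) - g (fst y)) / s\<^sup>2\<bar> <= 2 * Kg / s\<^sup>2"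
      by (simp add: divide_right_mono)
    from mult_mono[OF Kf(2) this Kf(1) abs_ge_zero] show ?thesis by (simp only: H_def real_norm_def abs_mult)
  qed
  have d: "distributed M lborel ?W (%y. ennreal (heat (s\<^sup>2) y))"
  proof -
    have "0 <= (0::real) & 0 < s\<^sup>2" using s by simp
    then have "distributed M lborel (%om. B (s\<^sup>2) om - B 0 om) (%x. ennreal (\<Prod>i\<in>UNIV. normal_density 0 (sqrt (s\<^sup>2 - 0)) (x $ i)))"
      using brownian unfolding brownian_motion_def by blast
    then show ?thesis by (simp add: heat_def)
  qed
  have dW: "distr M borel ?W = ?N"
  proof -
    have "distr M borel ?W = distr M lborel ?W" by (rule distr_cong) auto
    then show ?thesis using distributed_distr_eq_density[OF d] by simp
  qed
  have joint: "distr M borel (X 0) \<Otimes>\<^sub>M distr M borel ?W = distr M (borel \<Otimes>\<^sub>M borel) (%om. (X 0 om, ?W om))"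
  proof (rule distr_pair_of_independent_of_process[OF prob_space_axioms _ X0 W])
    show "independent_of_process M (X 0) B" using solution by (simp add: sde_solution_def)
    show "?W = (%om. (%y. y (s\<^sup>2) - y 0) (\<lambda>t\<in>{0..}. B t om))" by simp
    have c: "(%y. y t) \<in> borel_measurable (PiM {0..} (%_. borel :: (real^'d) measure))" if "t >= 0" for t :: real
      using that by (intro measurable_component_singleton) simp
    show "(%y. y (s\<^sup>2) - y 0) \<in> borel_measurable (PiM {0..} (%_. borel :: (real^'d) measure))"
      by (intro borel_measurable_diff c) auto
  qed
  interpret X0: prob_space "distr M borel (X 0)" by (rule prob_space_distr[OF X0])
  interpret W: prob_space "distr M borel ?W" by (rule prob_space_distr[OF W])
  interpret P: pair_prob_space "distr M borel (X 0)" "distr M borel ?W" ..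
  have "(\<integral>om. f (X 0 om) * ((g (perturbed (s\<^sup>2) om) - g (X 0 om)) / s\<^sup>2) \<partial>M) = (\<integral>om. H (X 0 om, ?W om) \<partial>M)"
    by (simp add: H_def perturbed_def)
  also have "... = integral\<^sup>L (distr M borel (X 0) \<Otimes>\<^sub>M distr M borel ?W) H"
    unfolding joint by (rule integral_distr[OF measurable_Pair[OF X0 W] Hp, symmetric])
  also have "... = (\<integral>x. (\<integral>y. H (x, y) \<partial>distr M borel ?W) \<partial>distr M borel (X 0))"
  proof (rule P.integral_fst'[symmetric], rule P.integrable_const_bound)
    show "H \<in> borel_measurable (distr M borel (X 0) \<Otimes>\<^sub>M distr M borel ?W)"
      unfolding measurable_cong_sets[OF sets_pair_measure_cong[OF sets_distr sets_distr] refl] by (rule Hp)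
    show "AE y in distr M borel (X 0) \<Otimes>\<^sub>M distr M borel ?W. norm (H y) <= Kf * (2 * Kg / s\<^sup>2)" by (intro AE_I2 Hb)
  qed
  also have "... = (\<integral>x. f x * noise_quotient \<sigma> g s x \<partial>distr M borel (X 0))"
  proof (rule Bochner_Integration.integral_cong[OF refl])
    fix x
    have gm: "(%y. (g (x + (0, 0, \<sigma> *R y)) - g x) / s\<^sup>2) \<in> borel_measurable borel" unfolding divide_inverse
      by (intro borel_measurable_continuous_onI continuous_on_mult continuous_on_diff continuous_on_const
          continuous_on_compose2[OF g(1) _ subset_UNIV, of UNIV "%y. x + (0, 0, \<sigma> *R y)"])
        (intro continuous_intros)
    have Hx: "(%y. H (x, y)) \<in> borel_measurable borel"
      unfolding H_def fst_conv snd_conv by (intro borel_measurable_times borel_measurable_const gm)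
    have "(\<integral>y. H (x, y) \<partial>distr M borel ?W) = (LB y. heat (s\<^sup>2) y * H (x, y))"
      unfolding dW using Hx by (subst integral_density) (auto simp: heat_nonneg)
    also have "... = (LB y. f x * (heat (s\<^sup>2) y * ((g (x + (0, 0, \<sigma> *R y)) - g x) / s\<^sup>2)))"
      by (simp add: H_def mult_ac)
    also have "... = f x * (LB y. heat (s\<^sup>2) y * ((g (x + (0, 0, \<sigma> *R y)) - g x) / s\<^sup>2))"
      by (rule integral_mult_right_zero)
    also have "(LB y. heat (s\<^sup>2) y * ((g (x + (0, 0, \<sigma> *R y)) - g x) / s\<^sup>2)) = noise_quotient \<sigma> g s x"
      unfolding integral_heat_scale[OF gm s] noise_quotient_def by (simp add: mult.commute)
    finally show "(\<integral>y. H (x, y) \<partial>distr M borel ?W) = f x * noise_quotient \<sigma> g s x" .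
  qed
  also have "... = (\<integral>om. f (X 0 om) * noise_quotient \<sigma> g s (X 0 om) \<partial>M)" by (rule integral_distr[OF X0])
      (intro borel_measurable_times noise_quotient_measurable[OF g(1)] borel_measurable_continuous_onI[OF f(1)])
  finally show ?thesis .
qed

lemma noise_limit:
  assumes f: "continuous_on UNIV f" "csupp f" and g: "Ck 2 g" "csupp g" and s: "!!n. s n > 0" "s ----> 0"
  shows "(%n. \<integral>om. f (X 0 om) * ((g (perturbed ((s n)\<^sup>2) om) - g (X 0 om)) / (s n)\<^sup>2) \<partial>M)
    ----> (\<integral>om. f (X 0 om) * (\<alpha> / \<beta> * (\<Sum>i\<in>UNIV. pd (ez i) (pd (ez i) g) (X 0 om))) \<partial>M)"
proof -
  have gc: "continuous_on UNIV g" using Ck_continuous[OF g(1)] .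
  have C: "Ck 1 (pd v g)" for v using g(1) Ck_pd[of 1 g v] by (simp add: numeral_2_eq_2 One_nat_def)
  obtain K where K: "!!s x. s > 0 ==> \<bar>noise_quotient \<sigma> g s x\<bar> <= K"
    using noise_quotient_bound[OF g less_imp_le[OF \<sigma>_pos]] by blast
  obtain Kf where Kf: "Kf >= 0" "!!x. \<bar>f x\<bar> <= Kf" using bounded_of_csupp[OF f] by blast
  have X0: "X 0 \<in> borel_measurable M" by (rule X_measurable) simp
  have fm: "f \<in> borel_measurable borel" by (rule borel_measurable_continuous_onI[OF f(1)])
  have pm: "pd (ez i) (pd (ez i) g) \<in> borel_measurable borel" for i
    by (rule borel_measurable_continuous_onI[OF Ck1_continuous_pd[OF C]])
  show ?thesis unfolding expectation_noise[OF f gc g(2) s(1)]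
  proof (rule integral_dominated_convergence[where w = "%_. Kf * K"])
    show "AE om in M. (%n. f (X 0 om) * noise_quotient \<sigma> g (s n) (X 0 om))
      ----> f (X 0 om) * (\<alpha> / \<beta> * (\<Sum>i\<in>UNIV. pd (ez i) (pd (ez i) g) (X 0 om)))" unfolding \<sigma>_sq[symmetric]
      by (intro AE_I2 tendsto_mult tendsto_const noise_quotient_limit[OF g less_imp_le[OF \<sigma>_pos] s])
    show "AE om in M. norm (f (X 0 om) * noise_quotient \<sigma> g (s n) (X 0 om)) <= Kf * K" for n
      unfolding real_norm_def abs_mult by (intro AE_I2 mult_mono Kf K s(1) abs_ge_zero)
    show "(%om. f (X 0 om) * noise_quotient \<sigma> g (s n) (X 0 om)) \<in> borel_measurable M" for n
      by (intro borel_measurable_times measurable_compose[OF X0 fm] measurable_compose[OF X0 noise_quotient_measurable[OF gc]])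
    show "(%om. f (X 0 om) * (\<alpha> / \<beta> * (\<Sum>i\<in>UNIV. pd (ez i) (pd (ez i) g) (X 0 om)))) \<in> borel_measurable M"
      by (intro borel_measurable_times borel_measurable_const borel_measurable_sum measurable_compose[OF X0 fm] measurable_compose[OF X0 pm])
  qed simp
qed

text \<open>The difference quotient is bounded except on an event of probability \<open>O(t\<^sup>2)\<close>, on which it is
  at most \<open>O(1/t)\<close>. Clamping it therefore does not change the limit.\<close>
lemma drift_limit: assumes f: "continuous_on UNIV f" "csupp f" and g: "Ck 1 g" "csupp g"
    and t: "!!n. t n > 0" "!!n. t n <= 1" "t ----> 0"
  shows "(%n. \<integral>om. f (X 0 om) * ((g (X (t n) om) - g (perturbed (t n) om)) / t n) \<partial>M)
    ----> (\<integral>om. f (X 0 om) * pd (drift b \<alpha> (X 0 om)) g (X 0 om) \<partial>M)"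
proof -
  have gc: "continuous_on UNIV g" using Ck_continuous[OF g(1)] .
  obtain Kf where Kf: "Kf >= 0" "!!x. \<bar>f x\<bar> <= Kf" using bounded_of_csupp[OF f] by blast
  obtain Kg where Kg: "Kg >= 0" "!!x. \<bar>g x\<bar> <= Kg" using bounded_of_csupp[OF gc g(2)] by blast
  obtain R where R: "R >= 0" "!!x. norm x > R ==> f x = 0" using csupp_cball[OF f(2)] by blast
  have "csupp (%x. pd (drift b \<alpha> x) g x)"
  \<comment> \<open>The sum of squares of the partial derivatives has compact support, and where it
    vanishes so does every directional derivative, whatever the direction field.\<close>
  proof (rule csupp_mono[OF csupp_sum[where I = Basis and f = "%e x. (pd e g x)\<^sup>2"]])
    show "csupp (%x. (pd e g x)\<^sup>2)" for e by (rule csupp_mono[OF csupp_pd[OF g(2), of e]]) simp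
    fix x assume "(\<Sum>e\<in>Basis. (pd e g x)\<^sup>2) = 0"
    then have "pd e g x = 0" if "e \<in> Basis" for e using that by (simp add: sum_nonneg_eq_0_iff)
    then show "pd (drift b \<alpha> x) g x = 0" unfolding pd_basis[OF g(1), where v = "drift b \<alpha> x"] by simp
  qed
  from bounded_of_csupp[OF continuous_pd_drift[OF g(1) b_continuous] this]
  obtain Kd where Kd: "!!x. \<bar>pd (drift b \<alpha> x) g x\<bar> <= Kd" by blast
  obtain K where K: "K >= 0" "!!y d. \<bar>g (y + d) - g y\<bar> <= K * norm d" using increment_bound[OF g] by blast
  obtain C \<tau> where C: "0 < C" "0 < \<tau>"
    and dis: "!!W X t. path_solution b \<alpha> \<sigma> W 1 X ==> norm (X 0) <= R ==> 0 < t ==> t <= \<tau> ==> t <= 1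
      ==> (!!s. s \<in> {0..t} ==> norm (\<sigma> *R (W s - W 0)) <= 1) ==> norm (displacement \<sigma> W X t) <= C * t"
    using displacement_bound[OF b_continuous R(1), of \<alpha> \<sigma>] by metis
  \<comment> \<open>With this tolerance the noise scaled by \<open>\<sigma>\<close> stays below 1,
    as \<open>displacement_bound\<close> demands.\<close>
  have "1 / \<sigma> > 0" using \<sigma>_pos by simp
  from small_oscillation[OF this] obtain C' where C': "C' >= 0" and N: "\<forall>t>0. \<exists>N\<in>sets M. prob N <= C' * t\<^sup>2 &
      (\<forall>om\<in>space M - N. continuous_on {0..t} (%s. B s om) --> (\<forall>s\<in>{0..t}. norm (B s om - B 0 om) <= 1 / \<sigma>))" by blast
  have "\<forall>n. \<exists>N. N \<in> sets M & prob N <= C' * (t n)\<^sup>2 &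
      (\<forall>om\<in>space M - N. continuous_on {0..t n} (%s. B s om) --> (\<forall>s\<in>{0..t n}. norm (B s om - B 0 om) <= 1 / \<sigma>))"
    using N t(1) by blast
  from choice[OF this] obtain N where N: "!!n. N n \<in> sets M" "!!n. prob (N n) <= C' * (t n)\<^sup>2"
    and quiet: "!!n om s. om \<in> space M - N n ==> continuous_on {0..t n} (%s. B s om) ==> s \<in> {0..t n} ==> norm (B s om - B 0 om) <= 1 / \<sigma>"
    by blast
  define A where "A n om = (g (X (t n) om) - g (perturbed (t n) om)) / t n" for n om
  define a where "a om = pd (drift b \<alpha> (X 0 om)) g (X 0 om)" for om
  \<comment> \<open>\<open>K * C\<close> bounds the quotient off the exceptional event and
    \<open>Kd\<close> bounds its limit, so the clamp at level \<open>m\<close> alters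
    neither.\<close>
  define m where "m = max (K * C) Kd"
  define cl where "cl y = max (- m) (min m y)" for y :: real
  have m0: "m >= 0" using K(1) C(1) by (simp add: m_def le_max_iff_disj)
  have cl_id: "\<bar>y\<bar> <= m ==> cl y = y" for y by (simp add: cl_def)
  have cl_le: "\<bar>cl y\<bar> <= m" for y using m0 by (simp add: cl_def)
  have cl_diff: "\<bar>y - cl y\<bar> <= \<bar>y\<bar>" for y using m0 by (auto simp: cl_def max_def min_def)
  have t0: "t n >= 0" for n using t(1)[of n] by simp
  have X0: "X 0 \<in> borel_measurable M" by (rule X_measurable) simp
  have [measurable]: "(%om. f (X 0 om)) \<in> borel_measurable M"
    by (rule measurable_compose[OF X0 borel_measurable_continuous_onI[OF f(1)]])
  have [measurable]: "A n \<in> borel_measurable M" for n unfolding A_def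
    by (intro borel_measurable_divide borel_measurable_diff borel_measurable_const
        measurable_compose[OF X_measurable[OF t0] borel_measurable_continuous_onI[OF gc]]
        measurable_compose[OF perturbed_measurable[OF t0] borel_measurable_continuous_onI[OF gc]])
  have [measurable]: "a \<in> borel_measurable M"
    unfolding a_def by (rule measurable_compose[OF X0 borel_measurable_continuous_onI[OF continuous_pd_drift[OF g(1) b_continuous]]])
  have X_eq: "X s om = perturbed s om + displacement \<sigma> (%t. B t om) (%t. X t om) s" for s om
    by (simp add: perturbed_def displacement_def)
  have Bc: "AE om in M. continuous_on {0..} (%t. B t om)" using brownian by (simp add: brownian_motion_def)
  have lim: "AE om in M. (%n. A n om) ----> a om" using AE_path_solution Bc
  proof eventually_elim
    case (elim om)
    have sol: "path_solution b \<alpha> \<sigma> (%t. B t om) 1 (%t. X t om)" using elim(1) by blast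
    have "(%n. B (t n) om) ----> B 0 om" using t0 by (intro continuous_on_tendsto_compose[OF elim(2) t(3)]) auto
    then have "(%n. X 0 om + (0, 0, \<sigma> *R (B (t n) om - B 0 om))) ----> X 0 om + (0, 0, \<sigma> *R (B 0 om - B 0 om))"
      by (intro tendsto_intros)
    then have "(%n. perturbed (t n) om) ----> X 0 om" by (simp add: perturbed_def zero_prod_def[symmetric])
    from increment_limit[OF g(1) t(1,3) this displacement_limit[OF sol b_continuous t]]
    show ?case by (simp only: A_def a_def X_eq[symmetric])
  qed
  have h_lim: "(%n. \<integral>om. f (X 0 om) * cl (A n om) \<partial>M) ----> (\<integral>om. f (X 0 om) * a om \<partial>M)"
  proof (rule integral_dominated_convergence[where w = "%_. Kf * m"])
    show "AE om in M. (%n. f (X 0 om) * cl (A n om)) ----> f (X 0 om) * a om" using lim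
    proof eventually_elim
      case (elim om)
      have "(%n. cl (A n om)) ----> cl (a om)" unfolding cl_def by (intro tendsto_max tendsto_min tendsto_const elim)
      moreover have "cl (a om) = a om" unfolding a_def by (rule cl_id) (simp only: m_def order_trans[OF Kd max.cobounded2])
      ultimately show ?case by (intro tendsto_mult tendsto_const) simp
    qed
    show "AE om in M. norm (f (X 0 om) * cl (A n om)) <= Kf * m" for n
      unfolding real_norm_def abs_mult by (intro AE_I2 mult_mono Kf cl_le abs_ge_zero)
  qed (simp_all add: cl_def)
  \<comment> \<open>Off \<open>N n\<close> the quotient is below the clamp, or the initial value
    lies outside the support of \<open>f\<close>; on \<open>N n\<close> only the crude bound
    \<open>2 * Kg / t n\<close> is used. Its integral is of order \<open>t n\<close> because
    \<open>N n\<close> has probability of order \<open>(t n)^2\<close>.\<close>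
  have bound: "AE om in M. \<bar>f (X 0 om) * A n om - f (X 0 om) * cl (A n om)\<bar> <= Kf * (2 * Kg / t n) * indicator (N n) om"
    if tn: "t n <= \<tau>" for n using AE_path_solution Bc AE_space
  proof eventually_elim
    case (elim om)
    have sol: "path_solution b \<alpha> \<sigma> (%t. B t om) 1 (%t. X t om)" using elim(1) by blast
    show ?case
    proof (cases "om \<in> N n")
      case True
      have "\<bar>g (X (t n) om) - g (perturbed (t n) om)\<bar> <= 2 * Kg"
        using Kg(2)[of "X (t n) om"] Kg(2)[of "perturbed (t n) om"] by linarith
      then have "\<bar>A n om\<bar> <= 2 * Kg / t n" using t(1)[of n] by (simp add: A_def abs_divide divide_right_mono)
      then have "\<bar>A n om - cl (A n om)\<bar> <= 2 * Kg / t n" using cl_diff[of "A n om"] by linarith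
      from mult_mono[OF Kf(2) this Kf(1) abs_ge_zero]
      show ?thesis using True by (simp add: abs_mult right_diff_distrib[symmetric])
    next
      case False
      have "f (X 0 om) = 0 | cl (A n om) = A n om"
      proof (cases "norm (X 0 om) <= R")
        case True
        have "norm (displacement \<sigma> (%t. B t om) (%t. X t om) (t n)) <= C * t n"
        proof (rule dis[OF sol True t(1) tn t(2)])
          fix s assume s: "s \<in> {0..t n}"
          have "norm (B s om - B 0 om) <= 1 / \<sigma>"
            using False elim(3) s by (intro quiet continuous_on_subset[OF elim(2)]) auto
          then show "norm (\<sigma> *R (B s om - B 0 om)) <= 1" using \<sigma>_pos by (simp add: pos_le_divide_eq mult.commute)
        qed
        then have "\<bar>g (X (t n) om) - g (perturbed (t n) om)\<bar> <= K * (C * t n)"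
          using K unfolding X_eq[of "t n" om] by (meson mult_left_mono order_trans)
        then have "\<bar>A n om\<bar> <= K * C" using t(1)[of n] by (simp add: A_def abs_divide pos_divide_le_eq mult.assoc)
        then show ?thesis by (intro disjI2 cl_id) (simp add: m_def)
      qed (use R(2) in auto)
      then show ?thesis using False by auto
    qed
  qed
  have diff: "\<bar>(\<integral>om. f (X 0 om) * A n om \<partial>M) - (\<integral>om. f (X 0 om) * cl (A n om) \<partial>M)\<bar> <= Kf * (2 * Kg) * C' * t n"
    if tn: "t n <= \<tau>" for n
  proof -
    have i1: "integrable M (%om. f (X 0 om) * A n om)"
    proof (rule integrable_const_bound)
      show "AE om in M. norm (f (X 0 om) * A n om) <= Kf * (2 * Kg / t n)"
      proof (rule AE_I2)
        fix om
        have "\<bar>g (X (t n) om) - g (perturbed (t n) om)\<bar> <= 2 * Kg"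
          using Kg(2)[of "X (t n) om"] Kg(2)[of "perturbed (t n) om"] by linarith
        then have "\<bar>A n om\<bar> <= 2 * Kg / t n" using t(1)[of n] by (simp add: A_def abs_divide divide_right_mono)
        from mult_mono[OF Kf(2) this Kf(1) abs_ge_zero]
        show "norm (f (X 0 om) * A n om) <= Kf * (2 * Kg / t n)" by (simp only: real_norm_def abs_mult)
      qed
    qed measurable
    have i2: "integrable M (%om. f (X 0 om) * cl (A n om))"
    proof (rule integrable_const_bound)
      show "AE om in M. norm (f (X 0 om) * cl (A n om)) <= Kf * m"
        unfolding real_norm_def abs_mult by (intro AE_I2 mult_mono Kf cl_le abs_ge_zero)
    qed (simp add: cl_def)
    have "\<bar>(\<integral>om. f (X 0 om) * A n om \<partial>M) - (\<integral>om. f (X 0 om) * cl (A n om) \<partial>M)\<bar>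
      = \<bar>\<integral>om. f (X 0 om) * A n om - f (X 0 om) * cl (A n om) \<partial>M\<bar>"
      by (simp only: Bochner_Integration.integral_diff[OF i1 i2])
    also have "... <= (\<integral>om. \<bar>f (X 0 om) * A n om - f (X 0 om) * cl (A n om)\<bar> \<partial>M)" by (rule integral_abs_bound)
    also have "... <= (\<integral>om. Kf * (2 * Kg / t n) * indicator (N n) om \<partial>M)"
      using N(1) by (intro integral_mono_AE bound[OF tn] integrable_abs Bochner_Integration.integrable_diff i1 i2 integrable_mult_right)
        (simp add: emeasure_eq_measure)
    also have "... = Kf * (2 * Kg / t n) * prob (N n)" using N(1) by simp
    also have "... <= Kf * (2 * Kg / t n) * (C' * (t n)\<^sup>2)"
      using Kf(1) Kg(1) t0[of n] by (intro mult_left_mono N(2)) auto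
    also have "... = Kf * (2 * Kg) * C' * t n" using t(1)[of n] by (simp add: power2_eq_square)
    finally show ?thesis .
  qed
  have "(%n. (\<integral>om. f (X 0 om) * A n om \<partial>M) - (\<integral>om. f (X 0 om) * cl (A n om) \<partial>M)) ----> 0"
  proof (rule Lim_null_comparison)
    have "\<forall>\<^sub>F n in sequentially. t n < \<tau>" using C(2) by (intro order_tendstoD(2)[OF t(3)])
    then show "\<forall>\<^sub>F n in sequentially. norm ((\<integral>om. f (X 0 om) * A n om \<partial>M) - (\<integral>om. f (X 0 om) * cl (A n om) \<partial>M)) <= Kf * (2 * Kg) * C' * t n"
      by eventually_elim (use diff in \<open>simp add: less_imp_le\<close>)
    have "(%n. Kf * (2 * Kg) * C' * t n) ----> Kf * (2 * Kg) * C' * 0" by (intro tendsto_intros t(3))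
    then show "(%n. Kf * (2 * Kg) * C' * t n) ----> 0" by simp
  qed
  from tendsto_add[OF this h_lim] show ?thesis by (simp add: A_def a_def)
qed

end

section \<open>From finite-dimensional distributions to the generator\<close>

lemma nn_integral_fdd: assumes "!!t. t \<in> J ==> Y t \<in> borel_measurable M" "G \<in> borel_measurable (PiM J (%_. borel))"
  shows "(\<integral>\<^sup>+y. G y \<partial>fdd M Y J) = (\<integral>\<^sup>+om. G (\<lambda>t\<in>J. Y t om) \<partial>M)"
  unfolding fdd_def by (subst nn_integral_distr[OF measurable_restrict]) (use assms in simp_all)

lemma integral_fdd:
  fixes G :: "_ => real" assumes "!!t. t \<in> J ==> Y t \<in> borel_measurable M" "G \<in> borel_measurable (PiM J (%_. borel))"
  shows "(\<integral>y. G y \<partial>fdd M Y J) = (\<integral>om. G (\<lambda>t\<in>J. Y t om) \<partial>M)"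
  unfolding fdd_def by (rule integral_distr[OF measurable_restrict assms(2)]) (rule assms(1))

context langevin_process
begin

text \<open>The increment of \<open>g\<close> is split at the \<open>perturbed\<close> state: the
  noise part converges by the Gaussian computation at scale \<open>sqrt t\<close>, the drift part by
  the pathwise estimate. The two limits add up to the generator.\<close>

lemma short_time_limit: assumes f: "continuous_on UNIV f" "csupp f" and g: "Ck 2 g" "csupp g"
  shows "(%n. (\<integral>om. f (X 0 om) * (g (X (inverse (real (Suc n))) om) - g (X 0 om)) \<partial>M) / inverse (real (Suc n)))
    ----> (\<integral>om. f (X 0 om) * generator \<alpha> \<beta> b g (X 0 om) \<partial>M)"
proof -
  define t where "t n = inverse (real (Suc n))" for n
  have t: "t n > 0" "t n <= 1" for n by (auto simp: t_def inverse_le_1_iff)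
  have t_lim: "t ----> 0" unfolding t_def[abs_def] by (rule LIMSEQ_inverse_real_of_nat)
  have s: "sqrt (t n) > 0" "(sqrt (t n))\<^sup>2 = t n" for n using t(1)[of n] by auto
  have s_lim: "(%n. sqrt (t n)) ----> 0" using tendsto_real_sqrt[OF t_lim] by simp
  have g1: "Ck 1 g" using g Ck_le[of 1 2 g] by simp
  have gc: "continuous_on UNIV g" using Ck_continuous[OF g(1)] .
  have C: "Ck 1 (pd v g)" for v using g(1) Ck_pd[of 1 g v] by (simp add: numeral_2_eq_2 One_nat_def)
  have X0: "X 0 \<in> borel_measurable M" by (rule X_measurable) simp
  have fm: "f \<in> borel_measurable borel" and gm: "g \<in> borel_measurable borel"
    by (rule borel_measurable_continuous_onI[OF f(1)] borel_measurable_continuous_onI[OF gc])+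
  obtain Kf where Kf: "Kf >= 0" "!!x. \<bar>f x\<bar> <= Kf" using bounded_of_csupp[OF f] by blast
  obtain Kg where Kg: "Kg >= 0" "!!x. \<bar>g x\<bar> <= Kg" using bounded_of_csupp[OF gc g(2)] by blast
  let ?N = "%n om. f (X 0 om) * ((g (perturbed (t n) om) - g (X 0 om)) / t n)"
  let ?D = "%n om. f (X 0 om) * ((g (X (t n) om) - g (perturbed (t n) om)) / t n)"
  have quotient: "integrable M (%om. f (X 0 om) * ((g (Y om) - g (Y' om)) / t n))"
    if Y: "Y \<in> borel_measurable M" "Y' \<in> borel_measurable M" for Y Y' n
  proof (rule integrable_const_bound)
    show "AE om in M. norm (f (X 0 om) * ((g (Y om) - g (Y' om)) / t n)) <= Kf * (2 * Kg / t n)"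
    proof (rule AE_I2)
      fix om
      have "\<bar>g (Y om) - g (Y' om)\<bar> <= 2 * Kg" using Kg(2)[of "Y om"] Kg(2)[of "Y' om"] by linarith
      then have "\<bar>(g (Y om) - g (Y' om)) / t n\<bar> <= 2 * Kg / t n" using t(1)[of n] by (simp add: abs_divide divide_right_mono)
      from mult_mono[OF Kf(2) this Kf(1) abs_ge_zero]
      show "norm (f (X 0 om) * ((g (Y om) - g (Y' om)) / t n)) <= Kf * (2 * Kg / t n)" by (simp only: real_norm_def abs_mult)
    qed
    show "(%om. f (X 0 om) * ((g (Y om) - g (Y' om)) / t n)) \<in> borel_measurable M"
      by (intro borel_measurable_times borel_measurable_divide borel_measurable_diff borel_measurable_const
          measurable_compose[OF X0 fm] measurable_compose[OF Y(1) gm] measurable_compose[OF Y(2) gm])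
  qed
  have Xt: "X (t n) \<in> borel_measurable M" and Yt: "perturbed (t n) \<in> borel_measurable M" for n
    using t(1)[of n] by (auto intro!: X_measurable perturbed_measurable)
  have split: "(\<integral>om. f (X 0 om) * (g (X (t n) om) - g (X 0 om)) \<partial>M) / t n = (\<integral>om. ?N n om \<partial>M) + (\<integral>om. ?D n om \<partial>M)" for n
  proof -
    have "(\<integral>om. f (X 0 om) * (g (X (t n) om) - g (X 0 om)) \<partial>M) / t n = (\<integral>om. f (X 0 om) * (g (X (t n) om) - g (X 0 om)) / t n \<partial>M)"
      by (rule integral_divide_zero[symmetric])
    also have "... = (\<integral>om. ?N n om + ?D n om \<partial>M)"
    proof (rule Bochner_Integration.integral_cong[OF refl])
      fix om
      show "f (X 0 om) * (g (X (t n) om) - g (X 0 om)) / t n = ?N n om + ?D n om"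
        by (simp add: distrib_left[symmetric] add_divide_distrib[symmetric])
    qed
    also have "... = (\<integral>om. ?N n om \<partial>M) + (\<integral>om. ?D n om \<partial>M)"
      by (rule Bochner_Integration.integral_add[OF quotient[OF Yt X0] quotient[OF Xt Yt]])
    finally show ?thesis .
  qed
  define L1 where "L1 x = \<alpha> / \<beta> * (\<Sum>i\<in>UNIV. pd (ez i) (pd (ez i) g) x)" for x
  define L2 where "L2 x = pd (drift b \<alpha> x) g x" for x
  have L1: "continuous_on UNIV L1"
    unfolding L1_def by (intro continuous_on_mult continuous_on_const continuous_on_sum Ck1_continuous_pd C)
  have L2: "continuous_on UNIV L2" unfolding L2_def by (rule continuous_pd_drift[OF g1 b_continuous])
  have intL: "integrable M (%om. f (X 0 om) * L (X 0 om))" if L: "continuous_on UNIV L" for L :: "'d state => real"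
  proof -
    have c: "continuous_on UNIV (%x. f x * L x)" by (intro continuous_on_mult f L)
    obtain K where K: "!!x. \<bar>f x * L x\<bar> <= K" using bounded_of_csupp[OF c csupp_mult_right[OF f(2)]] by blast
    show ?thesis
    proof (rule integrable_const_bound)
      show "AE om in M. norm (f (X 0 om) * L (X 0 om)) <= K" unfolding real_norm_def by (intro AE_I2 K)
      show "(%om. f (X 0 om) * L (X 0 om)) \<in> borel_measurable M"
        by (rule measurable_compose[OF X0 borel_measurable_continuous_onI[OF c]])
    qed
  qed
  have "(%n. (\<integral>om. ?N n om \<partial>M) + (\<integral>om. ?D n om \<partial>M))
    ----> (\<integral>om. f (X 0 om) * L1 (X 0 om) \<partial>M) + (\<integral>om. f (X 0 om) * L2 (X 0 om) \<partial>M)"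
    using noise_limit[OF f g s(1) s_lim] drift_limit[OF f g1 g(2) t t_lim]
    unfolding s(2) L1_def L2_def by (rule tendsto_add)
  also have "(\<integral>om. f (X 0 om) * L1 (X 0 om) \<partial>M) + (\<integral>om. f (X 0 om) * L2 (X 0 om) \<partial>M)
    = (\<integral>om. f (X 0 om) * L1 (X 0 om) + f (X 0 om) * L2 (X 0 om) \<partial>M)"
    by (rule Bochner_Integration.integral_add[OF intL[OF L1] intL[OF L2], symmetric])
  also have "... = (\<integral>om. f (X 0 om) * generator \<alpha> \<beta> b g (X 0 om) \<partial>M)"
    by (simp only: generator_eq_drift[OF g(1)] L1_def L2_def distrib_left)
  finally show ?thesis unfolding t_def[symmetric] split .
qed

lemma integral_initial:
  fixes f :: "'d state => real" assumes "f \<in> borel_measurable borel"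
  shows "(\<integral>om. f (X 0 om) \<partial>M) = (LB x. f x * \<rho> x)"
  using distributed_integral[OF initial, of f] assms \<rho>_pos by (simp add: less_imp_le mult.commute)

lemma \<rho>_measurable: "\<rho> \<in> borel_measurable borel"
proof -
  have "(%x. ennreal (\<rho> x)) \<in> borel_measurable borel" using distributed_borel_measurable[OF initial] by simp
  then have "(%x. enn2real (ennreal (\<rho> x))) \<in> borel_measurable borel" by measurable
  then show ?thesis using \<rho>_pos by (simp add: less_imp_le)
qed

lemma flip_X_measurable: "t >= 0 ==> (%om. flip_p (X t om)) \<in> borel_measurable M"
  by (rule measurable_compose[OF X_measurable measurable_flip_p])

lemma component_measurable:
  "s \<in> J ==> G \<in> borel_measurable borel ==> (%y. G (y s)) \<in> borel_measurable (PiM J (%_. borel))"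
  by (rule measurable_compose[OF measurable_component_singleton])

section \<open>Consequences of reversibility\<close>

context
  assumes rev: "reversible_process M X"
begin

text \<open>Reversal over the unit interval identifies the flipped state at time 1 with the initial
  state in law; stationarity identifies the states at times 0 and 1.\<close>

lemma initial_flip: assumes u: "u \<in> borel_measurable borel"
  shows "(\<integral>\<^sup>+om. u (flip_p (X 0 om)) \<partial>M) = (\<integral>\<^sup>+om. u (X 0 om) \<partial>M)"
proof -
  have uf: "(%x. u (flip_p x)) \<in> borel_measurable borel" by (rule measurable_compose[OF measurable_flip_p u])
  have 1: "fdd M (%t om. flip_p (X (1 - t) om)) {0} = fdd M X {0}"
    using rev unfolding reversible_process_def by (elim conjE allE[of _ 1] allE[of _ "{0}"]) simp
  have 2: "fdd M (%t. X (t + 1)) {0} = fdd M X {0}"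
    using rev unfolding reversible_process_def stationary_process_def by (elim conjE allE[of _ 1] allE[of _ "{0}"]) simp
  have "(\<integral>\<^sup>+om. u (flip_p (X 0 om)) \<partial>M) = (\<integral>\<^sup>+y. u (flip_p (y 0)) \<partial>fdd M X {0})"
    by (subst nn_integral_fdd) (auto intro!: X_measurable component_measurable[OF _ uf])
  also have "... = (\<integral>\<^sup>+om. u (flip_p (X 1 om)) \<partial>M)"
    unfolding 2[symmetric] by (subst nn_integral_fdd) (auto intro!: X_measurable component_measurable[OF _ uf])
  also have "... = (\<integral>\<^sup>+y. u (y 0) \<partial>fdd M (%t om. flip_p (X (1 - t) om)) {0})"
    by (subst nn_integral_fdd) (auto intro!: flip_X_measurable component_measurable[OF _ u])
  also have "... = (\<integral>\<^sup>+om. u (X 0 om) \<partial>M)"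
    unfolding 1 by (subst nn_integral_fdd) (auto intro!: X_measurable component_measurable[OF _ u])
  finally show ?thesis .
qed

lemma even_of_reversible: "even_in_p \<rho>"
proof -
  have \<rho>m [measurable]: "(%x. ennreal (\<rho> x)) \<in> borel_measurable borel"
    using distributed_borel_measurable[OF initial] by simp
  have \<rho>fm [measurable]: "(%x. ennreal (\<rho> (flip_p x))) \<in> borel_measurable borel"
    by (rule measurable_compose[OF measurable_flip_p \<rho>m])
  have "density lborel (%x. ennreal (\<rho> x)) = density lborel (%x. ennreal (\<rho> (flip_p x)))"
  proof (rule measure_eqI)
    fix A assume "A \<in> sets (density lborel (%x. ennreal (\<rho> x)))"
    then have A [measurable]: "A \<in> sets borel" by simp
    have im: "(%x. indicator A x :: ennreal) \<in> borel_measurable borel" by measurable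
    have imf: "(%x. indicator A (flip_p x) :: ennreal) \<in> borel_measurable borel"
      by (rule measurable_compose[OF measurable_flip_p im])
    have "(NN x. ennreal (\<rho> x) * indicator A x) = (NN x. ennreal (\<rho> x) * indicator A (flip_p x))"
      unfolding nn_integral_initial[OF im, symmetric] nn_integral_initial[OF imf, symmetric] by (rule initial_flip[OF im, symmetric])
    also have "... = (NN x. ennreal (\<rho> (flip_p x)) * indicator A x)"
      using nn_integral_flip_p[of "%x. ennreal (\<rho> (flip_p x)) * indicator A x"] by simp
    finally show "emeasure (density lborel (%x. ennreal (\<rho> x))) A = emeasure (density lborel (%x. ennreal (\<rho> (flip_p x)))) A"
      by (simp add: emeasure_density)
  qed simp
  from sigma_finite_measure.density_unique[OF lborel.sigma_finite_measure_axioms _ _ this] have "AE x in lborel. ennreal (\<rho> x) = ennreal (\<rho> (flip_p x))" by simp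
  then show ?thesis unfolding even_in_p_iff by eventually_elim (use \<rho>_pos in \<open>simp add: less_imp_le\<close>)
qed

lemma flipped_correlation:
  fixes f g :: "'d state => real"
  assumes f: "f \<in> borel_measurable borel" and g: "g \<in> borel_measurable borel" and t: "t > 0"
  shows "(\<integral>om. f (X 0 om) * g (X t om) \<partial>M) = (\<integral>om. g (flip_p (X 0 om)) * f (flip_p (X t om)) \<partial>M)"
proof -
  have G: "(%y. f (y 0) * g (y t)) \<in> borel_measurable (PiM {0, t} (%_. borel))"
    by (intro borel_measurable_times component_measurable f g) auto
  have r: "fdd M (%s om. flip_p (X (t - s) om)) {0, t} = fdd M X {0, t}"
    using rev t unfolding reversible_process_def by (elim conjE allE[of _ t] allE[of _ "{0, t}"]) simp
  have "(\<integral>om. f (X 0 om) * g (X t om) \<partial>M) = (\<integral>y. f (y 0) * g (y t) \<partial>fdd M X {0, t})"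
    by (subst integral_fdd[OF _ G]) (use t in \<open>auto intro!: X_measurable\<close>)
  also have "... = (\<integral>om. f (flip_p (X t om)) * g (flip_p (X 0 om)) \<partial>M)"
    unfolding r[symmetric] by (subst integral_fdd[OF _ G]) (use t in \<open>auto intro!: flip_X_measurable\<close>)
  finally show ?thesis by (simp only: mult.commute)
qed

text \<open>The correlations at lag \<open>t\<close> agree after reversal, and at lag 0 they agree
  by evenness. So the difference quotients on both sides coincide for every positive
  \<open>t\<close>, and the short-time limit applies to each side.\<close>

lemma symmetric_of_reversible: "symmetric_generator \<alpha> \<beta> b \<rho>" unfolding symmetric_generator_def
proof (intro allI impI, elim conjE)
  fix \<phi>1 \<phi>2 \<phi>3 \<psi>1 \<psi>2 \<psi>3 :: "real^'d => real"
  assume tests: "test_function \<phi>1" "test_function \<phi>2" "test_function \<phi>3" "test_function \<psi>1" "test_function \<psi>2" "test_function \<psi>3"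
  define f g where "f = tensor3 \<phi>1 \<phi>2 \<phi>3" and "g = tensor3 \<psi>1 \<psi>2 \<psi>3"
  define f' g' where "f' x = f (flip_p x)" and "g' x = g (flip_p x)" for x
  have "test_function f" "test_function g" unfolding f_def g_def by (intro test_function_tensor3 tests)+
  then have fg: "Ck 2 f" "csupp f" "Ck 2 g" "csupp g" by (simp_all add: test_function_iff smooth_def)
  have csupp_flip: "csupp (%x. h (flip_p x))" if h: "csupp h" for h :: "'d state => real"
  proof -
    obtain R where R: "!!x. norm x > R ==> h x = 0" using csupp_cball[OF h] by blast
    have "h (flip_p x) ~= 0 ==> norm x <= R" for x using R[of "flip_p x"] by (force simp: norm_flip_p)
    then show ?thesis by (intro boundedI[of _ R]) blast
  qed
  have fg': "Ck 2 f'" "csupp f'" "Ck 2 g'" "csupp g'"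
    unfolding f'_def[abs_def] g'_def[abs_def] using fg by (auto intro!: Ck_flip_p csupp_flip)
  have c: "continuous_on UNIV f" "continuous_on UNIV g" "continuous_on UNIV f'" "continuous_on UNIV g'"
    using fg fg' Ck_continuous by blast+
  have m: "f \<in> borel_measurable borel" "g \<in> borel_measurable borel" "f' \<in> borel_measurable borel" "g' \<in> borel_measurable borel"
    by (rule borel_measurable_continuous_onI c)+
  have gen_m: "generator \<alpha> \<beta> b h \<in> borel_measurable borel" if h: "Ck 2 h" for h :: "'d state => real"
  proof -
    have C: "Ck 1 (pd v h)" "Ck 1 h" for v using h Ck_pd[of 1 h v] Ck_le[of 1 2 h] by (auto simp: numeral_2_eq_2 One_nat_def)
    have "continuous_on UNIV (generator \<alpha> \<beta> b h)" unfolding generator_eq_drift[OF h, abs_def]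
      by (intro continuous_on_add continuous_on_mult continuous_on_const continuous_on_sum Ck1_continuous_pd C
          continuous_pd_drift b_continuous)
    then show ?thesis by (rule borel_measurable_continuous_onI)
  qed
  have int: "integrable M (%om. u (Y om) * v (Y' om))"
    if u: "continuous_on UNIV u" "csupp u" and v: "continuous_on UNIV v" "csupp v"
      and Y: "Y \<in> borel_measurable M" "Y' \<in> borel_measurable M" for u v :: "'d state => real" and Y Y'
  proof -
    obtain Ku where Ku: "Ku >= 0" "!!x. \<bar>u x\<bar> <= Ku" using bounded_of_csupp[OF u] by blast
    obtain Kv where Kv: "Kv >= 0" "!!x. \<bar>v x\<bar> <= Kv" using bounded_of_csupp[OF v] by blast
    show ?thesis
    proof (rule integrable_const_bound)
      show "AE om in M. norm (u (Y om) * v (Y' om)) <= Ku * Kv"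
        unfolding real_norm_def abs_mult by (intro AE_I2 mult_mono Ku Kv abs_ge_zero)
      show "(%om. u (Y om) * v (Y' om)) \<in> borel_measurable M"
        by (intro borel_measurable_times measurable_compose[OF Y(1) borel_measurable_continuous_onI[OF u(1)]]
            measurable_compose[OF Y(2) borel_measurable_continuous_onI[OF v(1)]])
    qed
  qed
  have X0: "X 0 \<in> borel_measurable M" by (rule X_measurable) simp
  have eq0: "(\<integral>om. f (X 0 om) * g (X 0 om) \<partial>M) = (\<integral>om. g' (X 0 om) * f' (X 0 om) \<partial>M)"
  proof -
    have "(\<integral>om. g' (X 0 om) * f' (X 0 om) \<partial>M) = (LB x. g' x * f' x * \<rho> x)"
      by (rule integral_initial[where f = "%x. g' x * f' x"]) (intro borel_measurable_times m)
    also have "... = (LB x. (g (flip_p x) * f (flip_p x)) * \<rho> (flip_p x))"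
    proof (rule integral_cong_AE)
      show "(%x. g' x * f' x * \<rho> x) \<in> borel_measurable lborel" using m \<rho>_measurable by simp
      show "(%x. (g (flip_p x) * f (flip_p x)) * \<rho> (flip_p x)) \<in> borel_measurable lborel"
        using m measurable_compose[OF measurable_flip_p \<rho>_measurable] by (simp add: f'_def[abs_def] g'_def[abs_def])
      show "AE x in lborel. g' x * f' x * \<rho> x = (g (flip_p x) * f (flip_p x)) * \<rho> (flip_p x)"
        using even_of_reversible unfolding even_in_p_iff by eventually_elim (simp add: f'_def g'_def)
    qed
    also have "... = (LB x. f x * g x * \<rho> x)"
    proof -
      note [measurable] = m \<rho>_measurable
      show ?thesis using integral_flip_p[of "%x. (g x * f x) * \<rho> x"] by (simp add: mult.commute)
    qed
    also have "... = (\<integral>om. f (X 0 om) * g (X 0 om) \<partial>M)"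
      by (rule integral_initial[where f = "%x. f x * g x", symmetric]) (intro borel_measurable_times m)
    finally show ?thesis ..
  qed
  have quotients: "(\<integral>om. f (X 0 om) * (g (X t om) - g (X 0 om)) \<partial>M) = (\<integral>om. g' (X 0 om) * (f' (X t om) - f' (X 0 om)) \<partial>M)" if t: "t > 0" for t
  proof -
    have Xt: "X t \<in> borel_measurable M" using t by (intro X_measurable) simp
    have "(\<integral>om. f (X 0 om) * (g (X t om) - g (X 0 om)) \<partial>M) = (\<integral>om. f (X 0 om) * g (X t om) \<partial>M) - (\<integral>om. f (X 0 om) * g (X 0 om) \<partial>M)"
      unfolding right_diff_distrib by (intro Bochner_Integration.integral_diff int c fg X0 Xt)
    also have "... = (\<integral>om. g' (X 0 om) * f' (X t om) \<partial>M) - (\<integral>om. g' (X 0 om) * f' (X 0 om) \<partial>M)"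
      unfolding eq0 flipped_correlation[OF m(1,2) t] by (simp only: f'_def g'_def)
    also have "... = (\<integral>om. g' (X 0 om) * (f' (X t om) - f' (X 0 om)) \<partial>M)"
      unfolding right_diff_distrib by (intro Bochner_Integration.integral_diff[symmetric] int c fg' X0 Xt)
    finally show ?thesis .
  qed
  have "(\<integral>om. f (X 0 om) * generator \<alpha> \<beta> b g (X 0 om) \<partial>M) = (\<integral>om. g' (X 0 om) * generator \<alpha> \<beta> b f' (X 0 om) \<partial>M)"
  proof (rule LIMSEQ_unique[OF short_time_limit[OF c(1) fg(2,3,4)]])
    have pos: "inverse (real (Suc n)) > 0" for n by simp
    show "(%n. (\<integral>om. f (X 0 om) * (g (X (inverse (real (Suc n))) om) - g (X 0 om)) \<partial>M) / inverse (real (Suc n)))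
      ----> (\<integral>om. g' (X 0 om) * generator \<alpha> \<beta> b f' (X 0 om) \<partial>M)"
      unfolding quotients[OF pos] by (rule short_time_limit[OF c(4) fg'(4,1,2)])
  qed
  then have "(LB x. f x * generator \<alpha> \<beta> b g x * \<rho> x) = (LB x. g' x * generator \<alpha> \<beta> b f' x * \<rho> x)"
    using integral_initial[of "%x. f x * generator \<alpha> \<beta> b g x"] integral_initial[of "%x. g' x * generator \<alpha> \<beta> b f' x"]
      m gen_m[OF fg(3)] gen_m[OF fg'(1)] by simp
  then show "(LB x. tensor3 \<phi>1 \<phi>2 \<phi>3 x * generator \<alpha> \<beta> b (tensor3 \<psi>1 \<psi>2 \<psi>3) x * \<rho> x)
      = (LB x. generator \<alpha> \<beta> b (tensor3 \<phi>1 (%p. \<phi>2 (- p)) \<phi>3) x * tensor3 \<psi>1 (%p. \<psi>2 (- p)) \<psi>3 x * \<rho> x)"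
    unfolding tensor3_flip_p f_def[symmetric] g_def[symmetric] f'_def[symmetric] g'_def[symmetric]
    by (simp only: mult.commute[of "generator \<alpha> \<beta> b f' _"])
qed

end

lemma langevin_density: "langevin_density \<rho> \<alpha> \<beta> b"
proof -
  note m = \<rho>_measurable
  have 1: "(NN x. ennreal (\<rho> x)) = 1" using nn_integral_initial[of "%_. 1"] by (simp add: emeasure_space_1)
  have i: "integrable lborel \<rho>" using m 1 \<rho>_pos by (intro integrableI_nonneg) (auto simp: less_imp_le)
  moreover have "(LB x. \<rho> x) = 1" using m 1 \<rho>_pos by (subst integral_eq_nn_integral) (auto simp: less_imp_le)
  ultimately show ?thesis using \<alpha> \<beta> smooth_b \<rho>_pos by unfold_locales auto
qed

end

theorem theorem2p3:
  fixes M :: "'w measure"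
    and B q p z :: "real \<Rightarrow> 'w \<Rightarrow> real^'d"
    and b :: "real^'d \<Rightarrow> real^'d"
    and \<alpha> \<beta> :: real
    and \<rho>0 :: "(real^'d) \<times> (real^'d) \<times> (real^'d) \<Rightarrow> real"
  assumes "\<alpha> > 0" and "\<beta> > 0"
    and "smooth b"
    and "prob_space M"
    and "brownian_motion M B"
    and "sde_well_posed \<alpha> \<beta> b M B"
    and "sde_solution \<alpha> \<beta> b M B q p z"
    and "distributed M lborel (state_process q p z 0) (\<lambda>x. ennreal (\<rho>0 x))"
    and "\<And>x. \<rho>0 x > 0"
  shows "(reversible_process M (state_process q p z)
            \<longleftrightarrow> even_in_p \<rho>0 \<and> symmetric_generator \<alpha> \<beta> b \<rho>0)
       \<and> (reversible_process M (state_process q p z)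
            \<longleftrightarrow> potential_condition \<beta> b \<rho>0)
       \<and> (reversible_process M (state_process q p z)
            \<longleftrightarrow> even_in_p \<rho>0 \<and> stationary_density \<alpha> \<beta> b \<rho>0)
       \<and> (reversible_process M (state_process q p z)
            \<longleftrightarrow> separated_variables \<rho>0 \<and> stationary_density \<alpha> \<beta> b \<rho>0)"
proof -
  interpret prob_space M by fact
  interpret langevin_process M B q p z b \<alpha> \<beta> \<rho>0 by unfold_locales fact+
  interpret langevin_density \<rho>0 \<alpha> \<beta> b by (rule langevin_density)
  have "reversible_process M X" if "potential_condition \<beta> b \<rho>0"
    using potential_conditionD[OF that] reversible_of_potential by blast
  \<comment> \<open>Every condition implies the potential condition, directly or by way of symmetry,
    and the potential condition implies reversibility. The evenness in the fourth condition is drawn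
    from reversibility.\<close>
  then show ?thesis
    using even_of_reversible symmetric_of_reversible potential_of_symmetric stationary_of_potential separated_of_potential
      potential_of_even_stationary potential_of_separated_stationary by blast
qed

end
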